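(* Assume the following two conjectures. (Conjecture A) For every $n$, if $L_p$ is the largest pseudosquare with $L_p\le n$, then $p=O(\log n\log\log n)$. (Conjecture B) For all positive integers $a,b$ with $\gcd(a,b)=1$ and all $x,y$, $$\#\{m\le x:\ m\equiv a \pmod b,\ p(m)>y\}\ \ll\ \frac{x}{b}\prod_{\substack{p\le y\\ \gcd(p,b)=1}}\left(1-\frac1p\right),$$ where $p(m)$ denotes the smallest prime divisor of $m$ and the product is over primes $p$. Let $c>2$ be a constant. Then there is an algorithm that, when given an integer $k>2$, a list of $k$ distinct linear polynomials over the integers with positive leading coefficients, $P=(f_1(x),\ldots,f_k(x))$ (the pattern), and a search bound $n$, finds all integers $x$ such that $\max\{f_i(x)\}\le n$ and all the values $f_1(x),\ldots,f_k(x)$ are prime. This algorithm uses at most $O_P\big(n/(\log\log n)^{k-1}\big)$ arithmetic operations and $n^{1/c}$ bits of space. The correctness of the algorithm's output does not depend on Conjectures A and B (only the bound on the number of operations does).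
   Context: The pseudosquare $L_p$ (for a prime $p$) is the smallest positive integer that is not a perfect square, is congruent to $1 \bmod 8$, and is a quadratic residue modulo every odd prime $q\le p$. Model of computation: a random access machine with direct-access memory addressable at the bit or word level, with word size $\Theta(\log n)$ bits; arithmetic operations on integers of $O(\log n)$ bits, memory accesses, comparisons and other basic operations each cost constant time. Space is counted in bits and does not include the space of the output. The notation $O_P(\cdot)$ means the implied constant may depend on the pattern $P$ (including $k$). *)

theory Defs
  imports
    "HOL-Number_Theory.Number_Theory"
    "HOL-Computational_Algebra.Computational_Algebra"
    "HOL-Library.Log_Nat"
    "HOL-Library.Landau_Symbols"
begin

section \<open>Word RAM\<close>

text \<open>
  The machine has finitely many registers and a memory of cells addressed by natural numbers.
  Registers and cells hold signed words of \<open>w\<close> bits (two's complement). A step that would produce a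
  value that does not fit into \<open>w\<close> bits, divide by zero, or use a negative address has no result, so
  unbounded intermediate values cannot be exploited.

  In \<open>Load r s\<close> and \<open>Store r s\<close> register \<open>s\<close> holds the cell address. In \<open>LoadBit r s t\<close> and
  \<open>StoreBit r s t\<close> the bit accessed is the one with the index in register \<open>t\<close>, counted through
  consecutive cells from the cell whose address is in register \<open>s\<close>. Register names are a type
  parameter only so that \<open>set_instr\<close> yields the registers an instruction mentions; jump targets are
  plain natural numbers.
\<close>

datatype alu_op =
  AddOp | SubOp | MulOp | DivOp | ModOp | AndOp | OrOp | XorOp | ShlOp | ShrOp

datatype 'r instr =
    Const 'r int
  | Alu alu_op 'r 'r 'r
  | Load 'r 'r
  | Store 'r 'r
  | LoadBit 'r 'r 'r
  | StoreBit 'r 'r 'r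
  | JumpLess 'r 'r nat
  | JumpEq 'r 'r nat
  | Output 'r
  | Halt

type_synonym program = "nat instr list"

text \<open>\<open>cells s\<close> is the length of the shortest initial segment of the memory that contains the
  input and all cells read or written so far.\<close>

record ram_state =
  pc :: nat
  reg :: "nat \<Rightarrow> int"
  mem :: "nat \<Rightarrow> int"
  cells :: nat
  printed :: "int list"

definition fits :: "nat \<Rightarrow> int \<Rightarrow> bool" where
  "fits w v \<longleftrightarrow> - (2 ^ w) \<le> 2 * v \<and> 2 * v < 2 ^ w"

fun alu :: "alu_op \<Rightarrow> int \<Rightarrow> int \<Rightarrow> int option" where
  "alu AddOp a b = Some (a + b)"
| "alu SubOp a b = Some (a - b)"
| "alu MulOp a b = Some (a * b)"
| "alu DivOp a b = (if b = 0 then None else Some (a div b))"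
| "alu ModOp a b = (if b = 0 then None else Some (a mod b))"
| "alu AndOp a b = Some (semiring_bit_operations_class.and a b)"
| "alu OrOp a b = Some (semiring_bit_operations_class.or a b)"
| "alu XorOp a b = Some (semiring_bit_operations_class.xor a b)"
| "alu ShlOp a b = (if b < 0 then None else Some (push_bit (nat b) a))"
| "alu ShrOp a b = (if b < 0 then None else Some (drop_bit (nat b) a))"

definition set_reg :: "nat \<Rightarrow> nat \<Rightarrow> int \<Rightarrow> ram_state \<Rightarrow> ram_state option" where
  "set_reg w r v s =
     (if fits w v then Some (s\<lparr>reg := (reg s)(r := v), pc := Suc (pc s)\<rparr>) else None)"

definition set_cell :: "nat \<Rightarrow> nat \<Rightarrow> int \<Rightarrow> ram_state \<Rightarrow> ram_state option" where
  "set_cell w a v s =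
     (if fits w v then Some (s\<lparr>mem := (mem s)(a := v), pc := Suc (pc s)\<rparr>) else None)"

definition touch :: "nat \<Rightarrow> ram_state \<Rightarrow> ram_state" where
  "touch a s = s\<lparr>cells := max (cells s) (Suc a)\<rparr>"

definition jump :: "bool \<Rightarrow> nat \<Rightarrow> ram_state \<Rightarrow> ram_state option" where
  "jump b l s = Some (s\<lparr>pc := (if b then l else Suc (pc s))\<rparr>)"

fun exec_instr :: "nat \<Rightarrow> nat instr \<Rightarrow> ram_state \<Rightarrow> ram_state option" where
  "exec_instr w (Const r v) s = set_reg w r v s"
| "exec_instr w (Alu f r p q) s =
     Option.bind (alu f (reg s p) (reg s q)) (\<lambda>v. set_reg w r v s)"
| "exec_instr w (Load r p) s =
     (if reg s p < 0 then None
      else let a = nat (reg s p) in set_reg w r (mem s a) (touch a s))"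
| "exec_instr w (Store r p) s =
     (if reg s p < 0 then None
      else let a = nat (reg s p) in set_cell w a (reg s r) (touch a s))"
| "exec_instr w (LoadBit r p q) s =
     (if reg s p < 0 \<or> reg s q < 0 then None
      else let a = nat (reg s p) + nat (reg s q) div w; j = nat (reg s q) mod w
           in set_reg w r (of_bool (bit (mem s a) j)) (touch a s))"
| "exec_instr w (StoreBit r p q) s =
     (if reg s p < 0 \<or> reg s q < 0 then None
      else let a = nat (reg s p) + nat (reg s q) div w; j = nat (reg s q) mod w;
               v = (if reg s r \<noteq> 0 then set_bit j (mem s a) else unset_bit j (mem s a))
           in set_cell w a (signed_take_bit (w - 1) v) (touch a s))"
| "exec_instr w (JumpLess p q l) s = jump (reg s p < reg s q) l s"
| "exec_instr w (JumpEq p q l) s = jump (reg s p = reg s q) l s"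
| "exec_instr w (Output r) s = Some (s\<lparr>printed := printed s @ [reg s r], pc := Suc (pc s)\<rparr>)"
| "exec_instr w Halt s = None"

definition step :: "nat \<Rightarrow> program \<Rightarrow> ram_state \<Rightarrow> ram_state option" where
  "step w prog s = (if pc s < length prog then exec_instr w (prog ! pc s) s else None)"

definition halted :: "program \<Rightarrow> ram_state \<Rightarrow> bool" where
  "halted prog s \<longleftrightarrow> pc s < length prog \<and> prog ! pc s = Halt"

definition init_state :: "int list \<Rightarrow> ram_state" where
  "init_state inp =
     \<lparr>pc = 0, reg = (\<lambda>_. 0), mem = (\<lambda>a. if a < length inp then inp ! a else 0),
      cells = length inp, printed = []\<rparr>"

text \<open>Words are a constant factor \<open>\<kappa>\<close> longer than the longest number in the input.\<close>

definition word_size :: "nat \<Rightarrow> int list \<Rightarrow> nat" where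
  "word_size \<kappa> inp = \<kappa> * Max ((\<lambda>v. floorlog 2 (nat \<bar>v\<bar>)) ` set inp)"

text \<open>
  On input \<open>inp\<close> the program halts properly after \<open>t\<close> executed instructions with output \<open>outp\<close>,
  having used \<open>sp\<close> bits: all registers it mentions and the memory segment, input included. The
  output stream is write-only and not counted. Since no step is possible in a halted state,
  \<open>outp\<close>, \<open>t\<close> and \<open>sp\<close> are determined by the program and the input.
\<close>

definition ram_computes ::
    "nat \<Rightarrow> program \<Rightarrow> int list \<Rightarrow> int list \<Rightarrow> nat \<Rightarrow> nat \<Rightarrow> bool" where
  "ram_computes \<kappa> prog inp outp t sp \<longleftrightarrow>
     (let w = word_size \<kappa> inp in
      \<exists>s. ((\<lambda>s'. Option.bind s' (step w prog)) ^^ t) (Some (init_state inp)) = Some s \<and>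
          halted prog s \<and> outp = printed s \<and>
          sp = w * (card (\<Union>i\<in>set prog. set_instr i) + cells s))"


section \<open>Patterns\<close>

definition is_pattern :: "int poly list \<Rightarrow> bool" where
  "is_pattern P \<longleftrightarrow> distinct P \<and> (\<forall>f\<in>set P. degree f = 1 \<and> lead_coeff f > 0)"

definition pattern_input :: "int poly list \<Rightarrow> nat \<Rightarrow> int list" where
  "pattern_input P n =
     int (length P) # int n # concat (map (\<lambda>f. [coeff f 1, coeff f 0]) P)"

definition prime_pattern_positions :: "int poly list \<Rightarrow> nat \<Rightarrow> int set" where
  "prime_pattern_positions P n =
     {x. Max ((\<lambda>f. poly f x) ` set P) \<le> int n \<and> (\<forall>f\<in>set P. prime (poly f x))}"


section \<open>The two conjectures\<close>

text \<open>As usual for pseudosquares, 0 does not count as a quadratic residue: the first values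
  \<open>L\<^sub>2 = 17\<close>, \<open>L\<^sub>3 = 73\<close>, \<open>L\<^sub>5 = 241\<close> require the Legendre symbol to be 1.\<close>

definition pseudosquare :: "nat \<Rightarrow> nat" where
  "pseudosquare p =
     (LEAST L. 0 < L \<and> \<not> is_square L \<and> [L = 1] (mod 8) \<and>
        (\<forall>q. prime q \<and> odd q \<and> q \<le> p \<longrightarrow> Legendre (int L) (int q) = 1))"

text \<open>Pseudosquares are at least 17, so \<open>ln (ln n) > 0\<close> whenever the premise holds.\<close>

definition conjecture_A :: bool where
  "conjecture_A \<longleftrightarrow>
     (\<exists>C::real. \<forall>(n::nat) (p::nat).
        prime p \<and> pseudosquare p \<le> n \<and>
        (\<forall>q. prime q \<and> pseudosquare q \<le> n \<longrightarrow> pseudosquare q \<le> pseudosquare p) \<longrightarrow>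
        real p \<le> C * (ln (real n) * ln (ln (real n))))"

definition least_prime_divisor :: "nat \<Rightarrow> nat" where
  "least_prime_divisor m = (LEAST q. prime q \<and> q dvd m)"

text \<open>
  The implied constant is absolute. No such constant exists for literally all \<open>x\<close> and \<open>y\<close>: for
  \<open>a = x = 3\<close>, \<open>y = 2\<close> the left-hand side is 1 for every \<open>b > 3\<close> with 3 not dividing \<open>b\<close>, while the right-hand
  side tends to 0 as \<open>b\<close> grows. The estimate is therefore read in the usual range of sieve bounds,
  in which the progression has at least about \<open>y\<close> terms up to \<open>x\<close>. This is implied by any reading
  with a larger range, so a theorem assuming it also covers those readings.
\<close>

definition conjecture_B :: bool where
  "conjecture_B \<longleftrightarrow>
     (\<exists>C::real. \<forall>(a::nat) (b::nat) (x::real) (y::real).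
        0 < a \<and> 0 < b \<and> coprime a b \<and> 1 \<le> y \<and> y \<le> x / real b \<longrightarrow>
        real (card {m::nat. 1 < m \<and> real m \<le> x \<and> [m = a] (mod b) \<and>
                            real (least_prime_divisor m) > y})
        \<le> C * (x / real b *
                (\<Prod>p | prime p \<and> real p \<le> y \<and> coprime p b. 1 - 1 / real p)))"

end

theory Submission
  imports Defs "HOL-Analysis.Harmonic_Numbers" "HOL-Real_Asymp.Real_Asymp"
begin

text \<open>
  Let \<open>y\<close> be about \<open>n\<close> to the power \<open>1/K\<close> for a large constant \<open>K\<close>, and let \<open>M\<close> be the largest
  primorial that is at most \<open>y\<close>. The search range is split into residue classes modulo \<open>M\<close>. Only a
  proportion of order \<open>(log log n)\<close> to the power \<open>-k\<close> of the classes contains no value divisible by a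
  prime factor of \<open>M\<close>. Each of these is sieved by the primes up to \<open>y\<close> in segments of length
  \<open>y\<close> squared, at a cost of order \<open>log log n\<close> per position, so that sieving takes
  \<open>n / (log log n)^(k-1)\<close> operations in space \<open>y\<close> squared. By Brun's pure sieve at most
  \<open>n (log log n / log n)^k\<close> positions survive. They are tested with the pseudosquare primality test of
  Lukes, Patterson and Williams: if \<open>m\<close> has no prime factor up to \<open>y\<close> and is not a perfect power,
  the Euler criterion for all small prime bases, up to a bound on the least quadratic nonresidues of
  pseudosquare candidates up to \<open>n / y\<close>, decides primality. The program computes this bound
  itself, so that correctness is unconditional; Conjecture A bounds it by a power of \<open>log n\<close> with
  exponent \<open>9/7\<close>. As \<open>k > 2\<close>, the cost of all tests is of smaller order than the cost of sieving.
\<close>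

section \<open>Legendre symbols\<close>

lemma Legendre_cases: "Legendre a p \<in> {-1, 0, 1}"
  by (auto simp: Legendre_def)

lemma abs_Legendre_le_1: "\<bar>Legendre a p\<bar> \<le> 1"
  by (simp add: Legendre_def)

lemma Legendre_eq_0_iff: "Legendre a p = 0 \<longleftrightarrow> p dvd a"
  by (auto simp: Legendre_def cong_0_iff)

lemma Legendre_mod: "Legendre (a mod p) p = Legendre a p"
  by (simp add: Legendre_def QuadRes_def unique_euclidean_semiring_class.cong_def)

lemma dvd_abs_less_imp_eq_0:
  fixes d x :: int
  shows "d dvd x \<Longrightarrow> \<bar>x\<bar> < d \<Longrightarrow> x = 0"
  using zdvd_not_zless[of "\<bar>x\<bar>" d] by (cases "x = 0") auto

lemma cong_imp_eq_if_abs_le_1: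
  fixes a b p :: int
  assumes "2 < p" "\<bar>a\<bar> \<le> 1" "\<bar>b\<bar> \<le> 1" "[a = b] (mod p)"
  shows "a = b"
  using dvd_abs_less_imp_eq_0[of p "a - b"] assms by (simp add: cong_iff_dvd_diff)

lemma Legendre_mult:
  assumes "prime p" "2 < p"
  shows "Legendre (a * b) (int p) = Legendre a (int p) * Legendre b (int p)"
proof (rule cong_imp_eq_if_abs_le_1[of "int p"])
  have "[Legendre (a * b) p = a ^ ((p - 1) div 2) * b ^ ((p - 1) div 2)] (mod p)"
    using euler_criterion[OF assms, of "a * b"] by (simp only: power_mult_distrib)
  also have "[a ^ ((p - 1) div 2) * b ^ ((p - 1) div 2) = Legendre a p * Legendre b p] (mod p)"
    by (intro cong_mult cong_sym[OF euler_criterion[OF assms]])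
  finally show "[Legendre (a * b) p = Legendre a p * Legendre b p] (mod p)" .
  show "\<bar>Legendre a p * Legendre b p\<bar> \<le> 1"
    using abs_Legendre_le_1[of a p] abs_Legendre_le_1[of b p] by (simp add: abs_mult mult_le_one)
qed (use assms abs_Legendre_le_1 in auto)

lemma Legendre_2:
  assumes "prime p" "2 < p"
  shows "Legendre 2 (int p) = (if p mod 8 = 1 \<or> p mod 8 = 7 then 1 else -1)"
proof -
  interpret G: GAUSS p 2
    using assms by unfold_locales (auto simp: cong_0_iff dest: zdvd_imp_le)
  define h where "h = (int p - 1) div 2"
  have p: "int p = 2 * h + 1" unfolding h_def using prime_odd_nat[OF assms] by presburger
  have "G.C = (\<lambda>x. 2 * x) ` {0<..h}"
    unfolding G.C_def G.B_def G.A_def h_def[symmetric] image_image by (intro image_cong) (auto simp: p)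
  then have "G.E = (\<lambda>x. 2 * x) ` {h div 2<..h}"
    unfolding G.E_def h_def[symmetric] by auto
  then have "card G.E = nat (h - h div 2)" by (simp add: card_image inj_on_def)
  then have "Legendre 2 p = (if even (nat (h - h div 2)) then 1 else -1)"
    using G.gauss_lemma by (simp add: minus_one_power_iff)
  moreover have "0 < h" using p assms(2) by linarith
  then have "even (nat (h - h div 2)) \<longleftrightarrow> even (h - h div 2)" by (simp add: even_nat_iff)
  moreover have "\<dots> \<longleftrightarrow> int p mod 8 = 1 \<or> int p mod 8 = 7"
    unfolding p by presburger
  moreover have "int p mod 8 = int (p mod 8)" by (simp add: zmod_int)
  ultimately show ?thesis by simp
qed

lemma Legendre_reciprocity_cong_4:
  assumes "prime p" "2 < p" "prime r" "2 < r" "[p = r] (mod 4)" "prime q" "2 < q" "p \<noteq> q" "r \<noteq> q"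
  shows "Legendre (int p) (int q) * Legendre (int q) (int p) = Legendre (int r) (int q) * Legendre (int q) (int r)"
proof -
  have "odd p" "odd r" using assms prime_odd_nat by auto
  moreover have "p mod 4 = r mod 4" using assms(5) by (simp add: unique_euclidean_semiring_class.cong_def)
  ultimately have "even ((p - 1) div 2) \<longleftrightarrow> even ((r - 1) div 2)" by presburger
  then have "(-1 :: int) ^ ((p - 1) div 2 * ((q - 1) div 2)) = (-1) ^ ((r - 1) div 2 * ((q - 1) div 2))"
    by (simp add: minus_one_power_iff)
  then show ?thesis using Quadratic_Reciprocity assms by metis
qed

lemma Legendre_reciprocity_1_mod_4:
  assumes "prime p" "2 < p" "p mod 4 = 1" "prime q" "2 < q" "p \<noteq> q"
  shows "Legendre (int p) (int q) = Legendre (int q) (int p)"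
proof -
  have "even ((p - 1) div 2)" using assms(3) by presburger
  then have "Legendre p q * Legendre q p = 1"
    using Quadratic_Reciprocity[of p q] assms by simp
  then show ?thesis using Legendre_cases[of p q] Legendre_cases[of q p] by auto
qed

section \<open>Pseudosquare candidates\<close>

definition pseudosquare_candidate :: "nat \<Rightarrow> bool" where
  "pseudosquare_candidate L \<longleftrightarrow> 1 < L \<and> \<not> is_square L \<and> L mod 8 = 1"

definition least_nonresidue :: "nat \<Rightarrow> nat" where
  "least_nonresidue L = (LEAST q. prime q \<and> odd q \<and> Legendre (int L) (int q) \<noteq> 1)"

lemma pseudosquare_candidate_ge_9:
  assumes "pseudosquare_candidate L"
  shows "9 \<le> L"
proof -
  have "1 < L" "L mod 8 = 1" using assms by (simp_all add: pseudosquare_candidate_def)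
  then show ?thesis by presburger
qed

lemma pseudosquare_candidate_odd:
  assumes "pseudosquare_candidate L"
  shows "odd L"
proof -
  have "L mod 8 = 1" using assms by (simp add: pseudosquare_candidate_def)
  then show ?thesis by presburger
qed

lemma
  assumes "1 < L" "odd L"
  shows prime_least_nonresidue: "prime (least_nonresidue L)"
    and least_nonresidue_gt_2: "2 < least_nonresidue L"
    and Legendre_least_nonresidue: "Legendre (int L) (int (least_nonresidue L)) \<noteq> 1"
    and least_nonresidue_le_self: "least_nonresidue L \<le> L"
proof -
  let ?P = "\<lambda>q. prime q \<and> odd q \<and> Legendre (int L) (int q) \<noteq> 1"
  obtain q where q: "prime q" "q dvd L" using assms(1) prime_factor_nat[of L] by auto
  moreover have "odd q" using q(2) assms(2) by (meson dvd_trans)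
  moreover have "Legendre (int L) (int q) = 0" using q(2) by (simp add: Legendre_eq_0_iff)
  ultimately have witness: "?P q" by simp
  have least: "?P (least_nonresidue L)" unfolding least_nonresidue_def using witness by (rule LeastI)
  then show "prime (least_nonresidue L)" "Legendre (int L) (int (least_nonresidue L)) \<noteq> 1" by auto
  have "least_nonresidue L \<noteq> 2" using least by auto
  then show "2 < least_nonresidue L" using least prime_ge_2_nat[of "least_nonresidue L"] by simp
  have "least_nonresidue L \<le> q" unfolding least_nonresidue_def using witness by (rule Least_le)
  then show "least_nonresidue L \<le> L" using q(2) assms(1) dvd_imp_le[of q L] by simp
qed

lemma least_nonresidue_le:
  "prime q \<Longrightarrow> odd q \<Longrightarrow> Legendre (int L) (int q) \<noteq> 1 \<Longrightarrow> least_nonresidue L \<le> q"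
  unfolding least_nonresidue_def by (rule Least_le) simp

lemma less_least_nonresidue:
  assumes "1 < L" "odd L" "\<And>q. prime q \<Longrightarrow> 2 < q \<Longrightarrow> q \<le> \<beta> \<Longrightarrow> Legendre (int L) (int q) = 1"
  shows "\<beta> < least_nonresidue L"
  using assms prime_least_nonresidue least_nonresidue_gt_2 Legendre_least_nonresidue not_le by metis

lemma least_nonresidue_if_all_residues:
  assumes "prime p" "p mod 4 = 1" "2 \<le> \<beta>" "\<And>q. prime q \<Longrightarrow> q \<le> \<beta> \<Longrightarrow> Legendre (int q) (int p) = 1"
  shows "pseudosquare_candidate p" "\<beta> < least_nonresidue p"
proof -
  have p: "2 < p" "odd p"
    using assms(2) prime_ge_2_nat[OF assms(1)] by presburger+
  have "p mod 8 = 1 \<or> p mod 8 = 7"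
    using assms(4)[of 2] assms(3) Legendre_2[OF assms(1) p(1)] by (simp split: if_splits)
  moreover have "p mod 4 = 1 \<Longrightarrow> p mod 8 \<noteq> 7" by presburger
  ultimately show "pseudosquare_candidate p"
    using assms(1,2) p(1) by (auto simp: pseudosquare_candidate_def is_nth_power_def prime_power_iff)
  show "\<beta> < least_nonresidue p"
  proof (rule less_least_nonresidue)
    fix q assume q: "prime q" "2 < q" "q \<le> \<beta>"
    have "p \<noteq> q" using assms(4)[OF q(1,3)] Legendre_eq_0_iff[of "int p" "int p"] by auto
    then show "Legendre (int p) (int q) = 1"
      using Legendre_reciprocity_1_mod_4[OF assms(1) p(1) assms(2) q(1,2)] assms(4)[OF q(1,3)] by simp
  qed (use p in auto)
qed

lemma not_is_square_prime_mult_prime: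
  fixes p r :: nat
  assumes "prime p" "prime r" "p \<noteq> r"
  shows "\<not> is_square (p * r)"
proof
  assume "is_square (p * r)"
  then obtain z where z: "p * r = z ^ 2" by (auto elim: is_nth_powerE)
  then have "p dvd z" using assms(1) by (metis dvd_triv_left prime_dvd_power)
  then have "p * p dvd p * r" unfolding z power2_eq_square by (intro mult_dvd_mono)
  then have "p dvd r" using assms(1) by (simp add: prime_gt_0_nat)
  then show False using assms primes_dvd_imp_eq[of p r] by simp
qed

lemma least_nonresidue_if_equal_symbols:
  assumes "prime p" "2 < p" "prime r" "2 < r" "p \<noteq> r" "[p = r] (mod 4)" "2 \<le> \<beta>"
    and equal: "\<And>q. prime q \<Longrightarrow> q \<le> \<beta> \<Longrightarrow> Legendre (int q) (int p) = Legendre (int q) (int r)"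
    and nonzero: "\<And>q. prime q \<Longrightarrow> q \<le> \<beta> \<Longrightarrow> Legendre (int q) (int p) \<noteq> 0"
  shows "pseudosquare_candidate (p * r)" "\<beta> < least_nonresidue (p * r)"
proof -
  have odd: "odd p" "odd r" using assms prime_odd_nat by auto
  have same_symbol: "p mod 8 = 1 \<or> p mod 8 = 7 \<longleftrightarrow> r mod 8 = 1 \<or> r mod 8 = 7"
    using equal[of 2] assms(7) Legendre_2[OF assms(1,2)] Legendre_2[OF assms(3,4)]
    by (simp split: if_splits)
  have "p mod 8 mod 4 = r mod 8 mod 4"
    using assms(6) by (simp add: unique_euclidean_semiring_class.cong_def mod_mod_cancel)
  moreover have cases: "x mod 8 \<in> {1, 3, 5, 7}" if "odd x" for x :: nat using that by simp presburger
  ultimately have "p mod 8 = r mod 8" using cases[OF odd(1)] cases[OF odd(2)] same_symbol by auto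
  then have "p * r mod 8 = r mod 8 * (r mod 8) mod 8" by (metis mod_mult_eq)
  then have "p * r mod 8 = 1" using cases[OF odd(2)] by auto
  moreover have gt_1: "1 < p * r" using assms(2,4) less_1_mult[of p r] by linarith
  ultimately show "pseudosquare_candidate (p * r)"
    using not_is_square_prime_mult_prime[OF assms(1,3,5)] by (simp add: pseudosquare_candidate_def)
  show "\<beta> < least_nonresidue (p * r)"
  proof (rule less_least_nonresidue[OF gt_1])
    fix q assume q: "prime q" "2 < q" "q \<le> \<beta>"
    have neq: "p \<noteq> q" "r \<noteq> q"
      using equal[OF q(1,3)] nonzero[OF q(1,3)] Legendre_eq_0_iff[of "int q" "int q"] by auto
    have "Legendre (int p) (int q) = Legendre (int r) (int q)"
      using Legendre_reciprocity_cong_4[OF assms(1-4,6) q(1,2) neq] equal[OF q(1,3)] nonzero[OF q(1,3)]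
      by simp
    moreover have "Legendre (int r) (int q) \<noteq> 0"
      using neq(2) q(1) assms(3) by (auto simp: Legendre_eq_0_iff dest: primes_dvd_imp_eq)
    ultimately show "Legendre (int (p * r)) (int q) = 1"
      using Legendre_mult[OF q(1,2), of "int p" "int r"] Legendre_cases[of "int r" "int q"] by auto
  qed (use odd in simp)
qed

lemma Legendre_eq_1_if_prime_divisors:
  assumes "prime p" "2 < p" "h \<noteq> 0" "\<And>q. prime q \<Longrightarrow> q dvd h \<Longrightarrow> Legendre (int q) (int p) = 1"
  shows "Legendre (int h) (int p) = 1"
  using assms(3,4)
proof (induction h rule: prime_divisors_induct)
  case (unit x)
  have "QuadRes (int p) 1" unfolding QuadRes_def by (rule exI[of _ 1]) simp
  then show ?case using unit assms(2) by (simp add: Legendre_def unique_euclidean_semiring_class.cong_def)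
next
  case (factor q x)
  then have "Legendre (int x) (int p) = 1" "Legendre (int q) (int p) = 1" by auto
  then show ?case using Legendre_mult[OF assms(1,2), of "int q" "int x"] by simp
qed simp

section \<open>Euler powers and witness bases\<close>

definition half_power :: "nat \<Rightarrow> nat \<Rightarrow> nat" where
  "half_power m q = q ^ ((m - 1) div 2) mod m"

lemma half_power_prime:
  assumes "prime p" "2 < p"
  shows "[int (half_power p q) = Legendre (int q) (int p)] (mod int p)"
  using cong_sym[OF euler_criterion[OF assms, of "int q"]] by (simp add: half_power_def zmod_int)

lemma half_power_eq_1_iff:
  assumes "prime p" "2 < p"
  shows "half_power p q = 1 \<longleftrightarrow> Legendre (int q) (int p) = 1"
proof
  assume "half_power p q = 1"
  then show "Legendre (int q) (int p) = 1"
    using half_power_prime[OF assms, of q] cong_imp_eq_if_abs_le_1[of "int p" "Legendre (int q) (int p)" 1]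
      abs_Legendre_le_1 assms(2) by (simp add: cong_sym)
next
  assume "Legendre (int q) (int p) = 1"
  then have "[half_power p q = 1] (mod p)"
    using half_power_prime[OF assms, of q] cong_int_iff[of _ 1] by simp
  then show "half_power p q = 1"
    using assms(2) by (simp add: half_power_def unique_euclidean_semiring_class.cong_def)
qed

lemma half_power_eq_minus_1:
  assumes "prime p" "2 < p" "Legendre (int q) (int p) = -1"
  shows "half_power p q = p - 1"
proof -
  have "[int (half_power p q) = int (p - 1)] (mod int p)"
    using half_power_prime[OF assms(1,2), of q] assms(2,3)
    by (simp add: of_nat_diff unique_euclidean_semiring_class.cong_def)
  then have "[half_power p q = p - 1] (mod p)" by (simp only: cong_int_iff)
  then show ?thesis using assms(2) by (simp add: half_power_def unique_euclidean_semiring_class.cong_def)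
qed

lemma half_power_prime_cases:
  assumes "prime p" "2 < p" "0 < q" "q < p"
  shows "half_power p q \<in> {1, p - 1}"
proof -
  have "Legendre (int q) (int p) \<noteq> 0" using assms by (auto simp: Legendre_eq_0_iff dest: dvd_imp_le)
  then show ?thesis
    using Legendre_cases[of q p] half_power_eq_1_iff[OF assms(1,2)] half_power_eq_minus_1[OF assms(1,2)]
    by blast
qed

lemma obtain_prime_nonresidue:
  assumes "prime p" "2 < p"
  obtains q where "prime q" "q < p" "Legendre (int q) (int p) \<noteq> 1"
proof -
  obtain g where g: "residue_primroot p g"
    using prime_primitive_root_exists assms(1) prime_gt_1_nat by blast
  then have ord: "coprime p g" "ord p g = p - 1"
    using assms(1) by (auto simp: residue_primroot_def totient_prime)
  have "g mod p \<noteq> 0"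
  proof
    assume "g mod p = 0"
    then have "p dvd g" by auto
    then show False using ord(1) assms(1) by (metis coprime_absorb_left not_prime_unit)
  qed
  moreover have "Legendre (int (g mod p)) (int p) \<noteq> 1"
  proof
    assume "Legendre (int (g mod p)) (int p) = 1"
    then have "half_power p g = 1"
      using half_power_eq_1_iff[OF assms, of g] by (simp add: zmod_int Legendre_mod)
    then have "[g ^ ((p - 1) div 2) = 1] (mod p)"
      using assms(2) by (simp add: half_power_def unique_euclidean_semiring_class.cong_def)
    then have "p - 1 dvd (p - 1) div 2" by (simp only: ord_divides ord(2))
    then show False using assms(2) by (auto dest: dvd_imp_le)
  qed
  ultimately obtain q where q: "prime q" "q dvd g mod p" "Legendre (int q) (int p) \<noteq> 1"
    using Legendre_eq_1_if_prime_divisors[OF assms, of "g mod p"] by blast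
  have "q \<le> g mod p" using q(2) \<open>g mod p \<noteq> 0\<close> by (simp add: dvd_imp_le)
  also have "\<dots> < p" using assms(2) by simp
  finally show ?thesis using that q by blast
qed

lemma Legendre_least_nonresidue_prime:
  assumes "prime p" "p mod 8 = 1"
  shows "Legendre (int (least_nonresidue p)) (int p) = -1"
proof -
  have p: "2 < p" "odd p" "p mod 4 = 1" using assms(2) prime_ge_2_nat[OF assms(1)] by presburger+
  let ?r = "least_nonresidue p"
  note reciprocity = Legendre_reciprocity_1_mod_4[OF assms(1) p(1,3)]
  obtain q where q: "prime q" "q < p" "Legendre (int q) (int p) \<noteq> 1"
    using obtain_prime_nonresidue[OF assms(1) p(1)] .
  moreover have "q \<noteq> 2" using q(3) Legendre_2[OF assms(1) p(1)] assms(2) by auto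
  then have "2 < q" using prime_ge_2_nat[OF q(1)] by simp
  ultimately have "?r \<le> q" using reciprocity[of q] prime_odd_nat by (intro least_nonresidue_le) auto
  moreover have r: "prime ?r" "2 < ?r" "Legendre (int p) (int ?r) \<noteq> 1"
    using prime_least_nonresidue least_nonresidue_gt_2 Legendre_least_nonresidue p by auto
  ultimately have "Legendre (int ?r) (int p) \<noteq> 1" using reciprocity[of ?r] q(2) by simp
  moreover have "Legendre (int ?r) (int p) \<noteq> 0"
    using r(2) \<open>?r \<le> q\<close> q(2) by (auto simp: Legendre_eq_0_iff dest: dvd_imp_le)
  ultimately show ?thesis using Legendre_cases[of ?r p] by auto
qed

definition witness_base :: "nat \<Rightarrow> nat" where
  "witness_base m = (if m mod 8 = 1 then least_nonresidue m else if m mod 8 = 5 then 2 else m - 1)"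

lemma half_power_witness_base:
  assumes "prime p" "2 < p"
  shows "half_power p (witness_base p) = p - 1"
proof -
  have "p mod 8 = 1 \<or> p mod 8 = 5 \<or> p mod 8 = 3 \<or> p mod 8 = 7"
    using prime_odd_nat[OF assms] by presburger
  then consider "p mod 8 = 1" | "p mod 8 = 5" | "p mod 8 = 3 \<or> p mod 8 = 7" by blast
  then have "Legendre (int (witness_base p)) (int p) = -1"
  proof cases
    case 1
    then show ?thesis using Legendre_least_nonresidue_prime assms(1) by (simp add: witness_base_def)
  next
    case 2
    then show ?thesis using Legendre_2[OF assms] by (simp add: witness_base_def)
  next
    case 3
    then have "odd ((p - 1) div 2)" by presburger
    then have "[Legendre (int (p - 1)) (int p) = (-1) ^ ((p - 1) div 2)] (mod int p)"
      using assms(2)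
      by (intro cong_trans[OF euler_criterion[OF assms]] cong_pow) (simp add: cong_iff_dvd_diff of_nat_diff)
    then have "Legendre (int (p - 1)) (int p) = -1"
      using \<open>odd ((p - 1) div 2)\<close> assms(2) abs_Legendre_le_1
      by (intro cong_imp_eq_if_abs_le_1[of "int p"]) auto
    then show ?thesis using 3 by (auto simp: witness_base_def)
  qed
  then show ?thesis by (rule half_power_eq_minus_1[OF assms])
qed

section \<open>Soundness of the pseudosquare test\<close>

lemma two_power_dvd_prime_minus_1:
  assumes "prime p" "2 < p" "[int (g ^ (2 ^ s * t)) = -1] (mod int p)"
  shows "2 ^ Suc s dvd p - 1"
proof -
  let ?h = "g ^ t"
  have minus_1: "[int (?h ^ (2 ^ s)) = -1] (mod int p)"
    using assms(3) by (simp add: mult.commute flip: power_mult)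
  have "[(int (?h ^ (2 ^ s)))\<^sup>2 = (-1)\<^sup>2] (mod int p)" using minus_1 by (rule cong_pow)
  then have "[int (?h ^ (2 ^ Suc s)) = int 1] (mod int p)" by (simp add: mult_ac flip: power_mult)
  then have one: "[?h ^ (2 ^ Suc s) = 1] (mod p)" by (simp only: cong_int_iff)
  then have "ord p ?h dvd 2 ^ Suc s" by (simp only: ord_divides)
  then obtain i where i: "i \<le> Suc s" "ord p ?h = 2 ^ i"
    using divides_primepow_nat[of 2 "ord p ?h" "Suc s"] by auto
  have "\<not> ord p ?h dvd 2 ^ s"
  proof
    assume "ord p ?h dvd 2 ^ s"
    then have "[int (?h ^ (2 ^ s)) = int 1] (mod int p)" by (simp only: cong_int_iff ord_divides)
    from cong_trans[OF cong_sym[OF minus_1] this] show False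
      using cong_imp_eq_if_abs_le_1[of "int p" "-1" 1] assms(2) by simp
  qed
  then have "i = Suc s" using i le_imp_power_dvd[of i s 2] by (cases "i = Suc s") auto
  moreover have "ord p ?h dvd p - 1"
  proof -
    have "coprime (?h ^ (2 ^ Suc s)) p" by (rule cong_imp_coprime[OF cong_sym[OF one]]) simp
    then have "\<not> p dvd ?h ^ (2 ^ Suc s)" using assms(1) by (metis coprime_absorb_right not_prime_unit)
    then have "\<not> p dvd ?h" by (meson dvd_power dvd_trans zero_less_numeral zero_less_power)
    then have "[?h ^ (p - 1) = 1] (mod p)" by (rule fermat_theorem[OF assms(1)])
    then show ?thesis by (simp only: ord_divides)
  qed
  ultimately show ?thesis using i by simp
qed

lemma Legendre_eq_power:
  fixes \<epsilon> :: int
  assumes "prime p" "2 < p" "[int (q ^ (2 ^ s * t)) = \<epsilon>] (mod int p)" "\<epsilon> \<in> {1, -1}" "odd t" "p - 1 = 2 ^ Suc s * u"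
  shows "Legendre (int q) (int p) = \<epsilon> ^ u"
proof (rule cong_imp_eq_if_abs_le_1[of "int p"])
  have unit: "\<epsilon> \<noteq> 0" "\<bar>\<epsilon>\<bar> \<le> 1" using assms(4) by auto
  have "Legendre (int q) p \<noteq> 0"
  proof
    assume "Legendre (int q) p = 0"
    then have "int p dvd int (q ^ (2 ^ s * t))"
      using odd_pos[OF \<open>odd t\<close>]
      by (simp add: Legendre_eq_0_iff dvd_power_iff dvd_trans[OF _ dvd_power])
    then have "[\<epsilon> = 0] (mod int p)" using assms(3) by (metis cong_0_iff cong_sym cong_trans)
    then show False using cong_imp_eq_if_abs_le_1[of "int p" \<epsilon> 0] unit assms(2) by auto
  qed
  then have odd_power: "Legendre (int q) p ^ t = Legendre (int q) p"
    using Legendre_cases[of q p] \<open>odd t\<close> by auto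
  have "(p - 1) div 2 = 2 ^ s * u" using assms(6) by simp
  then have "[Legendre (int q) p ^ t = (int q ^ (2 ^ s * u)) ^ t] (mod p)"
    using cong_pow[OF euler_criterion[OF assms(1,2), of "int q"], of t] by simp
  also have "(int q ^ (2 ^ s * u)) ^ t = int (q ^ (2 ^ s * t)) ^ u"
    by (simp add: mult_ac flip: power_mult)
  also have "[int (q ^ (2 ^ s * t)) ^ u = \<epsilon> ^ u] (mod p)"
    using assms(3) by (rule cong_pow)
  finally show "[Legendre (int q) p = \<epsilon> ^ u] (mod p)" unfolding odd_power .
  show "\<bar>\<epsilon> ^ u\<bar> \<le> 1" using unit by (simp add: power_abs power_le_one)
qed (use assms abs_Legendre_le_1 in auto)

lemma rough_cofactor_le:
  fixes L m n y :: nat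
  assumes "\<And>q. prime q \<Longrightarrow> q dvd m \<Longrightarrow> y < q" "L dvd m" "L \<noteq> m" "0 < m" "m \<le> n" "0 < y"
  shows "L \<le> n div y"
proof -
  obtain c where c: "m = L * c" using assms(2) by blast
  then have "c \<noteq> 1" "c \<noteq> 0" using assms by auto
  then obtain q where q: "prime q" "q dvd c" using prime_factor_nat by blast
  then have "y < q" using assms(1)[of q] c by auto
  also have "q \<le> c" using q \<open>c \<noteq> 0\<close> by (simp add: dvd_imp_le)
  finally have "L * y \<le> n" using c assms(5) by (metis less_imp_le mult_le_mono2 order_trans)
  then show ?thesis using assms(6) by (simp add: less_eq_div_iff_mult_less_eq)
qed

definition perfect_power :: "nat \<Rightarrow> nat \<Rightarrow> bool" where
  "perfect_power K m \<longleftrightarrow> (\<exists>e\<in>{2..K}. \<exists>a. m = a ^ e)"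

lemma obtain_two_prime_divisors:
  assumes "1 < m" "\<not> prime m" "\<not> perfect_power K m" "m \<le> y ^ K" "\<And>q. prime q \<Longrightarrow> q dvd m \<Longrightarrow> y < q"
  obtains p r where "prime p" "p dvd m" "prime r" "r dvd m" "p \<noteq> r"
proof -
  obtain p where p: "prime p" "p dvd m" using assms(1) prime_factor_nat[of m] by auto
  have "\<exists>r. prime r \<and> r dvd m \<and> r \<noteq> p"
  proof (rule ccontr)
    assume no_other: "\<not> ?thesis"
    have "prime_factors m = {r. prime r \<and> r dvd m}" using assms(1) by (intro prime_factors_dvd) simp
    also have "\<dots> = {p}" using p no_other by blast
    finally have "m = p ^ multiplicity p m" using prod_prime_factors[of m] assms(1) by simp
    then obtain e where e: "m = p ^ e" ..
    then have "e \<noteq> 0" "e \<noteq> 1" using assms(1,2) p by auto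
    moreover have "e \<le> K"
    proof -
      have "y ^ K \<le> p ^ K" using assms(5)[OF p] by (intro power_mono) auto
      then have "p ^ e \<le> p ^ K" using assms(4) e by linarith
      then show ?thesis using power_le_imp_le_exp[OF prime_gt_1_nat[OF p(1)]] by simp
    qed
    ultimately have "perfect_power K m" using e by (auto simp: perfect_power_def)
    with assms(3) show False ..
  qed
  then show ?thesis using that p by blast
qed

text \<open>\<open>m - 1 = 2^(s+1) t\<close> with \<open>t\<close> odd. The base \<open>w\<close>, whose Euler power is \<open>-1\<close>, forces the same power
  of two to divide \<open>p - 1 = 2^(s+1) u\<close> for every prime divisor \<open>p\<close> of \<open>m\<close>. The other bases then have
  the symbol \<open>(q/p) = \<epsilon>^u\<close>, where the sign \<open>\<epsilon>\<close> does not depend on \<open>p\<close>.\<close>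

locale euler_bases =
  fixes m w \<beta> s t :: nat
  assumes m_eq: "m = 2 ^ Suc s * t + 1" and odd_t: "odd t"
    and witness: "half_power m w = m - 1"
    and bases: "\<And>q. 2 \<le> q \<Longrightarrow> q \<le> \<beta> \<Longrightarrow> q < m \<Longrightarrow> half_power m q \<in> {1, m - 1}"
begin

lemma half_power_eq: "half_power m q = q ^ (2 ^ s * t) mod m"
  by (simp add: half_power_def m_eq)

lemma m_gt_2: "2 < m"
proof -
  have "0 < 2 ^ s * t" using odd_pos[OF odd_t] by simp
  moreover have "m = 2 * (2 ^ s * t) + 1" by (simp add: m_eq)
  ultimately show ?thesis by linarith
qed

definition sign :: "nat \<Rightarrow> int" where
  "sign q = (if half_power m q = 1 then 1 else -1)"

lemma cong_sign:
  assumes "half_power m q \<in> {1, m - 1}" "p dvd m"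
  shows "[int (q ^ (2 ^ s * t)) = sign q] (mod int p)"
proof (rule cong_dvd_modulus)
  have "int (half_power m q) = 1 \<or> int (half_power m q) = int m - 1"
    using assms(1) m_gt_2 by (auto simp: of_nat_diff)
  then have "[int (half_power m q) = sign q] (mod int m)"
    using m_gt_2 by (auto simp: sign_def cong_iff_dvd_diff)
  then show "[int (q ^ (2 ^ s * t)) = sign q] (mod int m)"
    by (simp add: half_power_eq zmod_int del: of_nat_power)
qed (use assms(2) in simp)

lemma prime_divisor_gt_2: "prime p \<Longrightarrow> p dvd m \<Longrightarrow> 2 < p"
  using prime_ge_2_nat[of p] by (cases "p = 2") (auto simp: m_eq)

lemma obtain_cofactor:
  assumes "prime p" "p dvd m"
  obtains u where "p = 2 ^ Suc s * u + 1"
proof -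
  have "half_power m w \<noteq> 1" using witness m_gt_2 by simp
  then have "[int (w ^ (2 ^ s * t)) = -1] (mod int p)"
    using cong_sign[of w p] witness assms(2) by (simp add: sign_def)
  then have "2 ^ Suc s dvd p - 1"
    by (rule two_power_dvd_prime_minus_1[OF assms(1) prime_divisor_gt_2[OF assms]])
  then obtain u where "p - 1 = 2 ^ Suc s * u" by blast
  then show ?thesis using that[of u] prime_gt_0_nat[OF assms(1)] by linarith
qed

lemma Legendre_eq_sign_power:
  assumes "prime p" "p dvd m" "p = 2 ^ Suc s * u + 1" "2 \<le> q" "q \<le> \<beta>" "q < m"
  shows "Legendre (int q) (int p) = sign q ^ u"
  by (rule Legendre_eq_power[OF assms(1) prime_divisor_gt_2[OF assms(1,2)] cong_sign _ odd_t])
    (use assms bases in \<open>auto simp: sign_def\<close>)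

lemma prime_divisor_gt_bound:
  assumes "prime p" "p dvd m" "p < m"
  shows "\<beta> < p"
proof (rule ccontr)
  assume "\<not> \<beta> < p"
  moreover obtain u where "p = 2 ^ Suc s * u + 1" using assms(1,2) by (rule obtain_cofactor)
  ultimately have "Legendre (int p) (int p) = sign p ^ u"
    using assms prime_ge_2_nat[OF assms(1)] by (intro Legendre_eq_sign_power) auto
  moreover have "Legendre (int p) (int p) = 0" by (simp add: Legendre_eq_0_iff)
  ultimately show False by (simp add: sign_def split: if_splits)
qed

lemma odd_cofactor:
  assumes "prime p" "p dvd m" "p < m" "p = 2 ^ Suc s * u + 1" "2 \<le> \<beta>"
    and "pseudosquare_candidate p \<Longrightarrow> least_nonresidue p \<le> \<beta>"
  shows "odd u"
proof
  assume "even u"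
  then obtain v where "u = 2 * v" ..
  then have "p = 4 * (2 ^ s * v) + 1" using assms(4) by simp
  then have "p mod 4 = 1" by presburger
  moreover have "Legendre (int q) (int p) = 1" if "prime q" "q \<le> \<beta>" for q
    using that Legendre_eq_sign_power[OF assms(1,2,4), of q] prime_divisor_gt_bound[OF assms(1-3)] assms(3)
      prime_ge_2_nat[of q] \<open>even u\<close> by (simp add: sign_def)
  ultimately have "pseudosquare_candidate p" "\<beta> < least_nonresidue p"
    using least_nonresidue_if_all_residues[OF assms(1) _ assms(5)] by blast+
  then show False using assms(6) by simp
qed

lemma product_of_two_prime_divisors:
  assumes p: "prime p" "p dvd m" "p < m" "p = 2 ^ Suc s * u + 1" "odd u"
    and r: "prime r" "r dvd m" "r < m" "r = 2 ^ Suc s * v + 1" "odd v"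
    and "p \<noteq> r" "2 \<le> \<beta>"
  shows "pseudosquare_candidate (p * r)" "\<beta> < least_nonresidue (p * r)" "p * r dvd m" "p * r \<noteq> m"
proof -
  have "[2 * u = 2 * v] (mod 4)"
    using p(5) r(5) by (auto elim!: oddE simp: unique_euclidean_semiring_class.cong_def mod_Suc)
  then have "[2 ^ s * (2 * u) + 1 = 2 ^ s * (2 * v) + 1] (mod 4)"
    by (intro cong_add[OF cong_scalar_left cong_refl])
  then have cong: "[p = r] (mod 4)" by (simp add: p(4) r(4) mult_ac)
  have "Legendre (int q) (int p) = sign q" "Legendre (int q) (int r) = sign q" if "prime q" "q \<le> \<beta>" for q
    using Legendre_eq_sign_power[OF p(1,2,4), of q] Legendre_eq_sign_power[OF r(1,2,4), of q] that p(3,5) r(5)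
      prime_divisor_gt_bound[OF p(1-3)] prime_ge_2_nat[of q] by (auto simp: sign_def)
  then show "pseudosquare_candidate (p * r)" "\<beta> < least_nonresidue (p * r)"
    using least_nonresidue_if_equal_symbols[OF p(1) _ r(1) _ assms(11) cong assms(12)]
      prime_divisor_gt_2[OF p(1,2)] prime_divisor_gt_2[OF r(1,2)] by (auto simp: sign_def)
  show "p * r dvd m" using p(1,2) r(1,2) assms(11) by (simp add: primes_coprime divides_mult)
  show "p * r \<noteq> m"
  proof
    assume "p * r = m"
    moreover have "p * r = 2 ^ Suc s * (u + v + 2 ^ Suc s * u * v) + 1"
      unfolding p(4) r(4) by (simp add: algebra_simps)
    ultimately have "2 ^ Suc s * t = 2 ^ Suc s * (u + v + 2 ^ Suc s * u * v)" unfolding m_eq by linarith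
    then have "t = u + v + 2 ^ Suc s * u * v" by simp
    then show False using p(5) r(5) odd_t by simp
  qed
qed

end

definition test_passes :: "nat \<Rightarrow> nat \<Rightarrow> nat \<Rightarrow> bool" where
  "test_passes K \<beta> m \<longleftrightarrow> \<not> perfect_power K m \<and> half_power m (witness_base m) = m - 1 \<and>
    (\<forall>q. 2 \<le> q \<and> q \<le> \<beta> \<and> q < m \<longrightarrow> half_power m q \<in> {1, m - 1})"

lemma prime_if_test_passes:
  assumes "1 < m" "odd m" "m \<le> n" "n \<le> y ^ K" "0 < y"
    and rough: "\<And>q. prime q \<Longrightarrow> q dvd m \<Longrightarrow> y < q"
    and bound: "2 \<le> \<beta>" "\<And>L. pseudosquare_candidate L \<Longrightarrow> L \<le> n div y \<Longrightarrow> least_nonresidue L \<le> \<beta>"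
    and "test_passes K \<beta> m"
  shows "prime m"
proof (rule ccontr)
  assume "\<not> prime m"
  have "m - 1 \<noteq> 0" "even (m - 1)" using assms(1,2) by auto
  then obtain e t where "m - 1 = 2 ^ e * t" "odd t"
    using multiplicity_decompose'[of "m - 1" 2]
    by (metis nat_dvd_1_iff_1 numeral_eq_one_iff semiring_norm(85))
  with \<open>even (m - 1)\<close> obtain s where "m - 1 = 2 ^ Suc s * t" by (cases e) auto
  then interpret euler_bases m "witness_base m" \<beta> s t
    using \<open>odd t\<close> assms(1,9) by unfold_locales (auto simp: test_passes_def)
  obtain p r where pr: "prime p" "p dvd m" "prime r" "r dvd m" "p \<noteq> r"
    using obtain_two_prime_divisors[OF assms(1) \<open>\<not> prime m\<close>, of K y] assms(3,4,9) rough
    by (auto simp: test_passes_def)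
  have small: "q < m" "q \<le> n div y" if "prime q" "q dvd m" for q
  proof -
    have "q \<noteq> m" using that \<open>\<not> prime m\<close> by auto
    then show "q < m" using that assms(1) by (simp add: dvd_imp_le le_neq_implies_less)
    show "q \<le> n div y"
      using \<open>q \<noteq> m\<close> assms(1,3,5) that rough by (intro rough_cofactor_le) auto
  qed
  have odd: "odd u" if "prime q" "q dvd m" "q = 2 ^ Suc s * u + 1" for q u
    using odd_cofactor[OF that(1,2) small(1)[OF that(1,2)] that(3) bound(1)] bound(2)[OF _ small(2)[OF that(1,2)]] .
  obtain u v where uv: "p = 2 ^ Suc s * u + 1" "r = 2 ^ Suc s * v + 1"
    using obtain_cofactor pr by metis
  note product = product_of_two_prime_divisors[OF pr(1,2) small(1)[OF pr(1,2)] uv(1) odd[OF pr(1,2) uv(1)]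
      pr(3,4) small(1)[OF pr(3,4)] uv(2) odd[OF pr(3,4) uv(2)] pr(5) bound(1)]
  have "p * r \<le> n div y" using assms(1,3,5) product rough by (intro rough_cofactor_le) auto
  then show False using bound(2) product(1,2) by fastforce
qed

lemma test_passes_if_prime:
  assumes "prime m" "2 < m"
  shows "test_passes K \<beta> m"
  using assms half_power_witness_base half_power_prime_cases
  by (auto simp: test_passes_def perfect_power_def prime_power_iff)

section \<open>Elementary estimates for primes\<close>

lemma finite_primes_le [simp]: "finite {p :: nat. prime p \<and> p \<le> x}"
  by (rule finite_subset[of _ "{..x}"]) auto

lemma prod_primes_dvd:
  assumes "finite A" "\<And>p. p \<in> A \<Longrightarrow> prime p \<and> p dvd (n::nat)"
  shows "\<Prod>A dvd n"
  using assms
proof (induction A rule: finite_induct)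
  case (insert q A)
  have "coprime q (\<Prod>A)"
    by (rule prod_coprime_right) (use insert in \<open>auto intro: primes_coprime\<close>)
  then show ?case using insert by (auto intro: divides_mult)
qed auto

lemma card_primes_dyadic: "j * card {p::nat. prime p \<and> 2 ^ j < p \<and> p \<le> 2 * 2 ^ j} \<le> 2 * 2 ^ j"
proof -
  let ?N = "2 ^ j :: nat"
  let ?A = "{p. prime p \<and> ?N < p \<and> p \<le> 2 * ?N}"
  have fin: "finite ?A" by (rule finite_subset[of _ "{..2 * ?N}"]) auto
  have "\<Prod>?A dvd (2 * ?N choose ?N)"
  proof (rule prod_primes_dvd[OF fin])
    fix p assume p: "p \<in> ?A"
    have "fact ?N * fact ?N * (2 * ?N choose ?N) = (fact (2 * ?N) :: nat)"
      using binomial_fact_lemma[of ?N "2 * ?N"] by (simp add: mult_2)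
    moreover have "p dvd fact (2 * ?N)" "\<not> p dvd fact ?N"
      using p by (auto simp: prime_dvd_fact_iff)
    ultimately show "prime p \<and> p dvd (2 * ?N choose ?N)"
      using p by (metis (no_types, lifting) mem_Collect_eq prime_dvd_mult_iff)
  qed
  then have "\<Prod>?A \<le> (2 * ?N choose ?N)" by (intro dvd_imp_le) auto
  also have "\<dots> \<le> 2 ^ (2 * ?N)" by (rule binomial_le_pow2)
  finally have upper: "\<Prod>?A \<le> 2 ^ (2 * ?N)" .
  have "(2::nat) ^ (j * card ?A) = (\<Prod>p\<in>?A. ?N)" by (simp add: power_mult)
  also have "\<dots> \<le> \<Prod>?A" by (rule prod_mono) auto
  finally have "(2::nat) ^ (j * card ?A) \<le> 2 ^ (2 * ?N)" using upper by linarith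
  then show ?thesis by (simp only: power_increasing_iff)
qed

lemma sum_prime_reciprocals_two_power:
  "(\<Sum>p | prime p \<and> p \<le> 2 ^ Suc j. 1 / real p) \<le> 1 / 2 + 2 * harm j"
proof (induction j)
  case 0
  have "{p::nat. prime p \<and> p \<le> 2} = {2}" by (auto dest: prime_ge_2_nat intro: le_antisym)
  then show ?case by (simp add: harm_def)
next
  case (Suc j)
  let ?N = "2 ^ Suc j :: nat"
  let ?A = "{p. prime p \<and> ?N < p \<and> p \<le> 2 * ?N}"
  have "(\<Sum>p\<in>?A. 1 / real p) \<le> (\<Sum>p\<in>?A. 1 / real ?N)"
  proof (intro sum_mono divide_left_mono)
    fix p assume "p \<in> ?A"
    then have "?N \<le> p" "0 < p" by auto
    then show "real ?N \<le> real p" "0 < real p * real ?N" by (simp_all only: of_nat_le_iff) auto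
  qed auto
  also have "\<dots> = real (card ?A) / real ?N" by simp
  also have "\<dots> \<le> 2 / real (Suc j)"
  proof -
    have "real (Suc j * card ?A) \<le> real (2 * ?N)"
      using card_primes_dyadic[of "Suc j"] by (simp only: of_nat_le_iff)
    then show ?thesis by (simp add: field_simps)
  qed
  finally have dyadic: "(\<Sum>p\<in>?A. 1 / real p) \<le> 2 * inverse (real (Suc j))"
    by (simp add: field_simps)
  have "{p. prime p \<and> p \<le> 2 ^ Suc (Suc j)} = {p. prime p \<and> p \<le> ?N} \<union> ?A" by auto
  moreover have "finite ?A" by (rule finite_subset[of _ "{..2 * ?N}"]) auto
  ultimately have "(\<Sum>p | prime p \<and> p \<le> 2 ^ Suc (Suc j). 1 / real p) =
      (\<Sum>p | prime p \<and> p \<le> ?N. 1 / real p) + (\<Sum>p\<in>?A. 1 / real p)"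
    by (simp only:) (rule sum.union_disjoint, auto)
  then show ?case using Suc dyadic by (simp add: harm_Suc algebra_simps)
qed

lemma harm_le_ln:
  assumes "0 < n"
  shows "harm n \<le> 1 + ln (real n)"
proof -
  obtain m where m: "n = Suc m" using assms by (cases n) auto
  have "harm (Suc m) - ln (real (Suc m)) \<le> (harm (Suc 0) - ln (real (Suc 0)) :: real)"
    using decseqD[OF decseq_harm_diff_ln, of 0 m] by simp
  then show ?thesis using m by (simp add: harm_def)
qed

lemma sum_prime_reciprocals_le:
  assumes "2 \<le> x"
  shows "(\<Sum>p | prime p \<and> p \<le> x. 1 / real p) \<le> 2 * ln (ln (real x)) + 4"
proof -
  define j where "j = floorlog 2 x - 1"
  have "\<not> floorlog 2 x \<le> 1" using assms by (simp add: floorlog_le_iff)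
  then have "0 < j" "floorlog 2 x = Suc j" unfolding j_def by auto
  then have x: "2 ^ j \<le> x" "x \<le> 2 ^ Suc j" using floorlog_bounds[of x 2] assms by auto
  have "(\<Sum>p | prime p \<and> p \<le> x. 1 / real p) \<le> (\<Sum>p | prime p \<and> p \<le> 2 ^ Suc j. 1 / real p)"
    using x(2) by (intro sum_mono2) auto
  also have "\<dots> \<le> 1 / 2 + 2 * harm j" by (rule sum_prime_reciprocals_two_power)
  also have "\<dots> \<le> 1 / 2 + 2 * (1 + ln (real j))" using harm_le_ln[OF \<open>0 < j\<close>] by simp
  also have "ln (real j) \<le> ln (3 / 2 * ln (real x))"
  proof -
    have "real (2 ^ j) \<le> real x" using x(1) by (simp only: of_nat_le_iff)
    then have "ln (2 ^ j) \<le> ln (real x)" using assms by (subst ln_le_cancel_iff) auto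
    then have "real j * ln 2 \<le> ln (real x)" by (simp add: ln_realpow)
    moreover have "real j * (2 / 3) \<le> real j * ln 2"
      using ln2_ge_two_thirds by (intro mult_left_mono) auto
    ultimately have "real j \<le> 3 / 2 * ln (real x)" by linarith
    then show ?thesis using \<open>0 < j\<close> by (subst ln_le_cancel_iff) auto
  qed
  also have "ln (3 / 2 * ln (real x)) \<le> 1 / 2 + ln (ln (real x))"
    using ln_le_minus_one[of "3 / 2 :: real"] ln_mult[of "3 / 2" "ln (real x)"] assms by simp
  finally show ?thesis by simp
qed

definition euler_product :: "nat \<Rightarrow> real" where
  "euler_product x = (\<Prod>p | prime p \<and> p \<le> x. 1 - 1 / real p)"

lemma one_minus_prime_reciprocal_pos: "prime p \<Longrightarrow> 0 < 1 - 1 / real p"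
  using prime_gt_1_nat[of p] by simp

lemma euler_product_pos: "0 < euler_product x"
  unfolding euler_product_def by (intro prod_pos one_minus_prime_reciprocal_pos) simp

definition smooth :: "nat set \<Rightarrow> nat \<Rightarrow> nat set" where
  "smooth Q x = {m \<in> {1..x}. prime_factors m \<subseteq> Q}"

lemma finite_smooth [simp]: "finite (smooth Q x)"
  by (simp add: smooth_def)

lemma smooth_insert_subset:
  assumes "prime p"
  shows "smooth (insert p Q) x \<subseteq> smooth Q x \<union> (\<lambda>m. p * m) ` smooth (insert p Q) x"
proof
  fix m assume m: "m \<in> smooth (insert p Q) x"
  show "m \<in> smooth Q x \<union> (\<lambda>m. p * m) ` smooth (insert p Q) x"
  proof (cases "p dvd m")
    case True
    then obtain c where c: "m = p * c" by blast
    have "c \<le> p * c" using prime_gt_0_nat[OF assms] by simp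
    also have "\<dots> \<le> x" using m c by (simp add: smooth_def)
    finally have "c \<le> x" .
    moreover have "c \<noteq> 0" using m c by (auto simp: smooth_def)
    moreover have "prime_factors c \<subseteq> prime_factors m"
      using m c by (intro dvd_prime_factors) (auto simp: smooth_def)
    ultimately have "c \<in> smooth (insert p Q) x"
      using m by (auto simp: smooth_def)
    then show ?thesis using c by blast
  next
    case False
    then have "p \<notin> prime_factors m" by (auto simp: in_prime_factors_iff)
    then show ?thesis using m by (auto simp: smooth_def)
  qed
qed

text \<open>A new prime \<open>p\<close> contributes at most \<open>1/p\<close> times the whole sum, which gives Euler's bound without
  infinite series.\<close>

lemma sum_reciprocals_smooth_le:
  assumes "finite Q" "\<And>p. p \<in> Q \<Longrightarrow> prime p"
  shows "(\<Prod>p\<in>Q. 1 - 1 / real p) * (\<Sum>m\<in>smooth Q x. 1 / real m) \<le> 1"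
  using assms
proof (induction Q rule: finite_induct)
  case empty
  have "smooth {} x \<subseteq> {1}" by (auto simp: smooth_def prime_factorization_empty_iff)
  then have "(\<Sum>m\<in>smooth {} x. 1 / real m) \<le> (\<Sum>m\<in>{1}. 1 / real m)"
    by (intro sum_mono2) auto
  then show ?case by simp
next
  case (insert p Q)
  let ?sum = "\<lambda>Q. \<Sum>m\<in>smooth Q x. 1 / real m"
  let ?multiples = "(\<lambda>m. p * m) ` smooth (insert p Q) x"
  have p: "prime p" "0 < p" using insert by (auto simp: prime_gt_0_nat)
  have "?sum (insert p Q) \<le> (\<Sum>m\<in>smooth Q x \<union> ?multiples. 1 / real m)"
    by (rule sum_mono2) (use smooth_insert_subset[OF p(1)] in auto)
  also have "\<dots> \<le> ?sum Q + (\<Sum>m\<in>?multiples. 1 / real m)"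
    by (subst sum_Un) (auto intro!: sum_nonneg)
  also have "(\<Sum>m\<in>?multiples. 1 / real m) = (\<Sum>m\<in>smooth (insert p Q) x. 1 / real (p * m))"
    by (subst sum.reindex) (use p in \<open>auto simp: inj_on_def\<close>)
  also have "\<dots> = 1 / real p * ?sum (insert p Q)" by (simp add: sum_distrib_left)
  finally have step: "(1 - 1 / real p) * ?sum (insert p Q) \<le> ?sum Q" by (simp add: algebra_simps)
  have "(\<Prod>p\<in>insert p Q. 1 - 1 / real p) * ?sum (insert p Q) =
      (\<Prod>p\<in>Q. 1 - 1 / real p) * ((1 - 1 / real p) * ?sum (insert p Q))"
    using insert by simp
  also have "\<dots> \<le> (\<Prod>p\<in>Q. 1 - 1 / real p) * ?sum Q"
    using insert one_minus_prime_reciprocal_pos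
    by (intro mult_left_mono step prod_nonneg) (auto intro: less_imp_le)
  also have "\<dots> \<le> 1" using insert by auto
  finally show ?case .
qed

lemma euler_product_ln_le:
  assumes "1 \<le> x"
  shows "euler_product x * ln (real x) \<le> 1"
proof -
  have "smooth {p. prime p \<and> p \<le> x} x = {1..x}"
    by (auto simp: smooth_def in_prime_factors_iff dest!: dvd_imp_le)
  then have "euler_product x * harm x \<le> 1"
    using sum_reciprocals_smooth_le[OF finite_primes_le, of x x]
    by (simp add: euler_product_def harm_def inverse_eq_divide)
  moreover have "ln (real x) \<le> ln (real x + 1)" using assms by simp
  then have "ln (real x) \<le> harm x" using ln_le_harm[of x] by linarith
  then have "euler_product x * ln (real x) \<le> euler_product x * harm x"
    using euler_product_pos[of x] by (intro mult_left_mono) auto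
  ultimately show ?thesis by linarith
qed

lemma prod_prime_tail_le:
  assumes "2 \<le> x"
  shows "(\<Prod>p | prime p \<and> z < p \<and> p \<le> x. 1 - 1 / real p) \<le> 1 / (euler_product z * ln (real x))"
proof -
  let ?tail = "{p. prime p \<and> z < p \<and> p \<le> x}"
  define N where "N = max x z"
  have "{p. prime p \<and> p \<le> N} = {p. prime p \<and> p \<le> z} \<union> ?tail" by (auto simp: N_def)
  moreover have "finite ?tail" by (rule finite_subset[of _ "{..x}"]) auto
  ultimately have "euler_product N = euler_product z * (\<Prod>p\<in>?tail. 1 - 1 / real p)"
    unfolding euler_product_def by (simp only:) (rule prod.union_disjoint, auto)
  moreover have "ln (real x) \<le> ln (real N)" using assms unfolding N_def by (subst ln_le_cancel_iff) auto
  then have "euler_product N * ln (real x) \<le> euler_product N * ln (real N)"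
    using euler_product_pos[of N] by (intro mult_left_mono) auto
  then have "euler_product N * ln (real x) \<le> 1"
    using euler_product_ln_le[of N] assms unfolding N_def by linarith
  moreover have "0 < euler_product z * ln (real x)" using euler_product_pos[of z] assms by simp
  ultimately show ?thesis by (simp add: field_simps)
qed

lemma prod_one_minus_k_le:
  assumes "k \<le> z" "2 \<le> x"
  shows "(\<Prod>p | prime p \<and> z < p \<and> p \<le> x. 1 - real k / real p) \<le> (1 / (euler_product z * ln (real x))) ^ k"
proof -
  let ?tail = "{p. prime p \<and> z < p \<and> p \<le> x}"
  have "(\<Prod>p\<in>?tail. 1 - real k / real p) \<le> (\<Prod>p\<in>?tail. (1 - 1 / real p) ^ k)"
  proof (rule prod_mono, safe)
    fix p assume p: "prime p" "z < p"
    then have "0 < p" "k \<le> p" using assms by auto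
    then show "0 \<le> 1 - real k / real p" by (simp add: field_simps)
    show "1 - real k / real p \<le> (1 - 1 / real p) ^ k"
      using Bernoulli_inequality[of "- (1 / real p)" k] \<open>0 < p\<close> by simp
  qed
  also have "\<dots> = (\<Prod>p\<in>?tail. 1 - 1 / real p) ^ k" by (simp add: prod_power_distrib)
  also have "\<dots> \<le> (1 / (euler_product z * ln (real x))) ^ k"
    using one_minus_prime_reciprocal_pos
    by (intro power_mono prod_prime_tail_le[OF assms(2)] prod_nonneg) (auto intro: less_imp_le)
  finally show ?thesis .
qed

text \<open>The Leibniz harmonic triangle \<open>a! b! / (a + b + 1)!\<close> shows that every common multiple of
  \<open>1, \<dots>, 2m + 1\<close> is at least \<open>4^m\<close>.\<close>

lemma leibniz_triangle_integral:
  assumes "\<And>j. 1 \<le> j \<Longrightarrow> j \<le> n \<Longrightarrow> j dvd D" "a + b + 1 \<le> n"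
  shows "real D * (fact a * fact b / fact (a + b + 1)) \<in> \<int>"
  using assms(2)
proof (induction b arbitrary: a)
  case 0
  then obtain z where "D = (a + 1) * z" using assms(1)[of "a + 1"] by (auto elim: dvdE)
  moreover have "fact (a + 1) = (real a + 1) * fact a" "real a + 1 \<noteq> 0" by auto
  ultimately have "real D * (fact a * fact 0 / fact (a + 0 + 1)) = real z"
    by (simp del: fact_Suc add: divide_simps) (simp add: algebra_simps)
  then show ?case by simp
next
  case (Suc b)
  have "fact a * fact (Suc b) / fact (a + Suc b + 1) =
      fact a * fact b / fact (a + b + 1) - fact (Suc a) * fact b / (fact (Suc a + b + 1) :: real)"
    by (simp add: divide_simps) (simp add: algebra_simps)
  then have "real D * (fact a * fact (Suc b) / fact (a + Suc b + 1)) =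
      real D * (fact a * fact b / fact (a + b + 1)) - real D * (fact (Suc a) * fact b / fact (Suc a + b + 1))"
    by (simp only: right_diff_distrib)
  moreover have "real D * (fact a * fact b / fact (a + b + 1)) \<in> \<int>" using Suc by simp
  moreover have "real D * (fact (Suc a) * fact b / fact (Suc a + b + 1)) \<in> \<int>"
    using Suc.IH[of "Suc a"] Suc.prems by simp
  ultimately show ?case by (metis Ints_diff)
qed

lemma common_multiple_ge:
  assumes "\<And>j. 1 \<le> j \<Longrightarrow> j \<le> 2 * m + 1 \<Longrightarrow> j dvd D" "0 < D"
  shows "4 ^ m \<le> D"
proof -
  let ?v = "real D * (fact m * fact m / fact (m + m + 1))"
  have "?v \<in> \<int>" by (rule leibniz_triangle_integral[of "2 * m + 1"]) (use assms in auto)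
  moreover have "0 < ?v" using assms(2) by simp
  ultimately have "1 \<le> ?v"
    by (metis Ints_cases of_int_0_less_iff of_int_1_le_iff zless_imp_add1_zle add_0)
  moreover have "real (2 * m choose m) * (fact m * fact m) = fact (2 * m)"
    using binomial_fact[of m "2 * m", where 'a = real] by (simp add: field_simps)
  then have "fact (m + m + 1) = real (2 * m + 1) * real (2 * m choose m) * (fact m * fact m)"
    by (simp add: mult.assoc flip: mult_2)
  then have "?v = real D / (real (2 * m + 1) * real (2 * m choose m))" by simp
  moreover have "0 < real (2 * m + 1) * real (2 * m choose m)" by simp
  ultimately have "real (2 * m + 1) * real (2 * m choose m) \<le> real D"
    by (simp only: le_divide_eq) simp
  moreover have "4 ^ m \<le> real (2 * m + 1) * real (2 * m choose m)"
  proof (cases "m = 0")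
    case False
    then have "4 ^ m \<le> 2 * real m * real (2 * m choose m)"
      using central_binomial_lower_bound[of m] by (simp add: field_simps)
    also have "\<dots> \<le> real (2 * m + 1) * real (2 * m choose m)" by (intro mult_right_mono) auto
    finally show ?thesis .
  qed simp
  ultimately have "4 ^ m \<le> real D" by (rule order_trans[rotated])
  then have "real (4 ^ m) \<le> real D" by (simp only: of_nat_power of_nat_numeral)
  then show ?thesis by (simp only: of_nat_le_iff)
qed

lemma dvd_prod_prime_powers:
  assumes "1 \<le> j" "j \<le> x"
  shows "j dvd (\<Prod>p | prime p \<and> p \<le> x. p ^ (floorlog p x - 1))"
proof -
  have "j = (\<Prod>p\<in>prime_factors j. p ^ multiplicity p j)"
    using prod_prime_factors[of j] assms by simp
  also have "\<dots> dvd (\<Prod>p\<in>prime_factors j. p ^ (floorlog p x - 1))"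
  proof (rule prod_dvd_prod, rule le_imp_power_dvd)
    fix p assume p: "p \<in> prime_factors j"
    then have "1 < p" using prime_gt_1_nat[of p] by (simp add: in_prime_factors_iff)
    have "p ^ multiplicity p j \<le> j" using assms by (intro dvd_imp_le multiplicity_dvd) auto
    also have "\<dots> < p ^ floorlog p x"
      using floorlog_bounds[of x p] \<open>1 < p\<close> assms by linarith
    finally show "multiplicity p j \<le> floorlog p x - 1" using \<open>1 < p\<close> by simp
  qed
  also have "\<dots> dvd (\<Prod>p | prime p \<and> p \<le> x. p ^ (floorlog p x - 1))"
    using assms by (intro prod_dvd_prod_subset finite_primes_le) (auto simp: in_prime_factors_iff dest!: dvd_imp_le)
  finally show ?thesis .
qed

lemma four_power_le_power_card_primes:
  assumes "2 * m + 1 \<le> x"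
  shows "4 ^ m \<le> x ^ card {p. prime p \<and> p \<le> x}"
proof -
  have "4 ^ m \<le> (\<Prod>p | prime p \<and> p \<le> x. p ^ (floorlog p x - 1))"
    using assms by (intro common_multiple_ge dvd_prod_prime_powers prod_pos) (auto simp: prime_gt_0_nat)
  also have "\<dots> \<le> (\<Prod>p | prime p \<and> p \<le> x. x)"
  proof (rule prod_mono)
    fix p assume "p \<in> {p. prime p \<and> p \<le> x}"
    then have "1 < p" using prime_gt_1_nat[of p] by simp
    then show "0 \<le> p ^ (floorlog p x - 1) \<and> p ^ (floorlog p x - 1) \<le> x"
      using floorlog_bounds[of x p] assms by simp
  qed
  finally show ?thesis by simp
qed

lemma card_primes_ln_ge:
  assumes "2 \<le> x"
  shows "real x \<le> 5 * real (card {p. prime p \<and> p \<le> x}) * ln (real x)"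
proof -
  let ?c = "card {p. prime p \<and> p \<le> x}"
  define m where "m = (x - 1) div 2"
  have "4 ^ m \<le> x ^ ?c" unfolding m_def using assms by (intro four_power_le_power_card_primes) auto
  then have "real (4 ^ m) \<le> real (x ^ ?c)" by (simp only: of_nat_le_iff)
  then have "ln (4 ^ m) \<le> ln (real x ^ ?c)" using assms by (subst ln_le_cancel_iff) auto
  then have "real m * ln 4 \<le> real ?c * ln (real x)" using assms by (simp add: ln_realpow)
  moreover have "ln 4 = 2 * ln (2 :: real)" using ln_realpow[of 2 2] by simp
  then have "real m * (4 / 3) \<le> real m * ln 4" using ln2_ge_two_thirds by (intro mult_left_mono) auto
  moreover have "real x \<le> 2 * real m + 2" unfolding m_def by linarith
  moreover have "2 \<in> {p. prime p \<and> p \<le> x}" using assms by simp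
  then have "1 \<le> ?c" using card_gt_0_iff[of "{p. prime p \<and> p \<le> x}"] by fastforce
  moreover have "ln 2 \<le> ln (real x)" using assms by (subst ln_le_cancel_iff) auto
  ultimately show ?thesis using ln2_ge_two_thirds mult_mono[of 1 "real ?c" "2 / 3" "ln (real x)"] by simp
qed

section \<open>Consequences of Conjecture A\<close>

lemma pseudosquare_exists:
  "\<exists>L. 0 < L \<and> \<not> is_square L \<and> [L = 1] (mod 8) \<and>
    (\<forall>q. prime q \<and> odd q \<and> q \<le> p \<longrightarrow> Legendre (int L) (int q) = 1)"
proof -
  define Q :: nat where "Q = 8 * fact p"
  let ?L = "Q ^ 2 + 1"
  have "\<not> is_square ?L"
  proof
    assume "is_square ?L"
    then obtain z where z: "?L = z ^ 2" by (auto elim: is_nth_powerE)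
    then have "Q ^ 2 < z ^ 2" by linarith
    then have "Q < z" by (rule power_less_imp_less_base) simp
    then have "(Q + 1) ^ 2 \<le> z ^ 2" by (intro power_mono) auto
    then have "Q = 0" unfolding z[symmetric] by (simp add: power2_eq_square)
    then show False by (simp add: Q_def)
  qed
  moreover have "Legendre (int ?L) (int q) = 1" if "prime q" "odd q" "q \<le> p" for q
  proof -
    have "q dvd Q" using that dvd_fact[of q p] prime_gt_0_nat[of q] by (auto simp: Q_def)
    then have cong: "[1 = int ?L] (mod int q)" by (simp add: cong_iff_dvd_diff power2_eq_square)
    then have "QuadRes (int q) (int ?L)" unfolding QuadRes_def by (intro exI[of _ 1]) simp
    moreover have "\<not> [int ?L = 0] (mod int q)"
      using cong_trans[OF cong, of 0] prime_gt_1_nat[OF that(1)] by (auto simp: cong_0_iff)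
    ultimately show ?thesis by (simp add: Legendre_def)
  qed
  moreover have "[?L = 1] (mod 8)"
    by (simp add: Q_def unique_euclidean_semiring_class.cong_def power_mult_distrib mod_Suc)
  ultimately show ?thesis by (intro exI[of _ ?L]) auto
qed

lemma pseudosquare_properties:
  "0 < pseudosquare p" "\<not> is_square (pseudosquare p)" "[pseudosquare p = 1] (mod 8)"
  "prime q \<Longrightarrow> odd q \<Longrightarrow> q \<le> p \<Longrightarrow> Legendre (int (pseudosquare p)) (int q) = 1"
  using LeastI_ex[OF pseudosquare_exists[of p]] unfolding pseudosquare_def[symmetric] by blast+

lemma pseudosquare_le:
  assumes "0 < L" "\<not> is_square L" "[L = 1] (mod 8)"
    "\<And>q. prime q \<Longrightarrow> odd q \<Longrightarrow> q \<le> p \<Longrightarrow> Legendre (int L) (int q) = 1"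
  shows "pseudosquare p \<le> L"
  unfolding pseudosquare_def by (rule Least_le) (use assms in blast)

lemma pseudosquare_mono: "p \<le> q \<Longrightarrow> pseudosquare p \<le> pseudosquare q"
  by (rule pseudosquare_le) (use pseudosquare_properties in auto)

lemma pseudosquare_candidate_pseudosquare: "pseudosquare_candidate (pseudosquare p)"
proof -
  have "pseudosquare p \<noteq> 1" using pseudosquare_properties(2)[of p] by (metis is_nth_power_1)
  then show ?thesis
    using pseudosquare_properties(1-3)[of p]
    by (simp add: pseudosquare_candidate_def unique_euclidean_semiring_class.cong_def)
qed

lemma less_pseudosquare: "p < pseudosquare p"
proof -
  let ?L = "pseudosquare p"
  have L: "1 < ?L" "odd ?L"
    using pseudosquare_candidate_odd pseudosquare_candidate_pseudosquare
    by (auto simp: pseudosquare_candidate_def)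
  then have "p < least_nonresidue ?L"
    using pseudosquare_properties(4) prime_odd_nat by (intro less_least_nonresidue) auto
  also have "\<dots> \<le> ?L" using L by (rule least_nonresidue_le_self)
  finally show ?thesis .
qed

lemma pseudosquare_le_candidate:
  assumes "pseudosquare_candidate L" "p < least_nonresidue L"
  shows "pseudosquare p \<le> L"
proof (rule pseudosquare_le)
  fix q assume "prime q" "odd q" "q \<le> p"
  then show "Legendre (int L) (int q) = 1"
    using least_nonresidue_le[of q L] assms(2) by (meson not_le le_less_trans)
qed (use assms(1) in \<open>auto simp: pseudosquare_candidate_def unique_euclidean_semiring_class.cong_def\<close>)

lemma conjecture_A_bound:
  assumes "conjecture_A"
  obtains C where "0 < C"
    "\<And>n p. prime p \<Longrightarrow> pseudosquare p \<le> n \<Longrightarrow> real p \<le> C * (ln (real n) * ln (ln (real n)))"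
proof -
  obtain C where C: "\<And>n p. prime p \<Longrightarrow> pseudosquare p \<le> n \<Longrightarrow>
      (\<And>q. prime q \<Longrightarrow> pseudosquare q \<le> n \<Longrightarrow> pseudosquare q \<le> pseudosquare p) \<Longrightarrow>
      real p \<le> C * (ln (real n) * ln (ln (real n)))"
    using assms unfolding conjecture_A_def by blast
  have "real p \<le> max C 1 * (ln (real n) * ln (ln (real n)))" if p: "prime p" "pseudosquare p \<le> n" for n p
  proof -
    let ?S = "{q. prime q \<and> pseudosquare q \<le> n}"
    have S: "finite ?S" "p \<in> ?S"
      using p less_pseudosquare
      by (auto intro!: finite_subset[of ?S "{..n}"] intro: less_imp_le less_le_trans)
    then have max: "Max ?S \<in> ?S" by (intro Max_in) auto
    have "9 \<le> n"
      using p(2) pseudosquare_candidate_ge_9[OF pseudosquare_candidate_pseudosquare[of p]] by linarith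
    then have "exp 1 < real n" using exp_le by linarith
    then have "1 < ln (real n)" by (metis exp_less_cancel_iff exp_ln less_trans exp_gt_zero)
    then have pos: "0 < ln (real n) * ln (ln (real n))" by simp
    have "real p \<le> real (Max ?S)" using S by simp
    also have "\<dots> \<le> C * (ln (real n) * ln (ln (real n)))"
      using max S(1) by (intro C pseudosquare_mono Max_ge) auto
    also have "\<dots> \<le> max C 1 * (ln (real n) * ln (ln (real n)))"
      using pos by (intro mult_right_mono) auto
    finally show ?thesis .
  qed
  then show ?thesis using that[of "max C 1"] by simp
qed

lemma le_powr_if_le_mult_ln:
  fixes x A e :: real
  assumes "1 \<le> x" "x \<le> A * ln x" "0 \<le> A" "0 < e" "e < 1"
  shows "x \<le> (A / e) powr (1 / (1 - e))"
proof -
  have "ln (x powr e) \<le> x powr e" using ln_le_minus_one[of "x powr e"] assms(1) by simp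
  then have "ln x \<le> x powr e / e" using assms(1,4) by (simp add: ln_powr field_simps)
  then have "A * ln x \<le> A * (x powr e / e)" using assms(3) by (rule mult_left_mono)
  then have "x powr (1 - e) * x powr e \<le> A / e * x powr e"
    using assms(1,2) by (simp flip: powr_add)
  then have "x powr (1 - e) \<le> A / e" using assms(1) by (simp only: mult_le_cancel_right) auto
  then have "(x powr (1 - e)) powr (1 / (1 - e)) \<le> (A / e) powr (1 / (1 - e))"
    using assms(5) by (intro powr_mono2) auto
  then show ?thesis using assms(1,5) by (simp add: powr_powr)
qed

lemma least_nonresidue_candidate_le:
  assumes C: "0 < C" "\<And>n p. prime p \<Longrightarrow> pseudosquare p \<le> n \<Longrightarrow> real p \<le> C * (ln (real n) * ln (ln (real n)))"
    and L: "pseudosquare_candidate L" "L \<le> n"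
  shows "real (least_nonresidue L) \<le> (40 * C * (ln (real n) * ln (ln (real n)))) powr (8 / 7) + 1"
proof -
  define x where "x = least_nonresidue L - 1"
  let ?A = "C * (ln (real n) * ln (ln (real n)))"
  have "2 < least_nonresidue L"
    using L(1) pseudosquare_candidate_odd
    by (intro least_nonresidue_gt_2) (auto simp: pseudosquare_candidate_def)
  then have x: "2 \<le> x" "real (least_nonresidue L) = real x + 1" unfolding x_def by auto
  let ?P = "{p. prime p \<and> p \<le> x}"
  define p where "p = Max ?P"
  have "2 \<in> ?P" using x(1) by simp
  then have "p \<in> ?P" unfolding p_def by (intro Max_in finite_primes_le) blast
  then have "real p \<le> ?A"
    using C(2)[of p n] pseudosquare_le_candidate[OF L(1), of p] L(2) x by simp
  moreover have "?P \<subseteq> {1..p}" unfolding p_def by (auto simp: Suc_le_eq prime_gt_0_nat)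
  then have "card ?P \<le> p" using card_mono[of "{1..p}" ?P] by simp
  ultimately have card: "real (card ?P) \<le> ?A" by linarith
  have "real x \<le> 5 * real (card ?P) * ln (real x)" by (rule card_primes_ln_ge[OF x(1)])
  also have "\<dots> \<le> 5 * ?A * ln (real x)"
    using card x(1) by (intro mult_right_mono mult_left_mono) auto
  finally have "real x \<le> (5 * ?A / (1 / 8)) powr (1 / (1 - 1 / 8))"
    using x(1) card by (intro le_powr_if_le_mult_ln) auto
  then show ?thesis using x(2) by (simp add: mult.assoc)
qed

definition nonresidue_bound :: "nat \<Rightarrow> nat" where
  "nonresidue_bound n = Max (insert 2 (least_nonresidue ` {L. pseudosquare_candidate L \<and> L \<le> n}))"

lemma finite_candidates: "finite {L. pseudosquare_candidate L \<and> L \<le> n}"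
  by (rule finite_subset[of _ "{..n}"]) auto

lemma two_le_nonresidue_bound: "2 \<le> nonresidue_bound n"
  unfolding nonresidue_bound_def using finite_candidates by (intro Max_ge) auto

lemma least_nonresidue_le_bound:
  "pseudosquare_candidate L \<Longrightarrow> L \<le> n \<Longrightarrow> least_nonresidue L \<le> nonresidue_bound n"
  unfolding nonresidue_bound_def using finite_candidates by (intro Max_ge) auto

lemma nonresidue_bound_mono: "m \<le> n \<Longrightarrow> nonresidue_bound m \<le> nonresidue_bound n"
  unfolding nonresidue_bound_def using finite_candidates by (intro Max_mono) auto

lemma nonresidue_bound_Suc:
  "nonresidue_bound (Suc n) = (if pseudosquare_candidate (Suc n)
    then max (nonresidue_bound n) (least_nonresidue (Suc n)) else nonresidue_bound n)"
proof (cases "pseudosquare_candidate (Suc n)")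
  case True
  then have "{L. pseudosquare_candidate L \<and> L \<le> Suc n} = insert (Suc n) {L. pseudosquare_candidate L \<and> L \<le> n}"
    by (auto simp: le_Suc_eq)
  then show ?thesis
    using True finite_candidates[of n] by (simp add: nonresidue_bound_def insert_commute[of 2] max.commute)
next
  case False
  then have "{L. pseudosquare_candidate L \<and> L \<le> Suc n} = {L. pseudosquare_candidate L \<and> L \<le> n}"
    by (auto simp: le_Suc_eq)
  then show ?thesis using False by (simp add: nonresidue_bound_def)
qed

lemma nonresidue_bound_max_8: "nonresidue_bound (max 8 n) = nonresidue_bound n"
proof -
  have "{L. pseudosquare_candidate L \<and> L \<le> max 8 n} = {L. pseudosquare_candidate L \<and> L \<le> n}"
    using pseudosquare_candidate_ge_9 by fastforce
  then show ?thesis by (simp add: nonresidue_bound_def)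
qed

lemma nonresidue_bound_8: "nonresidue_bound 8 = 2"
proof -
  have "{L. pseudosquare_candidate L \<and> L \<le> 8} = {}" using pseudosquare_candidate_ge_9 by fastforce
  then show ?thesis by (simp only: nonresidue_bound_def image_empty) simp
qed

lemma nonresidue_bound_bigo:
  assumes "conjecture_A"
  shows "(\<lambda>n. real (nonresidue_bound n)) \<in> O(\<lambda>n. ln (real n) powr (9 / 7))"
proof -
  obtain C where C: "0 < C"
    "\<And>n p. prime p \<Longrightarrow> pseudosquare p \<le> n \<Longrightarrow> real p \<le> C * (ln (real n) * ln (ln (real n)))"
    using conjecture_A_bound[OF assms] by blast
  let ?bound = "\<lambda>n. (40 * C * (ln (real n) * ln (ln (real n)))) powr (8 / 7) + 2"
  have "real (nonresidue_bound n) \<le> ?bound n" for n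
  proof -
    let ?S = "insert 2 (least_nonresidue ` {L. pseudosquare_candidate L \<and> L \<le> n})"
    have "nonresidue_bound n \<in> ?S"
      unfolding nonresidue_bound_def using finite_candidates by (intro Max_in) auto
    then show ?thesis using least_nonresidue_candidate_le[OF C, of _ n] by fastforce
  qed
  then have "(\<lambda>n. real (nonresidue_bound n)) \<in> O(?bound)"
    by (intro landau_o.big_mono always_eventually allI) simp
  also have "?bound \<in> O(\<lambda>n::nat. ln (real n) powr (9 / 7))" using C(1) by real_asymp
  finally show ?thesis .
qed

section \<open>Periodic predicates on the integers\<close>

definition periodic :: "nat \<Rightarrow> (int \<Rightarrow> bool) \<Rightarrow> bool" where
  "periodic d R \<longleftrightarrow> (\<forall>x. R (x mod int d) = R x)"

lemma periodicD: "periodic d R \<Longrightarrow> R (x mod int d) = R x"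
  by (simp add: periodic_def)

lemma periodic_Ball_prod:
  fixes Q :: "nat set"
  assumes "finite Q" "\<And>p. p \<in> Q \<Longrightarrow> periodic p (R p)"
  shows "periodic (\<Prod>Q) (\<lambda>x. \<forall>p\<in>Q. R p x)"
  unfolding periodic_def
proof (intro allI ball_cong refl)
  fix x p assume p: "p \<in> Q"
  then have "int p dvd int (\<Prod>Q)"
    using dvd_prodI[OF assms(1) p, of id] by (simp only: int_dvd_int_iff id_apply) simp
  then have "x mod int (\<Prod>Q) mod int p = x mod int p" by (rule mod_mod_cancel)
  then show "R p (x mod int (\<Prod>Q)) = R p x" using periodicD[OF assms(2)[OF p]] by metis
qed

lemma bij_betw_mod_interval:
  assumes "0 < d"
  shows "bij_betw (\<lambda>x. x mod int d) {u..<u + int d} {0..<int d}"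
proof -
  have inj: "inj_on (\<lambda>x. x mod int d) {u..<u + int d}"
  proof (rule inj_onI)
    fix x y assume "x \<in> {u..<u + int d}" "y \<in> {u..<u + int d}" "x mod int d = y mod int d"
    then show "x = y" using dvd_abs_less_imp_eq_0[of "int d" "x - y"] by (auto simp: mod_eq_dvd_iff)
  qed
  moreover have "(\<lambda>x. x mod int d) ` {u..<u + int d} = {0..<int d}"
  proof (rule card_subset_eq)
    show "card ((\<lambda>x. x mod int d) ` {u..<u + int d}) = card {0..<int d}"
      using inj by (simp add: card_image)
  qed (use assms in auto)
  ultimately show ?thesis by (rule bij_betw_imageI)
qed

lemma bij_betw_mod_product:
  assumes "coprime d e" "0 < d" "0 < e"
  shows "bij_betw (\<lambda>x. (x mod int d, x mod int e)) {0..<int (d * e)} ({0..<int d} \<times> {0..<int e})"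
proof -
  let ?f = "\<lambda>x. (x mod int d, x mod int e)"
  have inj: "inj_on ?f {0..<int (d * e)}"
  proof (rule inj_onI)
    fix x y assume xy: "x \<in> {0..<int (d * e)}" "y \<in> {0..<int (d * e)}" "?f x = ?f y"
    then have "int d * int e dvd x - y" using assms(1) by (intro divides_mult) (auto simp: mod_eq_dvd_iff)
    then show "x = y" using xy(1,2) dvd_abs_less_imp_eq_0[of "int d * int e" "x - y"] by auto
  qed
  moreover have "?f ` {0..<int (d * e)} = {0..<int d} \<times> {0..<int e}"
  proof (rule card_subset_eq)
    show "card (?f ` {0..<int (d * e)}) = card ({0..<int d} \<times> {0..<int e})"
      using inj by (simp add: card_image card_cartesian_product nat_mult_distrib)
  qed (use assms in auto)
  ultimately show ?thesis by (rule bij_betw_imageI)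
qed

lemma card_eq_if_bij_betw:
  assumes "bij_betw f A B" "\<And>x. x \<in> A \<Longrightarrow> R x \<longleftrightarrow> T (f x)"
  shows "card {x \<in> A. R x} = card {y \<in> B. T y}"
proof (rule bij_betw_same_card[of f])
  show "bij_betw f {x \<in> A. R x} {y \<in> B. T y}"
    using assms by (auto simp: bij_betw_def inj_on_def)
qed

lemma card_periodic_shift:
  assumes "0 < d" "periodic d R"
  shows "card {x \<in> {u..<u + int d}. R x} = card {x \<in> {0..<int d}. R x}"
  using bij_betw_mod_interval[OF assms(1)] by (rule card_eq_if_bij_betw) (simp add: periodicD[OF assms(2)])

lemma card_crt_product:
  assumes "coprime d e" "0 < d" "0 < e" "periodic d R" "periodic e T"
  shows "card {x \<in> {0..<int (d * e)}. R x \<and> T x} =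
    card {x \<in> {0..<int d}. R x} * card {x \<in> {0..<int e}. T x}"
proof -
  have "card {x \<in> {0..<int (d * e)}. R x \<and> T x} =
      card {z \<in> {0..<int d} \<times> {0..<int e}. R (fst z) \<and> T (snd z)}"
    using bij_betw_mod_product[OF assms(1-3)]
    by (rule card_eq_if_bij_betw) (simp add: periodicD[OF assms(4)] periodicD[OF assms(5)])
  also have "{z \<in> {0..<int d} \<times> {0..<int e}. R (fst z) \<and> T (snd z)} =
      {x \<in> {0..<int d}. R x} \<times> {x \<in> {0..<int e}. T x}"
    by auto
  finally show ?thesis by (simp only: card_cartesian_product)
qed

lemma card_crt:
  fixes Q :: "nat set"
  assumes "finite Q" "\<And>p. p \<in> Q \<Longrightarrow> prime p" "\<And>p. p \<in> Q \<Longrightarrow> periodic p (R p)"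
  shows "card {x \<in> {u..<u + int (\<Prod>Q)}. \<forall>p\<in>Q. R p x} = (\<Prod>p\<in>Q. card {x \<in> {0..<int p}. R p x})"
proof -
  have pos: "0 < \<Prod>Q" using assms(2) by (auto intro!: prod_pos simp: prime_gt_0_nat)
  have "card {x \<in> {0..<int (\<Prod>Q)}. \<forall>p\<in>Q. R p x} = (\<Prod>p\<in>Q. card {x \<in> {0..<int p}. R p x})"
    using assms
  proof (induction Q rule: finite_induct)
    case empty
    have "{x \<in> {0..<int (\<Prod>({}::nat set))}. \<forall>p\<in>{}. R p x} = {0}" by auto
    then show ?case by simp
  next
    case (insert q Q)
    have "coprime q (\<Prod>Q)"
      by (rule prod_coprime_right) (use insert in \<open>auto intro: primes_coprime\<close>)
    moreover have "0 < \<Prod>Q" "0 < q" using insert by (auto intro!: prod_pos simp: prime_gt_0_nat)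
    ultimately have "card {x \<in> {0..<int (q * \<Prod>Q)}. R q x \<and> (\<forall>p\<in>Q. R p x)} =
        card {x \<in> {0..<int q}. R q x} * card {x \<in> {0..<int (\<Prod>Q)}. \<forall>p\<in>Q. R p x}"
      using insert by (intro card_crt_product periodic_Ball_prod) auto
    then show ?case using insert by simp
  qed
  then show ?thesis using card_periodic_shift[OF pos periodic_Ball_prod[OF assms(1,3)]] by simp
qed

lemma card_periodic_multiple:
  assumes "0 < d" "periodic d R"
  shows "card {x \<in> {u..<u + int (q * d)}. R x} = q * card {x \<in> {0..<int d}. R x}"
proof (induction q)
  case (Suc q)
  let ?v = "u + int (q * d)"
  have "u \<le> ?v" by simp
  moreover have "u + int (Suc q * d) = ?v + int d" by simp
  ultimately have "{x \<in> {u..<u + int (Suc q * d)}. R x} = {x \<in> {u..<?v}. R x} \<union> {x \<in> {?v..<?v + int d}. R x}"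
    by (auto simp del: of_nat_mult)
  moreover have "card \<dots> = card {x \<in> {u..<?v}. R x} + card {x \<in> {?v..<?v + int d}. R x}"
    by (intro card_Un_disjoint finite_Collect_conjI disjI1) auto
  ultimately show ?case using Suc card_periodic_shift[OF assms] by simp
qed simp

lemma card_periodic_interval:
  fixes d H :: nat
  assumes "0 < d" "periodic d R"
  defines "c \<equiv> card {x \<in> {0..<int d}. R x}"
  shows "\<bar>real (card {x \<in> {u..<u + int H}. R x}) - real H * (real c / real d)\<bar> \<le> real c"
proof -
  define q where "q = H div d"
  let ?N = "card {x \<in> {u..<u + int H}. R x}"
  have "H = q * d + H mod d" "H mod d < d" using assms(1) by (simp_all add: q_def)
  then have H: "q * d \<le> H" "H \<le> (q + 1) * d" by (metis le_add1, simp)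
  then have le: "int (q * d) \<le> int H" "int H \<le> int ((q + 1) * d)" by (simp_all only: of_nat_le_iff)
  have mono: "card {x \<in> {u..<v}. R x} \<le> card {x \<in> {u..<v'}. R x}" if "v \<le> v'" for v v'
    by (rule card_mono, rule finite_subset[of _ "{u..<v'}"]) (use that in auto)
  have "q * c \<le> ?N" "?N \<le> (q + 1) * c"
    using mono[OF add_left_mono[OF le(1)], of u] mono[OF add_left_mono[OF le(2)], of u]
    by (simp_all only: card_periodic_multiple[OF assms(1,2)] c_def)
  then have "real (q * c) \<le> real ?N" "real ?N \<le> real ((q + 1) * c)"
    by (simp_all only: of_nat_le_iff)
  then have N: "real q * real c \<le> real ?N" "real ?N \<le> (real q + 1) * real c"
    by (simp_all only: of_nat_mult of_nat_add of_nat_1)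
  have "real (q * d) \<le> real H" "real H \<le> real ((q + 1) * d)"
    using H by (simp_all only: of_nat_le_iff)
  then have "real q \<le> real H / real d" "real H / real d \<le> real q + 1"
    using assms(1) by (simp_all add: field_simps)
  then have "real q * real c \<le> real H / real d * real c" "real H / real d * real c \<le> (real q + 1) * real c"
    by (simp_all only: mult_right_mono of_nat_0_le_iff)
  then show ?thesis using N by (simp add: abs_le_iff distrib_right)
qed

section \<open>Brun's pure sieve\<close>

lemma bonferroni:
  assumes "finite A" "even r"
  shows "of_bool (A = {}) \<le> (\<Sum>D | D \<subseteq> A \<and> card D \<le> r. (-1::real) ^ card D)"
proof -
  let ?S = "{D. D \<subseteq> A \<and> card D \<le> r}"
  have fin: "finite ?S" by (rule finite_subset[of _ "Pow A"]) (use assms in auto)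
  have "(\<Sum>D\<in>?S. (-1::real) ^ card D) = (\<Sum>j\<le>r. \<Sum>D | D \<in> ?S \<and> card D = j. (-1) ^ card D)"
    by (rule sum.group[symmetric]) (use fin in auto)
  also have "\<dots> = (\<Sum>j\<le>r. real (card A choose j) * (-1) ^ j)"
  proof (rule sum.cong)
    fix j assume "j \<in> {..r}"
    then have "{D \<in> ?S. card D = j} = {D. D \<subseteq> A \<and> card D = j}" by auto
    then have "(\<Sum>D | D \<in> ?S \<and> card D = j. (-1::real) ^ card D) = (\<Sum>D | D \<subseteq> A \<and> card D = j. (-1) ^ j)"
      by (intro sum.cong) auto
    then show "(\<Sum>D | D \<in> ?S \<and> card D = j. (-1::real) ^ card D) = real (card A choose j) * (-1) ^ j"
      using n_subsets[OF assms(1), of j] by simp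
  qed simp
  also have "\<dots> = (\<Sum>j\<le>r. (real (card A) gchoose j) * (-1) ^ j)"
    by (simp add: binomial_gbinomial)
  also have "\<dots> = (-1) ^ r * ((real (card A) - 1) gchoose r)" by (rule gbinomial_sum_lower_neg)
  finally have alternating: "(\<Sum>D\<in>?S. (-1::real) ^ card D) = (real (card A) - 1) gchoose r"
    using assms(2) by simp
  show ?thesis
  proof (cases "A = {}")
    case True
    then have "?S = {{}}" by auto
    then show ?thesis using True by simp
  next
    case False
    then have "real (card A) - 1 = real (card A - 1)"
      using assms(1) by (simp add: of_nat_diff Suc_le_eq card_gt_0_iff)
    then have "(real (card A) - 1) gchoose r = real (card A - 1 choose r)"
      by (simp only: binomial_gbinomial)
    then show ?thesis using alternating False by simp
  qed
qed

lemma card_avoiding_le_alternating_sum: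
  assumes "finite I" "finite Q" "even r"
  shows "real (card {x \<in> I. \<forall>p\<in>Q. \<not> Z p x}) \<le>
    (\<Sum>D | D \<subseteq> Q \<and> card D \<le> r. (-1) ^ card D * real (card {x \<in> I. \<forall>p\<in>D. Z p x}))"
proof -
  let ?S = "{D. D \<subseteq> Q \<and> card D \<le> r}"
  have fin: "finite ?S" by (rule finite_subset[of _ "Pow Q"]) (use assms(2) in auto)
  have "real (card {x \<in> I. \<forall>p\<in>Q. \<not> Z p x}) = (\<Sum>x\<in>I. of_bool ({p \<in> Q. Z p x} = {}))"
    using assms(1) by (subst sum_of_bool_eq) (auto intro!: arg_cong[where f = card])
  also have "\<dots> \<le> (\<Sum>x\<in>I. \<Sum>D | D \<subseteq> {p \<in> Q. Z p x} \<and> card D \<le> r. (-1) ^ card D)"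
    by (intro sum_mono bonferroni) (use assms(2,3) in auto)
  also have "\<dots> = (\<Sum>x\<in>I. \<Sum>D\<in>?S. (-1) ^ card D * of_bool (\<forall>p\<in>D. Z p x))"
  proof (rule sum.cong[OF refl])
    fix x
    have "{D. D \<subseteq> {p \<in> Q. Z p x} \<and> card D \<le> r} = {D \<in> ?S. \<forall>p\<in>D. Z p x}" by auto
    then have "(\<Sum>D | D \<subseteq> {p \<in> Q. Z p x} \<and> card D \<le> r. (-1::real) ^ card D) =
        (\<Sum>D\<in>?S. if \<forall>p\<in>D. Z p x then (-1) ^ card D else 0)"
      using sum.inter_filter[OF fin, of "\<lambda>D. (-1::real) ^ card D" "\<lambda>D. \<forall>p\<in>D. Z p x"] by simp
    also have "\<dots> = (\<Sum>D\<in>?S. (-1) ^ card D * of_bool (\<forall>p\<in>D. Z p x))"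
      by (intro sum.cong) auto
    finally show "(\<Sum>D | D \<subseteq> {p \<in> Q. Z p x} \<and> card D \<le> r. (-1::real) ^ card D) =
        (\<Sum>D\<in>?S. (-1) ^ card D * of_bool (\<forall>p\<in>D. Z p x))" .
  qed
  also have "\<dots> = (\<Sum>D\<in>?S. \<Sum>x\<in>I. (-1) ^ card D * of_bool (\<forall>p\<in>D. Z p x))"
    by (rule sum.swap)
  also have "\<dots> = (\<Sum>D\<in>?S. (-1) ^ card D * real (card {x \<in> I. \<forall>p\<in>D. Z p x}))"
    using assms(1) by (intro sum.cong) (auto simp: sum_of_bool_eq Int_def simp flip: sum_distrib_left)
  finally show ?thesis .
qed

lemma sum_Pow_prod: "finite A \<Longrightarrow> (\<Sum>D\<in>Pow A. prod f D) = (\<Prod>x\<in>A. 1 + f x :: real)"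
  using prod_add[of A f "\<lambda>_. 1"] by (simp add: add.commute)

lemma prod_one_plus_le_exp:
  assumes "\<And>x. x \<in> A \<Longrightarrow> 0 \<le> f x"
  shows "(\<Prod>x\<in>A. 1 + f x :: real) \<le> exp (\<Sum>x\<in>A. f x)"
proof (cases "finite A")
  case True
  have "(\<Prod>x\<in>A. 1 + f x) \<le> (\<Prod>x\<in>A. exp (f x))"
    by (rule prod_mono) (use assms in \<open>auto simp: add_nonneg_nonneg exp_ge_add_one_self\<close>)
  then show ?thesis using True by (simp add: exp_sum)
qed auto

text \<open>Rankin's trick: a sum over subsets of restricted size is bounded by the sum over all subsets, each
  weighted by a factor that is at least 1 where it is needed.\<close>

lemma sum_prod_large_subsets_le:
  assumes "finite Q" "\<And>p. p \<in> Q \<Longrightarrow> 0 \<le> f p"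
  shows "(\<Sum>D | D \<subseteq> Q \<and> r < card D. \<Prod>p\<in>D. f p) \<le> exp (- real r + exp 1 * (\<Sum>p\<in>Q. f p))"
proof -
  have "(\<Sum>D | D \<subseteq> Q \<and> r < card D. \<Prod>p\<in>D. f p) \<le>
      (\<Sum>D | D \<subseteq> Q \<and> r < card D. exp (- real r) * (\<Prod>p\<in>D. exp 1 * f p))"
  proof (rule sum_mono)
    fix D assume D: "D \<in> {D. D \<subseteq> Q \<and> r < card D}"
    have "(\<Prod>p\<in>D. exp 1 * f p) = exp (real (card D)) * (\<Prod>p\<in>D. f p)"
      by (simp add: prod.distrib flip: exp_of_nat_mult)
    then have "exp (- real r) * (\<Prod>p\<in>D. exp 1 * f p) = exp (real (card D) - real r) * (\<Prod>p\<in>D. f p)"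
      by (simp add: exp_diff exp_minus field_simps)
    moreover have "1 \<le> exp (real (card D) - real r)" using D by simp
    moreover have "0 \<le> (\<Prod>p\<in>D. f p)" using D assms by (auto intro!: prod_nonneg)
    ultimately show "(\<Prod>p\<in>D. f p) \<le> exp (- real r) * (\<Prod>p\<in>D. exp 1 * f p)"
      using mult_right_mono[of 1 "exp (real (card D) - real r)" "\<Prod>p\<in>D. f p"] by simp
  qed
  also have "\<dots> \<le> (\<Sum>D\<in>Pow Q. exp (- real r) * (\<Prod>p\<in>D. exp 1 * f p))"
    by (rule sum_mono2) (use assms in \<open>auto intro!: mult_nonneg_nonneg prod_nonneg\<close>)
  also have "\<dots> = exp (- real r) * (\<Prod>p\<in>Q. 1 + exp 1 * f p)"
    using sum_Pow_prod[OF assms(1), of "\<lambda>p. exp 1 * f p"] by (simp flip: sum_distrib_left)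
  also have "\<dots> \<le> exp (- real r) * exp (\<Sum>p\<in>Q. exp 1 * f p)"
    by (intro mult_left_mono prod_one_plus_le_exp) (use assms in auto)
  also have "\<dots> = exp (- real r + exp 1 * (\<Sum>p\<in>Q. f p))"
    by (simp only: exp_add sum_distrib_left)
  finally show ?thesis .
qed

lemma sum_prod_small_subsets_le:
  fixes f :: "'a \<Rightarrow> real"
  assumes "finite Q" "\<And>p. p \<in> Q \<Longrightarrow> 0 \<le> f p" "1 \<le> Y" "(\<Sum>p\<in>Q. f p) \<le> Y"
  shows "(\<Sum>D | D \<subseteq> Q \<and> card D \<le> r. \<Prod>p\<in>D. f p) \<le> exp 1 * Y ^ r"
proof -
  have "(\<Sum>D | D \<subseteq> Q \<and> card D \<le> r. \<Prod>p\<in>D. f p) \<le>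
      (\<Sum>D | D \<subseteq> Q \<and> card D \<le> r. Y ^ r * (\<Prod>p\<in>D. f p / Y))"
  proof (rule sum_mono)
    fix D assume D: "D \<in> {D. D \<subseteq> Q \<and> card D \<le> r}"
    have "Y ^ r * (\<Prod>p\<in>D. f p / Y) = Y ^ (r - card D) * (\<Prod>p\<in>D. f p)"
      using D assms(3) by (simp add: prod_dividef power_diff)
    moreover have "1 \<le> Y ^ (r - card D)" using assms(3) by simp
    moreover have "0 \<le> (\<Prod>p\<in>D. f p)" using D assms by (auto intro!: prod_nonneg)
    ultimately show "(\<Prod>p\<in>D. f p) \<le> Y ^ r * (\<Prod>p\<in>D. f p / Y)"
      using mult_right_mono[of 1 "Y ^ (r - card D)" "\<Prod>p\<in>D. f p"] by simp
  qed
  also have "\<dots> \<le> (\<Sum>D\<in>Pow Q. Y ^ r * (\<Prod>p\<in>D. f p / Y))"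
    by (rule sum_mono2) (use assms in \<open>auto intro!: mult_nonneg_nonneg prod_nonneg\<close>)
  also have "\<dots> = Y ^ r * (\<Prod>p\<in>Q. 1 + f p / Y)"
    using sum_Pow_prod[OF assms(1), of "\<lambda>p. f p / Y"] by (simp flip: sum_distrib_left)
  also have "\<dots> \<le> Y ^ r * exp (\<Sum>p\<in>Q. f p / Y)"
    by (intro mult_left_mono prod_one_plus_le_exp) (use assms in auto)
  also have "\<dots> \<le> Y ^ r * exp 1"
    using assms by (intro mult_left_mono) (auto simp: divide_le_eq simp flip: sum_divide_distrib)
  finally show ?thesis by (simp add: mult.commute)
qed

lemma truncated_alternating_sum_le:
  assumes "finite Q" "\<And>p. p \<in> Q \<Longrightarrow> 0 \<le> f p"
  shows "(\<Sum>D | D \<subseteq> Q \<and> card D \<le> r. (-1) ^ card D * prod f D) \<le>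
    (\<Prod>p\<in>Q. 1 - f p) + exp (- real r + exp 1 * (\<Sum>p\<in>Q. f p))"
proof -
  let ?S = "{D. D \<subseteq> Q \<and> card D \<le> r}" and ?L = "{D. D \<subseteq> Q \<and> r < card D}"
  let ?term = "\<lambda>D. (-1) ^ card D * prod f D"
  have fin: "finite ?S" "finite ?L" by (rule finite_subset[of _ "Pow Q"]; use assms(1) in auto)+
  have "(\<Prod>p\<in>Q. 1 - f p) = (\<Sum>D\<in>Pow Q. ?term D)"
    using sum_Pow_prod[OF assms(1), of "\<lambda>p. - f p"] by (simp add: prod_uminus)
  also have "Pow Q = ?S \<union> ?L" by auto
  also have "(\<Sum>D\<in>?S \<union> ?L. ?term D) = (\<Sum>D\<in>?S. ?term D) + (\<Sum>D\<in>?L. ?term D)"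
    by (rule sum.union_disjoint) (use fin in auto)
  finally have "(\<Sum>D\<in>?S. ?term D) = (\<Prod>p\<in>Q. 1 - f p) + (\<Sum>D\<in>?L. - ?term D)"
    by (simp add: sum_negf)
  also have "(\<Sum>D\<in>?L. - ?term D) \<le> (\<Sum>D\<in>?L. prod f D)"
  proof (rule sum_mono)
    fix D assume "D \<in> ?L"
    then have "0 \<le> prod f D" using assms(2) by (intro prod_nonneg) auto
    then have "\<bar>?term D\<bar> = prod f D" by (simp add: abs_mult power_abs)
    then show "- ?term D \<le> prod f D" by linarith
  qed
  also have "\<dots> \<le> exp (- real r + exp 1 * (\<Sum>p\<in>Q. f p))"
    by (rule sum_prod_large_subsets_le[OF assms])
  finally show ?thesis by simp
qed

theorem brun_sieve:
  fixes Q :: "nat set" and H k r :: nat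
  assumes Q: "finite Q" "\<And>p. p \<in> Q \<Longrightarrow> prime p"
    and periodic: "\<And>p. p \<in> Q \<Longrightarrow> periodic p (Z p)"
    and count: "\<And>p. p \<in> Q \<Longrightarrow> card {x \<in> {0..<int p}. Z p x} = k"
    and r: "even r" and Y: "1 \<le> Y" "real k * real (card Q) \<le> Y"
  shows "real (card {x \<in> {u..<u + int H}. \<forall>p\<in>Q. \<not> Z p x}) \<le>
    real H * ((\<Prod>p\<in>Q. 1 - real k / real p) + exp (- real r + exp 1 * (\<Sum>p\<in>Q. real k / real p)))
      + exp 1 * Y ^ r"
proof -
  let ?S = "{D. D \<subseteq> Q \<and> card D \<le> r}"
  let ?density = "\<lambda>D. \<Prod>p\<in>D. real k / real p"
  define hit where "hit D = real (card {x \<in> {u..<u + int H}. \<forall>p\<in>D. Z p x})" for D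
  have hit: "\<bar>hit D - real H * ?density D\<bar> \<le> (\<Prod>p\<in>D. real k)" if D: "D \<subseteq> Q" for D
  proof -
    have fin: "finite D" using D Q(1) finite_subset by blast
    have pos: "0 < \<Prod>D" using D Q(2) by (auto intro!: prod_pos simp: prime_gt_0_nat)
    have "card {x \<in> {0..<int (\<Prod>D)}. \<forall>p\<in>D. Z p x} = (\<Prod>p\<in>D. card {x \<in> {0..<int p}. Z p x})"
      using card_crt[of D Z 0, OF fin] Q(2) periodic subsetD[OF D] by simp
    also have "\<dots> = (\<Prod>p\<in>D. k)" using count D by (intro prod.cong) auto
    finally have "\<bar>hit D - real H * (real (\<Prod>p\<in>D. k) / real (\<Prod>D))\<bar> \<le> real (\<Prod>p\<in>D. k)"
      using card_periodic_interval[OF pos periodic_Ball_prod[OF fin], of Z u H] periodic subsetD[OF D]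
      by (simp add: hit_def)
    then show ?thesis by (simp add: prod_dividef del: prod_constant)
  qed
  have "real (card {x \<in> {u..<u + int H}. \<forall>p\<in>Q. \<not> Z p x}) \<le> (\<Sum>D\<in>?S. (-1) ^ card D * hit D)"
    unfolding hit_def by (rule card_avoiding_le_alternating_sum[OF _ Q(1) r]) simp
  also have "\<dots> \<le> (\<Sum>D\<in>?S. real H * ((-1) ^ card D * ?density D) + (\<Prod>p\<in>D. real k))"
  proof (rule sum_mono)
    fix D assume D: "D \<in> ?S"
    have "(-1) ^ card D * hit D - real H * ((-1) ^ card D * ?density D) = (-1) ^ card D * (hit D - real H * ?density D)"
      by (simp add: algebra_simps)
    also have "\<dots> \<le> \<bar>(-1) ^ card D * (hit D - real H * ?density D)\<bar>" by simp
    also have "\<dots> \<le> (\<Prod>p\<in>D. real k)" using hit D by (auto simp: abs_mult power_abs)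
    finally show "(-1) ^ card D * hit D \<le> real H * ((-1) ^ card D * ?density D) + (\<Prod>p\<in>D. real k)" by linarith
  qed
  also have "\<dots> = real H * (\<Sum>D\<in>?S. (-1) ^ card D * ?density D) + (\<Sum>D\<in>?S. \<Prod>p\<in>D. real k)"
    by (simp only: sum.distrib sum_distrib_left)
  also have "\<dots> \<le> real H * ((\<Prod>p\<in>Q. 1 - real k / real p) + exp (- real r + exp 1 * (\<Sum>p\<in>Q. real k / real p)))
      + exp 1 * Y ^ r"
    using Y by (intro add_mono mult_left_mono truncated_alternating_sum_le sum_prod_small_subsets_le Q(1))
      (auto simp: mult.commute)
  finally show ?thesis .
qed

section \<open>Sieving values of linear forms\<close>

definition primorial :: "nat \<Rightarrow> nat" where
  "primorial m = \<Prod>{p. prime p \<and> p < m}"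

lemma finite_primes_less [simp]: "finite {p :: nat. prime p \<and> p < m}"
  by (rule finite_subset[of _ "{..m}"]) auto

lemma primorial_pos: "0 < primorial m"
  unfolding primorial_def by (rule prod_pos) (simp add: prime_gt_0_nat)

lemma primorial_2: "primorial 2 = 1"
proof -
  have "{p::nat. prime p \<and> p < 2} = {}" by (auto dest: prime_ge_2_nat)
  then show ?thesis by (simp only: primorial_def prod.empty)
qed

lemma primorial_Suc: "primorial (Suc q) = (if prime q then primorial q * q else primorial q)"
proof -
  have "{p. prime p \<and> p < Suc q} = (if prime q then insert q {p. prime p \<and> p < q} else {p. prime p \<and> p < q})"
    by (auto simp: less_Suc_eq)
  then show ?thesis by (simp add: primorial_def mult.commute)
qed

lemma primorial_times_le: "primorial m * m \<le> m ^ m"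
proof (cases m)
  case (Suc j)
  let ?A = "{p. prime p \<and> p < m}"
  have "?A \<subseteq> {1..<m}" by (auto dest: prime_gt_0_nat simp: Suc_le_eq)
  then have card: "card ?A \<le> j" using card_mono[of "{1..<m}" ?A] Suc by simp
  have "primorial m \<le> (\<Prod>p\<in>?A. m)" unfolding primorial_def by (intro prod_mono) auto
  also have "\<dots> \<le> m ^ j" using card Suc by (simp del: power_Suc add: power_increasing)
  finally show ?thesis using Suc mult_le_mono1[of "primorial m" "m ^ j" m] by (simp add: mult.commute)
qed simp

locale linear_forms =
  fixes k :: nat and a b :: "nat \<Rightarrow> int"
  assumes k_pos: "0 < k"
    and a_pos: "\<And>i. i < k \<Longrightarrow> 0 < a i"
    and distinct_forms: "\<And>i j. i < k \<Longrightarrow> j < k \<Longrightarrow> i \<noteq> j \<Longrightarrow> (a i, b i) \<noteq> (a j, b j)"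
begin

definition form :: "nat \<Rightarrow> int \<Rightarrow> int" where
  "form i x = a i * x + b i"

definition hits :: "nat \<Rightarrow> int \<Rightarrow> bool" where
  "hits p x \<longleftrightarrow> (\<exists>i<k. int p dvd form i x)"

abbreviation avoids_below :: "nat \<Rightarrow> int \<Rightarrow> bool" where
  "avoids_below m x \<equiv> \<forall>p. prime p \<and> p < m \<longrightarrow> \<not> hits p x"

abbreviation avoids_upto :: "nat \<Rightarrow> int \<Rightarrow> bool" where
  "avoids_upto y x \<equiv> \<forall>p. prime p \<and> p \<le> y \<longrightarrow> \<not> hits p x"

lemma dvd_form_mod: "int p dvd form i (x mod int p) \<longleftrightarrow> int p dvd form i x"
proof -
  have "form i x - form i (x mod int p) = a i * (x - x mod int p)" by (simp add: form_def algebra_simps)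
  moreover have "int p dvd x - x mod int p" by (simp add: minus_mod_eq_mult_div)
  ultimately have "int p dvd form i x - form i (x mod int p)" by simp
  then show ?thesis by (metis diff_add_cancel dvd_add_right_iff)
qed

lemma periodic_hits: "periodic p (hits p)"
  by (simp add: periodic_def hits_def dvd_form_mod)

lemma periodic_not_hits: "periodic p (\<lambda>x. \<not> hits p x)"
  by (simp add: periodic_def periodicD[OF periodic_hits])

definition nonproportional :: bool where
  "nonproportional \<longleftrightarrow> (\<forall>i<k. \<forall>j<k. i \<noteq> j \<longrightarrow> a i * b j \<noteq> a j * b i)"

text \<open>Two distinct proportional forms cannot both be primitive.\<close>

lemma obtain_fixed_divisor:
  assumes "\<not> nonproportional"
  obtains q where "prime q" "\<And>x. hits q x"
proof -
  obtain i j where ij: "i < k" "j < k" "i \<noteq> j" "a i * b j = a j * b i"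
    using assms by (auto simp: nonproportional_def)
  have "\<not> (coprime (a i) (b i) \<and> coprime (a j) (b j))"
  proof
    assume coprime: "coprime (a i) (b i) \<and> coprime (a j) (b j)"
    have "a i dvd a j * b i" "a j dvd a i * b j" using ij(4) by (metis dvd_triv_left)+
    then have "a i dvd a j" "a j dvd a i" using coprime by (auto simp: coprime_dvd_mult_left_iff)
    then have eq: "a i = a j" using a_pos[OF ij(1)] a_pos[OF ij(2)] by (simp add: zdvd_antisym_nonneg)
    then have "b i = b j" using ij(4) a_pos[OF ij(1)] by simp
    then show False using distinct_forms[OF ij(1-3)] eq by simp
  qed
  then obtain l where l: "l < k" "\<not> coprime (a l) (b l)" using ij by blast
  then have "\<bar>gcd (a l) (b l)\<bar> \<noteq> 1" by (simp add: coprime_iff_gcd_eq_1)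
  then obtain q :: int where "prime q" "q dvd gcd (a l) (b l)"
    using prime_factor_int by blast
  then have q: "prime q" "q dvd a l" "q dvd b l" by auto
  show ?thesis
  proof (rule that)
    show "prime (nat q)" using q(1) by (simp only: prime_int_nat_transfer)
    show "hits (nat q) x" for x
      unfolding hits_def form_def using q l prime_ge_0_int[OF q(1)] by (auto intro!: exI[of _ l])
  qed
qed

definition exceptional_bound :: nat where
  "exceptional_bound = k + (\<Sum>i<k. nat (a i)) + (\<Sum>i<k. \<Sum>j<k. nat \<bar>a i * b j - a j * b i\<bar>)"

lemma not_dvd_slope:
  assumes "exceptional_bound < p" "i < k"
  shows "\<not> int p dvd a i"
proof
  assume "int p dvd a i"
  then have "int p \<le> a i" using a_pos[OF assms(2)] by (simp add: zdvd_imp_le)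
  moreover have "nat (a i) \<le> (\<Sum>i<k. nat (a i))" using assms(2) by (intro member_le_sum) auto
  ultimately show False using assms(1) by (simp add: exceptional_bound_def)
qed

lemma not_dvd_determinant:
  assumes "exceptional_bound < p" nonproportional "i < k" "j < k" "i \<noteq> j"
  shows "\<not> int p dvd a i * b j - a j * b i"
proof
  assume "int p dvd a i * b j - a j * b i"
  moreover have "a i * b j - a j * b i \<noteq> 0" using assms by (auto simp: nonproportional_def)
  ultimately have "int p \<le> \<bar>a i * b j - a j * b i\<bar>"
    using dvd_imp_le_int[of "a i * b j - a j * b i" "int p"] by simp
  moreover have "nat \<bar>a i * b j - a j * b i\<bar> \<le> (\<Sum>j<k. nat \<bar>a i * b j - a j * b i\<bar>)"
    using assms by (intro member_le_sum) auto
  moreover have "(\<Sum>j<k. nat \<bar>a i * b j - a j * b i\<bar>) \<le> (\<Sum>i<k. \<Sum>j<k. nat \<bar>a i * b j - a j * b i\<bar>)"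
    using assms by (intro member_le_sum[where f = "\<lambda>i. \<Sum>j<k. nat \<bar>a i * b j - a j * b i\<bar>"]) auto
  ultimately show False using assms(1) by (simp add: exceptional_bound_def)
qed

lemma card_roots:
  assumes "prime p" "\<not> int p dvd a i"
  shows "card {x \<in> {0..<int p}. int p dvd form i x} = 1"
proof -
  have "coprime (a i) (int p)" using assms by (simp add: prime_imp_coprime coprime_commute)
  then obtain x where x: "[a i * x = 1] (mod int p)" using cong_solve_coprime_int by blast
  define root where "root = (x * (- b i)) mod int p"
  have "[a i * x * (- b i) = 1 * (- b i)] (mod int p)" using x by (rule cong_scalar_right)
  then have "int p dvd form i (x * (- b i))" by (simp add: form_def cong_iff_dvd_diff algebra_simps)
  then have root: "int p dvd form i root" "root \<in> {0..<int p}"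
    using prime_gt_0_nat[OF assms(1)] by (simp_all add: root_def dvd_form_mod)
  have "z = root" if z: "z \<in> {0..<int p}" "int p dvd form i z" for z
  proof -
    have "int p dvd form i z - form i root" using z root by simp
    then have "int p dvd a i * (z - root)" by (simp add: form_def algebra_simps)
    then have "int p dvd z - root" using assms by (simp add: prime_dvd_mult_iff)
    then show ?thesis using z(1) root(2) dvd_abs_less_imp_eq_0[of "int p" "z - root"] by auto
  qed
  then have "{z \<in> {0..<int p}. int p dvd form i z} = {root}" using root by blast
  then show ?thesis by simp
qed

lemma card_hits:
  assumes "prime p" "exceptional_bound < p" nonproportional
  shows "card {x \<in> {0..<int p}. hits p x} = k"
proof -
  let ?roots = "\<lambda>i. {x \<in> {0..<int p}. int p dvd form i x}"
  have "?roots i \<inter> ?roots j = {}" if ij: "i < k" "j < k" "i \<noteq> j" for i j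
  proof -
    have "int p dvd a i * b j - a j * b i" if "int p dvd form i x" "int p dvd form j x" for x
    proof -
      have "int p dvd a i * form j x - a j * form i x" using that by (intro dvd_diff dvd_mult)
      then show ?thesis by (simp add: form_def algebra_simps)
    qed
    then show ?thesis using not_dvd_determinant[OF assms(2,3) ij] by blast
  qed
  moreover have "{x \<in> {0..<int p}. hits p x} = (\<Union>i\<in>{..<k}. ?roots i)"
    by (auto simp: hits_def)
  moreover have "finite (?roots i)" for i by (rule finite_subset[of _ "{0..<int p}"]) auto
  ultimately have "card {x \<in> {0..<int p}. hits p x} = (\<Sum>i<k. card (?roots i))"
    by (simp only:) (intro card_UN_disjoint, auto)
  also have "\<dots> = (\<Sum>i<k. 1)"
    using card_roots[OF assms(1)] not_dvd_slope[OF assms(2)] by (intro sum.cong) auto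
  finally show ?thesis by simp
qed

definition unhit :: "nat \<Rightarrow> nat" where
  "unhit p = card {x \<in> {0..<int p}. \<not> hits p x}"

lemma unhit_eq: "unhit p = p - card {x \<in> {0..<int p}. hits p x}"
proof -
  have "{x \<in> {0..<int p}. \<not> hits p x} = {0..<int p} - {x \<in> {0..<int p}. hits p x}" by auto
  also have "card \<dots> = card {0..<int p} - card {x \<in> {0..<int p}. hits p x}"
    by (rule card_Diff_subset) (auto intro: finite_subset[of _ "{0..<int p}"])
  finally show ?thesis by (simp add: unhit_def)
qed

lemma card_avoids_below:
  "real (card {x \<in> {u..<u + int (primorial m)}. avoids_below m x}) =
    real (primorial m) * (\<Prod>p | prime p \<and> p < m. real (unhit p) / real p)"
proof -
  let ?Q = "{p. prime p \<and> p < m}"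
  have "{x \<in> {u..<u + int (primorial m)}. avoids_below m x} =
      {x \<in> {u..<u + int (\<Prod>?Q)}. \<forall>p\<in>?Q. \<not> hits p x}"
    by (auto simp: primorial_def)
  also have "card \<dots> = (\<Prod>p\<in>?Q. unhit p)"
    unfolding unhit_def by (rule card_crt) (auto intro: periodic_not_hits)
  also have "real \<dots> = (\<Prod>p\<in>?Q. real p * (real (unhit p) / real p))"
    by (simp add: prime_gt_0_nat)
  also have "\<dots> = real (primorial m) * (\<Prod>p\<in>?Q. real (unhit p) / real p)"
    by (simp only: prod.distrib primorial_def of_nat_prod)
  finally show ?thesis .
qed

lemma wheel_density_nonproportional:
  assumes nonproportional "3 \<le> m"
  shows "real (card {x \<in> {u..<u + int (primorial m)}. avoids_below m x})
    \<le> (1 / euler_product exceptional_bound) ^ k * real (primorial m) * (1 / ln (real (m - 1))) ^ k"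
proof -
  let ?e = exceptional_bound
  let ?Q = "{p. prime p \<and> p < m}" and ?B = "{p. prime p \<and> ?e < p \<and> p \<le> m - 1}"
  let ?density = "\<lambda>p. real (unhit p) / real p"
  have "(\<Prod>p\<in>?Q. ?density p) = (\<Prod>p\<in>?Q - ?B. ?density p) * (\<Prod>p\<in>?B. ?density p)"
    using assms(2) by (intro prod.subset_diff) auto
  also have "\<dots> \<le> 1 * (\<Prod>p\<in>?B. ?density p)"
    by (intro mult_right_mono prod_le_1 conjI prod_nonneg)
      (auto simp: unhit_eq prime_gt_0_nat divide_le_eq_1)
  also have "1 * (\<Prod>p\<in>?B. ?density p) = (\<Prod>p\<in>?B. 1 - real k / real p)"
    unfolding mult_1
  proof (rule prod.cong[OF refl])
    fix p assume p: "p \<in> ?B"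
    then have "unhit p = p - k" using card_hits[of p] assms(1) by (simp add: unhit_eq)
    moreover have "k \<le> p" "0 < p" using p by (auto simp: exceptional_bound_def)
    ultimately show "?density p = 1 - real k / real p" by (simp add: of_nat_diff field_simps)
  qed
  also have "\<dots> \<le> (1 / (euler_product ?e * ln (real (m - 1)))) ^ k"
    using prod_one_minus_k_le[of k ?e "m - 1"] assms(2) by (simp add: exceptional_bound_def)
  finally have "real (primorial m) * (\<Prod>p\<in>?Q. ?density p) \<le>
      real (primorial m) * (1 / (euler_product ?e * ln (real (m - 1)))) ^ k"
    by (intro mult_left_mono of_nat_0_le_iff)
  also have "\<dots> = (1 / euler_product ?e) ^ k * real (primorial m) * (1 / ln (real (m - 1))) ^ k"
    by (simp add: power_divide power_mult_distrib)
  finally show ?thesis unfolding card_avoids_below .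
qed

lemma wheel_density_fixed_divisor:
  assumes "prime q" "\<And>x. hits q x" "3 \<le> m"
  shows "real (card {x \<in> {u..<u + int (primorial m)}. avoids_below m x})
    \<le> ln (real q) ^ k * real (primorial m) * (1 / ln (real (m - 1))) ^ k"
proof (cases "q < m")
  case True
  then have "{x \<in> {u..<u + int (primorial m)}. avoids_below m x} = {}" using assms by auto
  moreover have "0 \<le> ln (real q)" "0 \<le> ln (real (m - 1))"
    using prime_ge_2_nat[OF assms(1)] assms(3) by auto
  ultimately show ?thesis by (simp only: card.empty) simp
next
  case False
  have "0 < ln (real (m - 1))" using assms(3) by simp
  moreover have "ln (real (m - 1)) \<le> ln (real q)" using False assms(3) by (subst ln_le_cancel_iff) auto
  ultimately have "1 ^ k \<le> (ln (real q) * (1 / ln (real (m - 1)))) ^ k" by (intro power_mono) auto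
  then have density: "1 \<le> ln (real q) ^ k * (1 / ln (real (m - 1))) ^ k"
    by (simp only: power_mult_distrib power_one)
  have "card {x \<in> {u..<u + int (primorial m)}. avoids_below m x} \<le> card {u..<u + int (primorial m)}"
    by (rule card_mono) auto
  then have "real (card {x \<in> {u..<u + int (primorial m)}. avoids_below m x}) \<le> real (primorial m) * 1" by simp
  also have "\<dots> \<le> real (primorial m) * (ln (real q) ^ k * (1 / ln (real (m - 1))) ^ k)"
    by (intro mult_left_mono density of_nat_0_le_iff)
  finally show ?thesis by (simp only: mult_ac)
qed

lemma wheel_density:
  obtains C where "0 < C"
    "\<And>m u. 3 \<le> m \<Longrightarrow> real (card {x \<in> {u..<u + int (primorial m)}. avoids_below m x})
      \<le> C * real (primorial m) * (1 / ln (real (m - 1))) ^ k"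
proof (cases nonproportional)
  case True
  have "0 < (1 / euler_product exceptional_bound) ^ k" using euler_product_pos by simp
  then show ?thesis using that wheel_density_nonproportional[OF True] by blast
next
  case False
  then obtain q where q: "prime q" "\<And>x. hits q x" by (rule obtain_fixed_divisor) blast
  have "0 < ln (real q) ^ k" using prime_ge_2_nat[OF q(1)] by simp
  then show ?thesis using that wheel_density_fixed_divisor[OF q] by blast
qed

lemma brun_sieve_forms:
  assumes nonproportional "2 \<le> z" "even r"
  shows "real (card {x \<in> {u..<u + int H}. avoids_upto z x}) \<le>
    real H * ((1 / (euler_product exceptional_bound * ln (real z))) ^ k +
      exp (- real r + 3 * (real k * (2 * ln (ln (real z)) + 4)))) + 3 * (real k * real z) ^ r"
proof -
  let ?Q = "{p. prime p \<and> exceptional_bound < p \<and> p \<le> z}"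
  have fin: "finite ?Q" by (rule finite_subset[of _ "{..z}"]) auto
  have "card ?Q \<le> card {1..z}" by (rule card_mono) (auto simp: Suc_le_eq prime_gt_0_nat)
  then have Y: "1 \<le> real k * real z" "real k * real (card ?Q) \<le> real k * real z"
    using k_pos assms(2) mult_mono[of 1 "real k" 1 "real z"] by (auto intro: mult_left_mono)
  have "(\<Sum>p\<in>?Q. real k / real p) \<le> (\<Sum>p | prime p \<and> p \<le> z. real k / real p)"
    by (intro sum_mono2) auto
  also have "\<dots> = real k * (\<Sum>p | prime p \<and> p \<le> z. 1 / real p)"
    by (simp add: sum_distrib_left)
  also have "\<dots> \<le> real k * (2 * ln (ln (real z)) + 4)"
    by (intro mult_left_mono sum_prime_reciprocals_le assms(2)) auto
  finally have "exp 1 * (\<Sum>p\<in>?Q. real k / real p) \<le> 3 * (real k * (2 * ln (ln (real z)) + 4))"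
    using exp_le by (intro mult_mono) (auto intro!: sum_nonneg)
  then have tail: "exp (- real r + exp 1 * (\<Sum>p\<in>?Q. real k / real p)) \<le>
      exp (- real r + 3 * (real k * (2 * ln (ln (real z)) + 4)))"
    by simp
  have "real (card {x \<in> {u..<u + int H}. avoids_upto z x}) \<le>
      real (card {x \<in> {u..<u + int H}. \<forall>p\<in>?Q. \<not> hits p x})"
    unfolding of_nat_le_iff by (rule card_mono, rule finite_subset[of _ "{u..<u + int H}"]) auto
  also have "\<dots> \<le>
      real H * ((\<Prod>p\<in>?Q. 1 - real k / real p) + exp (- real r + exp 1 * (\<Sum>p\<in>?Q. real k / real p))) +
      exp 1 * (real k * real z) ^ r"
    by (rule brun_sieve[OF fin]) (use assms card_hits periodic_hits Y in auto)
  also have "\<dots> \<le> real H * ((1 / (euler_product exceptional_bound * ln (real z))) ^ k +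
      exp (- real r + 3 * (real k * (2 * ln (ln (real z)) + 4)))) + 3 * (real k * real z) ^ r"
    using assms(2) exp_le
    by (intro add_mono mult_left_mono mult_right_mono prod_one_minus_k_le tail) (auto simp: exceptional_bound_def)
  finally show ?thesis .
qed

end

lemma half_le_ln_nat_floor_exp:
  fixes v :: real
  assumes "2 \<le> v"
  shows "v / 2 \<le> ln (real (nat \<lfloor>exp v\<rfloor>))"
proof -
  define w where "w = exp (v / 2)"
  have "2 \<le> w" unfolding w_def using exp_ge_add_one_self[of "v / 2"] assms by linarith
  moreover have "w * w = exp v" by (simp add: w_def flip: exp_add)
  ultimately have "w \<le> exp v - 1" using mult_right_mono[of 2 w w] by linarith
  then have "w \<le> real (nat \<lfloor>exp v\<rfloor>)" by linarith
  then have "ln w \<le> ln (real (nat \<lfloor>exp v\<rfloor>))"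
    using \<open>2 \<le> w\<close> by (intro ln_mono) auto
  then show ?thesis by (simp add: w_def)
qed

lemma le_if_le_exp_divide:
  fixes l c :: real and y z :: nat
  assumes "0 < l" "real z \<le> exp (l / c)" "real K < c" "exp l \<le> real (y ^ K)"
  shows "z \<le> y"
proof (rule ccontr)
  assume "\<not> z \<le> y"
  then have "y ^ K \<le> z ^ K" by (intro power_mono) auto
  then have "exp l \<le> real (z ^ K)"
    using assms(4) of_nat_mono[of "y ^ K" "z ^ K", where 'a = real] by linarith
  also have "\<dots> \<le> exp (l / c) ^ K" using assms(2) by (simp add: power_mono)
  also have "\<dots> = exp (real K * (l / c))" by (rule exp_of_nat_mult[symmetric])
  finally have "l * 1 \<le> l * (real K / c)" by (simp add: mult.commute)
  then have "1 \<le> real K / c" using assms(1) by (simp only: mult_le_cancel_left_pos)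
  then show False using assms(3) by (simp add: le_divide_eq split: if_splits)
qed

lemma exp_minus_le_power:
  fixes l :: real
  assumes "1 \<le> ln l" "0 < l"
  shows "exp (- (real k * ln l)) \<le> (ln l / l) ^ k"
proof -
  have "exp (- (real k * ln l)) = (1 / l) ^ k"
    using assms(2) by (simp add: exp_minus power_divide exp_of_nat_mult field_simps)
  also have "\<dots> \<le> (ln l / l) ^ k" using assms by (intro power_mono divide_right_mono) auto
  finally show ?thesis .
qed

lemma obtain_even_between:
  fixes g h :: real
  assumes "0 \<le> g" "g + 2 \<le> h"
  obtains r :: nat where "even r" "g \<le> real r" "real r \<le> h"
proof (rule that)
  show "g \<le> real (2 * nat \<lceil>g / 2\<rceil>)" "real (2 * nat \<lceil>g / 2\<rceil>) \<le> h"
    using assms by linarith+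
qed simp

text \<open>The sieving limit \<open>z = n^(1 / (36 k log log n))\<close> is small enough for the error term \<open>(k z)^r\<close> to be
  negligible when \<open>r\<close> is as large as \<open>8 k log log n\<close>.\<close>

lemma sieve_error_negligible:
  fixes l v k :: real
  assumes "1 \<le> k" "14 \<le> ln l" "16 * k ^ 2 * ln l + 2 * (k * ln l) + 2 * ln l \<le> l" "14 \<le> l"
    and v: "v = l / (36 * k * ln l)"
    and z: "2 \<le> z" "ln z \<le> v" and r: "real r \<le> 8 * k * ln l"
  shows "3 * (k * z) ^ r \<le> exp (l - k * ln l)"
proof -
  have "ln k \<le> k" using ln_le_minus_one[of k] assms(1) by linarith
  then have "ln (k * z) \<le> k + v" using z assms(1) by (simp add: ln_mult)
  moreover have kz: "1 \<le> k * z" using assms(1) z(1) mult_mono[of 1 k 1 z] by simp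
  ultimately have "real r * ln (k * z) \<le> (8 * k * ln l) * (k + v)"
    using r assms(1,2) by (intro mult_mono) auto
  also have "\<dots> = 8 * k ^ 2 * ln l + 2 / 9 * l"
    unfolding v using assms(1,2) by (simp add: field_simps power2_eq_square)
  finally have "2 + real r * ln (k * z) \<le> l - k * ln l" using assms(2-4) by linarith
  then have "exp (2 + real r * ln (k * z)) \<le> exp (l - k * ln l)" by simp
  then have "exp 2 * (k * z) ^ r \<le> exp (l - k * ln l)"
    using kz by (simp only: exp_add exp_of_nat_mult exp_ln)
  moreover have "3 * (k * z) ^ r \<le> exp 2 * (k * z) ^ r"
    using exp_ge_add_one_self[of 2] kz by (intro mult_right_mono) auto
  ultimately show ?thesis by linarith
qed

lemma obtain_brun_parameters:
  fixes l :: real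
  assumes k: "0 < k" and L: "14 \<le> ln l" "(72 * real k + 16 * real k ^ 2 + 2) * ln l \<le> l"
  obtains z r :: nat where "2 \<le> z" "even r" "real z \<le> exp (l / (36 * real k * ln l))"
    "1 / ln (real z) \<le> 72 * real k * (ln l / l)"
    "exp (- real r + 3 * (real k * (2 * ln (ln (real z)) + 4))) \<le> (ln l / l) ^ k"
    "3 * (real k * real z) ^ r \<le> exp l * (ln l / l) ^ k"
proof -
  let ?k = "real k" and ?L = "ln l"
  define v where "v = l / (36 * ?k * ?L)"
  define z where "z = nat \<lfloor>exp v\<rfloor>"
  have k1: "1 \<le> ?k" using k by simp
  have nonneg: "0 \<le> ?k * ?L" "0 \<le> ?k ^ 2 * ?L" "?k * 14 \<le> ?k * ?L"
    using L(1) k1 by (auto intro: mult_left_mono)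
  have "72 * (?k * ?L) + 16 * (?k ^ 2 * ?L) + 2 * ?L \<le> l" using L(2) by (simp add: algebra_simps)
  then have parts: "72 * ?k * ?L \<le> l" "16 * ?k ^ 2 * ?L + 2 * (?k * ?L) + 2 * ?L \<le> l" "14 \<le> l"
    using nonneg L(1) k1 unfolding mult.assoc by linarith+
  have "1 \<le> 36 * ?k * ?L" using mult_mono[of 1 "36 * ?k" 1 ?L] k1 L(1) by simp
  then have v: "2 \<le> v" "v \<le> l"
    unfolding v_def using parts(1,3) by (simp_all add: le_divide_eq divide_le_eq)
  have "3 \<le> exp v" using exp_ge_add_one_self[of v] v(1) by linarith
  then have z: "2 \<le> z" "real z \<le> exp v" unfolding z_def by linarith+
  then have ln_z: "ln (real z) \<le> v" "v / 2 \<le> ln (real z)"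
    using half_le_ln_nat_floor_exp[OF v(1)] ln_mono[of "real z" "exp v"] v(1) by (simp_all add: z_def)
  have "0 \<le> 7 * ?k * ?L + 12 * ?k" "7 * ?k * ?L + 12 * ?k + 2 \<le> 8 * ?k * ?L"
    using nonneg k1 unfolding mult.assoc by linarith+
  then obtain r where r: "even r" "7 * ?k * ?L + 12 * ?k \<le> real r" "real r \<le> 8 * ?k * ?L"
    by (rule obtain_even_between)
  have power: "exp (- (?k * ?L)) \<le> (?L / l) ^ k" using L(1) parts(3) by (intro exp_minus_le_power) auto
  show ?thesis
  proof (rule that[OF z(1) r(1)])
    show "real z \<le> exp (l / (36 * ?k * ?L))" using z(2) by (simp add: v_def)
    have "1 / ln (real z) \<le> 1 / (v / 2)" using ln_z v(1) by (intro divide_left_mono) auto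
    then show "1 / ln (real z) \<le> 72 * ?k * (?L / l)" by (simp add: v_def)
    have "ln (ln (real z)) \<le> ?L" using v ln_z by (intro ln_mono) auto
    then have "?k * (2 * ln (ln (real z)) + 4) \<le> ?k * (2 * ?L + 4)" by (intro mult_left_mono) auto
    then have "- real r + 3 * (?k * (2 * ln (ln (real z)) + 4)) \<le> - (?k * ?L)"
      using r(2) by (simp add: algebra_simps)
    then show "exp (- real r + 3 * (?k * (2 * ln (ln (real z)) + 4))) \<le> (?L / l) ^ k"
      using power by (meson exp_le_cancel_iff order_trans)
    have "3 * (?k * real z) ^ r \<le> exp (l - ?k * ?L)"
      using z(1) by (intro sieve_error_negligible[OF k1 L(1) parts(2,3) v_def _ ln_z(1) r(3)]) simp
    also have "\<dots> = exp l * exp (- (?k * ?L))" by (simp flip: exp_add)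
    also have "\<dots> \<le> exp l * (?L / l) ^ k" using power by (intro mult_left_mono) auto
    finally show "3 * (?k * real z) ^ r \<le> exp l * (?L / l) ^ k" .
  qed
qed

context linear_forms
begin

lemma survivors_bound_nonproportional:
  fixes n :: nat
  defines "l \<equiv> ln (real n)"
  assumes nonproportional "14 \<le> ln l" "(72 * real k + 16 * real k ^ 2 + 2) * ln l \<le> l" "real K < ln l" "n \<le> y ^ K"
  shows "real (card {x \<in> {u..<u + int n}. avoids_upto y x}) \<le>
    ((72 * real k / euler_product exceptional_bound) ^ k + 2) * real n * (ln l / l) ^ k"
proof -
  let ?E = "euler_product exceptional_bound"
  obtain z r where z: "2 \<le> z" "even r" "real z \<le> exp (l / (36 * real k * ln l))"
      "1 / ln (real z) \<le> 72 * real k * (ln l / l)"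
    and error: "exp (- real r + 3 * (real k * (2 * ln (ln (real z)) + 4))) \<le> (ln l / l) ^ k"
      "3 * (real k * real z) ^ r \<le> exp l * (ln l / l) ^ k"
    using obtain_brun_parameters[OF k_pos assms(3,4)] .
  have "0 < (72 * real k + 16 * real k ^ 2 + 2) * ln l"
    using assms(3) by (intro mult_pos_pos add_nonneg_pos) auto
  then have "0 < l" using assms(4) by linarith
  then have n: "real n = exp l" unfolding l_def by (cases "n = 0") auto
  have "1 * ln l \<le> 36 * real k * ln l" using k_pos assms(3) by (intro mult_right_mono) auto
  then have "real K < 36 * real k * ln l" using assms(5) by linarith
  moreover have "exp l \<le> real (y ^ K)" using of_nat_mono[OF assms(6), where 'a = real] n by simp
  ultimately have "z \<le> y" by (rule le_if_le_exp_divide[OF \<open>0 < l\<close> z(3)])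
  then have "card {x \<in> {u..<u + int n}. avoids_upto y x} \<le> card {x \<in> {u..<u + int n}. avoids_upto z x}"
    by (intro card_mono finite_subset[OF _ finite_atLeastLessThan_int[of u "u + int n"]]) auto
  then have "real (card {x \<in> {u..<u + int n}. avoids_upto y x}) \<le> real (card {x \<in> {u..<u + int n}. avoids_upto z x})"
    by simp
  also have "\<dots> \<le> real n * ((1 / (?E * ln (real z))) ^ k +
      exp (- real r + 3 * (real k * (2 * ln (ln (real z)) + 4)))) + 3 * (real k * real z) ^ r"
    by (rule brun_sieve_forms[OF assms(2) z(1,2)])
  also have "\<dots> \<le> real n * ((72 * real k / ?E * (ln l / l)) ^ k + (ln l / l) ^ k) + real n * (ln l / l) ^ k"
  proof (intro add_mono mult_left_mono power_mono error(1))
    have "1 / ?E * (1 / ln (real z)) \<le> 1 / ?E * (72 * real k * (ln l / l))"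
      using z(4) euler_product_pos[of exceptional_bound] by (intro mult_left_mono) auto
    then show "1 / (?E * ln (real z)) \<le> 72 * real k / ?E * (ln l / l)" by simp
    show "0 \<le> 1 / (?E * ln (real z))" using euler_product_pos[of exceptional_bound] z(1) by simp
  qed (use error(2) n in auto)
  also have "\<dots> = ((72 * real k / ?E) ^ k + 2) * real n * (ln l / l) ^ k"
    by (simp only: power_mult_distrib) (simp add: algebra_simps)
  finally show ?thesis .
qed

lemma survivors_bound_fixed_divisor:
  assumes "prime q" "\<And>x. hits q x"
  shows "\<forall>\<^sub>F n in sequentially. \<forall>u y. n \<le> y ^ K \<longrightarrow>
    real (card {x \<in> {u..<u + int n}. avoids_upto y x}) \<le> real n * (ln (ln (real n)) / ln (real n)) ^ k"
proof -
  have "\<forall>\<^sub>F n::nat in sequentially. 0 \<le> ln (ln (real n)) / ln (real n)" by real_asymp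
  moreover have "\<forall>\<^sub>F n::nat in sequentially. q ^ K < n" by (rule eventually_gt_at_top)
  ultimately show ?thesis
  proof eventually_elim
    case (elim n)
    show ?case
    proof (intro allI impI)
      fix u y assume "n \<le> y ^ K"
      then have "q \<le> y" using elim(2) power_mono[of y q K] by (cases "q \<le> y") auto
      then have "{x \<in> {u..<u + int n}. avoids_upto y x} = {}" using assms by auto
      moreover have "0 \<le> real n * (ln (ln (real n)) / ln (real n)) ^ k"
        using elim(1) by (intro mult_nonneg_nonneg zero_le_power) auto
      ultimately show "real (card {x \<in> {u..<u + int n}. avoids_upto y x})
          \<le> real n * (ln (ln (real n)) / ln (real n)) ^ k"
        by (simp only: card.empty of_nat_0)
    qed
  qed
qed

lemma survivors_bound:
  obtains C where "0 < C" "\<forall>\<^sub>F n in sequentially. \<forall>u y. n \<le> y ^ K \<longrightarrow>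
    real (card {x \<in> {u..<u + int n}. avoids_upto y x}) \<le> C * real n * (ln (ln (real n)) / ln (real n)) ^ k"
proof (cases nonproportional)
  case True
  let ?C = "(72 * real k / euler_product exceptional_bound) ^ k + 2"
  have "0 < 72 * real k + 16 * real k ^ 2 + 2" by (intro add_nonneg_pos) auto
  then have "\<forall>\<^sub>F n::nat in sequentially. (72 * real k + 16 * real k ^ 2 + 2) * ln (ln (real n)) \<le> ln (real n)"
    by real_asymp
  moreover have "\<forall>\<^sub>F n::nat in sequentially. 14 \<le> ln (ln (real n))" by real_asymp
  moreover have "\<forall>\<^sub>F n::nat in sequentially. real K < ln (ln (real n))" by real_asymp
  ultimately have "\<forall>\<^sub>F n in sequentially. \<forall>u y. n \<le> y ^ K \<longrightarrow>
      real (card {x \<in> {u..<u + int n}. avoids_upto y x}) \<le> ?C * real n * (ln (ln (real n)) / ln (real n)) ^ k"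
    by eventually_elim (use survivors_bound_nonproportional[OF True] in blast)
  moreover have "0 < ?C"
    using euler_product_pos[of exceptional_bound] by (intro add_nonneg_pos zero_le_power) auto
  ultimately show ?thesis using that by blast
next
  case False
  then obtain q where q: "prime q" "\<And>x. hits q x" by (rule obtain_fixed_divisor) blast
  show ?thesis by (rule that[of 1]) (use survivors_bound_fixed_divisor[OF q] in simp_all)
qed

end

section \<open>A structured language for the word RAM\<close>

datatype exp = N int | V nat | Bin alu_op exp exp

datatype bexp = Lt exp exp | Eq exp exp

datatype com =
    Skip
  | Assign nat exp
  | Get nat exp
  | Put exp exp
  | Print exp
  | Seq com com
  | Cond bexp com com
  | Loop bexp com

notation Lt (infix "[<]" 70)
notation Eq (infix "[=]" 70)
notation Assign (infix "::=" 65)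
notation Seq (infixr ";;" 60)
notation Cond ("(IF _/ THEN _/ ELSE _)" [0, 0, 61] 61)
notation Loop ("(WHILE _/ DO _)" [0, 61] 61)

abbreviation plus_exp (infixl "[+]" 75) where "a [+] b \<equiv> Bin AddOp a b"
abbreviation minus_exp (infixl "[-]" 75) where "a [-] b \<equiv> Bin SubOp a b"
abbreviation times_exp (infixl "[*]" 80) where "a [*] b \<equiv> Bin MulOp a b"
abbreviation div_exp (infixl "[div]" 80) where "a [div] b \<equiv> Bin DivOp a b"
abbreviation mod_exp (infixl "[mod]" 80) where "a [mod] b \<equiv> Bin ModOp a b"

definition For :: "nat \<Rightarrow> exp \<Rightarrow> exp \<Rightarrow> com \<Rightarrow> com" ("(FOR _ FROM _ TO _/ DO _)" [0, 0, 0, 61] 61) where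
  "FOR x FROM e TO e' DO c = x ::= e;; WHILE V x [<] e' DO (c;; x ::= V x [+] N 1)"

fun binop :: "alu_op \<Rightarrow> int \<Rightarrow> int \<Rightarrow> int" where
  "binop AddOp a b = a + b"
| "binop SubOp a b = a - b"
| "binop MulOp a b = a * b"
| "binop DivOp a b = a div b"
| "binop ModOp a b = a mod b"
| "binop _ a b = 0"

text \<open>Quotients and remainders are never larger than the operands, so they need no bound.\<close>

fun binop_safe :: "int \<Rightarrow> alu_op \<Rightarrow> int \<Rightarrow> int \<Rightarrow> bool" where
  "binop_safe B AddOp a b \<longleftrightarrow> \<bar>a + b\<bar> < B"
| "binop_safe B SubOp a b \<longleftrightarrow> \<bar>a - b\<bar> < B"
| "binop_safe B MulOp a b \<longleftrightarrow> \<bar>a * b\<bar> < B"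
| "binop_safe B DivOp a b \<longleftrightarrow> b \<noteq> 0"
| "binop_safe B ModOp a b \<longleftrightarrow> b \<noteq> 0"
| "binop_safe B _ a b \<longleftrightarrow> False"

fun aval :: "(nat \<Rightarrow> int) \<Rightarrow> exp \<Rightarrow> int" where
  "aval R (N c) = c"
| "aval R (V x) = R x"
| "aval R (Bin f a b) = binop f (aval R a) (aval R b)"

fun safe :: "int \<Rightarrow> (nat \<Rightarrow> int) \<Rightarrow> exp \<Rightarrow> bool" where
  "safe B R (Bin f a b) \<longleftrightarrow> safe B R a \<and> safe B R b \<and> binop_safe B f (aval R a) (aval R b)"
| "safe B R _ \<longleftrightarrow> True"

fun test :: "(nat \<Rightarrow> int) \<Rightarrow> bexp \<Rightarrow> bool" where
  "test R (a [<] b) \<longleftrightarrow> aval R a < aval R b"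
| "test R (a [=] b) \<longleftrightarrow> aval R a = aval R b"

fun safe_test :: "int \<Rightarrow> (nat \<Rightarrow> int) \<Rightarrow> bexp \<Rightarrow> bool" where
  "safe_test B R (a [<] b) \<longleftrightarrow> safe B R a \<and> safe B R b"
| "safe_test B R (a [=] b) \<longleftrightarrow> safe B R a \<and> safe B R b"

text \<open>
  In \<open>big B A c s t s'\<close> the words are bounded by \<open>B\<close>, the addresses by \<open>A\<close>, and the cost \<open>t\<close> is the
  number of loop iterations; the running time of the compiled code is larger by at most a factor that
  depends only on the command. The program counter of a state plays no role here.
\<close>

inductive big :: "int \<Rightarrow> nat \<Rightarrow> com \<Rightarrow> ram_state \<Rightarrow> nat \<Rightarrow> ram_state \<Rightarrow> bool" for B A where
  Skip: "big B A Skip s 0 s"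
| Assign: "safe B (reg s) e \<Longrightarrow> big B A (x ::= e) s 0 (s\<lparr>reg := (reg s)(x := aval (reg s) e)\<rparr>)"
| Get: "safe B (reg s) e \<Longrightarrow> 0 \<le> aval (reg s) e \<Longrightarrow> a = nat (aval (reg s) e) \<Longrightarrow> a < A \<Longrightarrow>
    big B A (Get x e) s 0 (touch a (s\<lparr>reg := (reg s)(x := mem s a)\<rparr>))"
| Put: "safe B (reg s) e \<Longrightarrow> safe B (reg s) e' \<Longrightarrow> 0 \<le> aval (reg s) e \<Longrightarrow> a = nat (aval (reg s) e) \<Longrightarrow>
    a < A \<Longrightarrow> big B A (Put e e') s 0 (touch a (s\<lparr>mem := (mem s)(a := aval (reg s) e')\<rparr>))"
| Print: "safe B (reg s) e \<Longrightarrow> big B A (Print e) s 0 (s\<lparr>printed := printed s @ [aval (reg s) e]\<rparr>)"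
| Seq: "big B A c1 s t1 s' \<Longrightarrow> big B A c2 s' t2 s'' \<Longrightarrow> big B A (c1;; c2) s (t1 + t2) s''"
| CondT: "safe_test B (reg s) b \<Longrightarrow> test (reg s) b \<Longrightarrow> big B A c1 s t s' \<Longrightarrow>
    big B A (IF b THEN c1 ELSE c2) s t s'"
| CondF: "safe_test B (reg s) b \<Longrightarrow> \<not> test (reg s) b \<Longrightarrow> big B A c2 s t s' \<Longrightarrow>
    big B A (IF b THEN c1 ELSE c2) s t s'"
| LoopF: "safe_test B (reg s) b \<Longrightarrow> \<not> test (reg s) b \<Longrightarrow> big B A (WHILE b DO c) s 0 s"
| LoopT: "safe_test B (reg s) b \<Longrightarrow> test (reg s) b \<Longrightarrow> big B A c s t1 s' \<Longrightarrow>
    big B A (WHILE b DO c) s' t2 s'' \<Longrightarrow> big B A (WHILE b DO c) s (Suc (t1 + t2)) s''"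

lemma big_cells: "big B A c s t s' \<Longrightarrow> cells s' \<le> max (cells s) A"
  by (induction rule: big.induct) (auto simp: touch_def)

definition words_bounded :: "int \<Rightarrow> ram_state \<Rightarrow> bool" where
  "words_bounded B s \<longleftrightarrow> (\<forall>x. \<bar>reg s x\<bar> < B) \<and> (\<forall>a. \<bar>mem s a\<bar> < B)"

fun consts_exp :: "exp \<Rightarrow> int set" where
  "consts_exp (N c) = {c}"
| "consts_exp (V x) = {}"
| "consts_exp (Bin f a b) = consts_exp a \<union> consts_exp b"

fun consts_test :: "bexp \<Rightarrow> int set" where
  "consts_test (a [<] b) = consts_exp a \<union> consts_exp b"
| "consts_test (a [=] b) = consts_exp a \<union> consts_exp b"

fun constants :: "com \<Rightarrow> int set" where
  "constants Skip = {}"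
| "constants (x ::= e) = consts_exp e"
| "constants (Get x e) = consts_exp e"
| "constants (Put e e') = consts_exp e \<union> consts_exp e'"
| "constants (Print e) = consts_exp e"
| "constants (c1;; c2) = constants c1 \<union> constants c2"
| "constants (IF b THEN c1 ELSE c2) = consts_test b \<union> constants c1 \<union> constants c2"
| "constants (WHILE b DO c) = consts_test b \<union> constants c"

fun vars_exp :: "exp \<Rightarrow> nat set" where
  "vars_exp (N c) = {}"
| "vars_exp (V x) = {x}"
| "vars_exp (Bin f a b) = vars_exp a \<union> vars_exp b"

fun vars_test :: "bexp \<Rightarrow> nat set" where
  "vars_test (a [<] b) = vars_exp a \<union> vars_exp b"
| "vars_test (a [=] b) = vars_exp a \<union> vars_exp b"

fun vars :: "com \<Rightarrow> nat set" where
  "vars Skip = {}"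
| "vars (x ::= e) = insert x (vars_exp e)"
| "vars (Get x e) = insert x (vars_exp e)"
| "vars (Put e e') = vars_exp e \<union> vars_exp e'"
| "vars (Print e) = vars_exp e"
| "vars (c1;; c2) = vars c1 \<union> vars c2"
| "vars (IF b THEN c1 ELSE c2) = vars_test b \<union> vars c1 \<union> vars c2"
| "vars (WHILE b DO c) = vars_test b \<union> vars c"

lemma abs_div_le:
  fixes a b :: int
  shows "\<bar>a div b\<bar> \<le> \<bar>a\<bar>"
proof -
  have pos: "\<bar>a div b\<bar> \<le> \<bar>a\<bar>" if "0 < b" for a b :: int
    using that zdiv_mono2_neg[of a 1 b] zdiv_mono2[of a 1 b] pos_imp_zdiv_nonneg_iff[of b a]
    by (cases "0 \<le> a") (simp_all add: abs_if not_less)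
  show ?thesis
    using pos[of b a] pos[of "- b" "- a"] by (cases b "0 :: int" rule: linorder_cases) auto
qed

lemma abs_binop_less:
  assumes "binop_safe B f a b" "\<bar>a\<bar> < B" "\<bar>b\<bar> < B"
  shows "alu f a b = Some (binop f a b)" "\<bar>binop f a b\<bar> < B"
proof -
  show "alu f a b = Some (binop f a b)" using assms(1) by (cases f) auto
  have "\<bar>a mod b\<bar> < B" if "b \<noteq> 0" using abs_mod_less[OF that, of a] assms(3) by linarith
  then show "\<bar>binop f a b\<bar> < B" using assms abs_div_le[of a b] by (cases f) auto
qed

lemma abs_aval_less:
  assumes "safe B R e" "\<forall>x. \<bar>R x\<bar> < B" "\<forall>c\<in>consts_exp e. \<bar>c\<bar> < B"
  shows "\<bar>aval R e\<bar> < B"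
  using assms by (induction e) (auto intro!: abs_binop_less)

lemma big_bounded:
  "big B A c s t s' \<Longrightarrow> words_bounded B s \<Longrightarrow> \<forall>i\<in>constants c. \<bar>i\<bar> < B \<Longrightarrow> words_bounded B s'"
  by (induction rule: big.induct) (auto simp: words_bounded_def touch_def intro: abs_aval_less)

subsection \<open>Compilation\<close>

fun operand :: "exp \<Rightarrow> nat \<Rightarrow> nat" where
  "operand (V x) d = x"
| "operand e d = d"

fun code_exp :: "exp \<Rightarrow> nat \<Rightarrow> nat instr list" where
  "code_exp (N c) d = [Const d c]"
| "code_exp (V x) d = []"
| "code_exp (Bin f a b) d =
    code_exp a d @ code_exp b (Suc d) @ [Alu f d (operand a d) (operand b (Suc d))]"

fun code_test :: "bexp \<Rightarrow> nat \<Rightarrow> nat instr list" where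
  "code_test (a [<] b) d = code_exp a d @ code_exp b (Suc d)"
| "code_test (a [=] b) d = code_exp a d @ code_exp b (Suc d)"

fun branch :: "bexp \<Rightarrow> nat \<Rightarrow> nat \<Rightarrow> nat instr" where
  "branch (a [<] b) d l = JumpLess (operand a d) (operand b (Suc d)) l"
| "branch (a [=] b) d l = JumpEq (operand a d) (operand b (Suc d)) l"

fun code_length :: "nat \<Rightarrow> com \<Rightarrow> nat" where
  "code_length d Skip = 0"
| "code_length d (x ::= e) = length (code_exp e d) + 2"
| "code_length d (Get x e) = length (code_exp e d) + 1"
| "code_length d (Put e e') = length (code_exp e d @ code_exp e' (Suc d)) + 1"
| "code_length d (Print e) = length (code_exp e d) + 1"
| "code_length d (c1;; c2) = code_length d c1 + code_length d c2"
| "code_length d (IF b THEN c1 ELSE c2) =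
    length (code_test b d) + code_length d c2 + code_length d c1 + 2"
| "code_length d (WHILE b DO c) = length (code_test b d) + code_length d c + 3"

text \<open>The code for a command starts at position \<open>p\<close> and uses the registers from \<open>d\<close> on as scratch space.\<close>

fun code :: "nat \<Rightarrow> com \<Rightarrow> nat \<Rightarrow> nat instr list" where
  "code d Skip p = []"
| "code d (x ::= e) p = code_exp e d @ [Const (Suc d) 0, Alu AddOp x (operand e d) (Suc d)]"
| "code d (Get x e) p = code_exp e d @ [Load x (operand e d)]"
| "code d (Put e e') p =
    (code_exp e d @ code_exp e' (Suc d)) @ [Store (operand e' (Suc d)) (operand e d)]"
| "code d (Print e) p = code_exp e d @ [Output (operand e d)]"
| "code d (c1;; c2) p = code d c1 p @ code d c2 (p + code_length d c1)"
| "code d (IF b THEN c1 ELSE c2) p =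
    (let else_pos = Suc (p + length (code_test b d));
         then_pos = Suc (else_pos + code_length d c2)
     in (code_test b d @ [branch b d then_pos]) @ code d c2 else_pos @
        [JumpEq d d (then_pos + code_length d c1)] @ code d c1 then_pos)"
| "code d (WHILE b DO c) p =
    (let body_pos = Suc (Suc (p + length (code_test b d)))
     in (code_test b d @ [branch b d body_pos]) @ [JumpEq d d (Suc (body_pos + code_length d c))] @
        code d c body_pos @ [JumpEq d d p])"

lemma length_code [simp]: "length (code d c p) = code_length d c"
  by (induction d c p rule: code.induct) (auto simp: Let_def)

definition reach :: "nat \<Rightarrow> program \<Rightarrow> ram_state \<Rightarrow> nat \<Rightarrow> ram_state \<Rightarrow> bool" where
  "reach w prog s t s' \<longleftrightarrow> ((\<lambda>r. Option.bind r (step w prog)) ^^ t) (Some s) = Some s'"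

lemma reach_0 [simp]: "reach w prog s 0 s' \<longleftrightarrow> s' = s"
  by (auto simp: reach_def)

lemma reach_trans:
  "reach w prog s t s' \<Longrightarrow> reach w prog s' t' s'' \<Longrightarrow> reach w prog s (t + t') s''"
  unfolding reach_def by (subst add.commute) (simp add: funpow_add)

definition code_at :: "program \<Rightarrow> nat \<Rightarrow> nat instr list \<Rightarrow> bool" where
  "code_at prog p cs \<longleftrightarrow> (\<exists>xs ys. prog = xs @ cs @ ys \<and> length xs = p)"

lemma code_at_Nil [simp]: "code_at prog p [] \<longleftrightarrow> p \<le> length prog"
  by (metis append_Nil append_take_drop_id code_at_def length_take min.absorb2 le_add1 length_append)

lemma code_at_append [simp]:
  "code_at prog p (cs @ ds) \<longleftrightarrow> code_at prog p cs \<and> code_at prog (p + length cs) ds"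
proof
  assume "code_at prog p (cs @ ds)"
  then show "code_at prog p cs \<and> code_at prog (p + length cs) ds"
    unfolding code_at_def by (metis append.assoc length_append)
next
  assume "code_at prog p cs \<and> code_at prog (p + length cs) ds"
  then obtain xs ys xs' ys' where "prog = xs @ cs @ ys" "length xs = p"
    "prog = xs' @ ds @ ys'" "length xs' = p + length cs"
    unfolding code_at_def by blast
  then show "code_at prog p (cs @ ds)"
    unfolding code_at_def by (metis append.assoc append_eq_append_conv length_append)
qed

lemma code_at_Cons [simp]:
  "code_at prog p (i # cs) \<longleftrightarrow> p < length prog \<and> prog ! p = i \<and> code_at prog (Suc p) cs"
proof -
  have "code_at prog p [i]" if "p < length prog" "prog ! p = i"
    using that id_take_nth_drop[of p prog] unfolding code_at_def
    by (intro exI[of _ "take p prog"] exI[of _ "drop (Suc p) prog"]) simp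
  then have "code_at prog p [i] \<longleftrightarrow> p < length prog \<and> prog ! p = i"
    by (auto simp: code_at_def nth_append)
  then show ?thesis using code_at_append[of prog p "[i]" cs] by simp
qed

definition agree :: "nat \<Rightarrow> ram_state \<Rightarrow> ram_state \<Rightarrow> bool" where
  "agree d S s \<longleftrightarrow> (\<forall>x<d. reg S x = reg s x) \<and> mem S = mem s \<and> cells S = cells s \<and>
    printed S = printed s"

locale word_bound =
  fixes w :: nat and B :: int
  assumes fits_bound: "\<bar>v\<bar> < B \<Longrightarrow> fits w v"
begin

definition computes :: "program \<Rightarrow> ram_state \<Rightarrow> nat instr list \<Rightarrow> (nat \<Rightarrow> int) \<Rightarrow> bool" where
  "computes prog S cs R \<longleftrightarrow> reach w prog S (length cs) (S\<lparr>reg := R, pc := pc S + length cs\<rparr>)"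

lemma computes_Nil [simp]: "computes prog S [] (reg S)"
  by (simp add: computes_def)

lemma computes_append:
  "computes prog S cs R \<Longrightarrow> computes prog (S\<lparr>reg := R, pc := pc S + length cs\<rparr>) ds R' \<Longrightarrow>
    computes prog S (cs @ ds) R'"
  unfolding computes_def by (drule (1) reach_trans) (simp add: add.assoc)

lemma reach_instr:
  "pc S < length prog \<Longrightarrow> exec_instr w (prog ! pc S) S = Some S' \<Longrightarrow> reach w prog S (Suc 0) S'"
  by (simp add: reach_def step_def)

lemma reach_jump:
  "pc S < length prog \<Longrightarrow> prog ! pc S = JumpEq d d l \<Longrightarrow> reach w prog S (Suc 0) (S\<lparr>pc := l\<rparr>)"
  by (rule reach_instr) (simp_all add: jump_def)

lemma reach_computes_instr:
  assumes "computes prog S cs R" "code_at prog (pc S) (cs @ [i])"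
    "exec_instr w i (S\<lparr>reg := R, pc := pc S + length cs\<rparr>) = Some S'"
  shows "reach w prog S (Suc (length cs)) S'"
  using reach_trans[OF assms(1)[unfolded computes_def] reach_instr] assms(2,3) by simp

lemma computes_code_exp:
  assumes "safe B R e" "\<forall>x. \<bar>R x\<bar> < B" "\<forall>c\<in>consts_exp e. \<bar>c\<bar> < B"
    "code_at prog (pc S) (code_exp e d)" "vars_exp e \<subseteq> {..<d}" "\<forall>x\<in>vars_exp e. reg S x = R x"
  shows "\<exists>R'. computes prog S (code_exp e d) R' \<and> R' (operand e d) = aval R e \<and>
    (\<forall>x<d. R' x = reg S x)"
  using assms
proof (induction e arbitrary: d S)
  case (N c)
  then have "computes prog S [Const d c] ((reg S)(d := c))"
    unfolding computes_def by (simp add: reach_instr set_reg_def fits_bound)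
  then show ?case by (intro exI[of _ "(reg S)(d := c)"]) (auto simp: fun_upd_def)
next
  case (V x)
  then show ?case by (intro exI[of _ "reg S"]) simp
next
  case (Bin f a b)
  obtain R1 where a: "computes prog S (code_exp a d) R1" "R1 (operand a d) = aval R a"
    and R1: "\<forall>x<d. R1 x = reg S x"
    using Bin.IH(1)[of S d] Bin.prems by auto
  let ?S1 = "S\<lparr>reg := R1, pc := pc S + length (code_exp a d)\<rparr>"
  obtain R2 where b: "computes prog ?S1 (code_exp b (Suc d)) R2" "R2 (operand b (Suc d)) = aval R b"
    and R2: "\<forall>x<Suc d. R2 x = R1 x"
    using Bin.IH(2)[of ?S1 "Suc d"] Bin.prems R1 by (auto simp: subset_iff less_SucI)
  have "operand a d < Suc d" using Bin.prems(5) by (cases a) auto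
  then have op_a: "R2 (operand a d) = aval R a" using a(2) R2 by simp
  have "\<bar>aval R a\<bar> < B" "\<bar>aval R b\<bar> < B" using Bin.prems by (auto intro: abs_aval_less)
  then have alu: "alu f (aval R a) (aval R b) = Some (binop f (aval R a) (aval R b))"
    "fits w (binop f (aval R a) (aval R b))"
    using Bin.prems(1) by (auto intro: abs_binop_less fits_bound)
  have ab: "computes prog S (code_exp a d @ code_exp b (Suc d)) R2"
    using a(1) b(1) by (rule computes_append)
  have "computes prog S (code_exp (Bin f a b) d) (R2(d := aval R (Bin f a b)))"
    using reach_computes_instr[OF ab] Bin.prems(4) alu op_a b(2)
    by (simp add: computes_def set_reg_def add.assoc)
  then show ?case
    using R1 R2 by (intro exI[of _ "R2(d := aval R (Bin f a b))"]) (auto simp: fun_upd_def)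
qed

lemma operand_le: "vars_exp e \<subseteq> {..<d} \<Longrightarrow> operand e d \<le> d"
  by (cases e) auto

lemma code_exp2_correct:
  assumes "safe B R e" "safe B R e'" "\<forall>x. \<bar>R x\<bar> < B" "\<forall>c\<in>consts_exp e \<union> consts_exp e'. \<bar>c\<bar> < B"
    "code_at prog (pc S) (code_exp e d @ code_exp e' (Suc d))"
    "vars_exp e \<subseteq> {..<d}" "vars_exp e' \<subseteq> {..<d}" "\<forall>x<d. reg S x = R x"
  shows "\<exists>R'. computes prog S (code_exp e d @ code_exp e' (Suc d)) R' \<and>
    R' (operand e d) = aval R e \<and> R' (operand e' (Suc d)) = aval R e' \<and> (\<forall>x<d. R' x = R x)"
proof -
  obtain R1 where R1: "computes prog S (code_exp e d) R1" "R1 (operand e d) = aval R e"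
    "\<forall>x<d. R1 x = reg S x"
    using computes_code_exp[of R e prog S d] assms by (auto simp: subset_iff)
  let ?S1 = "S\<lparr>reg := R1, pc := pc S + length (code_exp e d)\<rparr>"
  obtain R2 where R2: "computes prog ?S1 (code_exp e' (Suc d)) R2"
    "R2 (operand e' (Suc d)) = aval R e'" "\<forall>x<Suc d. R2 x = R1 x"
    using computes_code_exp[of R e' prog ?S1 "Suc d"] assms R1(3) by fastforce
  show ?thesis
    using computes_append[OF R1(1) R2(1)] R1 R2 operand_le[OF assms(6)] assms(8)
    by (intro exI[of _ R2]) simp
qed

lemma computes_code_test:
  assumes "safe_test B R b" "\<forall>x. \<bar>R x\<bar> < B" "\<forall>c\<in>consts_test b. \<bar>c\<bar> < B"
    "code_at prog (pc S) (code_test b d @ [branch b d l])" "vars_test b \<subseteq> {..<d}" "\<forall>x<d. reg S x = R x"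
  shows "\<exists>R'. (\<forall>x<d. R' x = R x) \<and> reach w prog S (Suc (length (code_test b d)))
    (S\<lparr>reg := R', pc := if test R b then l else Suc (pc S + length (code_test b d))\<rparr>)"
proof -
  obtain e e' where b: "b = (e [<] e') \<or> b = (e [=] e')" by (cases b) auto
  then obtain R' where R': "computes prog S (code_exp e d @ code_exp e' (Suc d)) R'"
    "R' (operand e d) = aval R e" "R' (operand e' (Suc d)) = aval R e'" "\<forall>x<d. R' x = R x"
    using code_exp2_correct[of R e e' prog S d] assms by auto
  have "reach w prog S (Suc (length (code_exp e d @ code_exp e' (Suc d))))
    (S\<lparr>reg := R', pc := if test R b then l else Suc (pc S + length (code_test b d))\<rparr>)"
    by (rule reach_computes_instr[OF R'(1), where i = "branch b d l"])
      (use b assms(4) R' in \<open>auto simp: jump_def add.assoc\<close>)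
  then show ?thesis using b R'(4) by auto
qed

definition simulated :: "nat \<Rightarrow> com \<Rightarrow> ram_state \<Rightarrow> nat \<Rightarrow> ram_state \<Rightarrow> bool" where
  "simulated d c s t s' \<longleftrightarrow> (\<forall>prog S. code_at prog (pc S) (code d c (pc S)) \<and> agree d S s \<longrightarrow>
    (\<exists>u S'. reach w prog S u S' \<and> u \<le> code_length d c * (t + 1) \<and>
      pc S' = pc S + code_length d c \<and> agree d S' s'))"

lemma simulatedI:
  assumes "\<And>prog S. code_at prog (pc S) (code d c (pc S)) \<Longrightarrow> agree d S s \<Longrightarrow>
    \<exists>u S'. reach w prog S u S' \<and> u \<le> code_length d c * (t + 1) \<and>
      pc S' = pc S + code_length d c \<and> agree d S' s'"
  shows "simulated d c s t s'"
  using assms unfolding simulated_def by blast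

lemma simulatedE:
  assumes "simulated d c s t s'" "code_at prog (pc S) (code d c (pc S))" "agree d S s"
  obtains u S' where "reach w prog S u S'" "u \<le> code_length d c * (t + 1)"
    "pc S' = pc S + code_length d c" "agree d S' s'"
  using assms unfolding simulated_def by blast

lemma simulated_Assign:
  assumes "safe B (reg s) e" "words_bounded B s" "\<forall>i\<in>consts_exp e. \<bar>i\<bar> < B" "vars (x ::= e) \<subseteq> {..<d}"
  shows "simulated d (x ::= e) s 0 (s\<lparr>reg := (reg s)(x := aval (reg s) e)\<rparr>)"
proof (rule simulatedI)
  fix prog S assume code: "code_at prog (pc S) (code d (x ::= e) (pc S))" and S: "agree d S s"
  obtain R where R: "computes prog S (code_exp e d) R" "R (operand e d) = aval (reg s) e"
    "\<forall>y<d. R y = reg S y"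
    using computes_code_exp[of "reg s" e prog S d] assms code S
    by (auto simp: agree_def words_bounded_def subset_iff)
  have small: "\<bar>aval (reg s) e\<bar> < B"
    using assms by (auto simp: words_bounded_def intro: abs_aval_less)
  then have "computes prog S (code_exp e d @ [Const (Suc d) 0]) (R(Suc d := 0))"
    unfolding computes_def using reach_computes_instr[OF R(1)] code
    by (simp add: set_reg_def fits_bound)
  moreover have "operand e d \<noteq> Suc d" using operand_le[of e d] assms(4) by auto
  ultimately have "reach w prog S (code_length d (x ::= e))
    (S\<lparr>reg := R(Suc d := 0, x := aval (reg s) e), pc := pc S + code_length d (x ::= e)\<rparr>)"
    using reach_computes_instr[of prog S "code_exp e d @ [Const (Suc d) 0]" "R(Suc d := 0)"
      "Alu AddOp x (operand e d) (Suc d)"] code R(2) small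
    by (simp add: set_reg_def fits_bound)
  then show "\<exists>u S'. reach w prog S u S' \<and> u \<le> code_length d (x ::= e) * (0 + 1) \<and>
      pc S' = pc S + code_length d (x ::= e) \<and> agree d S' (s\<lparr>reg := (reg s)(x := aval (reg s) e)\<rparr>)"
    using R(3) S by (intro exI conjI) (auto simp: agree_def)
qed

lemma simulated_Get:
  assumes "safe B (reg s) e" "words_bounded B s" "\<forall>i\<in>consts_exp e. \<bar>i\<bar> < B" "vars (Get x e) \<subseteq> {..<d}"
    "0 \<le> aval (reg s) e" "a = nat (aval (reg s) e)"
  shows "simulated d (Get x e) s 0 (touch a (s\<lparr>reg := (reg s)(x := mem s a)\<rparr>))"
proof (rule simulatedI)
  fix prog S assume code: "code_at prog (pc S) (code d (Get x e) (pc S))" and S: "agree d S s"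
  obtain R where R: "computes prog S (code_exp e d) R" "R (operand e d) = aval (reg s) e"
    "\<forall>y<d. R y = reg S y"
    using computes_code_exp[of "reg s" e prog S d] assms code S
    by (auto simp: agree_def words_bounded_def subset_iff)
  let ?S' = "(touch a S)\<lparr>reg := R(x := mem s a), pc := pc S + code_length d (Get x e)\<rparr>"
  have "reach w prog S (code_length d (Get x e)) ?S'"
    using reach_computes_instr[OF R(1), of "Load x (operand e d)"] code R(2) S assms(2,5,6)
    by (simp add: set_reg_def fits_bound agree_def touch_def words_bounded_def Let_def)
  then show "\<exists>u S'. reach w prog S u S' \<and> u \<le> code_length d (Get x e) * (0 + 1) \<and>
      pc S' = pc S + code_length d (Get x e) \<and> agree d S' (touch a (s\<lparr>reg := (reg s)(x := mem s a)\<rparr>))"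
    using R(3) S by (intro exI[of _ "code_length d (Get x e)"] exI[of _ ?S']) (simp add: agree_def touch_def)
qed

lemma simulated_Put:
  assumes "safe B (reg s) e" "safe B (reg s) e'" "words_bounded B s" "\<forall>i\<in>consts_exp e \<union> consts_exp e'. \<bar>i\<bar> < B"
    "vars (Put e e') \<subseteq> {..<d}" "0 \<le> aval (reg s) e" "a = nat (aval (reg s) e)"
  shows "simulated d (Put e e') s 0 (touch a (s\<lparr>mem := (mem s)(a := aval (reg s) e')\<rparr>))"
proof (rule simulatedI)
  fix prog S assume code: "code_at prog (pc S) (code d (Put e e') (pc S))" and S: "agree d S s"
  obtain R where R: "computes prog S (code_exp e d @ code_exp e' (Suc d)) R"
    "R (operand e d) = aval (reg s) e" "R (operand e' (Suc d)) = aval (reg s) e'" "\<forall>y<d. R y = reg s y"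
    using code_exp2_correct[of "reg s" e e' prog S d] assms code S
    by (auto simp: agree_def words_bounded_def subset_iff)
  have "\<bar>aval (reg s) e'\<bar> < B" using assms by (auto simp: words_bounded_def intro: abs_aval_less)
  let ?S' = "(touch a (S\<lparr>reg := R\<rparr>))\<lparr>mem := (mem s)(a := aval (reg s) e'),
    pc := pc S + code_length d (Put e e')\<rparr>"
  from \<open>\<bar>aval (reg s) e'\<bar> < B\<close> have "reach w prog S (code_length d (Put e e')) ?S'"
    using reach_computes_instr[OF R(1), of "Store (operand e' (Suc d)) (operand e d)"]
      code R(2,3) S assms(6,7)
    by (simp add: set_cell_def fits_bound agree_def touch_def Let_def)
  then show "\<exists>u S'. reach w prog S u S' \<and> u \<le> code_length d (Put e e') * (0 + 1) \<and>
      pc S' = pc S + code_length d (Put e e') \<and> agree d S' (touch a (s\<lparr>mem := (mem s)(a := aval (reg s) e')\<rparr>))"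
    using R(4) S by (intro exI[of _ "code_length d (Put e e')"] exI[of _ ?S']) (simp add: agree_def touch_def)
qed

lemma simulated_Print:
  assumes "safe B (reg s) e" "words_bounded B s" "\<forall>i\<in>consts_exp e. \<bar>i\<bar> < B" "vars (Print e) \<subseteq> {..<d}"
  shows "simulated d (Print e) s 0 (s\<lparr>printed := printed s @ [aval (reg s) e]\<rparr>)"
proof (rule simulatedI)
  fix prog S assume code: "code_at prog (pc S) (code d (Print e) (pc S))" and S: "agree d S s"
  obtain R where R: "computes prog S (code_exp e d) R" "R (operand e d) = aval (reg s) e"
    "\<forall>y<d. R y = reg S y"
    using computes_code_exp[of "reg s" e prog S d] assms code S
    by (auto simp: agree_def words_bounded_def subset_iff)
  let ?S' = "S\<lparr>reg := R, printed := printed s @ [aval (reg s) e], pc := pc S + code_length d (Print e)\<rparr>"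
  have "reach w prog S (code_length d (Print e)) ?S'"
    using reach_computes_instr[OF R(1), of "Output (operand e d)"] code R(2) S by (simp add: agree_def)
  then show "\<exists>u S'. reach w prog S u S' \<and> u \<le> code_length d (Print e) * (0 + 1) \<and>
      pc S' = pc S + code_length d (Print e) \<and> agree d S' (s\<lparr>printed := printed s @ [aval (reg s) e]\<rparr>)"
    using R(3) S by (intro exI[of _ "code_length d (Print e)"] exI[of _ ?S']) (simp add: agree_def)
qed

lemma simulated_Seq:
  assumes "simulated d c1 s t1 s'" "simulated d c2 s' t2 s''"
  shows "simulated d (c1;; c2) s (t1 + t2) s''"
proof (rule simulatedI)
  fix prog S assume code: "code_at prog (pc S) (code d (c1;; c2) (pc S))" and S: "agree d S s"
  obtain u1 S1 where c1: "reach w prog S u1 S1" "u1 \<le> code_length d c1 * (t1 + 1)"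
    "pc S1 = pc S + code_length d c1" "agree d S1 s'"
    by (rule simulatedE[OF assms(1), of prog S]) (use code S in auto)
  obtain u2 S2 where c2: "reach w prog S1 u2 S2" "u2 \<le> code_length d c2 * (t2 + 1)"
    "pc S2 = pc S1 + code_length d c2" "agree d S2 s''"
    by (rule simulatedE[OF assms(2), of prog S1]) (use code c1 in auto)
  have "u1 + u2 \<le> code_length d (c1;; c2) * (t1 + t2 + 1)"
    using c1(2) c2(2) by (simp add: algebra_simps)
  then show "\<exists>u S'. reach w prog S u S' \<and> u \<le> code_length d (c1;; c2) * (t1 + t2 + 1) \<and>
      pc S' = pc S + code_length d (c1;; c2) \<and> agree d S' s''"
    using reach_trans[OF c1(1) c2(1)] c1(3) c2(3,4) by (intro exI[of _ "u1 + u2"] exI[of _ S2]) simp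
qed

lemma simulated_Cond:
  assumes "safe_test B (reg s) b" "words_bounded B s" "\<forall>i\<in>consts_test b. \<bar>i\<bar> < B" "vars_test b \<subseteq> {..<d}"
    and branch: "simulated d (if test (reg s) b then c1 else c2) s t s'"
  shows "simulated d (IF b THEN c1 ELSE c2) s t s'"
proof (rule simulatedI)
  fix prog S assume code: "code_at prog (pc S) (code d (IF b THEN c1 ELSE c2) (pc S))" and S: "agree d S s"
  let ?else = "Suc (pc S + length (code_test b d))"
  let ?then = "Suc (?else + code_length d c2)"
  let ?end = "?then + code_length d c1"
  obtain R where R: "\<forall>x<d. R x = reg s x" and test: "reach w prog S (Suc (length (code_test b d)))
    (S\<lparr>reg := R, pc := if test (reg s) b then ?then else ?else\<rparr>)"
    using computes_code_test[of "reg s" b prog S d ?then] assms(1-4) code S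
    by (auto simp: agree_def words_bounded_def)
  have "\<exists>u S'. reach w prog (S\<lparr>reg := R, pc := if test (reg s) b then ?then else ?else\<rparr>) u S' \<and>
    u \<le> Suc ((code_length d c1 + code_length d c2) * (t + 1)) \<and> pc S' = ?end \<and> agree d S' s'"
  proof (cases "test (reg s) b")
    case True
    obtain u S' where "reach w prog (S\<lparr>reg := R, pc := ?then\<rparr>) u S'" "u \<le> code_length d c1 * (t + 1)"
      "pc S' = ?end" "agree d S' s'"
      by (rule simulatedE[OF branch, of prog "S\<lparr>reg := R, pc := ?then\<rparr>"])
        (use True code S R in \<open>auto simp: agree_def Let_def\<close>)
    then show ?thesis using True by (intro exI[of _ u] exI[of _ S']) (simp add: algebra_simps)
  next
    case False
    obtain u S' where c2: "reach w prog (S\<lparr>reg := R, pc := ?else\<rparr>) u S'" "u \<le> code_length d c2 * (t + 1)"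
      "pc S' = ?else + code_length d c2" "agree d S' s'"
      by (rule simulatedE[OF branch, of prog "S\<lparr>reg := R, pc := ?else\<rparr>"])
        (use False code S R in \<open>auto simp: agree_def Let_def\<close>)
    have "reach w prog S' (Suc 0) (S'\<lparr>pc := ?end\<rparr>)"
      by (rule reach_jump[where d = d]) (use c2(3) code in \<open>simp_all add: Let_def\<close>)
    from reach_trans[OF c2(1) this] show ?thesis
      using False c2 by (intro exI[of _ "u + Suc 0"] exI[of _ "S'\<lparr>pc := ?end\<rparr>"])
        (simp add: agree_def algebra_simps)
  qed
  then obtain u S' where "reach w prog (S\<lparr>reg := R, pc := if test (reg s) b then ?then else ?else\<rparr>) u S'"
    "u \<le> Suc ((code_length d c1 + code_length d c2) * (t + 1))" "pc S' = ?end" "agree d S' s'"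
    by blast
  then show "\<exists>u S'. reach w prog S u S' \<and> u \<le> code_length d (IF b THEN c1 ELSE c2) * (t + 1) \<and>
      pc S' = pc S + code_length d (IF b THEN c1 ELSE c2) \<and> agree d S' s'"
    using reach_trans[OF test] by (intro exI conjI) (auto simp: algebra_simps)
qed

lemma simulated_LoopF:
  assumes "safe_test B (reg s) b" "words_bounded B s" "\<forall>i\<in>consts_test b. \<bar>i\<bar> < B" "vars_test b \<subseteq> {..<d}"
    "\<not> test (reg s) b"
  shows "simulated d (WHILE b DO c) s 0 s"
proof (rule simulatedI)
  fix prog S assume code: "code_at prog (pc S) (code d (WHILE b DO c) (pc S))" and S: "agree d S s"
  let ?exit = "Suc (pc S + length (code_test b d))" and ?end = "pc S + code_length d (WHILE b DO c)"
  obtain R where R: "\<forall>x<d. R x = reg s x"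
    "reach w prog S (Suc (length (code_test b d))) (S\<lparr>reg := R, pc := ?exit\<rparr>)"
    using computes_code_test[of "reg s" b prog S d "Suc ?exit"] assms code S
    by (auto simp: agree_def words_bounded_def Let_def)
  have "reach w prog (S\<lparr>reg := R, pc := ?exit\<rparr>) (Suc 0) (S\<lparr>reg := R, pc := ?end\<rparr>)"
    using reach_jump[of "S\<lparr>reg := R, pc := ?exit\<rparr>" prog d ?end] code
    by (simp add: Let_def eval_nat_numeral)
  from reach_trans[OF R(2) this]
  show "\<exists>u S'. reach w prog S u S' \<and> u \<le> code_length d (WHILE b DO c) * (0 + 1) \<and>
      pc S' = pc S + code_length d (WHILE b DO c) \<and> agree d S' s"
    using R(1) S
    by (intro exI[of _ "Suc (length (code_test b d)) + Suc 0"] exI[of _ "S\<lparr>reg := R, pc := ?end\<rparr>"])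
      (simp add: agree_def)
qed

lemma simulated_LoopT:
  assumes "safe_test B (reg s) b" "words_bounded B s" "\<forall>i\<in>consts_test b. \<bar>i\<bar> < B" "vars_test b \<subseteq> {..<d}"
    "test (reg s) b" "simulated d c s t1 s'" "simulated d (WHILE b DO c) s' t2 s''"
  shows "simulated d (WHILE b DO c) s (Suc (t1 + t2)) s''"
proof (rule simulatedI)
  fix prog S assume code: "code_at prog (pc S) (code d (WHILE b DO c) (pc S))" and S: "agree d S s"
  let ?start = "Suc (Suc (pc S + length (code_test b d)))"
  obtain R where R: "\<forall>x<d. R x = reg s x"
    "reach w prog S (Suc (length (code_test b d))) (S\<lparr>reg := R, pc := ?start\<rparr>)"
    using computes_code_test[of "reg s" b prog S d ?start] assms code S
    by (auto simp: agree_def words_bounded_def Let_def)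
  obtain u1 S1 where c: "reach w prog (S\<lparr>reg := R, pc := ?start\<rparr>) u1 S1" "u1 \<le> code_length d c * (t1 + 1)"
    "pc S1 = ?start + code_length d c" "agree d S1 s'"
    by (rule simulatedE[OF assms(6), of prog "S\<lparr>reg := R, pc := ?start\<rparr>"])
      (use R code S in \<open>auto simp: agree_def Let_def\<close>)
  have jump_back: "reach w prog S1 (Suc 0) (S1\<lparr>pc := pc S\<rparr>)"
    by (rule reach_jump[where d = d]) (use c(3) code in \<open>simp_all add: Let_def\<close>)
  obtain u2 S2 where loop: "reach w prog (S1\<lparr>pc := pc S\<rparr>) u2 S2"
    "u2 \<le> code_length d (WHILE b DO c) * (t2 + 1)"
    "pc S2 = pc S + code_length d (WHILE b DO c)" "agree d S2 s''"
    by (rule simulatedE[OF assms(7), of prog "S1\<lparr>pc := pc S\<rparr>"])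
      (use c(4) code in \<open>auto simp: agree_def\<close>)
  have "Suc (length (code_test b d)) + (u1 + (Suc 0 + u2)) \<le>
    code_length d (WHILE b DO c) * (Suc (t1 + t2) + 1)"
    using c(2) loop(2) by (auto simp: algebra_simps)
  then show "\<exists>u S'. reach w prog S u S' \<and> u \<le> code_length d (WHILE b DO c) * (Suc (t1 + t2) + 1) \<and>
      pc S' = pc S + code_length d (WHILE b DO c) \<and> agree d S' s''"
    using reach_trans[OF R(2) reach_trans[OF c(1) reach_trans[OF jump_back loop(1)]]] loop(3,4) by blast
qed

theorem big_simulated:
  assumes "big B A c s t s'" "words_bounded B s" "\<forall>i\<in>constants c. \<bar>i\<bar> < B" "vars c \<subseteq> {..<d}"
  shows "simulated d c s t s'"
  using assms
proof (induction rule: big.induct)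
  case (Skip s)
  then show ?case by (intro simulatedI exI[of _ "0::nat"]) auto
next
  case (Seq c1 s t1 s' c2 t2 s'')
  then show ?case using big_bounded[OF Seq.hyps(1)] by (auto intro!: simulated_Seq)
next
  case (LoopT s b c t1 s' t2 s'')
  then have "words_bounded B s'" using big_bounded[OF LoopT.hyps(3)] by auto
  with LoopT show ?case by (intro simulated_LoopT) auto
qed (auto intro!: simulated_Assign simulated_Get simulated_Put simulated_Print simulated_Cond simulated_LoopF
    split: if_splits simp: ball_Un)

end

subsection \<open>Total correctness with time budgets\<close>

definition runs :: "int \<Rightarrow> nat \<Rightarrow> com \<Rightarrow> nat \<Rightarrow> (ram_state \<Rightarrow> bool) \<Rightarrow> ram_state \<Rightarrow> bool" where
  "runs B A c T Q s \<longleftrightarrow> (\<exists>t s'. big B A c s t s' \<and> t \<le> T \<and> Q s')"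

fun writes :: "com \<Rightarrow> nat set" where
  "writes (x ::= e) = {x}"
| "writes (Get x e) = {x}"
| "writes (c1;; c2) = writes c1 \<union> writes c2"
| "writes (IF b THEN c1 ELSE c2) = writes c1 \<union> writes c2"
| "writes (WHILE b DO c) = writes c"
| "writes _ = {}"

fun stores :: "com \<Rightarrow> bool" where
  "stores (Put e e') \<longleftrightarrow> True"
| "stores (c1;; c2) \<longleftrightarrow> stores c1 \<or> stores c2"
| "stores (IF b THEN c1 ELSE c2) \<longleftrightarrow> stores c1 \<or> stores c2"
| "stores (WHILE b DO c) \<longleftrightarrow> stores c"
| "stores _ \<longleftrightarrow> False"

fun prints :: "com \<Rightarrow> bool" where
  "prints (Print e) \<longleftrightarrow> True"
| "prints (c1;; c2) \<longleftrightarrow> prints c1 \<or> prints c2"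
| "prints (IF b THEN c1 ELSE c2) \<longleftrightarrow> prints c1 \<or> prints c2"
| "prints (WHILE b DO c) \<longleftrightarrow> prints c"
| "prints _ \<longleftrightarrow> False"

lemma effects_For [simp]:
  "writes (FOR x FROM e TO e' DO c) = insert x (writes c)"
  "stores (FOR x FROM e TO e' DO c) = stores c"
  "prints (FOR x FROM e TO e' DO c) = prints c"
  by (auto simp: For_def)

definition frame :: "com \<Rightarrow> ram_state \<Rightarrow> ram_state \<Rightarrow> bool" where
  "frame c s s' \<longleftrightarrow> (\<forall>x. x \<notin> writes c \<longrightarrow> reg s' x = reg s x) \<and> (\<not> stores c \<longrightarrow> mem s' = mem s) \<and>
    (\<not> prints c \<longrightarrow> printed s' = printed s)"

lemma frameD:
  assumes "frame c s s'"
  shows "x \<notin> writes c \<Longrightarrow> reg s' x = reg s x"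
    and "\<not> stores c \<Longrightarrow> mem s' = mem s"
    and "\<not> prints c \<Longrightarrow> printed s' = printed s"
  using assms by (auto simp: frame_def)

lemma frame_refl: "frame c s s"
  by (simp add: frame_def)

lemma frame_trans: "frame c s s' \<Longrightarrow> frame c s' s'' \<Longrightarrow> frame c s s''"
  by (auto simp: frame_def)

lemma big_frame: "big B A c s t s' \<Longrightarrow> frame c s s'"
  by (induction rule: big.induct) (auto simp: frame_def touch_def)

lemma runs_conseq:
  assumes "runs B A c T P s" "T \<le> T'" "\<And>s'. frame c s s' \<Longrightarrow> P s' \<Longrightarrow> Q s'"
  shows "runs B A c T' Q s"
  using assms big_frame unfolding runs_def by (meson order_trans)

lemma runs_Seq:
  assumes "runs B A c1 T' P s" "\<And>s'. frame c1 s s' \<Longrightarrow> P s' \<Longrightarrow> runs B A c2 T'' Q s'" "T' + T'' \<le> T"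
  shows "runs B A (c1;; c2) T Q s"
proof -
  obtain t1 s1 where c1: "big B A c1 s t1 s1" "t1 \<le> T'" "P s1" using assms(1) by (auto simp: runs_def)
  then obtain t2 s2 where "big B A c2 s1 t2 s2" "t2 \<le> T''" "Q s2"
    using assms(2) big_frame by (force simp: runs_def)
  then show ?thesis using c1 assms(3) big.Seq by (force simp: runs_def)
qed

inductive_cases big_SkipE: "big B A Skip s t s'"
inductive_cases big_AssignE: "big B A (x ::= e) s t s'"
inductive_cases big_GetE: "big B A (Get x e) s t s'"
inductive_cases big_PutE: "big B A (Put e e') s t s'"
inductive_cases big_PrintE: "big B A (Print e) s t s'"
inductive_cases big_SeqE: "big B A (c1;; c2) s t s'"
inductive_cases big_CondE: "big B A (IF b THEN c1 ELSE c2) s t s'"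

lemma big_Cond_iff:
  "big B A (IF b THEN c1 ELSE c2) s t s' \<longleftrightarrow>
    safe_test B (reg s) b \<and> (if test (reg s) b then big B A c1 s t s' else big B A c2 s t s')"
  by (auto intro: big.CondT big.CondF elim: big_CondE)

lemma runs_Skip: "runs B A Skip T Q s \<longleftrightarrow> Q s"
  by (auto simp: runs_def intro: big.Skip elim: big_SkipE)

lemma runs_Assign:
  "runs B A (x ::= e) T Q s \<longleftrightarrow> safe B (reg s) e \<and> Q (s\<lparr>reg := (reg s)(x := aval (reg s) e)\<rparr>)"
  by (force simp: runs_def intro: big.Assign elim: big_AssignE)

lemma runs_Get:
  "runs B A (Get x e) T Q s \<longleftrightarrow> safe B (reg s) e \<and> 0 \<le> aval (reg s) e \<and> nat (aval (reg s) e) < A \<and>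
    Q (touch (nat (aval (reg s) e)) (s\<lparr>reg := (reg s)(x := mem s (nat (aval (reg s) e)))\<rparr>))"
  by (force simp: runs_def intro: big.Get elim: big_GetE)

lemma runs_Put:
  "runs B A (Put e e') T Q s \<longleftrightarrow> safe B (reg s) e \<and> safe B (reg s) e' \<and> 0 \<le> aval (reg s) e \<and>
    nat (aval (reg s) e) < A \<and>
    Q (touch (nat (aval (reg s) e)) (s\<lparr>mem := (mem s)(nat (aval (reg s) e) := aval (reg s) e')\<rparr>))"
  by (force simp: runs_def intro: big.Put elim: big_PutE)

lemma runs_Print:
  "runs B A (Print e) T Q s \<longleftrightarrow> safe B (reg s) e \<and> Q (s\<lparr>printed := printed s @ [aval (reg s) e]\<rparr>)"
  by (force simp: runs_def intro: big.Print elim: big_PrintE)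

lemma runs_Cond:
  "runs B A (IF b THEN c1 ELSE c2) T Q s \<longleftrightarrow> safe_test B (reg s) b \<and>
    (if test (reg s) b then runs B A c1 T Q s else runs B A c2 T Q s)"
  by (auto simp: runs_def big_Cond_iff)

lemma big_Seq_iff:
  "big B A (c1;; c2) s t s'' \<longleftrightarrow> (\<exists>t1 t2 s'. big B A c1 s t1 s' \<and> big B A c2 s' t2 s'' \<and> t = t1 + t2)"
  by (blast intro: big.Seq elim: big_SeqE)

lemma runs_Seq_assoc: "runs B A ((c1;; c2);; c3) T Q s \<longleftrightarrow> runs B A (c1;; (c2;; c3)) T Q s"
proof -
  have "big B A (c1;; (c2;; c3)) s t s'" if "big B A ((c1;; c2);; c3) s t s'" for t s'
    using that big.Seq[OF _ big.Seq, of B A c1 s _ _ c2 _ _ c3]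
    by (auto simp: add.assoc elim!: big_SeqE)
  moreover have "big B A ((c1;; c2);; c3) s t s'" if "big B A (c1;; (c2;; c3)) s t s'" for t s'
    using that big.Seq[OF big.Seq, of B A c1 s _ _ c2 _ _ c3]
    by (auto simp flip: add.assoc elim!: big_SeqE)
  ultimately show ?thesis unfolding runs_def by blast
qed

lemma runs_costless_Seq:
  assumes "\<And>t s'. big B A c1 s t s' \<Longrightarrow> t = 0"
  shows "runs B A (c1;; c2) T Q s \<longleftrightarrow> runs B A c1 T (runs B A c2 T Q) s"
proof -
  have "runs B A (c1;; c2) T Q s \<longleftrightarrow> (\<exists>s' s'' t. big B A c1 s 0 s' \<and> big B A c2 s' t s'' \<and> t \<le> T \<and> Q s'')"
    using assms unfolding runs_def big_Seq_iff by fastforce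
  then show ?thesis using assms unfolding runs_def by blast
qed

lemma runs_atomic_Seq:
  "runs B A (Skip;; c) T Q s \<longleftrightarrow> runs B A Skip T (runs B A c T Q) s"
  "runs B A (x ::= e;; c) T Q s \<longleftrightarrow> runs B A (x ::= e) T (runs B A c T Q) s"
  "runs B A (Get x e;; c) T Q s \<longleftrightarrow> runs B A (Get x e) T (runs B A c T Q) s"
  "runs B A (Put e e';; c) T Q s \<longleftrightarrow> runs B A (Put e e') T (runs B A c T Q) s"
  "runs B A (Print e;; c) T Q s \<longleftrightarrow> runs B A (Print e) T (runs B A c T Q) s"
  by (rule runs_costless_Seq; auto elim: big_SkipE big_AssignE big_GetE big_PutE big_PrintE)+

lemma runs_Cond_Seq:
  "runs B A ((IF b THEN c1 ELSE c2);; c) T Q s \<longleftrightarrow> safe_test B (reg s) b \<and>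
    (if test (reg s) b then runs B A (c1;; c) T Q s else runs B A (c2;; c) T Q s)"
  by (cases "test (reg s) b") (auto simp: runs_def big_Seq_iff big_Cond_iff)

lemmas runs_simps = runs_atomic_Seq runs_Cond_Seq runs_Seq_assoc runs_Skip runs_Assign runs_Get runs_Put
  runs_Print runs_Cond touch_def

text \<open>The budget of a loop also serves as its termination measure.\<close>

lemma runs_While:
  assumes "I p s"
    and safe: "\<And>p s'. frame c s s' \<Longrightarrow> I p s' \<Longrightarrow> safe_test B (reg s') b"
    and body: "\<And>p s'. frame c s s' \<Longrightarrow> I p s' \<Longrightarrow> test (reg s') b \<Longrightarrow>
      \<exists>T p'. T + p' < p \<and> runs B A c T (I p') s'"
    and exit: "\<And>p s'. frame c s s' \<Longrightarrow> I p s' \<Longrightarrow> \<not> test (reg s') b \<Longrightarrow> Q s'"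
  shows "runs B A (WHILE b DO c) p Q s"
proof -
  have "runs B A (WHILE b DO c) p Q s'" if "frame c s s'" "I p s'" for p s'
    using that
  proof (induction p arbitrary: s' rule: less_induct)
    case (less p)
    show ?case
    proof (cases "test (reg s') b")
      case True
      obtain T p' t1 s1 where p': "T + p' < p" and c: "big B A c s' t1 s1" "t1 \<le> T" "I p' s1"
        using body[OF less.prems True] by (auto simp: runs_def)
      have "frame c s s1" using less.prems(1) big_frame[OF c(1)] by (rule frame_trans)
      then obtain t2 s2 where "big B A (WHILE b DO c) s1 t2 s2" "t2 \<le> p'" "Q s2"
        using less.IH[of p' s1] p' c(3) by (auto simp: runs_def)
      then show ?thesis
        using big.LoopT[OF safe[OF less.prems] True c(1)] p' c(2) unfolding runs_def
        by (intro exI[of _ "Suc (t1 + t2)"] exI[of _ s2]) auto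
    next
      case False
      then show ?thesis
        using exit[OF less.prems] big.LoopF[OF safe[OF less.prems]] unfolding runs_def by blast
    qed
  qed
  then show ?thesis using assms(1) frame_refl by blast
qed

lemma aval_cong: "\<forall>x\<in>vars_exp e. R x = R' x \<Longrightarrow> aval R e = aval R' e"
  by (induction e) auto

lemma safe_cong: "\<forall>x\<in>vars_exp e. R x = R' x \<Longrightarrow> safe B R e = safe B R' e"
  by (induction e) (auto simp: aval_cong[of _ R R'])

lemma runs_For:
  fixes lo hi :: nat
  assumes "safe B (reg s) e" "aval (reg s) e = int lo"
    and e': "safe B (reg s) e'" "aval (reg s) e' = int hi" "int hi < B"
    and disjoint: "insert x (writes c) \<inter> vars_exp e' = {}" "x \<notin> writes c"
    and init: "I lo (s\<lparr>reg := (reg s)(x := int lo)\<rparr>)"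
    and body: "\<And>j s'. lo \<le> j \<Longrightarrow> j < hi \<Longrightarrow> frame (FOR x FROM e TO e' DO c) s s' \<Longrightarrow> reg s' x = int j \<Longrightarrow>
      I j s' \<Longrightarrow> runs B A c (T j) (\<lambda>s''. I (Suc j) (s''\<lparr>reg := (reg s'')(x := int (Suc j))\<rparr>)) s'"
    and exit: "\<And>s'. frame (FOR x FROM e TO e' DO c) s s' \<Longrightarrow> I (max lo hi) s' \<Longrightarrow> Q s'"
    and time: "(\<Sum>j\<in>{lo..<hi}. Suc (T j)) \<le> T'"
  shows "runs B A (FOR x FROM e TO e' DO c) T' Q s"
proof -
  let ?c = "c;; x ::= V x [+] N 1" and ?s = "s\<lparr>reg := (reg s)(x := int lo)\<rparr>"
  let ?I = "\<lambda>p s'. \<exists>j. lo \<le> j \<and> j \<le> max lo hi \<and> reg s' x = int j \<and> I j s' \<and> p = (\<Sum>i\<in>{j..<hi}. Suc (T i))"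
  have frame: "frame (FOR x FROM e TO e' DO c) s s'" if "frame ?c ?s s'" for s'
    using that by (auto simp: frame_def)
  have upper: "aval (reg s') e' = int hi" "safe B (reg s') e'" if "frame ?c ?s s'" for s'
  proof -
    have "\<forall>z\<in>vars_exp e'. reg s z = reg s' z"
      using frameD(1)[OF frame[OF that]] disjoint(1) by (metis disjoint_iff effects_For(1))
    then show "aval (reg s') e' = int hi" "safe B (reg s') e'"
      using e' aval_cong[of e' "reg s" "reg s'"] safe_cong[of e' "reg s" "reg s'"] by simp_all
  qed
  have step: "\<exists>T p'. T + p' < p \<and> runs B A ?c T (?I p') s'"
    if s': "frame ?c ?s s'" "?I p s'" "test (reg s') (V x [<] e')" for p s'
  proof -
    obtain j where j: "lo \<le> j" "reg s' x = int j" "I j s'" "p = (\<Sum>i\<in>{j..<hi}. Suc (T i))"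
      using s'(2) by blast
    have "j < hi" using s'(3) j(2) upper(1)[OF s'(1)] by simp
    let ?p = "\<Sum>i\<in>{Suc j..<hi}. Suc (T i)"
    have "runs B A ?c (T j) (?I ?p) s'"
    proof (rule runs_Seq[OF body[OF j(1) \<open>j < hi\<close> frame[OF s'(1)] j(2,3)]])
      fix s'' assume "frame c s' s''" "I (Suc j) (s''\<lparr>reg := (reg s'')(x := int (Suc j))\<rparr>)"
      then show "runs B A (x ::= V x [+] N 1) 0 (?I ?p) s''"
        using j(1,2) \<open>j < hi\<close> e'(3) disjoint(2)
        by (auto simp: runs_Assign frameD(1) add.commute intro!: exI[of _ "Suc j"])
    qed simp
    moreover have "T j + ?p < p"
      unfolding j(4) using \<open>j < hi\<close> by (simp add: sum.atLeast_Suc_lessThan)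
    ultimately show ?thesis by blast
  qed
  have "runs B A (WHILE V x [<] e' DO ?c) (\<Sum>i\<in>{lo..<hi}. Suc (T i)) Q ?s"
  proof (rule runs_While[where I = ?I])
    fix p s' assume s': "frame ?c ?s s'" "?I p s'" "\<not> test (reg s') (V x [<] e')"
    then obtain j where "lo \<le> j" "j \<le> max lo hi" "reg s' x = int j" "I j s'" by blast
    moreover from this have "j = max lo hi" using s'(3) upper(1)[OF s'(1)] by auto
    ultimately show "Q s'" using exit[OF frame[OF s'(1)]] by blast
  next
    show "?I (\<Sum>i\<in>{lo..<hi}. Suc (T i)) ?s" using init by (intro exI[of _ lo]) simp
  qed (use upper step in simp_all)
  then have "runs B A (WHILE V x [<] e' DO ?c) T' Q ?s" using time by (rule runs_conseq)
  then show ?thesis unfolding For_def using assms(1,2) by (simp add: runs_simps)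
qed

section \<open>Arithmetic subroutines\<close>

abbreviation (input) "r_cand \<equiv> 20 :: nat"
abbreviation (input) "r_div \<equiv> 21 :: nat"
abbreviation (input) "r_isprime \<equiv> 22 :: nat"
abbreviation (input) "r_base \<equiv> 23 :: nat"
abbreviation (input) "r_exp \<equiv> 24 :: nat"
abbreviation (input) "r_mod \<equiv> 25 :: nat"
abbreviation (input) "r_modpow \<equiv> 26 :: nat"
abbreviation (input) "r_arg \<equiv> 27 :: nat"
abbreviation (input) "r_deg \<equiv> 28 :: nat"
abbreviation (input) "r_low \<equiv> 29 :: nat"
abbreviation (input) "r_high \<equiv> 30 :: nat"
abbreviation (input) "r_mid \<equiv> 31 :: nat"
abbreviation (input) "r_pow \<equiv> 32 :: nat"
abbreviation (input) "r_count \<equiv> 33 :: nat"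
abbreviation (input) "r_ispow \<equiv> 34 :: nat"
abbreviation (input) "r_symbol \<equiv> 35 :: nat"
abbreviation (input) "r_nonres \<equiv> 36 :: nat"
abbreviation (input) "r_continue \<equiv> 37 :: nat"

definition prime_prog :: com where
  "prime_prog =
    r_isprime ::= N 1;;
    FOR r_div FROM N 2 TO V r_cand DO
      IF V r_cand [mod] V r_div [=] N 0 THEN r_isprime ::= N 0 ELSE Skip"

lemma prime_prog_effects [simp]:
  "writes prime_prog = {r_div, r_isprime}" "\<not> stores prime_prog" "\<not> prints prime_prog"
  by (auto simp: prime_prog_def)

lemma prime_iff_no_divisor:
  assumes "2 \<le> (m :: nat)"
  shows "prime m \<longleftrightarrow> (\<forall>e\<in>{2..<m}. \<not> e dvd m)"
  using assms prime_nat_iff' by auto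

lemma runs_prime_prog:
  assumes "reg s r_cand = int m" "2 \<le> m" "int m < B"
  shows "runs B A prime_prog m (\<lambda>s'. reg s' r_isprime = of_bool (prime m)) s"
proof -
  let ?I = "\<lambda>d s'. reg s' r_isprime = of_bool (\<forall>e\<in>{2..<d}. \<not> e dvd m)"
  have "runs B A (FOR r_div FROM N 2 TO V r_cand DO
      IF V r_cand [mod] V r_div [=] N 0 THEN r_isprime ::= N 0 ELSE Skip) m
    (\<lambda>s'. reg s' r_isprime = of_bool (prime m)) (s\<lparr>reg := (reg s)(r_isprime := 1)\<rparr>)" (is "runs B A ?loop m _ ?s")
  proof (rule runs_For[where I = ?I and lo = 2 and hi = m and T = "\<lambda>_. 0"])
    fix d s' assume d: "2 \<le> d" "d < m" "frame ?loop ?s s'" "reg s' r_div = int d" "?I d s'"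
    have "{2..<Suc d} = insert d {2..<d}" using d(1) by auto
    moreover have "reg s' r_cand = int m" using frameD(1)[OF d(3)] assms(1) by simp
    moreover have "int m mod int d = 0 \<longleftrightarrow> d dvd m" by (simp flip: dvd_eq_mod_eq_0)
    ultimately show "runs B A (IF V r_cand [mod] V r_div [=] N 0 THEN r_isprime ::= N 0 ELSE Skip) 0
        (\<lambda>s''. ?I (Suc d) (s''\<lparr>reg := (reg s'')(r_div := int (Suc d))\<rparr>)) s'"
      using d by (simp add: runs_simps)
  qed (use assms prime_iff_no_divisor[of m] in \<open>simp_all add: max_def\<close>)
  then show ?thesis unfolding prime_prog_def by (simp add: runs_simps)
qed

definition powmod_prog :: com where
  "powmod_prog =
    r_modpow ::= N 1;;
    WHILE N 0 [<] V r_exp DO (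
      (IF V r_exp [mod] N 2 [=] N 1 THEN r_modpow ::= V r_modpow [*] V r_base [mod] V r_mod ELSE Skip);;
      r_base ::= V r_base [*] V r_base [mod] V r_mod;;
      r_exp ::= V r_exp [div] N 2)"

lemma powmod_prog_effects [simp]:
  "writes powmod_prog = {r_base, r_exp, r_modpow}" "\<not> stores powmod_prog" "\<not> prints powmod_prog"
  by (auto simp: powmod_prog_def)

lemma floorlog_half: "0 < e \<Longrightarrow> floorlog 2 e = Suc (floorlog 2 (e div 2))"
  using compute_floorlog[of 2 e] by simp

lemma cong_square_and_multiply:
  fixes r b c m :: int
  assumes "[r * b ^ e = c] (mod m)"
  shows "[(if odd e then r * b mod m else r) * (b * b mod m) ^ (e div 2) = c] (mod m)"
proof -
  have "[(b * b mod m) ^ (e div 2) = b ^ (2 * (e div 2))] (mod m)"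
    by (simp add: unique_euclidean_semiring_class.cong_def power_mod power_mult power2_eq_square)
  then have "[(if odd e then r * b mod m else r) * (b * b mod m) ^ (e div 2) =
      (if odd e then r * b else r) * b ^ (2 * (e div 2))] (mod m)"
    by (intro cong_mult) auto
  also have "(if odd e then r * b else r) * b ^ (2 * (e div 2)) = r * b ^ e"
    by (auto simp: mult.assoc simp flip: power_Suc elim!: oddE)
  also note assms
  finally show ?thesis .
qed

lemma runs_powmod_prog:
  assumes "reg s r_base = int b" "reg s r_exp = int e" "reg s r_mod = int m" "b \<le> m" "2 \<le> m"
    "int m * int m < B"
  shows "runs B A powmod_prog (floorlog 2 e) (\<lambda>s'. reg s' r_modpow = int (b ^ e mod m)) s"
proof -
  let ?I = "\<lambda>p s'. reg s' r_base \<in> {0..int m} \<and> reg s' r_modpow \<in> {0..<int m} \<and> 0 \<le> reg s' r_exp \<and>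
    [reg s' r_modpow * reg s' r_base ^ nat (reg s' r_exp) = int (b ^ e)] (mod int m) \<and>
    p = floorlog 2 (nat (reg s' r_exp))"
  let ?c = "(IF V r_exp [mod] N 2 [=] N 1 THEN r_modpow ::= V r_modpow [*] V r_base [mod] V r_mod ELSE Skip);;
    r_base ::= V r_base [*] V r_base [mod] V r_mod;; r_exp ::= V r_exp [div] N 2"
  let ?s = "s\<lparr>reg := (reg s)(r_modpow := 1)\<rparr>"
  have product: "x * z < B" if "x \<in> {0..int m}" "z \<in> {0..int m}" for x z
    using mult_mono[of x "int m" z "int m"] that assms(6) by simp
  have "runs B A (WHILE N 0 [<] V r_exp DO ?c) (floorlog 2 e)
    (\<lambda>s'. reg s' r_modpow = int (b ^ e mod m)) ?s"
  proof (rule runs_While[where I = ?I])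
    fix p s' assume s': "frame ?c ?s s'" "?I p s'" "test (reg s') (N 0 [<] V r_exp)"
    let ?x = "reg s' r_exp"
    have "0 < ?x" using s'(3) by simp
    then have "0 < nat ?x" "?x mod 2 = 1 \<longleftrightarrow> odd (nat ?x)" "nat (?x div 2) = nat ?x div 2"
      by (auto simp: even_nat_iff nat_div_distrib odd_iff_mod_2_eq_one)
    moreover have "reg s' r_mod = int m" using frameD(1)[OF s'(1)] assms(3) by simp
    ultimately have "runs B A ?c 0 (?I (floorlog 2 (nat ?x div 2))) s'"
      using s'(2) assms(5) product[of "reg s' r_modpow" "reg s' r_base"] product[of "reg s' r_base" "reg s' r_base"]
        cong_square_and_multiply[of "reg s' r_modpow" "reg s' r_base" "nat ?x" "int (b ^ e)" "int m"]
      by (simp add: runs_simps less_imp_le split: if_splits)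
    then show "\<exists>T p'. T + p' < p \<and> runs B A ?c T (?I p') s'"
      using floorlog_half[OF \<open>0 < nat ?x\<close>] s'(2)
      by (intro exI[of _ 0] exI[of _ "floorlog 2 (nat ?x div 2)"]) simp
  next
    fix p s' assume "?I p s'" "\<not> test (reg s') (N 0 [<] V r_exp)"
    then show "reg s' r_modpow = int (b ^ e mod m)"
      by (auto simp: unique_euclidean_semiring_class.cong_def zmod_int)
  qed (use assms in simp_all)
  then show ?thesis unfolding powmod_prog_def by (simp add: runs_simps)
qed

definition pow_prog :: com where
  "pow_prog = r_pow ::= N 1;; FOR r_count FROM N 0 TO V r_deg DO r_pow ::= V r_pow [*] V r_mid"

lemma pow_prog_effects [simp]:
  "writes pow_prog = {r_pow, r_count}" "\<not> stores pow_prog" "\<not> prints pow_prog"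
  by (auto simp: pow_prog_def)

lemma runs_pow_prog:
  assumes "reg s r_mid = int b" "reg s r_deg = int e" "1 \<le> b" "int b ^ e < B" "int e < B"
  shows "runs B A pow_prog e (\<lambda>s'. reg s' r_pow = int (b ^ e)) s"
proof -
  have "runs B A (FOR r_count FROM N 0 TO V r_deg DO r_pow ::= V r_pow [*] V r_mid) e
    (\<lambda>s'. reg s' r_pow = int (b ^ e)) (s\<lparr>reg := (reg s)(r_pow := 1)\<rparr>)" (is "runs B A ?loop e _ ?s")
  proof (rule runs_For[where I = "\<lambda>j s'. reg s' r_pow = int (b ^ j)" and lo = 0 and hi = e and T = "\<lambda>_. 0"])
    fix j s' assume j: "j < e" "frame ?loop ?s s'" "reg s' r_pow = int (b ^ j)"
    have "int b ^ Suc j \<le> int b ^ e" using j(1) assms(3) by (intro power_increasing) auto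
    then show "runs B A (r_pow ::= V r_pow [*] V r_mid) 0
        (\<lambda>s''. reg (s''\<lparr>reg := (reg s'')(r_count := int (Suc j))\<rparr>) r_pow = int (b ^ Suc j)) s'"
      using j(3) frameD(1)[OF j(2)] assms(1,4) by (simp add: runs_simps mult.commute)
  qed (use assms in simp_all)
  then show ?thesis unfolding pow_prog_def by (simp add: runs_simps)
qed

lemma is_power_between_iff:
  fixes m l e :: nat
  assumes "l ^ e \<le> m" "m < Suc l ^ e" "0 < e"
  shows "(\<exists>a. m = a ^ e) \<longleftrightarrow> l ^ e = m"
proof
  assume "\<exists>a. m = a ^ e"
  then obtain a where a: "m = a ^ e" by blast
  have "a < Suc l" using assms(2) unfolding a by (rule power_less_imp_less_base) simp
  moreover have "l \<le> a" using assms(1,3) unfolding a by (simp add: power_mono_iff)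
  ultimately show "l ^ e = m" using a by (simp add: less_Suc_eq_le)
qed auto

lemma bisection_gap:
  fixes l h :: nat
  assumes "l + 1 < h"
  defines "mid \<equiv> (l + h) div 2"
  shows "l < mid" "mid < h"
    "Suc (floorlog 2 (h - mid - 1)) \<le> floorlog 2 (h - l - 1)"
    "Suc (floorlog 2 (mid - l - 1)) \<le> floorlog 2 (h - l - 1)"
proof -
  show "l < mid" "mid < h" using assms by auto
  have half: "floorlog 2 (h - l - 1) = Suc (floorlog 2 ((h - l - 1) div 2))"
    using assms(1) by (intro floorlog_half) simp
  obtain g where h: "h = l + g" using assms(1) by (metis add_lessD1 less_imp_add_positive)
  then have "mid = (2 * l + g) div 2" by (simp add: mid_def mult_2)
  then have "mid = l + g div 2" by simp
  moreover have "g - g div 2 - 1 \<le> (g - 1) div 2" "g div 2 - 1 \<le> (g - 1) div 2" by presburger+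
  ultimately have "h - mid - 1 \<le> (h - l - 1) div 2" "mid - l - 1 \<le> (h - l - 1) div 2"
    by (simp_all add: h)
  then show "Suc (floorlog 2 (h - mid - 1)) \<le> floorlog 2 (h - l - 1)"
    "Suc (floorlog 2 (mid - l - 1)) \<le> floorlog 2 (h - l - 1)"
    unfolding half by (simp_all add: floorlog_mono)
qed

definition bisect_prog :: com where
  "bisect_prog =
    r_mid ::= (V r_low [+] V r_high) [div] N 2;;
    pow_prog;;
    IF V r_arg [<] V r_pow THEN r_high ::= V r_mid ELSE r_low ::= V r_mid"

lemma bisect_prog_effects [simp]:
  "writes bisect_prog = {r_low, r_high, r_mid, r_pow, r_count}" "\<not> stores bisect_prog" "\<not> prints bisect_prog"
  by (auto simp: bisect_prog_def)

definition bisection :: "nat \<Rightarrow> nat \<Rightarrow> nat \<Rightarrow> ram_state \<Rightarrow> bool" where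
  "bisection m e p s \<longleftrightarrow> (\<exists>l h. reg s r_low = int l \<and> reg s r_high = int h \<and> 1 \<le> l \<and> l < h \<and> h \<le> m \<and>
    l ^ e \<le> m \<and> m < h ^ e \<and> (e + 1) * floorlog 2 (h - l - 1) \<le> p)"

lemma runs_bisect_prog:
  assumes s: "reg s r_arg = int m" "reg s r_deg = int e" "bisection m e p s" "reg s r_low + 1 < reg s r_high"
    and B: "int m ^ e < B" "int e < B" "2 * int m < B"
  shows "e + 1 \<le> p \<and> runs B A bisect_prog e (bisection m e (p - (e + 1))) s"
proof -
  obtain l h where I: "reg s r_low = int l" "reg s r_high = int h" "1 \<le> l" "l < h" "h \<le> m"
    "l ^ e \<le> m" "m < h ^ e" "(e + 1) * floorlog 2 (h - l - 1) \<le> p"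
    using s(3) unfolding bisection_def by blast
  have "l + 1 < h" using s(4) I by simp
  define mid where "mid = (l + h) div 2"
  note mid = bisection_gap[OF \<open>l + 1 < h\<close>, folded mid_def]
  have "int mid ^ e \<le> int m ^ e" using mid(2) I(5) by (intro power_mono) auto
  let ?p = "p - (e + 1)"
  have "(e + 1) * Suc (floorlog 2 (h - mid - 1)) \<le> p" "(e + 1) * Suc (floorlog 2 (mid - l - 1)) \<le> p"
    using mult_le_mono2[OF mid(3), of "e + 1"] mult_le_mono2[OF mid(4), of "e + 1"] I(8) by linarith+
  then have budget: "e + 1 \<le> p" "(e + 1) * floorlog 2 (h - mid - 1) \<le> ?p" "(e + 1) * floorlog 2 (mid - l - 1) \<le> ?p"
    by simp_all
  let ?s = "s\<lparr>reg := (reg s)(r_mid := int mid)\<rparr>"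
  let ?choice = "IF V r_arg [<] V r_pow THEN r_high ::= V r_mid ELSE r_low ::= V r_mid"
  have "runs B A (pow_prog;; ?choice) e (bisection m e ?p) ?s"
  proof (rule runs_Seq[OF runs_pow_prog])
    fix s' assume s': "frame pow_prog ?s s'" "reg s' r_pow = int (mid ^ e)"
    show "runs B A ?choice 0 (bisection m e ?p) s'"
    proof (cases "m < mid ^ e")
      case True
      then show ?thesis using s' frameD(1)[OF s'(1)] I mid(1,2) budget(3) s(1,2)
        by (auto simp: runs_simps bisection_def simp del: of_nat_power intro!: exI[of _ l] exI[of _ mid])
    next
      case False
      then show ?thesis using s' frameD(1)[OF s'(1)] I mid(1,2) budget(2) s(1,2)
        by (auto simp: runs_simps bisection_def simp del: of_nat_power intro!: exI[of _ mid] exI[of _ h])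
    qed
  qed (use s I(3,5) mid(1,2) \<open>int mid ^ e \<le> int m ^ e\<close> B in auto)
  moreover have "(int l + int h) div 2 = int mid" by (simp add: mid_def)
  ultimately show ?thesis using I B(3) budget(1) by (simp add: runs_simps bisect_prog_def)
qed

definition floor_root_prog :: com where
  "floor_root_prog =
    r_low ::= N 1;;
    r_high ::= V r_arg;;
    WHILE V r_low [+] N 1 [<] V r_high DO bisect_prog"

lemma floor_root_prog_effects [simp]:
  "writes floor_root_prog = {r_low, r_high, r_mid, r_pow, r_count}"
  "\<not> stores floor_root_prog" "\<not> prints floor_root_prog"
  by (auto simp: floor_root_prog_def)

lemma runs_floor_root_prog:
  assumes s: "reg s r_arg = int m" "reg s r_deg = int e" "2 \<le> m" "2 \<le> e"
    and B: "int m ^ e < B" "int e < B" "2 * int m < B"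
  shows "runs B A floor_root_prog ((e + 1) * floorlog 2 m)
    (\<lambda>s'. \<exists>l. reg s' r_low = int l \<and> 1 \<le> l \<and> l \<le> m \<and> l ^ e \<le> m \<and> m < Suc l ^ e) s"
proof -
  let ?s = "s\<lparr>reg := (reg s)(r_low := 1, r_high := int m)\<rparr>" and ?b = "V r_low [+] N 1 [<] V r_high"
  have "runs B A (WHILE ?b DO bisect_prog) ((e + 1) * floorlog 2 m)
    (\<lambda>s'. \<exists>l. reg s' r_low = int l \<and> 1 \<le> l \<and> l \<le> m \<and> l ^ e \<le> m \<and> m < Suc l ^ e) ?s"
  proof (rule runs_While[where I = "bisection m e"])
    have "m ^ 1 < m ^ e" using s(3,4) by (intro power_strict_increasing) auto
    moreover have "(e + 1) * floorlog 2 (m - 1 - 1) \<le> (e + 1) * floorlog 2 m"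
      by (intro mult_le_mono2 floorlog_mono) simp
    ultimately show "bisection m e ((e + 1) * floorlog 2 m) ?s"
      using s(3) unfolding bisection_def by (intro exI[of _ 1] exI[of _ m]) simp
  next
    fix p s' assume s': "frame bisect_prog ?s s'" "bisection m e p s'" "test (reg s') ?b"
    then have "e + 1 \<le> p \<and> runs B A bisect_prog e (bisection m e (p - (e + 1))) s'"
      using frameD(1)[OF s'(1)] s(1,2) B by (intro runs_bisect_prog) simp_all
    then show "\<exists>T p'. T + p' < p \<and> runs B A bisect_prog T (bisection m e p') s'"
      by (intro exI[of _ e] exI[of _ "p - (e + 1)"]) simp
  next
    fix p s' assume "bisection m e p s'" "\<not> test (reg s') ?b"
    then obtain l h where lh: "reg s' r_low = int l" "1 \<le> l" "l < h" "h \<le> m" "l ^ e \<le> m" "m < h ^ e" "h \<le> l + 1"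
      unfolding bisection_def by auto
    then have "h = Suc l" by simp
    with lh show "\<exists>l. reg s' r_low = int l \<and> 1 \<le> l \<and> l \<le> m \<and> l ^ e \<le> m \<and> m < Suc l ^ e"
      by (intro exI[of _ l]) simp
  qed (use B(3) in \<open>auto simp: bisection_def\<close>)
  then show ?thesis unfolding floor_root_prog_def using s(1) by (simp add: runs_simps)
qed

definition ispow_prog :: com where
  "ispow_prog =
    floor_root_prog;;
    r_mid ::= V r_low;;
    pow_prog;;
    IF V r_pow [=] V r_arg THEN r_ispow ::= N 1 ELSE r_ispow ::= N 0"

lemma ispow_prog_effects [simp]:
  "writes ispow_prog = {r_low, r_high, r_mid, r_pow, r_count, r_ispow}"
  "\<not> stores ispow_prog" "\<not> prints ispow_prog"
  by (auto simp: ispow_prog_def)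

lemma runs_ispow_prog:
  assumes s: "reg s r_arg = int m" "reg s r_deg = int e" "2 \<le> m" "2 \<le> e"
    and B: "int m ^ e < B" "int e < B" "2 * int m < B"
  shows "runs B A ispow_prog ((e + 1) * (floorlog 2 m + 1)) (\<lambda>s'. reg s' r_ispow = of_bool (\<exists>a. m = a ^ e)) s"
  unfolding ispow_prog_def
proof (rule runs_Seq[OF runs_floor_root_prog[OF s B], where T'' = e])
  let ?Q = "\<lambda>s'. reg s' r_ispow = of_bool (\<exists>a. m = a ^ e)"
  let ?answer = "IF V r_pow [=] V r_arg THEN r_ispow ::= N 1 ELSE r_ispow ::= N 0"
  fix s' assume s': "frame floor_root_prog s s'"
    "\<exists>l. reg s' r_low = int l \<and> 1 \<le> l \<and> l \<le> m \<and> l ^ e \<le> m \<and> m < Suc l ^ e"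
  then obtain l where l: "reg s' r_low = int l" "1 \<le> l" "l \<le> m" "l ^ e \<le> m" "m < Suc l ^ e"
    by blast
  have r: "reg s' r_arg = int m" "reg s' r_deg = int e" using frameD(1)[OF s'(1)] s(1,2) by simp_all
  let ?s = "s'\<lparr>reg := (reg s')(r_mid := int l)\<rparr>"
  have "int l ^ e \<le> int m ^ e" using l(3) by (intro power_mono) auto
  then have "int l ^ e < B" using B(1) by simp
  then have "runs B A (pow_prog;; ?answer) e ?Q ?s"
  proof (intro runs_Seq[OF runs_pow_prog, where T'' = 0])
    fix s'' assume s'': "frame pow_prog ?s s''" "reg s'' r_pow = int (l ^ e)"
    then show "runs B A ?answer 0 ?Q s''"
      using is_power_between_iff[OF l(4,5)] s(4) r(1) frameD(1)[OF s''(1)]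
      by (simp add: runs_simps del: of_nat_power)
  qed (use r l(2) B(2) in auto)
  then show "runs B A (r_mid ::= V r_low;; pow_prog;; ?answer) e ?Q s'" using l(1) by (simp add: runs_simps)
qed simp

definition nonresidue_step :: com where
  "nonresidue_step =
    r_nonres ::= V r_nonres [+] N 1;;
    r_cand ::= V r_nonres;;
    prime_prog;;
    IF V r_isprime [=] N 1 THEN (
      r_base ::= V r_symbol [mod] V r_nonres;;
      r_exp ::= (V r_nonres [-] N 1) [div] N 2;;
      r_mod ::= V r_nonres;;
      powmod_prog;;
      IF V r_modpow [=] N 1 THEN Skip ELSE r_continue ::= N 0)
    ELSE Skip"

lemma nonresidue_step_effects [simp]:
  "writes nonresidue_step = {r_cand, r_div, r_isprime, r_base, r_exp, r_mod, r_modpow, r_nonres, r_continue}"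
  "\<not> stores nonresidue_step" "\<not> prints nonresidue_step"
  by (auto simp: nonresidue_step_def)

definition nonresidue_prog :: com where
  "nonresidue_prog =
    r_nonres ::= N 2;;
    r_continue ::= N 1;;
    WHILE V r_continue [=] N 1 DO nonresidue_step"

lemma nonresidue_prog_effects [simp]:
  "writes nonresidue_prog = {r_cand, r_div, r_isprime, r_base, r_exp, r_mod, r_modpow, r_nonres, r_continue}"
  "\<not> stores nonresidue_prog" "\<not> prints nonresidue_prog"
  by (auto simp: nonresidue_prog_def)

lemma floorlog_le_self: "floorlog 2 x \<le> x"
  by (rule floorlog_leI) (simp_all add: less_exp)

lemma mod_power_half_eq_1_iff:
  assumes "prime p" "2 < p"
  shows "(a mod p) ^ ((p - 1) div 2) mod p = 1 \<longleftrightarrow> Legendre (int a) (int p) = 1"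
  using half_power_eq_1_iff[OF assms, of a] by (simp add: half_power_def power_mod)

lemma less_least_nonresidue_iff:
  assumes "2 < p" "p \<le> least_nonresidue L" "1 < L" "odd L"
  shows "p < least_nonresidue L \<longleftrightarrow> \<not> (prime p \<and> Legendre (int L) (int p) \<noteq> 1)"
  using prime_least_nonresidue[OF assms(3,4)] Legendre_least_nonresidue[OF assms(3,4)] least_nonresidue_le[of p L] prime_odd_nat[of p] assms(1,2)
  by (auto simp: le_less)

lemma runs_nonresidue_step:
  assumes L: "1 < L" "odd L" and B: "int L * int L < B"
    and s: "reg s r_symbol = int L" "reg s r_nonres = int q" "reg s r_continue = 1"
    and q: "2 \<le> q" "q < least_nonresidue L"
  shows "runs B A nonresidue_step (2 * least_nonresidue L)
    (\<lambda>s'. reg s' r_nonres = int (Suc q) \<and> reg s' r_continue = of_bool (Suc q < least_nonresidue L)) s"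
proof -
  let ?l = "least_nonresidue L"
  let ?Q = "\<lambda>s'. reg s' r_nonres = int (Suc q) \<and> reg s' r_continue = of_bool (Suc q < ?l)"
  define p where "p = Suc q"
  have p: "2 < p" "p \<le> ?l" "p \<le> L" using q least_nonresidue_le_self[OF L] by (auto simp: p_def)
  note continue = less_least_nonresidue_iff[OF p(1,2) L]
  have "int p * int p \<le> int L * int L" "int p \<le> int p * int p" using p by (auto intro: mult_mono)
  then have pB: "int p * int p < B" "int p < B" using B by linarith+
  let ?s = "s\<lparr>reg := (reg s)(r_nonres := int p, r_cand := int p)\<rparr>"
  let ?check = "powmod_prog;; IF V r_modpow [=] N 1 THEN Skip ELSE r_continue ::= N 0"
  let ?symbol = "IF V r_isprime [=] N 1 THEN (r_base ::= V r_symbol [mod] V r_nonres;;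
    r_exp ::= (V r_nonres [-] N 1) [div] N 2;; r_mod ::= V r_nonres;; ?check) ELSE Skip"
  have "runs B A (prime_prog;; ?symbol) (p + p) ?Q ?s"
  proof (rule runs_Seq[OF runs_prime_prog])
    fix s' assume s': "frame prime_prog ?s s'" "reg s' r_isprime = of_bool (prime p)"
    have r: "reg s' r_symbol = int L" "reg s' r_nonres = int p" "reg s' r_continue = 1"
      using frameD(1)[OF s'(1)] s by simp_all
    let ?e = "(p - 1) div 2"
    have "floorlog 2 ?e \<le> p" using floorlog_le_self[of ?e] by linarith
    show "runs B A ?symbol p ?Q s'"
    proof (cases "prime p")
      case True
      let ?s' = "s'\<lparr>reg := (reg s')(r_base := int (L mod p), r_exp := int ?e, r_mod := int p)\<rparr>"
      have "runs B A ?check p ?Q ?s'"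
      proof (rule runs_Seq[OF runs_powmod_prog, where T'' = 0])
        fix s'' assume s'': "frame powmod_prog ?s' s''" "reg s'' r_modpow = int ((L mod p) ^ ?e mod p)"
        then have "reg s'' r_modpow = 1 \<longleftrightarrow> p < ?l"
          using mod_power_half_eq_1_iff[OF True p(1), of L] continue True by (metis of_nat_1 of_nat_eq_iff)
        then show "runs B A (IF V r_modpow [=] N 1 THEN Skip ELSE r_continue ::= N 0) 0 ?Q s''"
          using frameD(1)[OF s''(1)] r by (simp add: runs_simps p_def)
      qed (use p pB \<open>floorlog 2 ?e \<le> p\<close> in \<open>auto intro: less_imp_le\<close>)
      moreover have "(int p - 1) div 2 = int ?e" using p(1) by (simp add: of_nat_diff zdiv_int)
      ultimately show ?thesis
        using True s'(2) r p(1) pB(2) by (simp add: runs_simps zmod_int)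
    next
      case False
      then show ?thesis using s'(2) r continue by (simp add: runs_simps p_def)
    qed
  qed (use p pB in auto)
  then have "runs B A (prime_prog;; ?symbol) (2 * ?l) ?Q ?s" by (rule runs_conseq) (use p in auto)
  then show ?thesis
    unfolding nonresidue_step_def using s(2) pB(2) by (simp add: runs_simps p_def add.commute)
qed

lemma runs_nonresidue_prog:
  assumes "reg s r_symbol = int L" "1 < L" "odd L" "int L * int L < B"
  shows "runs B A nonresidue_prog (3 * least_nonresidue L ^ 2)
    (\<lambda>s'. reg s' r_nonres = int (least_nonresidue L)) s"
proof -
  let ?l = "least_nonresidue L"
  let ?I = "\<lambda>p s'. \<exists>q. reg s' r_nonres = int q \<and> reg s' r_continue = of_bool (q < ?l) \<and> 2 \<le> q \<and> q \<le> ?l \<and>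
    p = (?l - q) * (3 * ?l)"
  let ?s = "s\<lparr>reg := (reg s)(r_nonres := 2, r_continue := 1)\<rparr>"
  have l: "2 < ?l" by (rule least_nonresidue_gt_2[OF assms(2,3)])
  have "runs B A (WHILE V r_continue [=] N 1 DO nonresidue_step) ((?l - 2) * (3 * ?l))
    (\<lambda>s'. reg s' r_nonres = int ?l) ?s"
  proof (rule runs_While[where I = ?I])
    fix p s' assume s': "frame nonresidue_step ?s s'" "?I p s'" "test (reg s') (V r_continue [=] N 1)"
    then obtain q where q: "reg s' r_nonres = int q" "reg s' r_continue = 1" "2 \<le> q" "q < ?l"
      "p = (?l - q) * (3 * ?l)" by (auto split: if_splits)
    have "runs B A nonresidue_step (2 * ?l) (?I ((?l - Suc q) * (3 * ?l))) s'"
      by (rule runs_conseq[OF runs_nonresidue_step[of L B s' q]])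
        (use frameD(1)[OF s'(1)] q assms in \<open>auto intro!: exI[of _ "Suc q"]\<close>)
    moreover have "?l - q = Suc (?l - Suc q)" using q(4) by simp
    ultimately show "\<exists>T p'. T + p' < p \<and> runs B A nonresidue_step T (?I p') s'"
      using l q(5) by (intro exI[of _ "2 * ?l"] exI[of _ "(?l - Suc q) * (3 * ?l)"]) simp
  qed (use l in \<open>auto split: if_splits\<close>)
  moreover have "(?l - 2) * (3 * ?l) \<le> 3 * ?l ^ 2" by (simp add: power2_eq_square)
  ultimately have "runs B A (WHILE V r_continue [=] N 1 DO nonresidue_step) (3 * ?l ^ 2)
    (\<lambda>s'. reg s' r_nonres = int ?l) ?s" by (rule runs_conseq)
  then show ?thesis unfolding nonresidue_prog_def by (simp add: runs_simps)
qed

section \<open>Searching for prime values of linear forms\<close>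

lemma le_div_iff_int:
  fixes a p x :: int
  assumes "0 < a"
  shows "x \<le> p div a \<longleftrightarrow> x * a \<le> p"
proof
  assume "x \<le> p div a"
  then have "x * a \<le> p div a * a" using assms by simp
  also have "\<dots> \<le> p" using div_mult_mod_eq[of p a] pos_mod_sign[OF assms, of p] by linarith
  finally show "x * a \<le> p" .
next
  assume "x * a \<le> p"
  then have "x * a div a \<le> p div a" using assms by (intro zdiv_mono1)
  then show "x \<le> p div a" using assms by simp
qed

locale pattern_search = linear_forms k a b for k :: nat and a b :: "nat \<Rightarrow> int" +
  fixes K n :: nat
  assumes K: "3 \<le> K"
begin

definition y :: nat where "y = (LEAST y. 2 \<le> y \<and> n \<le> y ^ K)"

lemma y_bounds: "2 \<le> y" "n \<le> y ^ K"
  and y_least: "2 \<le> v \<Longrightarrow> n \<le> v ^ K \<Longrightarrow> y \<le> v"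
  and y_le: "y \<le> max 2 n"
proof -
  have "max 2 n ^ 1 \<le> max 2 n ^ K" using K by (intro power_increasing) auto
  then have max: "2 \<le> max 2 n \<and> n \<le> max 2 n ^ K" by auto
  show "2 \<le> y" "n \<le> y ^ K"
    using LeastI[where P = "\<lambda>y. 2 \<le> y \<and> n \<le> y ^ K", OF max] by (auto simp: y_def)
  show least: "2 \<le> v \<Longrightarrow> n \<le> v ^ K \<Longrightarrow> y \<le> v" for v
    unfolding y_def by (rule Least_le) simp
  show "y \<le> max 2 n" using max by (intro least) auto
qed

definition level :: nat where "level = (LEAST m. 2 \<le> m \<and> y < primorial m * m)"

lemma level_bounds: "2 \<le> level" "y < primorial level * level" "level \<le> y + 1"
  and primorial_le_if_less_level: "2 \<le> q \<Longrightarrow> q < level \<Longrightarrow> primorial q * q \<le> y"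
proof -
  have "1 * (y + 1) \<le> primorial (y + 1) * (y + 1)"
    using primorial_pos[of "y + 1"] by (intro mult_le_mono1) simp
  then have exists: "2 \<le> y + 1 \<and> y < primorial (y + 1) * (y + 1)" using y_bounds(1) by simp
  then show "2 \<le> level" "y < primorial level * level" "level \<le> y + 1"
    unfolding level_def
      using LeastI[of "\<lambda>m. 2 \<le> m \<and> y < primorial m * m"] by (blast intro: Least_le)+
  show "2 \<le> q \<Longrightarrow> q < level \<Longrightarrow> primorial q * q \<le> y"
    using not_less_Least[of q "\<lambda>m. 2 \<le> m \<and> y < primorial m * m"] by (auto simp: level_def)
qed

definition wheel :: nat where "wheel = primorial level"
definition block_length :: nat where "block_length = y * y"

lemma wheel_bounds: "0 < wheel" "wheel \<le> y"
proof -
  show "0 < wheel" by (simp add: wheel_def primorial_pos)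
  show "wheel \<le> y"
  proof (cases "level = 2")
    case False
    then obtain q where q: "level = Suc q" "2 \<le> q" using level_bounds(1) by (cases level) auto
    have "primorial (Suc q) \<le> primorial q * q" using q(2) by (simp add: primorial_Suc)
    then show ?thesis using primorial_le_if_less_level[of q] q by (simp add: wheel_def)
  qed (use y_bounds(1) in \<open>simp add: wheel_def primorial_2\<close>)
qed

lemma block_length_pos: "0 < block_length"
  using y_bounds(1) by (simp add: block_length_def)

definition form_lo :: "nat \<Rightarrow> int" where "form_lo i = - ((b i - 2) div a i)"
definition form_hi :: "nat \<Rightarrow> int" where "form_hi i = (int n - b i) div a i"
definition lo :: int where "lo = Max (form_lo ` {..<k})"
definition hi :: int where "hi = Min (form_hi ` {..<k})"

lemma le_form_iff:
  assumes "i < k"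
  shows "2 \<le> form i x \<longleftrightarrow> form_lo i \<le> x" "form i x \<le> int n \<longleftrightarrow> x \<le> form_hi i"
  using le_div_iff_int[OF a_pos[OF assms], of "- x" "b i - 2"] le_div_iff_int[OF a_pos[OF assms], of x "int n - b i"]
  by (auto simp: form_lo_def form_hi_def form_def mult.commute)

lemma lo_le_iff: "lo \<le> x \<longleftrightarrow> (\<forall>i<k. 2 \<le> form i x)"
  and le_hi_iff: "x \<le> hi \<longleftrightarrow> (\<forall>i<k. form i x \<le> int n)"
  using k_pos le_form_iff by (auto simp: lo_def hi_def lessThan_empty_iff)

definition start :: int where "start = lo + int y"

definition all_prime :: "int \<Rightarrow> bool" where
  "all_prime x \<longleftrightarrow> (\<forall>i<k. prime (form i x))"

lemma form_mono:
  assumes "i < k" "x \<le> z"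
  shows "form i x + (z - x) \<le> form i z"
proof -
  have "1 * (z - x) \<le> a i * (z - x)" using assms a_pos[of i] by (intro mult_right_mono) auto
  then show ?thesis by (simp add: form_def algebra_simps)
qed

lemma form_start:
  assumes "i < k" "start \<le> x"
  shows "int y + 2 \<le> form i x"
proof -
  have "form i (x - int y) + (x - (x - int y)) \<le> form i x" using assms(1) by (intro form_mono) auto
  moreover have "2 \<le> form i (x - int y)" using assms lo_le_iff[of "x - int y"] by (simp add: start_def)
  ultimately show ?thesis by simp
qed

definition start_form_sum :: nat where
  "start_form_sum = (\<Sum>i<k. nat (form i start))"

lemma form_le_start_form_sum:
  assumes "i < k" "x \<le> start"
  shows "form i x \<le> int start_form_sum"
proof -
  have "nat (form i start) \<le> start_form_sum"
    unfolding start_form_sum_def using assms(1) by (intro member_le_sum) auto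
  then show ?thesis using form_mono[OF assms] assms(2) by linarith
qed

lemma form_prime_iff_test_passes:
  assumes "start \<le> x" "x \<le> hi" "avoids_upto y x" "i < k"
  defines "p \<equiv> nat (form i x)"
  shows "form i x = int p" "2 < p" "odd p" "p \<le> n" "test_passes K (nonresidue_bound (n div y)) p \<longleftrightarrow> prime (form i x)"
proof -
  have bounds: "int y + 2 \<le> form i x" "form i x \<le> int n"
    using form_start[OF assms(4,1)] le_hi_iff[of x] assms(2,4) by auto
  then show p: "form i x = int p" "2 < p" "p \<le> n" using y_bounds(1) by (auto simp: p_def)
  have rough: "y < q" if "prime q" "q dvd p" for q
  proof -
    have "hits q x" using assms(4) that(2) p(1) unfolding hits_def by auto
    then show ?thesis using assms(3) that(1) by (meson not_le)
  qed
  then show "odd p" using y_bounds(1) by (metis leD two_is_prime_nat)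
  have "test_passes K (nonresidue_bound (n div y)) p \<longleftrightarrow> prime p"
  proof
    assume "test_passes K (nonresidue_bound (n div y)) p"
    with \<open>odd p\<close> show "prime p"
      using p(2) y_bounds(1) two_le_nonresidue_bound least_nonresidue_le_bound
      by (intro prime_if_test_passes[OF _ _ p(3) y_bounds(2) _ rough]) auto
  qed (rule test_passes_if_prime[OF _ p(2)])
  then show "test_passes K (nonresidue_bound (n div y)) p \<longleftrightarrow> prime (form i x)"
    by (simp add: p(1))
qed

lemma avoids_upto_if_all_prime:
  assumes "start \<le> x" "all_prime x"
  shows "avoids_upto y x"
proof (intro allI impI notI)
  fix p assume p: "prime p \<and> p \<le> y" "hits p x"
  then obtain i where i: "i < k" "int p dvd form i x" by (auto simp: hits_def)
  then have "int p = form i x"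
    using assms(2) p(1) primes_dvd_imp_eq[of "int p" "form i x"] by (simp add: all_prime_def)
  then show False using form_start[OF i(1) assms(1)] p(1) by linarith
qed

definition pos :: "nat \<Rightarrow> nat \<Rightarrow> int" where
  "pos r u = start + int r + int wheel * int u"

lemma pos_ge_start: "start \<le> pos r u"
  by (simp add: pos_def)

lemma dvd_form_pos_mod: "int q dvd form i (pos r (T + u)) \<longleftrightarrow> int q dvd form i (pos r (T + u mod q))"
proof -
  have "u - u mod q = q * (u div q)" by (simp add: minus_mod_eq_mult_div)
  then have "int u - int (u mod q) = int q * int (u div q)"
    by (metis mod_less_eq_dividend of_nat_diff of_nat_mult)
  moreover have "form i (pos r (T + u)) - form i (pos r (T + u mod q)) = a i * int wheel * (int u - int (u mod q))"
    by (simp add: form_def pos_def algebra_simps)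
  ultimately have "int q dvd form i (pos r (T + u)) - form i (pos r (T + u mod q))" by simp
  then show ?thesis by (metis diff_add_cancel dvd_add_right_iff)
qed

definition admissible :: "nat \<Rightarrow> bool" where
  "admissible r \<longleftrightarrow> (\<forall>i<k. \<forall>q\<in>{2..y}. q dvd wheel \<longrightarrow> \<not> int q dvd form i (start + int r))"

definition found :: "nat \<Rightarrow> nat set \<Rightarrow> int set" where
  "found r U = {x. \<exists>u\<in>U. x = pos r u \<and> x \<le> hi \<and> all_prime x}"

lemma found_Un: "found r (U \<union> U') = found r U \<union> found r U'"
  by (auto simp: found_def)

lemma found_eq_empty_if_not_admissible:
  assumes "\<not> admissible r"
  shows "found r UNIV = {}"
proof -
  obtain i q where q: "i < k" "2 \<le> q" "q \<le> y" "q dvd wheel" "int q dvd form i (start + int r)"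
    using assms by (auto simp: admissible_def)
  have False if "all_prime (pos r u)" for u
  proof -
    have "form i (pos r u) = form i (start + int r) + a i * int wheel * int u"
      by (simp add: form_def pos_def algebra_simps)
    then have "int q dvd form i (pos r u)" using q(4,5) by simp
    moreover have "prime (form i (pos r u))" using that q(1) by (simp add: all_prime_def)
    ultimately have "int q = 1 \<or> int q = form i (pos r u)"
      unfolding prime_int_iff by (metis of_nat_0_le_iff)
    then show False using q(2,3) form_start[OF q(1) pos_ge_start[of r u]] by linarith
  qed
  then show ?thesis by (auto simp: found_def)
qed

definition blocks :: nat where
  "blocks = nat (hi - start) div (wheel * block_length) + 1"

lemma less_blocks_if_le_hi:
  assumes "pos r u \<le> hi"
  shows "u < blocks * block_length"
proof -
  have "int (wheel * u) \<le> int (nat (hi - start))" using assms by (simp add: pos_def)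
  then have "wheel * u \<le> nat (hi - start)" by (simp only: of_nat_le_iff)
  also have "\<dots> < wheel * block_length + nat (hi - start) div (wheel * block_length) * (wheel * block_length)"
    using wheel_bounds(1) block_length_pos by (intro dividend_less_div_times) simp
  also have "\<dots> = wheel * (blocks * block_length)" by (simp add: blocks_def algebra_simps)
  finally show ?thesis by simp
qed

lemma found_lessThan_blocks: "found r {..<blocks * block_length} = found r UNIV"
  using less_blocks_if_le_hi[of r] by (auto simp: found_def)

lemma UN_found: "(\<Union>r<wheel. found r UNIV) = {x. start \<le> x \<and> x \<le> hi \<and> all_prime x}"
proof -
  have "\<exists>r<wheel. \<exists>u. x = pos r u" if "start \<le> x" for x
  proof -
    have "x = start + (x - start) mod int wheel + int wheel * ((x - start) div int wheel)" by simp
    moreover have "0 \<le> (x - start) mod int wheel" "(x - start) mod int wheel < int wheel" "0 \<le> (x - start) div int wheel"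
      using wheel_bounds(1) that by (simp_all add: pos_imp_zdiv_nonneg_iff)
    ultimately show ?thesis
      by (intro exI[of _ "nat ((x - start) mod int wheel)"] conjI exI[of _ "nat ((x - start) div int wheel)"])
        (auto simp: pos_def)
  qed
  then show ?thesis using pos_ge_start by (fastforce simp: found_def)
qed

abbreviation "bits \<equiv> floorlog 2 n"

abbreviation "max_base \<equiv> nonresidue_bound n"

text \<open>The costs bound the numbers of loop iterations of the programs for the corresponding tasks.\<close>

definition test_cost :: nat where
  "test_cost = K * ((K + 2) * (bits + 1)) + 3 * max_base\<^sup>2 + (max_base + 1) * (bits + 1)"

definition bound_step_cost :: nat where
  "bound_step_cost = 3 * (bits + 1) + 3 * max_base\<^sup>2"

definition bound_cost :: nat where
  "bound_cost = (n div y) * (bound_step_cost + 1)"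

definition offset_cost :: "nat \<Rightarrow> nat \<Rightarrow> nat \<Rightarrow> nat \<Rightarrow> nat \<Rightarrow> nat" where
  "offset_cost r T i q w = (if int q dvd form i (pos r (T + w)) then block_length div q + 1 else 0)"

definition form_cost :: "nat \<Rightarrow> nat \<Rightarrow> nat \<Rightarrow> nat \<Rightarrow> nat" where
  "form_cost r T q i = (\<Sum>w<q. 1 + offset_cost r T i q w)"

definition prime_cost :: "nat \<Rightarrow> nat \<Rightarrow> nat \<Rightarrow> nat" where
  "prime_cost r T q = 1 + q + (if prime q then \<Sum>i<k. 1 + form_cost r T q i else 0)"

definition sieve_cost :: nat where
  "sieve_cost = (k + 1) * (y * (y + 1)) + k * (\<Sum>q | prime q \<and> q \<le> y. y * y div q) + k * y +
    2 * (y * y) * (\<Sum>i<k. nat (a i))"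

lemma card_hit_offsets_le_1:
  assumes "admissible r" "i < k" "prime q" "q \<le> y" "\<not> int q dvd a i"
  shows "card {w. w < q \<and> int q dvd form i (pos r (T + w))} \<le> 1" (is "card ?H \<le> 1")
proof (cases "q dvd wheel")
  case True
  have "form i (pos r (T + w)) = form i (start + int r) + a i * int wheel * (int T + int w)" for w
    by (simp add: form_def pos_def algebra_simps)
  then have "int q dvd form i (pos r (T + w)) \<longleftrightarrow> int q dvd form i (start + int r)" for w
    using True by (simp add: dvd_add_left_iff)
  then have "?H = {}" using assms(1,2,4) True prime_ge_2_nat[OF assms(3)] by (auto simp: admissible_def)
  then show ?thesis by (simp only: card.empty)
next
  case False
  have "w = v" if "w \<in> ?H" "v \<in> ?H" for w v
  proof -
    have "form i (pos r (T + w)) - form i (pos r (T + v)) = a i * int wheel * (int w - int v)"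
      by (simp add: form_def pos_def algebra_simps)
    then have "int q dvd a i * int wheel * (int w - int v)"
      using that dvd_diff by (metis (lifting) mem_Collect_eq)
    then have "int q dvd int w - int v" using False assms(3,5) by (simp add: prime_dvd_mult_iff)
    moreover have "\<bar>int w - int v\<bar> < int q" using that by auto
    ultimately show "w = v" using zdvd_imp_le[of "int q" "\<bar>int w - int v\<bar>"] by fastforce
  qed
  then show ?thesis by (intro card_le_Suc0_iff_eq[THEN iffD2, unfolded One_nat_def[symmetric]]) auto
qed

definition divisor_cost :: "nat \<Rightarrow> nat \<Rightarrow> nat" where
  "divisor_cost i q = (if int q dvd a i then 2 * block_length else 0)"

lemma form_cost_le:
  assumes "admissible r" "i < k" "prime q" "q \<le> y"
  shows "form_cost r T q i \<le> y + block_length div q + 1 + divisor_cost i q"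
proof -
  let ?H = "{w. w < q \<and> int q dvd form i (pos r (T + w))}"
  have "(\<Sum>w<q. offset_cost r T i q w) = card ?H * (block_length div q + 1)"
    by (simp add: offset_cost_def sum.If_cases Int_def)
  then have cost: "form_cost r T q i = q + card ?H * (block_length div q + 1)"
    by (simp only: form_cost_def sum.distrib) simp
  have "card ?H * (block_length div q + 1) \<le> block_length div q + 1 + divisor_cost i q"
  proof (cases "int q dvd a i")
    case True
    have "card ?H \<le> q" using card_mono[of "{..<q}" ?H] by auto
    then have "card ?H * (block_length div q + 1) \<le> q * (block_length div q + 1)"
      by (rule mult_le_mono1)
    also have "\<dots> \<le> block_length + q" by simp
    also have "q \<le> block_length" using assms(4) by (simp add: block_length_def le_square order_trans)
    finally show ?thesis using True by (simp add: divisor_cost_def)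
  next
    case False
    have "card ?H * (block_length div q + 1) \<le> 1 * (block_length div q + 1)"
      using card_hit_offsets_le_1[OF assms False] by (rule mult_le_mono1)
    then show ?thesis by simp
  qed
  then show ?thesis using cost assms(4) by linarith
qed

lemma sum_divisor_cost_le:
  assumes "i < k"
  shows "(\<Sum>q | prime q \<and> q \<le> y. divisor_cost i q) \<le> 2 * block_length * nat (a i)"
proof -
  let ?P = "{q. prime q \<and> q \<le> y}"
  have "finite ?P" by (rule finite_subset[of _ "{..y}"]) auto
  then have "(\<Sum>q\<in>?P. divisor_cost i q) = card {q\<in>?P. int q dvd a i} * (2 * block_length)"
    unfolding divisor_cost_def by (subst sum.inter_filter[symmetric]) simp_all
  moreover have "{q\<in>?P. int q dvd a i} \<subseteq> {1..nat (a i)}"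
    using a_pos[OF assms] by (auto dest!: zdvd_imp_le dest: prime_gt_0_nat simp: Suc_le_eq)
  then have "card {q\<in>?P. int q dvd a i} \<le> nat (a i)"
    using card_mono[of "{1..nat (a i)}"] by fastforce
  ultimately show ?thesis by (simp add: mult.commute)
qed

lemma sum_prime_cost_le:
  assumes "admissible r"
  shows "(\<Sum>q\<in>{2..<y + 1}. prime_cost r T q) \<le> sieve_cost"
proof -
  let ?P = "{q. prime q \<and> q \<le> y}"
  have "?P \<subseteq> {1..y}" by (auto dest: prime_gt_0_nat simp: Suc_le_eq)
  then have card: "card ?P \<le> y" using card_mono[of "{1..y}" ?P] by simp
  have P: "{q \<in> {2..<y + 1}. prime q} = ?P" by (auto dest: prime_ge_2_nat)
  have split: "(\<Sum>q\<in>{2..<y + 1}. prime_cost r T q) =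
    (\<Sum>q\<in>{2..<y + 1}. 1 + q) + (\<Sum>q\<in>?P. \<Sum>i<k. 1 + form_cost r T q i)"
    unfolding prime_cost_def P[symmetric]
    by (subst sum.distrib, subst sum.inter_filter[symmetric]) (simp_all del: sum.op_ivl_Suc)
  have "(\<Sum>q\<in>{2..<y + 1}. 1 + q) \<le> of_nat (card {2..<y + 1}) * (y + 1)"
    by (rule sum_bounded_above) auto
  also have "\<dots> \<le> y * (y + 1)" by (intro mult_le_mono1) simp
  finally have trial: "(\<Sum>q\<in>{2..<y + 1}. 1 + q) \<le> y * (y + 1)" .
  have "(\<Sum>q\<in>?P. \<Sum>i<k. 1 + form_cost r T q i) \<le> (\<Sum>q\<in>?P. \<Sum>i<k. (y + 1) + (block_length div q + 1 + divisor_cost i q))"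
  proof (intro sum_mono)
    fix q i assume "q \<in> ?P" "i \<in> {..<k}"
    then show "1 + form_cost r T q i \<le> (y + 1) + (block_length div q + 1 + divisor_cost i q)"
      using form_cost_le[OF assms, of i q T] by simp
  qed
  also have "\<dots> = card ?P * (k * (y + 1)) + k * (\<Sum>q\<in>?P. block_length div q) + card ?P * k + (\<Sum>q\<in>?P. \<Sum>i<k. divisor_cost i q)"
    by (simp only: sum.distrib sum_distrib_left sum_constant card_lessThan of_nat_id) (simp add: distrib_left)
  also have "card ?P * (k * (y + 1)) \<le> y * (k * (y + 1))" using card by (rule mult_le_mono1)
  also have "card ?P * k \<le> y * k" using card by (rule mult_le_mono1)
  also have "(\<Sum>q\<in>?P. \<Sum>i<k. divisor_cost i q) \<le> 2 * block_length * (\<Sum>i<k. nat (a i))"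
    using sum_mono[of "{..<k}", OF sum_divisor_cost_le] by (subst sum.swap) (simp add: sum_distrib_left)
  finally show ?thesis
    using split trial unfolding sieve_cost_def block_length_def by (simp add: algebra_simps)
qed

definition survivor_cost :: "nat \<Rightarrow> nat \<Rightarrow> nat" where
  "survivor_cost r u = (if pos r u \<le> hi \<and> avoids_upto y (pos r u) then k * (test_cost + 1) else 0)"

definition class_survivors :: "nat \<Rightarrow> nat set" where
  "class_survivors r = {u. pos r u \<le> hi \<and> avoids_upto y (pos r u)}"

lemma finite_class_survivors: "finite (class_survivors r)"
proof (rule finite_subset)
  show "class_survivors r \<subseteq> {..<blocks * block_length}"
    using less_blocks_if_le_hi[of r] by (simp add: class_survivors_def subset_iff)
qed simp

definition class_cost :: "nat \<Rightarrow> nat" where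
  "class_cost r = blocks * (1 + 2 * block_length + sieve_cost) + card (class_survivors r) * (k * (test_cost + 1))"

lemma sum_block_costs_le:
  "(\<Sum>j<blocks. Suc (2 * block_length + sieve_cost + (\<Sum>u<block_length. survivor_cost r (j * block_length + u)))) \<le> class_cost r"
proof -
  have "(\<Sum>u<block_length. survivor_cost r (j * block_length + u)) = sum (survivor_cost r) {j * block_length..<j * block_length + block_length}" for j
    using sum.shift_bounds_nat_ivl[of "survivor_cost r" 0 "j * block_length" block_length]
    by (simp add: add.commute lessThan_atLeast0)
  then have "(\<Sum>j<blocks. \<Sum>u<block_length. survivor_cost r (j * block_length + u)) = (\<Sum>u<blocks * block_length. survivor_cost r u)"
    by (simp only: sum.nat_group)
  also have "\<dots> = card ({..<blocks * block_length} \<inter> class_survivors r) * (k * (test_cost + 1))"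
    by (simp add: survivor_cost_def class_survivors_def sum.If_cases)
  also have "\<dots> \<le> card (class_survivors r) * (k * (test_cost + 1))"
    by (intro mult_le_mono1 card_mono finite_class_survivors) auto
  finally show ?thesis by (simp add: class_cost_def sum_Suc sum.distrib algebra_simps)
qed

definition classes_cost :: nat where
  "classes_cost = (\<Sum>r<wheel. Suc (k * (y + 1) + of_bool (admissible r) * class_cost r))"

lemma sum_card_class_survivors_le: "(\<Sum>r<wheel. card (class_survivors r)) \<le> card {x \<in> {start..hi}. avoids_upto y x}"
proof -
  have "(\<Sum>r<wheel. card (class_survivors r)) = card (SIGMA r:{..<wheel}. class_survivors r)"
    by (simp add: finite_class_survivors)
  also have "\<dots> \<le> card {x \<in> {start..hi}. avoids_upto y x}"
  proof (rule card_inj_on_le)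
    show "inj_on (\<lambda>(r, u). pos r u) (SIGMA r:{..<wheel}. class_survivors r)"
    proof (intro inj_onI, clarify)
      fix r u r' u' assume eq: "r < wheel" "r' < wheel" "pos r u = pos r' u'"
      then have "int (r + wheel * u) = int (r' + wheel * u')" by (simp add: pos_def)
      then have sum_eq: "r + wheel * u = r' + wheel * u'" by (simp only: of_nat_eq_iff)
      have "r = r'" using arg_cong[OF sum_eq, of "\<lambda>z. z mod wheel"] eq(1,2) by simp
      then show "r = r' \<and> u = u'" using sum_eq wheel_bounds(1) by simp
    qed
    show "(\<lambda>(r, u). pos r u) ` (SIGMA r:{..<wheel}. class_survivors r) \<subseteq> {x \<in> {start..hi}. avoids_upto y x}"
      using pos_ge_start by (auto simp: class_survivors_def)
    show "finite {x \<in> {start..hi}. avoids_upto y x}" by (rule finite_subset[of _ "{start..hi}"]) auto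
  qed
  finally show ?thesis .
qed

lemma admissible_avoids_below:
  assumes "admissible r"
  shows "avoids_below level (start + int r)"
proof (intro allI impI)
  fix p assume p: "prime p \<and> p < level"
  have "finite {p. prime p \<and> p < level}" by (rule finite_subset[of _ "{..<level}"]) auto
  then have "p dvd wheel"
    unfolding wheel_def primorial_def by (rule dvd_prodI[of _ p "\<lambda>p. p"]) (use p in simp)
  moreover from this have "p \<le> y" using wheel_bounds by (meson dvd_imp_le order_trans)
  ultimately show "\<not> hits p (start + int r)"
    using assms p prime_ge_2_nat[of p] by (auto simp: admissible_def hits_def)
qed

lemma classes_cost_le:
  "classes_cost \<le> wheel * (1 + k * (y + 1)) +
    card {r. r < wheel \<and> avoids_below level (start + int r)} * (blocks * (1 + 2 * block_length + sieve_cost)) +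
    card {x \<in> {start..hi}. avoids_upto y x} * (k * (test_cost + 1))"
proof -
  let ?block = "blocks * (1 + 2 * block_length + sieve_cost)" and ?test = "k * (test_cost + 1)"
  have "classes_cost \<le> (\<Sum>r<wheel. (1 + k * (y + 1)) + of_bool (avoids_below level (start + int r)) * ?block +
    card (class_survivors r) * ?test)"
    unfolding classes_cost_def class_cost_def
      using admissible_avoids_below by (intro sum_mono) (auto simp: algebra_simps)
  also have "\<dots> = wheel * (1 + k * (y + 1)) + (\<Sum>r<wheel. of_bool (avoids_below level (start + int r))) * ?block +
    (\<Sum>r<wheel. card (class_survivors r)) * ?test"
    by (simp only: sum.distrib sum_distrib_right sum_constant card_lessThan of_nat_id) simp
  also have "(\<Sum>r<wheel. of_bool (avoids_below level (start + int r))) = card {r. r < wheel \<and> avoids_below level (start + int r)}"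
    by (simp add: Int_def)
  also have "(\<Sum>r<wheel. card (class_survivors r)) * ?test \<le> card {x \<in> {start..hi}. avoids_upto y x} * ?test"
    using sum_card_class_survivors_le by (rule mult_le_mono1)
  finally show ?thesis by simp
qed

definition memory_size :: nat where
  "memory_size = 2 + 2 * k + block_length"

definition total_cost :: nat where
  "total_cost = K + y * (K + 1) + (y + 1) * (y + 1) + bound_cost + k +
    y * (k * (start_form_sum + 1) + 1) + classes_cost"

end

section \<open>The cost of the search\<close>

lemma loglog_large: "\<forall>\<^sub>F n in sequentially. 1 \<le> ln (ln (real n))"
  by real_asymp

lemma floorlog_bigo: "(\<lambda>n. real (floorlog 2 n + 1)) \<in> O(\<lambda>n. ln (real n))"
proof -
  have "(\<lambda>n. real (floorlog 2 n + 1)) \<in> O(\<lambda>n. log 2 (real n) + 2)"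
  proof (intro landau_o.big_mono eventually_sequentiallyI[of 1])
    fix n :: nat assume "1 \<le> n"
    then have "0 \<le> log 2 (real n)" by simp
    then have "real (nat \<lfloor>log 2 (real n)\<rfloor>) \<le> log 2 (real n)" by linarith
    then show "norm (real (floorlog 2 n + 1)) \<le> norm (log 2 (real n) + 2)"
      using \<open>1 \<le> n\<close> by (simp add: floorlog_def)
  qed
  also have "(\<lambda>n. log 2 (real n) + 2) \<in> O(\<lambda>n::nat. ln (real n))" by real_asymp
  finally show ?thesis .
qed

context pattern_search
begin

lemma y_le_root:
  assumes "1 \<le> n"
  shows "real y \<le> 2 * real n powr (1 / real K)"
proof -
  define z where "z = real n powr (1 / real K)"
  define v where "v = max 2 (nat \<lceil>z\<rceil>)"
  have "1 \<le> z" using assms unfolding z_def by (intro ge_one_powr_ge_zero) auto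
  then have v: "z \<le> real v" "real v \<le> 2 * z" unfolding v_def by linarith+
  have "real n = z ^ K" using K assms unfolding z_def by (simp add: powr_powr flip: powr_realpow)
  also have "\<dots> \<le> real v ^ K" using v \<open>1 \<le> z\<close> by (intro power_mono) auto
  finally have "n \<le> v ^ K" by (simp flip: of_nat_power)
  then have "y \<le> v" by (intro y_least) (simp_all add: v_def)
  then show ?thesis using v(2) unfolding z_def by linarith
qed

lemma root_le_y: "real n powr (1 / real K) \<le> real y"
proof -
  have "real n powr (1 / real K) \<le> real (y ^ K) powr (1 / real K)"
    using y_bounds(2) by (intro powr_mono2) auto
  also have "\<dots> = real y" using y_bounds(1) K by (simp add: powr_powr flip: powr_realpow)
  finally show ?thesis .
qed

lemma range_width:
  assumes "0 < n"
  shows "hi < start + int n"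
proof (cases "start \<le> hi")
  case True
  have "form 0 hi \<le> int n" "2 \<le> form 0 start"
    using le_hi_iff[of hi] lo_le_iff[of start] k_pos by (auto simp: start_def)
  then show ?thesis using form_mono[OF k_pos True] by linarith
qed (use assms in simp)

lemma start_form_sum_le: "start_form_sum \<le> (\<Sum>i<k. nat \<bar>form i lo\<bar> + nat (a i)) * y"
  unfolding start_form_sum_def sum_distrib_right
proof (rule sum_mono)
  fix i assume "i \<in> {..<k}"
  then have "0 < a i" using a_pos by simp
  have "form i start = form i lo + a i * int y" by (simp add: form_def start_def algebra_simps)
  also have "\<dots> \<le> \<bar>form i lo\<bar> * int y + a i * int y"
    using y_bounds(1) mult_left_mono[of 1 "int y" "\<bar>form i lo\<bar>"] by simp
  also have "\<dots> = int ((nat \<bar>form i lo\<bar> + nat (a i)) * y)"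
    using \<open>0 < a i\<close> by (simp add: algebra_simps)
  finally show "nat (form i start) \<le> (nat \<bar>form i lo\<bar> + nat (a i)) * y" by linarith
qed

definition wheel_cost :: nat where
  "wheel_cost = card {r. r < wheel \<and> avoids_below level (start + int r)} * (blocks * (1 + 2 * block_length + sieve_cost))"

definition survivors_cost :: nat where
  "survivors_cost = card {x \<in> {start..hi}. avoids_upto y x} * (k * (test_cost + 1))"

lemma total_cost_le:
  assumes "(\<Sum>i<k. nat \<bar>form i lo\<bar> + nat (a i)) = c"
  shows "total_cost \<le> (2 * K + k * (c + 5) + 9) * y ^ 3 + bound_cost + wheel_cost + survivors_cost"
proof -
  have powers: "y \<le> y ^ 3" "y * y \<le> y ^ 3" "1 \<le> y ^ 3"
    using y_bounds(1) power_increasing[of 1 3 y] power_increasing[of 2 3 y]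
    by (simp_all add: power2_eq_square)
  have "K + y * (K + 1) + (y + 1) * (y + 1) + k + y * (k * (start_form_sum + 1) + 1) + wheel * (1 + k * (y + 1)) \<le>
    K * 1 + y * (K + 1) + (y + y) * (y + y) + k * 1 + y * (k * (c * y + y) + y) + y * (y + k * (y + y))"
    using start_form_sum_le wheel_bounds y_bounds(1) assms by (intro add_mono mult_le_mono) auto
  also have "\<dots> = K * 1 + (K + 1) * y + k * 1 + (6 + k * (c + 3)) * (y * y)"
    by (simp add: algebra_simps)
  also have "\<dots> \<le> K * y ^ 3 + (K + 1) * y ^ 3 + k * y ^ 3 + (6 + k * (c + 3)) * y ^ 3"
    using powers by (intro add_mono mult_le_mono2)
  also have "\<dots> \<le> (2 * K + k * (c + 5) + 9) * y ^ 3" by (simp add: algebra_simps)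
  finally show ?thesis
    using classes_cost_le unfolding total_cost_def wheel_cost_def survivors_cost_def by linarith
qed

lemma sum_prime_quotients_le:
  assumes "2 \<le> y" "y \<le> n"
  shows "real (\<Sum>q | prime q \<and> q \<le> y. y * y div q) \<le> real y ^ 2 * (2 * ln (ln (real n)) + 4)"
proof -
  have "real (\<Sum>q | prime q \<and> q \<le> y. y * y div q) \<le> (\<Sum>q | prime q \<and> q \<le> y. real y ^ 2 * (1 / real q))"
    unfolding of_nat_sum of_nat_le_iff
  proof (rule sum_mono)
    fix q
    show "real (y * y div q) \<le> real y ^ 2 * (1 / real q)"
      using of_nat_div_le_of_nat[of "y * y" q, where 'a = real] by (simp add: power2_eq_square)
  qed
  also have "\<dots> = real y ^ 2 * (\<Sum>q | prime q \<and> q \<le> y. 1 / real q)"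
    by (simp only: sum_distrib_left)
  also have "\<dots> \<le> real y ^ 2 * (2 * ln (ln (real y)) + 4)"
    using assms(1) by (intro mult_left_mono sum_prime_reciprocals_le) auto
  also have "\<dots> \<le> real y ^ 2 * (2 * ln (ln (real n)) + 4)"
    using assms by (intro mult_left_mono add_right_mono ln_mono) auto
  finally show ?thesis .
qed

end

locale pattern_family = linear_forms k a b for k :: nat and a b :: "nat \<Rightarrow> int" +
  fixes K :: nat
  assumes K_ge_6: "6 \<le> K"

sublocale pattern_family \<subseteq> search: pattern_search k a b K n for n
  by unfold_locales (use K_ge_6 in simp)

context pattern_family
begin

definition rate :: "nat \<Rightarrow> real" where
  "rate n = real n / ln (ln (real n)) ^ (k - 1)"

lemma y_bigo: "(\<lambda>n. real (search.y n)) \<in> O(\<lambda>n. real n powr (1 / real K))"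
  using search.y_le_root by (intro bigoI[of _ 2] eventually_sequentiallyI[of 1]) simp

lemma y_cube_bigo: "(\<lambda>n. real (search.y n) ^ 3) \<in> O(\<lambda>n. real n powr (1 / 2))"
proof -
  have "(\<lambda>n. real (search.y n) ^ 3) \<in> O(\<lambda>n. (real n powr (1 / real K)) ^ 3)"
    by (rule landau_o.big_power[OF y_bigo])
  also have "(\<lambda>n. (real n powr (1 / real K)) ^ 3) \<in> O(\<lambda>n. real n powr (1 / 2))"
  proof (intro landau_o.big_mono eventually_sequentiallyI[of 1])
    fix n :: nat assume "1 \<le> n"
    then have "(real n powr (1 / real K)) ^ 3 = real n powr (3 / real K)"
      by (simp add: powr_powr flip: powr_realpow)
    also have "\<dots> \<le> real n powr (1 / 2)"
      using \<open>1 \<le> n\<close> K_ge_6 by (intro powr_mono) (auto simp: field_simps)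
    finally show "norm ((real n powr (1 / real K)) ^ 3) \<le> norm (real n powr (1 / 2))" by simp
  qed
  finally show ?thesis .
qed

lemma sqrt_bigo_rate: "(\<lambda>n. real n powr (1 / 2)) \<in> O(rate)"
  unfolding rate_def by real_asymp

lemma eventually_y_ge: "\<forall>\<^sub>F n in sequentially. c \<le> search.y n"
proof -
  have "filterlim (\<lambda>n. real n powr (1 / real K)) at_top sequentially"
    using K_ge_6 by real_asymp
  then have "\<forall>\<^sub>F n in sequentially. real c \<le> real n powr (1 / real K)"
    by (simp add: filterlim_at_top)
  then show ?thesis
  proof eventually_elim
    case (elim n)
    then show ?case using search.root_le_y[of n] by simp
  qed
qed

lemma eventually_cube_y_le: "\<forall>\<^sub>F n in sequentially. real (search.y n) ^ 3 \<le> real n"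
proof -
  have "(\<lambda>n. real n powr (1 / 2)) \<in> o(\<lambda>n. real n)" by real_asymp
  with y_cube_bigo have "(\<lambda>n. real (search.y n) ^ 3) \<in> o(\<lambda>n. real n)"
    by (rule landau_o.big_small_trans)
  from landau_o.smallD[OF this, of 1] show ?thesis by simp
qed

lemma test_cost_bigo:
  assumes "conjecture_A"
  shows "(\<lambda>n. real (k * (search.test_cost n + 1))) \<in> O(\<lambda>n. ln (real n) powr (18 / 7))"
    and "(\<lambda>n. real (search.bound_step_cost n + 1)) \<in> O(\<lambda>n. ln (real n) powr (18 / 7))"
proof -
  let ?O = "O(\<lambda>n::nat. ln (real n) powr (18 / 7))"
  note max_base = nonresidue_bound_bigo[OF assms]
  have "(\<lambda>n. real (nonresidue_bound n) ^ 2) \<in> O(\<lambda>n. (ln (real n) powr (9 / 7)) ^ 2)"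
    by (rule landau_o.big_power[OF max_base])
  also have "(\<lambda>n. (ln (real n) powr (9 / 7)) ^ 2) \<in> ?O" by real_asymp
  finally have max_base_square: "(\<lambda>n. real (nonresidue_bound n) ^ 2) \<in> ?O" .
  have "(\<lambda>n. real (nonresidue_bound n) * real (floorlog 2 n + 1)) \<in> O(\<lambda>n. ln (real n) powr (9 / 7) * ln (real n))"
    by (intro landau_o.big.mult max_base floorlog_bigo)
  also have "(\<lambda>n. ln (real n) powr (9 / 7) * ln (real n)) \<in> ?O" by real_asymp
  finally have max_base_bits: "(\<lambda>n. real (nonresidue_bound n) * real (floorlog 2 n + 1)) \<in> ?O" .
  have "(\<lambda>n. ln (real n)) \<in> ?O" by real_asymp
  with floorlog_bigo have bits: "(\<lambda>n. real (floorlog 2 n + 1)) \<in> ?O"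
    by (rule landau_o.big_trans)
  have one: "(\<lambda>n. 1) \<in> ?O" by real_asymp
  have "(\<lambda>n. real (K * (K + 2)) * real (floorlog 2 n + 1) + 3 * real (nonresidue_bound n) ^ 2 +
      (real (nonresidue_bound n) * real (floorlog 2 n + 1) + real (floorlog 2 n + 1)) + 1) \<in> ?O" (is "?f \<in> _")
    by (intro sum_in_bigo) (use bits max_base_square max_base_bits one K_ge_6 in simp_all)
  then have "(\<lambda>n. real k * ?f n) \<in> ?O" using k_pos by simp
  moreover have "real (k * (search.test_cost n + 1)) = real k * ?f n" for n
    unfolding search.test_cost_def by (simp add: algebra_simps)
  ultimately show "(\<lambda>n. real (k * (search.test_cost n + 1))) \<in> ?O" by simp
  have "(\<lambda>n. 3 * f n + 3 * g n + 1) \<in> ?O" if "f \<in> ?O" "g \<in> ?O" for f g :: "nat \<Rightarrow> real"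
    by (intro sum_in_bigo) (use that one in simp_all)
  note this[OF bits max_base_square]
  moreover have "real (search.bound_step_cost n + 1) =
    3 * real (floorlog 2 n + 1) + 3 * real (nonresidue_bound n) ^ 2 + 1" for n
    unfolding search.bound_step_cost_def by simp
  ultimately show "(\<lambda>n. real (search.bound_step_cost n + 1)) \<in> ?O" by simp
qed

lemma bound_cost_bigo:
  assumes "conjecture_A"
  shows "(\<lambda>n. real (search.bound_cost n)) \<in> O(rate)"
proof -
  define e where "e = 1 / real K"
  have "0 < e" using K_ge_6 by (simp add: e_def)
  have "(\<lambda>n. real (n div search.y n)) \<in> O(\<lambda>n. real n powr (1 - e))"
  proof (intro landau_o.big_mono eventually_sequentiallyI[of 1])
    fix n :: nat assume n: "1 \<le> n"
    have "real (n div search.y n) \<le> real n / real (search.y n)" by (rule of_nat_div_le_of_nat)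
    also have "\<dots> \<le> real n / real n powr e" 
      using search.root_le_y[of n] search.y_bounds(1)[of n] n
        unfolding e_def by (intro divide_left_mono) auto
    finally show "norm (real (n div search.y n)) \<le> norm (real n powr (1 - e))"
      using n by (simp add: powr_diff)
  qed
  from landau_o.big.mult[OF this test_cost_bigo(2)[OF assms]]
  have "(\<lambda>n. real (search.bound_cost n)) \<in> O(\<lambda>n. real n powr (1 - e) * ln (real n) powr (18 / 7))"
    by (simp only: search.bound_cost_def of_nat_mult)
  also have "(\<lambda>n. real n powr (1 - e) * ln (real n) powr (18 / 7)) \<in> O(rate)"
    unfolding rate_def using \<open>0 < e\<close> by real_asymp
  finally show ?thesis .
qed

lemma survivors_cost_bigo:
  assumes "conjecture_A" "3 \<le> k"
  shows "(\<lambda>n. real (search.survivors_cost n)) \<in> O(rate)"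
proof -
  obtain C where C: "0 < C" "\<forall>\<^sub>F n in sequentially. \<forall>u y. n \<le> y ^ K \<longrightarrow>
      real (card {x \<in> {u..<u + int n}. avoids_upto y x}) \<le> C * real n * (ln (ln (real n)) / ln (real n)) ^ k"
    by (rule survivors_bound) blast
  have "(\<lambda>n. real (card {x \<in> {search.start n..search.hi n}. avoids_upto (search.y n) x})) \<in>
    O(\<lambda>n. real n * (ln (ln (real n)) / ln (real n)) ^ k)"
  proof (rule bigoI[of _ C])
    show "\<forall>\<^sub>F n in sequentially. norm (real (card {x \<in> {search.start n..search.hi n}. avoids_upto (search.y n) x})) \<le>
      C * norm (real n * (ln (ln (real n)) / ln (real n)) ^ k)"
      using C(2) eventually_gt_at_top[of 0]
    proof eventually_elim
      case (elim n)
      let ?A = "{x \<in> {search.start n..search.hi n}. avoids_upto (search.y n) x}"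
      let ?A' = "{x \<in> {search.start n..<search.start n + int n}. avoids_upto (search.y n) x}"
      have "finite ?A'" by (rule finite_subset[of _ "{search.start n..<search.start n + int n}"]) auto
      then have "card ?A \<le> card ?A'" using search.range_width[OF elim(2)] by (intro card_mono) auto
      then have "real (card ?A) \<le> C * real n * (ln (ln (real n)) / ln (real n)) ^ k"
        using elim(1) search.y_bounds(2) by (meson of_nat_le_iff order_trans)
      also have "\<dots> \<le> C * norm (real n * (ln (ln (real n)) / ln (real n)) ^ k)"
        using C(1) by (simp add: mult.assoc)
      finally show ?case by simp
    qed
  qed
  from landau_o.big.mult[OF this test_cost_bigo(1)[OF assms(1)]]
  have "(\<lambda>n. real (search.survivors_cost n)) \<in>
    O(\<lambda>n. real n * (ln (ln (real n)) / ln (real n)) ^ k * ln (real n) powr (18 / 7))"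
    by (simp add: search.survivors_cost_def)
  also have "(\<lambda>n. real n * (ln (ln (real n)) / ln (real n)) ^ k * ln (real n) powr (18 / 7)) \<in> O(rate)"
    unfolding rate_def using assms(2) by real_asymp
  finally show ?thesis .
qed

lemma eventually_level_large:
  "\<forall>\<^sub>F n in sequentially. 3 \<le> search.level n \<and> ln (ln (real n)) / 3 \<le> ln (real (search.level n - 1))"
proof -
  define C where "C = real K"
  have "0 < C" using K_ge_6 by (simp add: C_def)
  then have "\<forall>\<^sub>F n::nat in sequentially. ln (real n) powr (1 / 3) + 1 \<le> sqrt (ln (real n) / C)" by real_asymp
  moreover have "\<forall>\<^sub>F n::nat in sequentially. 2 \<le> ln (real n) powr (1 / 3)" by real_asymp
  moreover have "\<forall>\<^sub>F n::nat in sequentially. 1 \<le> ln (real n)" by real_asymp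
  ultimately show ?thesis
  proof eventually_elim
    case (elim n)
    let ?m = "search.level n" and ?y = "search.y n"
    have y: "2 \<le> ?y" "n \<le> ?y ^ K" by (rule search.y_bounds)+
    have "0 < n" using elim(3) by (cases n) auto
    have "2 \<le> ?m" by (rule search.level_bounds)
    have "ln (real n) \<le> ln (real (?y ^ K))" using y(2) \<open>0 < n\<close> by (intro ln_mono) auto
    also have "\<dots> = C * ln (real ?y)" using y(1) by (simp add: ln_realpow C_def)
    also have "?y \<le> ?m ^ ?m" using search.level_bounds(2)[of n] primorial_times_le[of ?m] by linarith
    then have "ln (real ?y) \<le> ln (real (?m ^ ?m))"
      using y(1) by (intro ln_mono) (auto simp: of_nat_le_iff simp del: of_nat_power)
    then have "C * ln (real ?y) \<le> C * (real ?m * ln (real ?m))"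
      using \<open>0 < C\<close> \<open>2 \<le> ?m\<close> by (simp add: ln_realpow)
    also have "\<dots> \<le> C * (real ?m * real ?m)"
      using \<open>0 < C\<close> \<open>2 \<le> ?m\<close> ln_le_minus_one[of "real ?m"]
      by (intro mult_left_mono) auto
    finally have "ln (real n) / C \<le> real ?m ^ 2"
      using \<open>0 < C\<close> by (simp add: field_simps power2_eq_square)
    then have "sqrt (ln (real n) / C) \<le> real ?m" by (simp add: real_le_lsqrt)
    then have m: "ln (real n) powr (1 / 3) \<le> real (?m - 1)"
      using elim(1) \<open>2 \<le> ?m\<close> by (simp add: of_nat_diff)
    have "ln (ln (real n)) / 3 = ln (ln (real n) powr (1 / 3))" using elim(3) by (simp add: ln_powr)
    also have "\<dots> \<le> ln (real (?m - 1))" using m elim(2) by (intro ln_mono) auto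
    finally show ?case using m elim(2) by simp
  qed
qed

lemma admissible_classes_bigo:
  "(\<lambda>n. real (card {r. r < search.wheel n \<and> avoids_below (search.level n) (search.start n + int r)})) \<in>
    O(\<lambda>n. real (search.wheel n) / ln (ln (real n)) ^ k)"
proof -
  obtain C where C: "0 < C" "\<And>m u. 3 \<le> m \<Longrightarrow> real (card {x \<in> {u..<u + int (primorial m)}. avoids_below m x})
    \<le> C * real (primorial m) * (1 / ln (real (m - 1))) ^ k"
    by (rule wheel_density) blast
  show ?thesis
  proof (rule bigoI[of _ "C * 3 ^ k"])
    show "\<forall>\<^sub>F n in sequentially. norm (real (card {r. r < search.wheel n \<and> avoids_below (search.level n) (search.start n + int r)}))
      \<le> C * 3 ^ k * norm (real (search.wheel n) / ln (ln (real n)) ^ k)"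
      using eventually_level_large loglog_large
    proof eventually_elim
      case (elim n)
      let ?m = "search.level n" and ?u = "search.start n" and ?l = "ln (ln (real n))"
      let ?A = "{x \<in> {?u..<?u + int (search.wheel n)}. avoids_below ?m x}"
      have "card {r. r < search.wheel n \<and> avoids_below ?m (?u + int r)} \<le> card ?A"
      proof (rule card_inj_on_le[where f = "\<lambda>r. ?u + int r"])
        show "finite ?A" by (rule finite_subset[of _ "{?u..<?u + int (search.wheel n)}"]) auto
      qed (auto intro: inj_onI)
      then have "real (card {r. r < search.wheel n \<and> avoids_below ?m (?u + int r)}) \<le>
        C * real (search.wheel n) * (1 / ln (real (?m - 1))) ^ k"
        using C(2)[of ?m ?u] elim(1) unfolding search.wheel_def by linarith
      also have "\<dots> \<le> C * real (search.wheel n) * (3 / ?l) ^ k"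
        using elim C(1) by (intro mult_left_mono power_mono) (auto simp: field_simps)
      finally show ?case using elim(2) by (simp add: power_divide mult_ac)
    qed
  qed
qed

lemma blocks_bigo: "(\<lambda>n. real (search.blocks n)) \<in> O(\<lambda>n. real n / (real (search.wheel n) * real (search.y n) ^ 2))"
proof (rule bigoI[of _ 2])
  show "\<forall>\<^sub>F n in sequentially. norm (real (search.blocks n)) \<le> 2 * norm (real n / (real (search.wheel n) * real (search.y n) ^ 2))"
    using eventually_cube_y_le eventually_gt_at_top[of 0]
  proof eventually_elim
    case (elim n)
    let ?block_length = "real (search.wheel n) * real (search.y n) ^ 2"
    have pos: "0 < ?block_length" using search.wheel_bounds(1)[of n] search.y_bounds(1)[of n] by simp
    have "?block_length \<le> real (search.y n) * real (search.y n) ^ 2"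
      using search.wheel_bounds(2) by (intro mult_right_mono) auto
    then have "?block_length \<le> real n" using elim(1) by (simp add: power2_eq_square power3_eq_cube)
    then have "1 \<le> real n / ?block_length" using pos by (simp add: pos_le_divide_eq)
    moreover have "real (nat (search.hi n - search.start n) div (search.wheel n * search.block_length n)) \<le> real n / ?block_length"
    proof -
      have "nat (search.hi n - search.start n) \<le> n" using search.range_width[OF elim(2)] by linarith
      then have "real (nat (search.hi n - search.start n)) / real (search.wheel n * search.block_length n) \<le> real n / ?block_length"
        using pos by (intro frac_le) (auto simp: search.block_length_def power2_eq_square)
      then show ?thesis using of_nat_div_le_of_nat order_trans by blast
    qed
    ultimately have "real (search.blocks n) \<le> real n / ?block_length + real n / ?block_length"
      unfolding search.blocks_def of_nat_add of_nat_1 by (intro add_mono)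
    then show ?case by simp
  qed
qed

lemma sieve_cost_bigo:
  "(\<lambda>n. real (1 + 2 * search.block_length n + search.sieve_cost n)) \<in> O(\<lambda>n. real (search.y n) ^ 2 * ln (ln (real n)))"
proof -
  define c where "c = real (\<Sum>i<k. nat (a i))"
  show ?thesis
  proof (rule bigoI[of _ "9 * real k + 2 * c + 5"])
    show "\<forall>\<^sub>F n in sequentially. norm (real (1 + 2 * search.block_length n + search.sieve_cost n)) \<le>
      (9 * real k + 2 * c + 5) * norm (real (search.y n) ^ 2 * ln (ln (real n)))"
      using eventually_y_ge[of 2] eventually_cube_y_le loglog_large
    proof eventually_elim
      case (elim n)
      define Y l where "Y = real (search.y n)" and "l = ln (ln (real n))"
      define S where "S = real (\<Sum>q | prime q \<and> q \<le> search.y n. search.y n * search.y n div q)"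
      have Y: "2 \<le> Y" "1 \<le> l" "Y ^ 2 \<le> Y ^ 2 * l" using elim by (simp_all add: Y_def l_def)
      have "Y \<le> Y ^ 3" using Y(1) power_increasing[of 1 3 Y] by simp
      then have "search.y n \<le> n" using elim(2) unfolding Y_def by linarith
      then have "S \<le> Y ^ 2 * (2 * l + 4)"
        unfolding S_def Y_def l_def by (rule search.sum_prime_quotients_le[OF elim(1)])
      have "1 \<le> Y ^ 2" "Y \<le> Y ^ 2" using Y(1) by (simp_all add: power2_eq_square mult_ge1_I)
      then have "1 \<le> Y ^ 2 * l" "Y \<le> Y ^ 2 * l" "Y * (Y + 1) \<le> 2 * (Y ^ 2 * l)"
        using Y(3) by (simp_all add: power2_eq_square algebra_simps)
      moreover have "S \<le> 6 * (Y ^ 2 * l)"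
        using \<open>S \<le> Y ^ 2 * (2 * l + 4)\<close> Y(3) by (simp add: algebra_simps)
      moreover have "real (1 + 2 * search.block_length n + search.sieve_cost n) = 1 + 2 * Y ^ 2 + (real k + 1) * (Y * (Y + 1)) +
        real k * S + real k * Y + 2 * Y ^ 2 * c"
        unfolding search.sieve_cost_def search.block_length_def c_def Y_def S_def
        by (simp add: power2_eq_square algebra_simps del: of_nat_sum)
      moreover have "0 \<le> c" by (simp add: c_def del: of_nat_sum)
      ultimately have "real (1 + 2 * search.block_length n + search.sieve_cost n) \<le> Y ^ 2 * l + 2 * (Y ^ 2 * l) +
        (real k + 1) * (2 * (Y ^ 2 * l)) + real k * (6 * (Y ^ 2 * l)) + real k * (Y ^ 2 * l) + 2 * (Y ^ 2 * l) * c"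
        using Y(3) by (simp only:) (intro add_mono mult_left_mono[of _ _ "real k"] mult_left_mono[of _ _ "real k + 1"]
          mult_left_mono[of _ _ 2] mult_right_mono[of _ _ c]; simp)
      also have "\<dots> = (9 * real k + 2 * c + 5) * (Y ^ 2 * l)" by (simp add: algebra_simps)
      finally show ?case using Y by (simp add: Y_def l_def)
    qed
  qed
qed

lemma wheel_cost_bigo: "(\<lambda>n. real (search.wheel_cost n)) \<in> O(rate)"
proof -
  let ?wheel = "\<lambda>n. real (search.wheel n)" and ?Y = "\<lambda>n. real (search.y n) ^ 2" and ?l = "\<lambda>n. ln (ln (real n))"
  have "(\<lambda>n. real (search.wheel_cost n)) \<in> O(\<lambda>n. ?wheel n / ?l n ^ k * (real n / (?wheel n * ?Y n) * (?Y n * ?l n)))"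
    using landau_o.big.mult[OF admissible_classes_bigo landau_o.big.mult[OF blocks_bigo sieve_cost_bigo]]
    by (simp only: search.wheel_cost_def of_nat_mult)
  also have "(\<lambda>n. ?wheel n / ?l n ^ k * (real n / (?wheel n * ?Y n) * (?Y n * ?l n))) \<in> O(rate)"
  proof (intro landau_o.big_mono)
    show "\<forall>\<^sub>F n in sequentially. norm (?wheel n / ?l n ^ k * (real n / (?wheel n * ?Y n) * (?Y n * ?l n))) \<le> norm (rate n)"
      using loglog_large
    proof eventually_elim
      case (elim n)
      have "0 < ?wheel n" "0 < ?Y n" using search.wheel_bounds(1)[of n] search.y_bounds(1)[of n] by simp_all
      moreover have "?l n ^ k = ?l n * ?l n ^ (k - 1)" using k_pos by (metis power_Suc Suc_diff_1)
      ultimately show ?case using elim by (simp add: rate_def)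
    qed
  qed
  finally show ?thesis .
qed

lemma memory_size_bigo: "(\<lambda>n. real (search.memory_size n)) \<in> O(\<lambda>n. real n powr (2 / real K))"
proof -
  define e where "e = 2 / real K"
  have "0 < e" using K_ge_6 by (simp add: e_def)
  have "(\<lambda>n. real (search.y n) ^ 2) \<in> O(\<lambda>n. (real n powr (1 / real K)) ^ 2)"
    by (rule landau_o.big_power[OF y_bigo])
  also have "(\<lambda>n. (real n powr (1 / real K)) ^ 2) = (\<lambda>n. real n powr e)"
    by (simp add: e_def power2_eq_square flip: powr_add)
  finally have "(\<lambda>n. real (2 + 2 * k) + real (search.y n) ^ 2) \<in> O(\<lambda>n. real n powr e)"
    using \<open>0 < e\<close> by (intro sum_in_bigo) real_asymp
  then show ?thesis
    by (simp add: search.memory_size_def search.block_length_def e_def power2_eq_square add.assoc)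
qed

theorem total_cost_bigo:
  assumes "conjecture_A" "3 \<le> k"
  shows "(\<lambda>n. real (search.total_cost n)) \<in> O(rate)"
proof -
  define c where "c = (\<Sum>i<k. nat \<bar>form i search.lo\<bar> + nat (a i))"
  let ?c = "2 * K + k * (c + 5) + 9"
  have "real (search.total_cost n) \<le>
    real (?c * search.y n ^ 3 + search.bound_cost n + search.wheel_cost n + search.survivors_cost n)" for n
    using search.total_cost_le[of c n] by (simp only: of_nat_le_iff c_def)
  then have "(\<lambda>n. real (search.total_cost n)) \<in> O(\<lambda>n. real ?c * real (search.y n) ^ 3 + real (search.bound_cost n) +
    real (search.wheel_cost n) + real (search.survivors_cost n))"
    by (intro landau_o.big_mono always_eventually allI) (simp only: real_norm_def of_nat_add of_nat_mult of_nat_power, simp)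
  also have "(\<lambda>n. real ?c * real (search.y n) ^ 3 + real (search.bound_cost n) +
      real (search.wheel_cost n) + real (search.survivors_cost n)) \<in> O(rate)"
    using landau_o.big_trans[OF y_cube_bigo sqrt_bigo_rate] bound_cost_bigo[OF assms(1)] wheel_cost_bigo
      survivors_cost_bigo[OF assms]
    by (intro sum_in_bigo) simp_all
  finally show ?thesis .
qed

end

section \<open>The primality test as a program\<close>

abbreviation (input) "r_maxbase \<equiv> 5 :: nat"
abbreviation (input) "r_val \<equiv> 16 :: nat"
abbreviation (input) "r_half \<equiv> 38 :: nat"
abbreviation (input) "r_ok \<equiv> 42 :: nat"
abbreviation (input) "r_b \<equiv> 43 :: nat"
abbreviation (input) "r_end \<equiv> 44 :: nat"
abbreviation (input) "r_witness \<equiv> 45 :: nat"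

definition powers_prog :: "nat \<Rightarrow> com" where
  "powers_prog K =
    r_ok ::= N 1;;
    r_arg ::= V r_val;;
    FOR r_deg FROM N 2 TO N (int K + 1) DO (
      ispow_prog;;
      IF V r_ispow [=] N 1 THEN r_ok ::= N 0 ELSE Skip)"

definition witness_prog :: com where
  "witness_prog =
    r_half ::= (V r_val [-] N 1) [div] N 2;;
    IF V r_val [mod] N 8 [=] N 1 THEN (r_symbol ::= V r_val;; nonresidue_prog;; r_witness ::= V r_nonres)
    ELSE IF V r_val [mod] N 8 [=] N 5 THEN r_witness ::= N 2 ELSE r_witness ::= V r_val [-] N 1"

definition half_power_prog :: "nat \<Rightarrow> com" where
  "half_power_prog q = r_base ::= V q;; r_exp ::= V r_half;; r_mod ::= V r_val;; powmod_prog"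

definition bases_prog :: com where
  "bases_prog =
    (IF V r_maxbase [<] V r_val THEN r_end ::= V r_maxbase [+] N 1 ELSE r_end ::= V r_val);;
    FOR r_b FROM N 2 TO V r_end DO (
      half_power_prog r_b;;
      IF V r_modpow [=] N 1 THEN Skip
      ELSE IF V r_modpow [=] V r_val [-] N 1 THEN Skip ELSE r_ok ::= N 0)"

definition test_prog :: "nat \<Rightarrow> com" where
  "test_prog K =
    powers_prog K;;
    IF V r_ok [=] N 1 THEN (
      witness_prog;;
      half_power_prog r_witness;;
      IF V r_modpow [=] V r_val [-] N 1 THEN bases_prog ELSE r_ok ::= N 0)
    ELSE Skip"

lemma powers_prog_effects [simp]:
  "writes (powers_prog K) = {r_arg, r_deg, r_low, r_high, r_mid, r_pow, r_count, r_ispow, r_ok}"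
  "\<not> stores (powers_prog K)" "\<not> prints (powers_prog K)"
  by (auto simp: powers_prog_def)

lemma witness_prog_effects [simp]:
  "writes witness_prog = {r_cand, r_div, r_isprime, r_base, r_exp, r_mod, r_modpow, r_symbol, r_nonres,
    r_continue, r_half, r_witness}"
  "\<not> stores witness_prog" "\<not> prints witness_prog"
  by (auto simp: witness_prog_def)

lemma half_power_prog_effects [simp]:
  "writes (half_power_prog q) = {r_base, r_exp, r_mod, r_modpow}"
  "\<not> stores (half_power_prog q)" "\<not> prints (half_power_prog q)"
  by (auto simp: half_power_prog_def)

lemma bases_prog_effects [simp]:
  "writes bases_prog = {r_base, r_exp, r_mod, r_modpow, r_ok, r_b, r_end}"
  "\<not> stores bases_prog" "\<not> prints bases_prog"
  by (auto simp: bases_prog_def)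

lemma test_prog_effects [simp]:
  "writes (test_prog K) = {r_cand, r_div, r_isprime, r_base, r_exp, r_mod, r_modpow, r_arg, r_deg, r_low, r_high,
    r_mid, r_pow, r_count, r_ispow, r_symbol, r_nonres, r_continue, r_half, r_ok, r_b, r_end, r_witness}"
  "\<not> stores (test_prog K)" "\<not> prints (test_prog K)"
  by (auto simp: test_prog_def)

locale sieve_run = pattern_search k a b K n for k :: nat and a b :: "nat \<Rightarrow> int" and K n :: nat +
  fixes W B :: int
  assumes W: "4 \<le> W" "int k < W" "int n < W" "\<And>i. i < k \<Longrightarrow> a i < W" "\<And>i. i < k \<Longrightarrow> \<bar>b i\<bar> < W"
    and B: "W ^ (K + 12) \<le> B"
begin

lemma less_B_if_le_power: "v \<le> W ^ j \<Longrightarrow> j < K + 12 \<Longrightarrow> v < B"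
  using W(1) B power_strict_increasing[of j "K + 12" W] by linarith

lemma W_square: "4 * W \<le> W ^ 2" "4 * W < B"
proof -
  show "4 * W \<le> W ^ 2" using W(1) by (simp add: power2_eq_square)
  then show "4 * W < B" using less_B_if_le_power[of "4 * W" 2] by simp
qed

lemma less_B_if_le_n:
  assumes "m \<le> n"
  shows "int m < B" "2 * int m < B" "int m * int m < B" "e \<le> K \<Longrightarrow> int m ^ e < B"
proof -
  have m: "int m \<le> W" using assms W(3) by simp
  then show "int m < B" "2 * int m < B" using W_square W(1) by linarith+
  have power: "int m ^ e < B" if "e < K + 12" for e
    using power_mono[OF m] that by (intro less_B_if_le_power[of _ e]) auto
  show "int m * int m < B" using power[of 2] by (simp add: power2_eq_square)
  show "int m ^ e < B" if "e \<le> K" using power that by simp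
qed

lemma K_less_B: "int K + 1 < B"
proof -
  have "int K + 1 \<le> 2 ^ K"
    using less_exp[of K] by (metis Suc_leI of_nat_Suc of_nat_le_iff of_nat_numeral of_nat_power add.commute)
  also have "\<dots> \<le> W ^ K" using W(1) by (intro power_mono) auto
  finally show ?thesis by (intro less_B_if_le_power[of _ K]) auto
qed

lemma runs_powers_prog:
  assumes "reg s r_val = int m" "2 \<le> m" "m \<le> n"
  shows "runs B A (powers_prog K) (K * ((K + 2) * (bits + 1)))
    (\<lambda>s'. reg s' r_ok = of_bool (\<not> perfect_power K m)) s"
proof -
  let ?I = "\<lambda>e s'. reg s' r_ok = of_bool (\<forall>d\<in>{2..<e}. \<not> (\<exists>a. m = a ^ d))"
  let ?s = "s\<lparr>reg := (reg s)(r_ok := 1, r_arg := int m)\<rparr>"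
  let ?update = "IF V r_ispow [=] N 1 THEN r_ok ::= N 0 ELSE Skip"
  let ?T = "(K + 1) * (bits + 1)"
  note small = less_B_if_le_n[OF assms(3)]
  have "runs B A (FOR r_deg FROM N 2 TO N (int K + 1) DO (ispow_prog;; ?update)) (K * ((K + 2) * (bits + 1)))
    (\<lambda>s'. reg s' r_ok = of_bool (\<not> perfect_power K m)) ?s"
  proof (rule runs_For[where I = ?I and lo = 2 and hi = "K + 1" and T = "\<lambda>_. ?T"])
    fix e s' assume e: "2 \<le> e" "e < K + 1" and frame: "frame (FOR r_deg FROM N 2 TO N (int K + 1) DO (ispow_prog;; ?update)) ?s s'"
      and s': "reg s' r_deg = int e" "?I e s'"
    have "(e + 1) * (floorlog 2 m + 1) \<le> ?T"
      using e(2) floorlog_mono[OF assms(3), of 2] by (intro mult_le_mono) auto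
    moreover have "{2..<Suc e} = insert e {2..<e}" using e(1) by auto
    ultimately show "runs B A (ispow_prog;; ?update) ?T (\<lambda>s''. ?I (Suc e) (s''\<lparr>reg := (reg s'')(r_deg := int (Suc e))\<rparr>)) s'"
      using e s' frameD(1)[OF frame] assms(2) small small(4)[of e] K_less_B
      by (intro runs_Seq[OF runs_ispow_prog, where T'' = 0]) (auto simp: runs_simps frameD(1))
  next
    have "(\<Sum>e\<in>{2..<K + 1}. Suc ?T) = (K - 1) * Suc ?T" by simp
    also have "\<dots> \<le> K * ((K + 2) * (bits + 1))" by (intro mult_le_mono) auto
    finally show "(\<Sum>e\<in>{2..<K + 1}. Suc ?T) \<le> K * ((K + 2) * (bits + 1))" .
  next
    fix s' assume "?I (max 2 (K + 1)) s'"
    moreover have "{2..<max 2 (K + 1)} = {2..K}" using K by auto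
    ultimately show "reg s' r_ok = of_bool (\<not> perfect_power K m)" by (auto simp: perfect_power_def)
  qed (use K K_less_B in auto)
  then show ?thesis unfolding powers_prog_def using assms(1) by (simp add: runs_simps)
qed

lemma runs_witness_prog:
  assumes "reg s r_val = int m" "2 < m" "odd m" "m \<le> n" "\<not> is_square m"
  shows "runs B A witness_prog (3 * max_base\<^sup>2)
    (\<lambda>s'. reg s' r_half = int ((m - 1) div 2) \<and> reg s' r_witness = int (witness_base m)) s"
proof -
  let ?h = "(m - 1) div 2"
  let ?Q = "\<lambda>s'. reg s' r_half = int ?h \<and> reg s' r_witness = int (witness_base m)"
  let ?s = "s\<lparr>reg := (reg s)(r_half := int ?h, r_symbol := int m)\<rparr>"
  have half: "(int m - 1) div 2 = int ?h" using assms(2) by (simp add: of_nat_diff zdiv_int)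
  have mod8: "int m mod 8 = 1 \<longleftrightarrow> m mod 8 = 1" "int m mod 8 = 5 \<longleftrightarrow> m mod 8 = 5"
    by (metis of_nat_1 of_nat_eq_iff of_nat_mod of_nat_numeral)+
  have m: "int m < B" by (rule less_B_if_le_n) (rule assms)
  show ?thesis
  proof (cases "m mod 8 = 1")
    case True
    have "runs B A (nonresidue_prog;; r_witness ::= V r_nonres) (3 * max_base\<^sup>2) ?Q ?s"
    proof (rule runs_Seq[OF runs_nonresidue_prog, where T'' = 0])
      have "least_nonresidue m \<le> max_base"
        using least_nonresidue_le_bound[of m n] assms True by (auto simp: pseudosquare_candidate_def)
      then show "3 * (least_nonresidue m)\<^sup>2 + 0 \<le> 3 * max_base\<^sup>2" by (simp add: power_mono)
    qed (use True assms less_B_if_le_n(3)[OF assms(4)] in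
        \<open>auto simp: runs_simps frameD(1) witness_base_def\<close>)
    then show ?thesis unfolding witness_prog_def using assms(1,2) m True by (simp add: runs_simps half mod8)
  next
    case False
    then show ?thesis unfolding witness_prog_def
      using assms(1,2) m by (simp add: runs_simps half mod8 witness_base_def of_nat_diff)
  qed
qed

lemma runs_half_power_prog:
  assumes "reg s r_val = int m" "reg s r_half = int ((m - 1) div 2)" "reg s q = int c" "c \<le> m" "2 < m" "m \<le> n"
    "q \<notin> {r_base, r_exp, r_mod}"
  shows "runs B A (half_power_prog q) bits (\<lambda>s'. reg s' r_modpow = int (half_power m c)) s"
proof -
  let ?s = "s\<lparr>reg := (reg s)(r_base := int c, r_exp := int ((m - 1) div 2), r_mod := int m)\<rparr>"
  have "runs B A powmod_prog bits (\<lambda>s'. reg s' r_modpow = int (half_power m c)) ?s"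
    by (rule runs_conseq[OF runs_powmod_prog])
      (use assms less_B_if_le_n(3)[OF assms(6)] in \<open>auto simp: half_power_def intro!: floorlog_mono\<close>)
  then show ?thesis unfolding half_power_prog_def using assms by (simp add: runs_simps)
qed

lemma runs_bases_prog:
  assumes "reg s r_val = int m" "reg s r_half = int ((m - 1) div 2)" "2 < m" "m \<le> n"
    "reg s r_maxbase = int \<beta>" "\<beta> \<le> max_base" "reg s r_ok = 1"
  shows "runs B A bases_prog (max_base * (bits + 1))
    (\<lambda>s'. reg s' r_ok = of_bool (\<forall>q. 2 \<le> q \<and> q \<le> \<beta> \<and> q < m \<longrightarrow> half_power m q \<in> {1, m - 1})) s"
    (is "runs B A _ _ ?Q s")
proof -
  let ?G = "\<lambda>q. half_power m q \<in> {1, m - 1}"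
  let ?I = "\<lambda>q s'. reg s' r_ok = of_bool (\<forall>q'\<in>{2..<q}. ?G q')"
  let ?update = "IF V r_modpow [=] N 1 THEN Skip ELSE IF V r_modpow [=] V r_val [-] N 1 THEN Skip ELSE r_ok ::= N 0"
  define lim where "lim = (if \<beta> < m then \<beta> + 1 else m)"
  let ?s = "s\<lparr>reg := (reg s)(r_end := int lim)\<rparr>"
  have m: "int m < B" by (rule less_B_if_le_n) (rule assms)
  have m1: "int m - 1 = int (m - 1)" using assms(3) by (simp add: of_nat_diff)
  have "runs B A (FOR r_b FROM N 2 TO V r_end DO (half_power_prog r_b;; ?update)) (max_base * (bits + 1)) ?Q ?s" (is "runs B A ?loop _ _ _")
  proof (rule runs_For[where I = ?I and lo = 2 and hi = lim and T = "\<lambda>_. bits"])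
    fix q s' assume q: "2 \<le> q" "q < lim" "frame ?loop ?s s'" "reg s' r_b = int q" "?I q s'"
    have "{2..<Suc q} = insert q {2..<q}" using q(1) by auto
    moreover have "?G q \<longleftrightarrow> int (half_power m q) = 1 \<or> int (half_power m q) = int m - 1"
      unfolding m1 by auto
    moreover have "q < m" using q(2) by (auto simp: lim_def split: if_splits)
    ultimately show "runs B A (half_power_prog r_b;; ?update) bits
        (\<lambda>s''. ?I (Suc q) (s''\<lparr>reg := (reg s'')(r_b := int (Suc q))\<rparr>)) s'"
      using q(4,5) frameD(1)[OF q(3)] assms m
      by (intro runs_Seq[OF runs_half_power_prog[of s' m r_b q], where T'' = 0]) (auto simp: runs_simps frameD(1))
  next
    fix s' :: ram_state assume "?I (max 2 lim) s'"
    moreover have "(\<forall>q\<in>{2..<max 2 lim}. ?G q) \<longleftrightarrow> (\<forall>q. 2 \<le> q \<and> q \<le> \<beta> \<and> q < m \<longrightarrow> ?G q)"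
      using assms(3) by (auto simp: lim_def max_def less_Suc_eq_le)
    ultimately show "?Q s'" by simp
  next
    have "(lim - 2) * Suc bits \<le> max_base * Suc bits"
      by (intro mult_le_mono1) (use assms(6) in \<open>auto simp: lim_def\<close>)
    then show "(\<Sum>q\<in>{2..<lim}. Suc bits) \<le> max_base * (bits + 1)" by simp
  qed (use assms m in \<open>auto simp: lim_def\<close>)
  moreover have "int \<beta> + 1 < B" if "\<beta> < m" using that m by linarith
  ultimately show ?thesis unfolding bases_prog_def using assms
    by (cases "\<beta> < m") (simp_all add: runs_simps lim_def add.commute)
qed

lemma runs_test_prog:
  assumes "reg s r_val = int m" "2 < m" "odd m" "m \<le> n" "reg s r_maxbase = int \<beta>" "\<beta> \<le> max_base"
  shows "runs B A (test_prog K) test_cost (\<lambda>s'. reg s' r_ok = of_bool (test_passes K \<beta> m)) s"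
proof -
  let ?Q = "\<lambda>s'. reg s' r_ok = of_bool (test_passes K \<beta> m)"
  let ?bases = "IF V r_modpow [=] V r_val [-] N 1 THEN bases_prog ELSE r_ok ::= N 0"
  have m: "int m < B" by (rule less_B_if_le_n) (rule assms)
  have m1: "int m - 1 = int (m - 1)" using assms(2) by (simp add: of_nat_diff)
  have bases: "runs B A ?bases (max_base * (bits + 1)) ?Q s'"
    if "reg s' r_val = int m" "reg s' r_half = int ((m - 1) div 2)" "reg s' r_maxbase = int \<beta>" "reg s' r_ok = 1"
      "reg s' r_modpow = int (half_power m (witness_base m))" "\<not> perfect_power K m" for s'
    using runs_bases_prog[OF that(1,2) assms(2,4) that(3) assms(6) that(4)] that m assms(2)
    by (auto simp: runs_simps m1 test_passes_def simp del: of_nat_diff)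
  have tests: "runs B A (witness_prog;; half_power_prog r_witness;; ?bases) (3 * max_base\<^sup>2 + (max_base + 1) * (bits + 1)) ?Q s'"
    if s': "reg s' r_val = int m" "reg s' r_maxbase = int \<beta>" "reg s' r_ok = 1" "\<not> perfect_power K m" for s'
  proof (rule runs_Seq[OF runs_witness_prog, where T'' = "(max_base + 1) * (bits + 1)"])
    show "\<not> is_square m" using s'(4) K by (auto simp: perfect_power_def is_nth_power_def)
    fix s'' assume s'': "frame witness_prog s' s''"
      "reg s'' r_half = int ((m - 1) div 2) \<and> reg s'' r_witness = int (witness_base m)"
    have "witness_base m \<le> m"
      using least_nonresidue_le_self[of m] assms(2,3) by (auto simp: witness_base_def)
    then show "runs B A (half_power_prog r_witness;; ?bases) ((max_base + 1) * (bits + 1)) ?Q s''"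
      using s'' frameD(1)[OF s''(1)] s' assms(2,4)
      by (intro runs_Seq[OF runs_half_power_prog, where T'' = "max_base * (bits + 1)"] bases) (auto simp: frameD(1))
  qed (use s' assms in auto)
  show ?thesis
    unfolding test_prog_def
  proof (rule runs_Seq[OF runs_powers_prog, where T'' = "3 * max_base\<^sup>2 + (max_base + 1) * (bits + 1)"])
    fix s' assume s': "frame (powers_prog K) s s'" "reg s' r_ok = of_bool (\<not> perfect_power K m)"
    then show "runs B A (IF V r_ok [=] N 1 THEN (witness_prog;; half_power_prog r_witness;; ?bases) ELSE Skip)
        (3 * max_base\<^sup>2 + (max_base + 1) * (bits + 1)) ?Q s'"
      using tests[of s'] frameD(1)[OF s'(1)] assms(1,5)
      by (cases "perfect_power K m") (simp_all add: runs_simps test_passes_def)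
  qed (use assms in \<open>auto simp: test_cost_def\<close>)
qed

end

section \<open>Preparing the sieve\<close>

abbreviation (input) "r_forms \<equiv> 0 :: nat"
abbreviation (input) "r_n \<equiv> 1 :: nat"
abbreviation (input) "r_root \<equiv> 2 :: nat"
abbreviation (input) "r_wheel \<equiv> 3 :: nat"
abbreviation (input) "r_length \<equiv> 4 :: nat"
abbreviation (input) "r_lo \<equiv> 6 :: nat"
abbreviation (input) "r_hi \<equiv> 7 :: nat"
abbreviation (input) "r_form \<equiv> 14 :: nat"
abbreviation (input) "r_q \<equiv> 17 :: nat"
abbreviation (input) "r_slope \<equiv> 40 :: nat"
abbreviation (input) "r_intercept \<equiv> 41 :: nat"
abbreviation (input) "r_quot \<equiv> 46 :: nat"
abbreviation (input) "r_pseudo \<equiv> 47 :: nat"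
abbreviation (input) "r_form_lo \<equiv> 48 :: nat"
abbreviation (input) "r_form_hi \<equiv> 49 :: nat"

definition root_step :: com where
  "root_step = r_root ::= V r_root [+] N 1;; r_mid ::= V r_root;; pow_prog"

definition root_prog :: "nat \<Rightarrow> com" where
  "root_prog K =
    r_root ::= N 2;;
    r_mid ::= N 2;;
    r_deg ::= N (int K);;
    pow_prog;;
    WHILE V r_pow [<] V r_n DO root_step"

definition wheel_step :: com where
  "wheel_step =
    IF V r_wheel [*] V r_q [<] V r_root [+] N 1 THEN (
      r_cand ::= V r_q;;
      prime_prog;;
      IF V r_isprime [=] N 1 THEN r_wheel ::= V r_wheel [*] V r_q ELSE Skip)
    ELSE Skip"

definition wheel_prog :: com where
  "wheel_prog = r_wheel ::= N 1;; FOR r_q FROM N 2 TO V r_root [+] N 1 DO wheel_step"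

definition bound_step :: com where
  "bound_step =
    IF V r_pseudo [mod] N 8 [=] N 1 THEN (
      r_arg ::= V r_pseudo;;
      r_deg ::= N 2;;
      ispow_prog;;
      IF V r_ispow [=] N 1 THEN Skip
      ELSE (
        r_symbol ::= V r_pseudo;;
        nonresidue_prog;;
        IF V r_maxbase [<] V r_nonres THEN r_maxbase ::= V r_nonres ELSE Skip))
    ELSE Skip"

definition bound_prog :: com where
  "bound_prog =
    r_length ::= V r_root [*] V r_root;;
    r_quot ::= V r_n [div] V r_root;;
    r_maxbase ::= N 2;;
    FOR r_pseudo FROM N 9 TO V r_quot [+] N 1 DO bound_step"

definition coefficients_prog :: com where
  "coefficients_prog =
    Get r_slope (N 2 [+] N 2 [*] V r_form);;
    Get r_intercept (N 3 [+] N 2 [*] V r_form)"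

definition form_range_prog :: com where
  "form_range_prog =
    coefficients_prog;;
    r_form_lo ::= N 0 [-] (V r_intercept [-] N 2) [div] V r_slope;;
    r_form_hi ::= (V r_n [-] V r_intercept) [div] V r_slope"

definition range_prog :: com where
  "range_prog =
    r_form ::= N 0;;
    form_range_prog;;
    r_lo ::= V r_form_lo;;
    r_hi ::= V r_form_hi;;
    FOR r_form FROM N 1 TO V r_forms DO (
      form_range_prog;;
      (IF V r_lo [<] V r_form_lo THEN r_lo ::= V r_form_lo ELSE Skip);;
      IF V r_form_hi [<] V r_hi THEN r_hi ::= V r_form_hi ELSE Skip)"

lemma root_step_effects [simp]:
  "writes root_step = {r_root, r_mid, r_pow, r_count}" "\<not> stores root_step" "\<not> prints root_step"
  by (auto simp: root_step_def)

lemma root_prog_effects [simp]: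
  "writes (root_prog K) = {r_root, r_mid, r_deg, r_pow, r_count}"
  "\<not> stores (root_prog K)" "\<not> prints (root_prog K)"
  by (auto simp: root_prog_def)

lemma wheel_step_effects [simp]:
  "writes wheel_step = {r_wheel, r_cand, r_div, r_isprime}" "\<not> stores wheel_step" "\<not> prints wheel_step"
  by (auto simp: wheel_step_def)

lemma wheel_prog_effects [simp]:
  "writes wheel_prog = {r_wheel, r_q, r_cand, r_div, r_isprime}"
  "\<not> stores wheel_prog" "\<not> prints wheel_prog"
  by (auto simp: wheel_prog_def)

lemma bound_step_effects [simp]:
  "writes bound_step = {r_maxbase, r_cand, r_div, r_isprime, r_base, r_exp, r_mod, r_modpow, r_arg, r_deg,
    r_low, r_high, r_mid, r_pow, r_count, r_ispow, r_symbol, r_nonres, r_continue}"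
  "\<not> stores bound_step" "\<not> prints bound_step"
  by (auto simp: bound_step_def)

lemma bound_prog_effects [simp]:
  "writes bound_prog = {r_length, r_quot, r_pseudo} \<union> writes bound_step"
  "\<not> stores bound_prog" "\<not> prints bound_prog"
  by (auto simp: bound_prog_def)

lemma coefficients_prog_effects [simp]:
  "writes coefficients_prog = {r_slope, r_intercept}"
  "\<not> stores coefficients_prog" "\<not> prints coefficients_prog"
  by (auto simp: coefficients_prog_def)

lemma form_range_prog_effects [simp]:
  "writes form_range_prog = {r_slope, r_intercept, r_form_lo, r_form_hi}"
  "\<not> stores form_range_prog" "\<not> prints form_range_prog"
  by (auto simp: form_range_prog_def)

lemma range_prog_effects [simp]:
  "writes range_prog = {r_lo, r_hi, r_form, r_slope, r_intercept, r_form_lo, r_form_hi}"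
  "\<not> stores range_prog" "\<not> prints range_prog"
  by (auto simp: range_prog_def)

context sieve_run
begin

lemma y_less_W: "int y < W"
  using y_le W by linarith

lemma less_B_if_le_y:
  assumes "v \<le> y" "j < K + 12"
  shows "int v ^ j < B"
proof -
  have "int v ^ j \<le> W ^ j" using assms(1) y_less_W by (intro power_mono) auto
  then show ?thesis using assms(2) by (rule less_B_if_le_power)
qed

lemma y_less_B: "int y + 1 < B" "int y * int y < B" "v \<le> y \<Longrightarrow> u \<le> y \<Longrightarrow> int v * int u < B"
proof -
  show "int y + 1 < B" using y_less_W W_square by linarith
  show product: "v \<le> y \<Longrightarrow> u \<le> y \<Longrightarrow> int v * int u < B" for v u
    using less_B_if_le_y[of y 2] mult_mono[of "int v" "int y" "int u" "int y"]
    by (simp add: power2_eq_square)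
  show "int y * int y < B" by (rule product) auto
qed

lemma runs_root_prog:
  assumes "reg s r_n = int n"
  shows "runs B A (root_prog K) (K + y * (K + 1)) (\<lambda>s'. reg s' r_root = int y) s"
proof -
  let ?I = "\<lambda>p s'. \<exists>v. reg s' r_root = int v \<and> reg s' r_deg = int K \<and> reg s' r_pow = int (v ^ K) \<and>
    2 \<le> v \<and> v \<le> y \<and> p = (y - v) * (K + 1)"
  have pow: "runs B A pow_prog K (\<lambda>s''. reg s'' r_pow = int (v ^ K)) s'"
    if "reg s' r_mid = int v" "reg s' r_deg = int K" "2 \<le> v" "v \<le> y" for s' v
    using that less_B_if_le_y[of v K] K_less_B by (intro runs_pow_prog) auto
  let ?s = "s\<lparr>reg := (reg s)(r_root := 2, r_mid := 2, r_deg := int K)\<rparr>"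
  have "runs B A (pow_prog;; WHILE V r_pow [<] V r_n DO root_step) (K + y * (K + 1))
    (\<lambda>s'. reg s' r_root = int y) ?s"
  proof (rule runs_Seq[OF pow[of ?s 2], where T'' = "(y - 2) * (K + 1)"])
    fix s' assume s': "frame pow_prog ?s s'" "reg s' r_pow = int (2 ^ K)"
    show "runs B A (WHILE V r_pow [<] V r_n DO root_step) ((y - 2) * (K + 1)) (\<lambda>s'. reg s' r_root = int y) s'"
    proof (rule runs_While[where I = ?I])
      show "?I ((y - 2) * (K + 1)) s'" using s' frameD(1)[OF s'(1)] y_bounds(1) by (intro exI[of _ 2]) auto
    next
      fix p u assume u: "frame root_step s' u" "?I p u" "test (reg u) (V r_pow [<] V r_n)"
      then obtain v where v: "reg u r_root = int v" "reg u r_deg = int K" "reg u r_pow = int (v ^ K)"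
        "2 \<le> v" "v \<le> y" "p = (y - v) * (K + 1)" by blast
      have "reg u r_n = int n" using frameD(1)[OF u(1)] frameD(1)[OF s'(1)] assms by simp
      then have "v ^ K < n" using u(3) v(3) by (simp del: of_nat_power)
      then have "Suc v \<le> y" using v(5) y_bounds(2) by (cases "v = y") auto
      let ?u = "u\<lparr>reg := (reg u)(r_root := int (Suc v), r_mid := int (Suc v))\<rparr>"
      have "runs B A pow_prog K (?I ((y - Suc v) * (K + 1))) ?u"
        by (rule runs_conseq[OF pow[of ?u "Suc v"]])
          (use v \<open>Suc v \<le> y\<close> in \<open>auto simp: frameD(1) intro!: exI[of _ "Suc v"]\<close>)
      then have "runs B A root_step K (?I ((y - Suc v) * (K + 1))) u"
        using v(1) \<open>Suc v \<le> y\<close> y_less_B(1)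
        by (simp add: root_step_def runs_simps add.commute)
      moreover have "y - v = Suc (y - Suc v)" using \<open>Suc v \<le> y\<close> by simp
      ultimately show "\<exists>T p'. T + p' < p \<and> runs B A root_step T (?I p') u"
        unfolding v(6) by (intro exI[of _ K] exI[of _ "(y - Suc v) * (K + 1)"]) simp
    next
      fix p u assume u: "frame root_step s' u" "?I p u" "\<not> test (reg u) (V r_pow [<] V r_n)"
      then obtain v where v: "reg u r_root = int v" "reg u r_pow = int (v ^ K)" "2 \<le> v" "v \<le> y"
        by blast
      have "reg u r_n = int n" using frameD(1)[OF u(1)] frameD(1)[OF s'(1)] assms by simp
      then have "n \<le> v ^ K" using u(3) v(2) by (simp add: not_less del: of_nat_power)
      then show "reg u r_root = int y" using v y_least[of v] by simp
    qed simp
  next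
    show "K + (y - 2) * (K + 1) \<le> K + y * (K + 1)" by (intro add_left_mono mult_le_mono1) simp
  qed (use y_bounds(1) in auto)
  then show ?thesis unfolding root_prog_def by (simp add: runs_simps)
qed

definition wheel_upto :: "nat \<Rightarrow> ram_state \<Rightarrow> bool" where
  "wheel_upto q s \<longleftrightarrow> reg s r_wheel = int (primorial (min q level))"

lemma runs_wheel_step:
  assumes "reg s r_root = int y" "reg s r_q = int q" "2 \<le> q" "q \<le> y" "wheel_upto q s"
  shows "runs B A wheel_step q (wheel_upto (Suc q)) s"
proof (cases "q < level")
  case True
  let ?extend = "IF V r_isprime [=] N 1 THEN r_wheel ::= V r_wheel [*] V r_q ELSE Skip"
  have small: "primorial q * q \<le> y" using primorial_le_if_less_level[OF assms(3) True] .
  then have product: "int (primorial q) * int q < int y + 1" by (simp flip: of_nat_mult)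
  let ?s = "s\<lparr>reg := (reg s)(r_cand := int q)\<rparr>"
  have "runs B A (prime_prog;; ?extend) q (wheel_upto (Suc q)) ?s"
  proof (rule runs_Seq[OF runs_prime_prog, where T'' = 0])
    fix s' assume s': "frame prime_prog ?s s'" "reg s' r_isprime = of_bool (prime q)"
    then show "runs B A ?extend 0 (wheel_upto (Suc q)) s'"
      using frameD(1)[OF s'(1)] True assms(2,5) product y_less_B(1)
      by (auto simp: runs_simps primorial_Suc wheel_upto_def min_def)
  qed (use assms(3,4) y_less_B(1) in auto)
  then show ?thesis
    using True assms(1,2,5) product y_less_B(1) by (simp add: wheel_step_def wheel_upto_def runs_simps)
next
  case False
  have wheel: "reg s r_wheel = int wheel"
    using assms(5) False by (simp add: wheel_upto_def wheel_def min_def)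
  have "wheel * level \<le> wheel * q" using False by simp
  then have "y + 1 \<le> wheel * q" using level_bounds(2) unfolding wheel_def by linarith
  then have "int y + 1 \<le> int wheel * int q" by (simp flip: of_nat_mult)
  then show ?thesis
    using y_less_B(3)[OF wheel_bounds(2) assms(4)] wheel assms(1,2) y_less_B(1) False
    by (simp add: wheel_step_def wheel_upto_def runs_simps wheel_def min_def)
qed

lemma runs_wheel_prog:
  assumes "reg s r_root = int y"
  shows "runs B A wheel_prog ((y + 1) * (y + 1)) (\<lambda>s'. reg s' r_wheel = int wheel) s"
proof -
  have "runs B A (FOR r_q FROM N 2 TO V r_root [+] N 1 DO wheel_step) ((y + 1) * (y + 1))
    (\<lambda>s'. reg s' r_wheel = int wheel) (s\<lparr>reg := (reg s)(r_wheel := 1)\<rparr>)" (is "runs B A ?loop _ _ ?s")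
  proof (rule runs_For[where I = wheel_upto and lo = 2 and hi = "y + 1" and T = "\<lambda>q. q"])
    fix q s' assume q: "2 \<le> q" "q < y + 1" "frame ?loop ?s s'" "reg s' r_q = int q" "wheel_upto q s'"
    then have "runs B A wheel_step q (wheel_upto (Suc q)) s'"
      using frameD(1)[OF q(3)] assms by (intro runs_wheel_step) simp_all
    then show "runs B A wheel_step q (\<lambda>s''. wheel_upto (Suc q) (s''\<lparr>reg := (reg s'')(r_q := int (Suc q))\<rparr>)) s'"
      by (rule runs_conseq) (simp_all add: wheel_upto_def)
  next
    have "(\<Sum>q\<in>{2..<y + 1}. Suc q) \<le> of_nat (card {2..<y + 1}) * (y + 1)"
      by (rule sum_bounded_above) auto
    also have "\<dots> \<le> (y + 1) * (y + 1)" by (intro mult_le_mono1) simp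
    finally show "(\<Sum>q\<in>{2..<y + 1}. Suc q) \<le> (y + 1) * (y + 1)" .
  qed (use assms y_less_B(1) level_bounds(1,3) primorial_2 in \<open>auto simp: wheel_upto_def wheel_def min_def\<close>)
  then show ?thesis unfolding wheel_prog_def by (simp add: runs_simps)
qed

lemma runs_bound_step:
  assumes "reg s r_pseudo = int L" "9 \<le> L" "L \<le> n" "reg s r_maxbase = int \<beta>"
  shows "runs B A bound_step bound_step_cost
    (\<lambda>s'. reg s' r_maxbase = int (if pseudosquare_candidate L then max \<beta> (least_nonresidue L) else \<beta>)) s"
    (is "runs B A _ _ ?Q s")
proof (cases "L mod 8 = 1")
  case False
  then have "int L mod 8 \<noteq> 1" by (metis of_nat_1 of_nat_eq_iff of_nat_mod of_nat_numeral)
  then show ?thesis using False assms by (simp add: bound_step_def runs_simps pseudosquare_candidate_def)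
next
  case True
  then have mod8: "int L mod 8 = 1" by (metis of_nat_1 of_nat_mod of_nat_numeral)
  have "odd L" using True by presburger
  have candidate: "pseudosquare_candidate L \<longleftrightarrow> \<not> is_square L"
    using True assms(2) by (simp add: pseudosquare_candidate_def)
  note small = less_B_if_le_n[OF assms(3)]
  let ?update = "IF V r_maxbase [<] V r_nonres THEN r_maxbase ::= V r_nonres ELSE Skip"
  let ?search = "IF V r_ispow [=] N 1 THEN Skip ELSE (r_symbol ::= V r_pseudo;; nonresidue_prog;; ?update)"
  let ?s = "s\<lparr>reg := (reg s)(r_arg := int L, r_deg := 2)\<rparr>"
  have search: "runs B A ?search (3 * max_base\<^sup>2) ?Q s'"
    if s': "reg s' r_pseudo = int L" "reg s' r_maxbase = int \<beta>" "reg s' r_ispow = of_bool (is_square L)" for s'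
  proof (cases "is_square L")
    case False
    then have "least_nonresidue L \<le> max_base"
      using candidate least_nonresidue_le_bound assms(3) by blast
    then have cost: "3 * (least_nonresidue L)\<^sup>2 + 0 \<le> 3 * max_base\<^sup>2"
      by (simp add: power_mono)
    have "runs B A (nonresidue_prog;; ?update) (3 * max_base\<^sup>2) ?Q (s'\<lparr>reg := (reg s')(r_symbol := int L)\<rparr>)"
      by (rule runs_Seq[OF runs_nonresidue_prog _ cost])
        (use s' assms(2) small(3) \<open>odd L\<close> False candidate in \<open>auto simp: runs_simps frameD(1) max_def\<close>)
    then show ?thesis using s' False by (simp add: runs_simps)
  qed (use s' candidate in \<open>simp add: runs_simps\<close>)
  have "runs B A (ispow_prog;; ?search) bound_step_cost ?Q ?s"
  proof (rule runs_Seq[OF runs_ispow_prog, where T'' = "3 * max_base\<^sup>2"])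
    fix s' assume s': "frame ispow_prog ?s s'" "reg s' r_ispow = of_bool (\<exists>a. L = a ^ 2)"
    then show "runs B A ?search (3 * max_base\<^sup>2) ?Q s'"
      using frameD(1)[OF s'(1)] assms(1,4) by (intro search) (simp_all add: is_nth_power_def)
  next
    show "(2 + 1) * (floorlog 2 L + 1) + 3 * max_base\<^sup>2 \<le> bound_step_cost"
      using floorlog_mono[OF assms(3), of 2] by (simp add: bound_step_cost_def)
  qed (use assms(2) small small(4)[of 2] K in auto)
  then show ?thesis using assms(1) mod8 by (simp add: bound_step_def runs_simps)
qed

lemma runs_bound_prog:
  assumes "reg s r_root = int y" "reg s r_n = int n"
  shows "runs B A bound_prog bound_cost
    (\<lambda>s'. reg s' r_length = int block_length \<and> reg s' r_maxbase = int (nonresidue_bound (n div y))) s"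
    (is "runs B A _ _ ?Q s")
proof -
  define X where "X = n div y"
  have "X \<le> n" by (simp add: X_def)
  have "int X + 1 < B" using \<open>X \<le> n\<close> W(1,3) W_square(2) by linarith
  let ?I = "\<lambda>L s'. reg s' r_maxbase = int (nonresidue_bound (L - 1))"
  let ?s = "s\<lparr>reg := (reg s)(r_length := int block_length, r_quot := int X, r_maxbase := 2)\<rparr>"
  have "runs B A (FOR r_pseudo FROM N 9 TO V r_quot [+] N 1 DO bound_step) bound_cost ?Q ?s" (is "runs B A ?loop _ _ _")
  proof (rule runs_For[where I = ?I and lo = 9 and hi = "X + 1" and T = "\<lambda>_. bound_step_cost"])
    fix L s' assume L: "9 \<le> L" "L < X + 1" "frame ?loop ?s s'" "reg s' r_pseudo = int L" "?I L s'"
    have "L \<le> n" using L(2) \<open>X \<le> n\<close> by simp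
    moreover have "Suc (L - 1) = L" using L(1) by simp
    ultimately show "runs B A bound_step bound_step_cost
        (\<lambda>s''. ?I (Suc L) (s''\<lparr>reg := (reg s'')(r_pseudo := int (Suc L))\<rparr>)) s'"
      using nonresidue_bound_Suc[of "L - 1"]
      by (intro runs_conseq[OF runs_bound_step[OF L(4,1) _ L(5)]]) auto
  next
    fix s' assume s': "frame ?loop ?s s'" "?I (max 9 (X + 1)) s'"
    have "max 9 (X + 1) - 1 = max 8 X" by (simp add: max_def)
    then show "?Q s'" using s'(2) frameD(1)[OF s'(1)] by (simp add: nonresidue_bound_max_8 X_def)
  next
    have "(X + 1 - 9) * Suc bound_step_cost \<le> X * Suc bound_step_cost" by (intro mult_le_mono1) simp
    then show "(\<Sum>L\<in>{9..<X + 1}. Suc bound_step_cost) \<le> bound_cost"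
      by (simp add: bound_cost_def X_def)
  qed (use \<open>int X + 1 < B\<close> nonresidue_bound_8 in auto)
  moreover have "int n div int y = int X" by (simp add: X_def zdiv_int)
  ultimately show ?thesis
    unfolding bound_prog_def using assms y_bounds(1) y_less_B(2) by (simp add: runs_simps block_length_def)
qed

definition input_memory :: "(nat \<Rightarrow> int) \<Rightarrow> bool" where
  "input_memory \<mu> \<longleftrightarrow> \<mu> 0 = int k \<and> \<mu> 1 = int n \<and> (\<forall>i<k. \<mu> (2 + 2 * i) = a i \<and> \<mu> (3 + 2 * i) = b i)"

lemma runs_coefficients_prog:
  assumes "input_memory (mem s)" "reg s r_form = int i" "i < k"
  shows "runs B memory_size coefficients_prog 0 (\<lambda>s'. reg s' r_slope = a i \<and> reg s' r_intercept = b i) s"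
proof -
  have "nat (2 + 2 * int i) = 2 + 2 * i" "nat (3 + 2 * int i) = 3 + 2 * i" by auto
  moreover have "2 * int i + 3 < B" using assms(3) W(1,2) W_square by linarith
  ultimately show ?thesis
    unfolding coefficients_prog_def using assms by (simp add: runs_simps input_memory_def memory_size_def)
qed

lemma abs_form_range_le:
  assumes "i < k"
  shows "\<bar>form_lo i\<bar> \<le> 2 * W" "\<bar>form_hi i\<bar> \<le> 2 * W"
proof -
  have "\<bar>b i\<bar> < W" using W(5) assms .
  then show "\<bar>form_lo i\<bar> \<le> 2 * W" "\<bar>form_hi i\<bar> \<le> 2 * W"
    using abs_div_le[of "b i - 2" "a i"] abs_div_le[of "int n - b i" "a i"] W(1,3)
    unfolding form_lo_def form_hi_def by linarith+
qed

lemma abs_lo_le: "\<bar>lo\<bar> \<le> 2 * W" and abs_hi_le: "\<bar>hi\<bar> \<le> 2 * W"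
proof -
  have "lo \<in> form_lo ` {..<k}" "hi \<in> form_hi ` {..<k}"
    unfolding lo_def hi_def using k_pos by (auto intro!: Max_in Min_in simp: lessThan_empty_iff)
  then show "\<bar>lo\<bar> \<le> 2 * W" "\<bar>hi\<bar> \<le> 2 * W" using abs_form_range_le by auto
qed

lemma runs_form_range_prog:
  assumes "input_memory (mem s)" "reg s r_form = int i" "i < k" "reg s r_n = int n"
  shows "runs B memory_size form_range_prog 0
    (\<lambda>s'. reg s' r_form_lo = form_lo i \<and> reg s' r_form_hi = form_hi i) s"
  unfolding form_range_prog_def
proof (rule runs_Seq[OF runs_coefficients_prog[OF assms(1-3)], where T'' = 0])
  fix s' assume s': "frame coefficients_prog s s'" "reg s' r_slope = a i \<and> reg s' r_intercept = b i"
  have "a i \<noteq> 0" "\<bar>b i\<bar> < W" using a_pos[OF assms(3)] W(5)[OF assms(3)] by auto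
  moreover from this have "\<bar>b i - 2\<bar> < B" "\<bar>int n - b i\<bar> < B" "\<bar>form_lo i\<bar> < B"
    using W(1,3) W_square(2) abs_form_range_le(1)[OF assms(3)] by linarith+
  ultimately show "runs B memory_size (r_form_lo ::= N 0 [-] (V r_intercept [-] N 2) [div] V r_slope;;
      r_form_hi ::= (V r_n [-] V r_intercept) [div] V r_slope) 0
      (\<lambda>s'. reg s' r_form_lo = form_lo i \<and> reg s' r_form_hi = form_hi i) s'"
    using s' frameD(1)[OF s'(1)] assms(4) by (simp add: runs_simps form_lo_def form_hi_def)
qed simp

lemma runs_range_prog:
  assumes "input_memory (mem s)" "reg s r_forms = int k" "reg s r_n = int n"
  shows "runs B memory_size range_prog k (\<lambda>s'. reg s' r_lo = lo \<and> reg s' r_hi = hi) s"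
    (is "runs B _ _ _ ?Q s")
proof -
  let ?I = "\<lambda>i s'. reg s' r_lo = Max (form_lo ` {..<i}) \<and> reg s' r_hi = Min (form_hi ` {..<i})"
  let ?tighten = "(IF V r_lo [<] V r_form_lo THEN r_lo ::= V r_form_lo ELSE Skip);;
    IF V r_form_hi [<] V r_hi THEN r_hi ::= V r_form_hi ELSE Skip"
  let ?loop = "FOR r_form FROM N 1 TO V r_forms DO (form_range_prog;; ?tighten)"
  have "int k < B" using W(1,2) W_square(2) by linarith
  have loop: "runs B memory_size ?loop k ?Q s'"
    if s': "?I 1 s'" "mem s' = mem s" "reg s' r_forms = int k" "reg s' r_n = int n" for s'
  proof (rule runs_For[where I = ?I and lo = 1 and hi = k and T = "\<lambda>_. 0"])
    fix i u assume i: "1 \<le> i" "i < k" "frame ?loop s' u" "reg u r_form = int i" "?I i u"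
    show "runs B memory_size (form_range_prog;; ?tighten) 0 (\<lambda>u'. ?I (Suc i) (u'\<lparr>reg := (reg u')(r_form := int (Suc i))\<rparr>)) u"
    proof (rule runs_Seq[OF runs_form_range_prog[of u i]])
      fix v assume v: "frame form_range_prog u v" "reg v r_form_lo = form_lo i \<and> reg v r_form_hi = form_hi i"
      define l h where "l = Max (form_lo ` {..<i})" and "h = Min (form_hi ` {..<i})"
      have "{..<i} \<noteq> {}" using i(1) by (auto simp: lessThan_empty_iff)
      then have "Max (form_lo ` {..<Suc i}) = max (form_lo i) l" "Min (form_hi ` {..<Suc i}) = min (form_hi i) h"
        by (simp_all add: lessThan_Suc l_def h_def)
      moreover have "reg v r_lo = l" "reg v r_hi = h"
        using frameD(1)[OF v(1)] i(5) by (simp_all add: l_def h_def)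
      ultimately show "runs B memory_size ?tighten 0 (\<lambda>u'. ?I (Suc i) (u'\<lparr>reg := (reg u')(r_form := int (Suc i))\<rparr>)) v"
        using v(2) by (simp add: runs_simps)
    qed (use i frameD[OF i(3)] s' assms(1) in auto)
  qed (use s' k_pos \<open>int k < B\<close> in \<open>auto simp: max_def lo_def hi_def\<close>)
  have "runs B memory_size (form_range_prog;; r_lo ::= V r_form_lo;; r_hi ::= V r_form_hi;; ?loop) k ?Q
    (s\<lparr>reg := (reg s)(r_form := 0)\<rparr>)" (is "runs B _ _ _ _ ?s")
  proof (rule runs_Seq[OF runs_form_range_prog[of ?s 0]])
    fix s' assume s': "frame form_range_prog ?s s'" "reg s' r_form_lo = form_lo 0 \<and> reg s' r_form_hi = form_hi 0"
    have "runs B memory_size ?loop k ?Q (s'\<lparr>reg := (reg s')(r_lo := reg s' r_form_lo, r_hi := reg s' r_form_hi)\<rparr>)"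
      using s'(2) frameD[OF s'(1)] assms(2,3) by (intro loop) (simp_all add: lessThan_Suc)
    then show "runs B memory_size (r_lo ::= V r_form_lo;; r_hi ::= V r_form_hi;; ?loop) k ?Q s'"
      by (simp add: runs_simps)
  qed (use assms k_pos in auto)
  then show ?thesis unfolding range_prog_def by (simp add: runs_simps)
qed

end

section \<open>The segmented wheel sieve\<close>

abbreviation (input) "r_start \<equiv> 8 :: nat"
abbreviation (input) "r_class \<equiv> 9 :: nat"
abbreviation (input) "r_block \<equiv> 10 :: nat"
abbreviation (input) "r_coprime \<equiv> 11 :: nat"
abbreviation (input) "r_off \<equiv> 12 :: nat"
abbreviation (input) "r_pos \<equiv> 13 :: nat"
abbreviation (input) "r_all \<equiv> 15 :: nat"
abbreviation (input) "r_residue \<equiv> 18 :: nat"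
abbreviation (input) "r_marks \<equiv> 19 :: nat"
abbreviation (input) "r_mark \<equiv> 50 :: nat"
abbreviation (input) "r_index \<equiv> 51 :: nat"
abbreviation (input) "r_blocks \<equiv> 52 :: nat"
abbreviation (input) "r_segment \<equiv> 53 :: nat"

definition load_form_prog :: com where
  "load_form_prog = coefficients_prog;; r_val ::= V r_slope [*] V r_pos [+] V r_intercept"

definition every_form_prog :: "com \<Rightarrow> nat \<Rightarrow> com" where
  "every_form_prog c r =
    r_all ::= N 1;;
    FOR r_form FROM N 0 TO V r_forms DO (
      load_form_prog;;
      c;;
      IF V r [=] N 1 THEN Skip ELSE r_all ::= N 0)"

definition naive_prog :: com where
  "naive_prog = every_form_prog (r_cand ::= V r_val;; prime_prog) r_isprime"

definition tests_prog :: "nat \<Rightarrow> com" where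
  "tests_prog K = every_form_prog (test_prog K) r_ok"

definition coprime_prog :: com where
  "coprime_prog =
    r_coprime ::= N 1;;
    FOR r_q FROM N 2 TO V r_root [+] N 1 DO
      IF V r_wheel [mod] V r_q [=] N 0
      THEN IF V r_val [mod] V r_q [=] N 0 THEN r_coprime ::= N 0 ELSE Skip
      ELSE Skip"

definition admissible_prog :: com where
  "admissible_prog = r_pos ::= V r_start [+] V r_class;; every_form_prog coprime_prog r_coprime"

definition report_prog :: "com \<Rightarrow> com" where
  "report_prog c =
    IF V r_hi [<] V r_pos THEN Skip ELSE (c;; IF V r_all [=] N 1 THEN Print (V r_pos) ELSE Skip)"

definition small_prog :: com where
  "small_prog =
    FOR r_index FROM N 0 TO V r_root DO (r_pos ::= V r_lo [+] V r_index;; report_prog naive_prog)"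

definition locate_prog :: "nat \<Rightarrow> com" where
  "locate_prog r = r_pos ::= V r_start [+] V r_class [+] V r_wheel [*] (V r_block [+] V r)"

definition clear_prog :: com where
  "clear_prog = FOR r_off FROM N 0 TO V r_length DO Put (V r_marks [+] V r_off) (N 0)"

definition mark_prog :: com where
  "mark_prog =
    FOR r_index FROM N 0 TO V r_length [div] V r_q [+] N 1 DO (
      r_off ::= V r_residue [+] V r_index [*] V r_q;;
      IF V r_off [<] V r_length THEN Put (V r_marks [+] V r_off) (N 1) ELSE Skip)"

definition cross_prog :: com where
  "cross_prog = IF V r_val [mod] V r_q [=] N 0 THEN mark_prog ELSE Skip"

definition offsets_prog :: com where
  "offsets_prog =
    FOR r_residue FROM N 0 TO V r_q DO (
      locate_prog r_residue;;
      load_form_prog;;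
      cross_prog)"

definition forms_prog :: com where
  "forms_prog = FOR r_form FROM N 0 TO V r_forms DO offsets_prog"

definition sieve_prog :: com where
  "sieve_prog =
    FOR r_q FROM N 2 TO V r_root [+] N 1 DO (
      r_cand ::= V r_q;;
      prime_prog;;
      IF V r_isprime [=] N 1 THEN forms_prog ELSE Skip)"

definition scan_step :: "nat \<Rightarrow> com" where
  "scan_step K =
    Get r_mark (V r_marks [+] V r_off);;
    IF V r_mark [=] N 0 THEN (locate_prog r_off;; report_prog (tests_prog K)) ELSE Skip"

definition scan_prog :: "nat \<Rightarrow> com" where
  "scan_prog K = FOR r_off FROM N 0 TO V r_length DO scan_step K"

definition block_prog :: "nat \<Rightarrow> com" where
  "block_prog K = clear_prog;; sieve_prog;; scan_prog K"

definition class_prog :: "nat \<Rightarrow> com" where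
  "class_prog K =
    IF V r_hi [<] V r_start THEN Skip
    ELSE (
      r_blocks ::= (V r_hi [-] V r_start) [div] (V r_wheel [*] V r_length) [+] N 1;;
      FOR r_segment FROM N 0 TO V r_blocks DO (r_block ::= V r_segment [*] V r_length;; block_prog K))"

definition classes_prog :: "nat \<Rightarrow> com" where
  "classes_prog K =
    FOR r_class FROM N 0 TO V r_wheel DO (
      admissible_prog;;
      IF V r_all [=] N 1 THEN class_prog K ELSE Skip)"

lemma load_form_prog_effects [simp]:
  "writes load_form_prog = {r_slope, r_intercept, r_val}" "\<not> stores load_form_prog" "\<not> prints load_form_prog"
  by (auto simp: load_form_prog_def)

lemma every_form_prog_effects [simp]:
  "writes (every_form_prog c r) = {r_all, r_form, r_slope, r_intercept, r_val} \<union> writes c"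
  "stores (every_form_prog c r) \<longleftrightarrow> stores c" "prints (every_form_prog c r) \<longleftrightarrow> prints c"
  by (auto simp: every_form_prog_def)

lemma naive_prog_effects [simp]:
  "writes naive_prog = {r_all, r_form, r_slope, r_intercept, r_val, r_cand, r_div, r_isprime}"
  "\<not> stores naive_prog" "\<not> prints naive_prog"
  by (auto simp: naive_prog_def)

lemma tests_prog_effects [simp]:
  "writes (tests_prog K) = {r_all, r_form, r_slope, r_intercept, r_val} \<union> writes (test_prog K)"
  "\<not> stores (tests_prog K)" "\<not> prints (tests_prog K)"
  by (simp_all only: tests_prog_def every_form_prog_effects test_prog_effects simp_thms)

lemma coprime_prog_effects [simp]:
  "writes coprime_prog = {r_coprime, r_q}" "\<not> stores coprime_prog" "\<not> prints coprime_prog"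
  by (auto simp: coprime_prog_def)

lemma admissible_prog_effects [simp]:
  "writes admissible_prog = {r_pos, r_all, r_form, r_slope, r_intercept, r_val, r_coprime, r_q}"
  "\<not> stores admissible_prog" "\<not> prints admissible_prog"
  by (auto simp: admissible_prog_def)

lemma report_prog_effects [simp]:
  "writes (report_prog c) = writes c" "stores (report_prog c) \<longleftrightarrow> stores c" "prints (report_prog c)"
  by (auto simp: report_prog_def)

lemma small_prog_effects [simp]:
  "writes small_prog = {r_index, r_pos} \<union> writes naive_prog" "\<not> stores small_prog"
  by (simp_all only: small_prog_def effects_For writes.simps stores.simps report_prog_effects naive_prog_effects) auto

lemma locate_prog_effects [simp]:
  "writes (locate_prog r) = {r_pos}" "\<not> stores (locate_prog r)" "\<not> prints (locate_prog r)"
  by (auto simp: locate_prog_def)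

lemma clear_prog_effects [simp]: "writes clear_prog = {r_off}" "\<not> prints clear_prog"
  by (auto simp: clear_prog_def)

lemma mark_prog_effects [simp]: "writes mark_prog = {r_index, r_off}" "\<not> prints mark_prog"
  by (auto simp: mark_prog_def)

lemma cross_prog_effects [simp]: "writes cross_prog = {r_index, r_off}" "\<not> prints cross_prog"
  by (auto simp: cross_prog_def)

lemma offsets_prog_effects [simp]:
  "writes offsets_prog = {r_residue, r_pos, r_slope, r_intercept, r_val, r_index, r_off}" "\<not> prints offsets_prog"
  by (auto simp: offsets_prog_def)

lemma forms_prog_effects [simp]: "writes forms_prog = insert r_form (writes offsets_prog)" "\<not> prints forms_prog"
  by (auto simp: forms_prog_def)

lemma sieve_prog_effects [simp]:
  "writes sieve_prog = {r_q, r_cand, r_div, r_isprime} \<union> writes forms_prog" "\<not> prints sieve_prog"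
  by (auto simp: sieve_prog_def)

lemma scan_step_effects [simp]:
  "writes (scan_step K) = {r_mark, r_pos} \<union> writes (tests_prog K)" "\<not> stores (scan_step K)"
  by (auto simp: scan_step_def)

lemma scan_prog_effects [simp]:
  "writes (scan_prog K) = insert r_off (writes (scan_step K))" "\<not> stores (scan_prog K)"
  by (auto simp: scan_prog_def)

lemma block_prog_effects [simp]:
  "writes (block_prog K) = writes clear_prog \<union> (writes sieve_prog \<union> writes (scan_prog K))"
  by (simp only: block_prog_def writes.simps)

lemma class_prog_effects [simp]:
  "writes (class_prog K) = {r_blocks, r_segment, r_block} \<union> writes (block_prog K)"
  by (auto simp: class_prog_def)

context sieve_run
begin

definition base :: nat where "base = 2 + 2 * k"

lemma four_times_power:
  assumes "i < j"
  shows "4 * W ^ i \<le> W ^ j"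
proof -
  have "4 * W ^ i \<le> W ^ Suc i" using W(1) by (simp add: mult_right_mono)
  also have "\<dots> \<le> W ^ j" using assms W(1) by (intro power_increasing) auto
  finally show ?thesis .
qed

lemma block_length_le: "int block_length \<le> W\<^sup>2"
  using y_less_W mult_mono[of "int y" W "int y" W] W(1) by (simp add: block_length_def power2_eq_square)

lemma memory_size_less_B: "int (base + block_length) + int y < B" "int (base + block_length) < B" "int block_length + 1 < B" "int block_length + int y < B"
proof -
  have "int (base + block_length) + int y \<le> W ^ 3"
    using block_length_le y_less_W W(1,2) W_square(1) four_times_power[of 2 3] by (simp add: base_def)
  then show "int (base + block_length) + int y < B" by (rule less_B_if_le_power) simp
  then show "int (base + block_length) < B" "int block_length + 1 < B" "int block_length + int y < B"
    using y_bounds(1) by (auto simp: base_def)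
qed

definition prepared :: "ram_state \<Rightarrow> bool" where
  "prepared s \<longleftrightarrow> reg s r_forms = int k \<and> reg s r_root = int y \<and> reg s r_wheel = int wheel \<and> reg s r_length = int block_length \<and>
    reg s r_maxbase = int (nonresidue_bound (n div y)) \<and> reg s r_lo = lo \<and> reg s r_hi = hi \<and> reg s r_start = start \<and> reg s r_marks = int base"

lemma preparedD:
  assumes "prepared s"
  shows "reg s r_forms = int k" "reg s r_root = int y" "reg s r_wheel = int wheel" "reg s r_length = int block_length"
    "reg s r_maxbase = int (nonresidue_bound (n div y))" "reg s r_lo = lo" "reg s r_hi = hi" "reg s r_start = start" "reg s r_marks = int base"
  using assms by (simp_all add: prepared_def)

lemma prepared_frame:
  assumes "prepared s" "frame c s s'"
    "writes c \<inter> {r_forms, r_root, r_wheel, r_length, r_maxbase, r_lo, r_hi, r_start, r_marks} = {}"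
  shows "prepared s'"
  using assms(1) assms(2,3)[unfolded frame_def disjoint_iff] by (auto simp: prepared_def)

definition marked :: "nat set \<Rightarrow> ram_state \<Rightarrow> bool" where
  "marked S s \<longleftrightarrow> input_memory (mem s) \<and> (\<forall>u<block_length. mem s (base + u) = of_bool (u \<in> S))"

lemma base_less:
  assumes "u < block_length"
  shows "base + u < memory_size" "int base + int u < B"
proof -
  show "base + u < memory_size" using assms by (simp add: memory_size_def base_def block_length_def)
  show "int base + int u < B" using assms memory_size_less_B(2) by linarith
qed

lemma runs_put_mark:
  assumes "prepared s" "input_memory (mem s)" "reg s r_off = int u" "u < block_length"
  shows "runs B memory_size (Put (V r_marks [+] V r_off) (N v)) 0
    (\<lambda>s'. input_memory (mem s') \<and> (\<forall>w. mem s' (base + w) = (if w = u then v else mem s (base + w)))) s"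
proof -
  have "nat (int base + int u) = base + u" by simp
  moreover note base_less[OF assms(4)]
  moreover have "input_memory ((mem s)(base + u := v))"
    using assms(2) by (auto simp: input_memory_def base_def)
  ultimately show ?thesis using preparedD(9)[OF assms(1)] assms(3) by (simp add: runs_simps)
qed

lemma form_bounds:
  assumes "\<bar>x\<bar> \<le> W ^ 5" "i < k"
  shows "\<bar>a i * x\<bar> < B" "\<bar>form i x\<bar> < B"
proof -
  have coeffs: "0 < a i" "a i \<le> W" "\<bar>b i\<bar> \<le> W"
    using a_pos W(4,5) assms(2) by (auto intro: less_imp_le)
  have "\<bar>a i * x\<bar> \<le> W * W ^ 5"
    unfolding abs_mult using coeffs assms W(1) by (intro mult_mono) auto
  then have product: "\<bar>a i * x\<bar> \<le> W ^ 6" by (simp flip: power_Suc)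
  then show "\<bar>a i * x\<bar> < B" by (rule less_B_if_le_power) simp
  have "W \<le> W ^ 6" using power_increasing[of 1 6 W] W(1) by simp
  then have "\<bar>form i x\<bar> \<le> W ^ 7"
    using product coeffs(3) four_times_power[of 6 7] abs_triangle_ineq[of "a i * x" "b i"]
    by (simp add: form_def)
  then show "\<bar>form i x\<bar> < B" by (rule less_B_if_le_power) simp
qed

lemma runs_load_form_prog:
  assumes "input_memory (mem s)" "reg s r_form = int i" "i < k" "reg s r_pos = x" "\<bar>x\<bar> \<le> W ^ 5"
  shows "runs B memory_size load_form_prog 0 (\<lambda>s'. reg s' r_val = form i x) s"
  unfolding load_form_prog_def
  by (rule runs_Seq[OF runs_coefficients_prog[OF assms(1-3)], where T'' = 0])
    (use form_bounds[OF assms(5,3)] assms(4) in \<open>auto simp: runs_simps form_def frameD(1)\<close>)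

lemma runs_every_form_prog:
  assumes s: "input_memory (mem s)" "reg s r_forms = int k" "reg s r_pos = x" "\<bar>x\<bar> \<le> W ^ 5"
    and c: "writes c \<inter> {r_forms, r_pos, r_form, r_all} = {}" "\<not> stores c"
    and runs_c: "\<And>i s'. i < k \<Longrightarrow> frame (every_form_prog c r) s s' \<Longrightarrow> reg s' r_val = form i x \<Longrightarrow>
      runs B memory_size c T (\<lambda>s''. reg s'' r = of_bool (P i)) s'"
  shows "runs B memory_size (every_form_prog c r) (k * (T + 1)) (\<lambda>s'. reg s' r_all = of_bool (\<forall>i<k. P i)) s"
proof -
  let ?I = "\<lambda>i s'. reg s' r_all = of_bool (\<forall>j<i. P j)"
  let ?update = "IF V r [=] N 1 THEN Skip ELSE r_all ::= N 0"
  let ?loop = "FOR r_form FROM N 0 TO V r_forms DO (load_form_prog;; c;; ?update)"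
  let ?s = "s\<lparr>reg := (reg s)(r_all := 1)\<rparr>"
  have outside: "z \<notin> writes c" if "z \<in> {r_forms, r_pos, r_form, r_all}" for z
    using c(1) that by blast
  have "runs B memory_size ?loop (k * (T + 1)) (\<lambda>s'. reg s' r_all = of_bool (\<forall>i<k. P i)) ?s"
  proof (rule runs_For[where I = ?I and lo = 0 and hi = k and T = "\<lambda>_. T"])
    fix i s' assume i: "i < k" "frame ?loop ?s s'" "reg s' r_form = int i" "?I i s'"
    note s' = frameD[OF i(2), simplified]
    show "runs B memory_size (load_form_prog;; c;; ?update) T
        (\<lambda>s''. ?I (Suc i) (s''\<lparr>reg := (reg s'')(r_form := int (Suc i))\<rparr>)) s'"
    proof (rule runs_Seq[OF runs_load_form_prog[OF _ i(3,1)], where T'' = T])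
      fix u assume u: "frame load_form_prog s' u" "reg u r_val = form i x"
      have "frame (every_form_prog c r) s u"
        using i(2) u(1) c(2) by (auto simp: frame_def)
      then show "runs B memory_size (c;; ?update) T (\<lambda>s''. ?I (Suc i) (s''\<lparr>reg := (reg s'')(r_form := int (Suc i))\<rparr>)) u"
        using u frameD(1)[OF u(1)] i(3,4) outside
        by (intro runs_Seq[OF runs_c[OF i(1)], where T'' = 0]) (auto simp: runs_simps frameD(1) less_Suc_eq)
    qed (use s' s c(2) outside in auto)
  qed (use s outside memory_size_less_B(2) in \<open>auto simp: base_def\<close>)
  then show ?thesis unfolding every_form_prog_def by (simp add: runs_simps)
qed

lemma runs_naive_prog:
  assumes "input_memory (mem s)" "reg s r_forms = int k" "reg s r_pos = x" "\<bar>x\<bar> \<le> W ^ 5"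
    "\<And>i. i < k \<Longrightarrow> 2 \<le> form i x \<and> form i x \<le> int F"
  shows "runs B memory_size naive_prog (k * (F + 1)) (\<lambda>s'. reg s' r_all = of_bool (all_prime x)) s"
  unfolding naive_prog_def all_prime_def
proof (rule runs_every_form_prog[OF assms(1-4)])
  fix i s' assume i: "i < k" and s': "frame (every_form_prog (r_cand ::= V r_val;; prime_prog) r_isprime) s s'" "reg s' r_val = form i x"
  define p where "p = nat (form i x)"
  have p: "form i x = int p" "2 \<le> p" "p \<le> F" using assms(5)[OF i] by (auto simp: p_def)
  have "int p < B" using form_bounds(2)[OF assms(4) i] p(1) by simp
  then have "runs B memory_size prime_prog F (\<lambda>s''. reg s'' r_isprime = of_bool (prime p)) (s'\<lparr>reg := (reg s')(r_cand := int p)\<rparr>)"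
    by (intro runs_conseq[OF runs_prime_prog]) (use p in auto)
  then show "runs B memory_size (r_cand ::= V r_val;; prime_prog) F (\<lambda>s''. reg s'' r_isprime = of_bool (prime (form i x))) s'"
    using s'(2) p(1) by (simp add: runs_simps)
qed auto

lemma abs_le_if_le_hi:
  assumes "lo \<le> x" "x \<le> hi"
  shows "\<bar>x\<bar> \<le> W ^ 5"
  using assms abs_lo_le abs_hi_le four_times_power[of 1 5] by simp

lemma runs_report_prog:
  assumes "reg s r_pos = x" "reg s r_hi = hi" "r_pos \<notin> writes c" "\<not> prints c"
    and runs_c: "x \<le> hi \<Longrightarrow> runs B A c T (\<lambda>s'. reg s' r_all = of_bool (all_prime x)) s"
  shows "runs B A (report_prog c) T
    (\<lambda>s'. set (printed s') = set (printed s) \<union> {z. z = x \<and> z \<le> hi \<and> all_prime z}) s"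
proof (cases "x \<le> hi")
  case True
  have "runs B A (c;; IF V r_all [=] N 1 THEN Print (V r_pos) ELSE Skip) T
    (\<lambda>s'. set (printed s') = set (printed s) \<union> {z. z = x \<and> z \<le> hi \<and> all_prime z}) s"
    by (rule runs_Seq[OF runs_c[OF True], where T'' = 0])
      (use assms(1,3,4) True in \<open>auto simp: runs_simps frameD\<close>)
  then show ?thesis using True assms(1,2) by (simp add: report_prog_def runs_simps)
qed (use assms(1,2) in \<open>auto simp: report_prog_def runs_simps\<close>)

lemma runs_small_prog:
  assumes "prepared s" "input_memory (mem s)"
  shows "runs B memory_size small_prog (y * (k * (start_form_sum + 1) + 1))
    (\<lambda>s'. set (printed s') = set (printed s) \<union> {x. lo \<le> x \<and> x < start \<and> x \<le> hi \<and> all_prime x}) s"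
  unfolding small_prog_def
proof (rule runs_For[where lo = 0 and hi = y and T = "\<lambda>_. k * (start_form_sum + 1)" and
      I = "\<lambda>j s'. set (printed s') = set (printed s) \<union> {x. lo \<le> x \<and> x < lo + int j \<and> x \<le> hi \<and> all_prime x}"])
  fix j s' assume j: "j < y" "frame (FOR r_index FROM N 0 TO V r_root DO (r_pos ::= V r_lo [+] V r_index;; report_prog naive_prog)) s s'"
    "reg s' r_index = int j"
    "set (printed s') = set (printed s) \<union> {x. lo \<le> x \<and> x < lo + int j \<and> x \<le> hi \<and> all_prime x}"
  define x where "x = lo + int j"
  have s': "prepared s'" by (rule prepared_frame[OF assms(1) j(2)]) auto
  let ?s = "s'\<lparr>reg := (reg s')(r_pos := x)\<rparr>"
  have "runs B memory_size (report_prog naive_prog) (k * (start_form_sum + 1))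
    (\<lambda>s''. set (printed s'') = set (printed ?s) \<union> {z. z = x \<and> z \<le> hi \<and> all_prime z}) ?s"
  proof (rule runs_report_prog)
    assume "x \<le> hi"
    then show "runs B memory_size naive_prog (k * (start_form_sum + 1)) (\<lambda>s'. reg s' r_all = of_bool (all_prime x)) ?s"
      using preparedD(1)[OF s'] frameD(2)[OF j(2)] assms(2) lo_le_iff[of x] form_le_start_form_sum[of _ x] j(1)
      by (intro runs_naive_prog abs_le_if_le_hi) (auto simp: x_def start_def)
  qed (use preparedD(7)[OF s'] in auto)
  moreover have "\<bar>x\<bar> < B" using abs_lo_le j(1) y_less_W W_square(2) by (simp add: x_def)
  ultimately have "runs B memory_size (r_pos ::= V r_lo [+] V r_index;; report_prog naive_prog) (k * (start_form_sum + 1))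
    (\<lambda>s''. set (printed s'') = set (printed s') \<union> {z. z = x \<and> z \<le> hi \<and> all_prime z}) s'"
    using preparedD(6)[OF s'] j(3) by (simp add: runs_simps x_def)
  moreover have "{x. lo \<le> x \<and> x < lo + int (Suc j) \<and> x \<le> hi \<and> all_prime x} =
    {x. lo \<le> x \<and> x < lo + int j \<and> x \<le> hi \<and> all_prime x} \<union> {z. z = x \<and> z \<le> hi \<and> all_prime z}"
    by (auto simp: x_def)
  ultimately show "runs B memory_size (r_pos ::= V r_lo [+] V r_index;; report_prog naive_prog) (k * (start_form_sum + 1))
      (\<lambda>s''. set (printed (s''\<lparr>reg := (reg s'')(r_index := int (Suc j))\<rparr>)) = set (printed s) \<union>
        {x. lo \<le> x \<and> x < lo + int (Suc j) \<and> x \<le> hi \<and> all_prime x}) s'"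
    by (elim runs_conseq) (simp_all add: j(4) Un_assoc)
qed (use preparedD(2)[OF assms(1)] y_less_B(1) in \<open>auto simp: start_def\<close>)
lemma runs_tests_prog:
  assumes "prepared s" "input_memory (mem s)" "reg s r_pos = x" "start \<le> x" "x \<le> hi" "avoids_upto y x"
  shows "runs B memory_size (tests_prog K) (k * (test_cost + 1)) (\<lambda>s'. reg s' r_all = of_bool (all_prime x)) s"
  unfolding tests_prog_def all_prime_def
proof (rule runs_every_form_prog[OF assms(2) preparedD(1)[OF assms(1)] assms(3)])
  show "\<bar>x\<bar> \<le> W ^ 5" using assms(4,5) by (intro abs_le_if_le_hi) (simp_all add: start_def)
next
  fix i s' assume i: "i < k" "frame (every_form_prog (test_prog K) r_ok) s s'" "reg s' r_val = form i x"
  note test = form_prime_iff_test_passes[OF assms(4-6) i(1)]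
  have "reg s' r_maxbase = int (nonresidue_bound (n div y))"
    using frameD(1)[OF i(2)] preparedD(5)[OF assms(1)] by simp
  then show "runs B memory_size (test_prog K) test_cost (\<lambda>s''. reg s'' r_ok = of_bool (prime (form i x))) s'"
    using runs_test_prog[of s' "nat (form i x)" "nonresidue_bound (n div y)" memory_size] test i(3) nonresidue_bound_mono[OF div_le_dividend] by simp
qed auto

lemma runs_coprime_prog:
  assumes "prepared s" "reg s r_val = z"
  shows "runs B A coprime_prog y
    (\<lambda>s'. reg s' r_coprime = of_bool (\<forall>q\<in>{2..y}. q dvd wheel \<longrightarrow> \<not> int q dvd z)) s"
    (is "runs B A _ y ?Q s")
proof -
  let ?G = "\<lambda>q. q dvd wheel \<longrightarrow> \<not> int q dvd z"
  let ?I = "\<lambda>q s'. reg s' r_coprime = of_bool (\<forall>p\<in>{2..<q}. ?G p)"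
  let ?body = "IF V r_wheel [mod] V r_q [=] N 0
    THEN IF V r_val [mod] V r_q [=] N 0 THEN r_coprime ::= N 0 ELSE Skip ELSE Skip"
  let ?loop = "FOR r_q FROM N 2 TO V r_root [+] N 1 DO ?body"
  let ?s = "s\<lparr>reg := (reg s)(r_coprime := 1)\<rparr>"
  have prepared: "prepared ?s" using assms(1) by (simp add: prepared_def)
  have "runs B A ?loop y ?Q ?s"
  proof (rule runs_For[where I = ?I and lo = 2 and hi = "y + 1" and T = "\<lambda>_. 0"])
    fix q s' assume q: "2 \<le> q" "q < y + 1" "frame ?loop ?s s'" "reg s' r_q = int q" "?I q s'"
    have "{2..<Suc q} = insert q {2..<q}" using q(1) by auto
    moreover have "reg s' r_wheel = int wheel" "reg s' r_val = z"
      using frameD(1)[OF q(3)] preparedD(3)[OF prepared] assms(2) by simp_all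
    moreover have "int wheel mod int q = 0 \<longleftrightarrow> q dvd wheel" "z mod int q = 0 \<longleftrightarrow> int q dvd z"
      by (auto simp flip: dvd_eq_mod_eq_0)
    ultimately show "runs B A ?body 0 (\<lambda>s''. ?I (Suc q) (s''\<lparr>reg := (reg s'')(r_q := int (Suc q))\<rparr>)) s'"
      using q(1,4,5) by (simp add: runs_simps)
  next
    fix s' :: ram_state assume "?I (max 2 (y + 1)) s'"
    moreover have "{2..<max 2 (y + 1)} = {2..y}" using y_bounds(1) by auto
    ultimately show "?Q s'" by simp
  qed (use preparedD(2)[OF prepared] y_less_B(1) in auto)
  then show ?thesis unfolding coprime_prog_def by (simp add: runs_simps)
qed

lemma abs_class_start:
  assumes "r < wheel"
  shows "\<bar>start + int r\<bar> < B" "\<bar>start + int r\<bar> \<le> W ^ 5"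
proof -
  have "\<bar>start + int r\<bar> \<le> W\<^sup>2"
    using abs_lo_le assms wheel_bounds(2) y_less_W W_square(1) unfolding start_def by linarith
  moreover have "W\<^sup>2 \<le> W ^ 5" using W(1) by (intro power_increasing) auto
  ultimately show "\<bar>start + int r\<bar> \<le> W ^ 5" "\<bar>start + int r\<bar> < B"
    using less_B_if_le_power[of "\<bar>start + int r\<bar>" 2] by auto
qed

lemma runs_admissible_prog:
  assumes "prepared s" "input_memory (mem s)" "reg s r_class = int r" "r < wheel"
  shows "runs B memory_size admissible_prog (k * (y + 1)) (\<lambda>s'. reg s' r_all = of_bool (admissible r)) s"
proof -
  let ?s = "s\<lparr>reg := (reg s)(r_pos := start + int r)\<rparr>"
  have prepared: "prepared ?s" using assms(1) by (simp add: prepared_def)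
  have "runs B memory_size (every_form_prog coprime_prog r_coprime) (k * (y + 1)) (\<lambda>s'. reg s' r_all = of_bool (admissible r)) ?s"
    unfolding admissible_def
  proof (rule runs_every_form_prog[where x = "start + int r"])
    fix i s' assume "frame (every_form_prog coprime_prog r_coprime) ?s s'" "reg s' r_val = form i (start + int r)"
    then show "runs B memory_size coprime_prog y (\<lambda>s''. reg s'' r_coprime =
        of_bool (\<forall>q\<in>{2..y}. q dvd wheel \<longrightarrow> \<not> int q dvd form i (start + int r))) s'"
      by (intro runs_coprime_prog prepared_frame[OF prepared]) auto
  qed (use assms preparedD(1)[OF prepared] abs_class_start in auto)
  then show ?thesis
    using assms(3,4) preparedD(8)[OF assms(1)] abs_class_start(1)
    by (simp add: admissible_prog_def runs_simps)
qed

definition block_start :: "nat \<Rightarrow> nat \<Rightarrow> bool" where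
  "block_start r T \<longleftrightarrow> r < wheel \<and> start + int wheel * int T \<le> hi"

lemma pos_bounds:
  assumes "block_start r T" "u < block_length"
  shows "int T + int u < B" "int wheel * (int T + int u) < B" "start \<le> pos r (T + u)" "\<bar>pos r (T + u)\<bar> \<le> W ^ 5"
proof -
  have r: "r < wheel" "int wheel * int T \<le> hi - start" using assms(1) by (auto simp: block_start_def)
  have "int wheel * int u \<le> W * W\<^sup>2"
    using wheel_bounds(2) y_less_W W(1) assms(2) block_length_le by (intro mult_mono) auto
  then have "int wheel * int u \<le> W ^ 3" by (simp add: power2_eq_square power3_eq_cube)
  moreover have "\<bar>start\<bar> \<le> 3 * W" using abs_lo_le y_less_W by (simp add: start_def)
  moreover have "4 * W ^ 3 \<le> W ^ 4" "4 * W\<^sup>2 \<le> W ^ 3" by (rule four_times_power; simp)+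
  moreover have split: "int wheel * int (T + u) = int wheel * int T + int wheel * int u"
    by (simp add: algebra_simps)
  ultimately have upper: "int wheel * int (T + u) \<le> W ^ 4"
    using r(2) abs_hi_le W_square(1) W(1) by linarith
  then show "int wheel * (int T + int u) < B" using less_B_if_le_power[OF upper] by simp
  moreover have "int (T + u) \<le> int wheel * int (T + u)"
    using wheel_bounds(1) by (simp add: mult_le_cancel_right1)
  ultimately show "int T + int u < B" by simp
  show "start \<le> pos r (T + u)" by (simp add: pos_def)
  have "4 * W ^ 4 \<le> W ^ 5" "4 * W \<le> W ^ 4"
    using four_times_power[of 4 5] four_times_power[of 1 4] by simp_all
  moreover have "int r < W" using r(1) wheel_bounds(2) y_less_W by linarith
  moreover have "0 \<le> int wheel * int (T + u)" by simp
  ultimately show "\<bar>pos r (T + u)\<bar> \<le> W ^ 5"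
    using upper \<open>\<bar>start\<bar> \<le> 3 * W\<close> W(1) unfolding pos_def by linarith
qed

lemma runs_locate_prog:
  assumes "prepared s" "reg s r_class = int r" "reg s r_block = int T" "reg s z = int u" "block_start r T" "u < block_length"
  shows "runs B A (locate_prog z) 0 (\<lambda>s'. reg s' r_pos = pos r (T + u)) s"
proof -
  note bounds = pos_bounds[OF assms(5,6)]
  have "\<bar>pos r (T + u)\<bar> < B" using bounds(4) by (rule less_B_if_le_power) simp
  then show ?thesis
    using assms(2-5) preparedD(3,8)[OF assms(1)] bounds(1,2) abs_class_start(1)[of r]
    by (simp add: locate_prog_def runs_simps pos_def block_start_def)
qed

lemma runs_clear_prog:
  assumes "prepared s" "input_memory (mem s)"
  shows "runs B memory_size clear_prog block_length (marked {}) s"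
  unfolding clear_prog_def
proof (rule runs_For[where lo = 0 and hi = block_length and T = "\<lambda>_. 0" and
      I = "\<lambda>u s'. input_memory (mem s') \<and> (\<forall>v<u. mem s' (base + v) = 0)"])
  fix u s' assume u: "u < block_length" "frame (FOR r_off FROM N 0 TO V r_length DO Put (V r_marks [+] V r_off) (N 0)) s s'"
    "reg s' r_off = int u" "input_memory (mem s') \<and> (\<forall>v<u. mem s' (base + v) = 0)"
  have "prepared s'" by (rule prepared_frame[OF assms(1) u(2)]) auto
  then show "runs B memory_size (Put (V r_marks [+] V r_off) (N 0)) 0
      (\<lambda>s''. input_memory (mem (s''\<lparr>reg := (reg s'')(r_off := int (Suc u))\<rparr>)) \<and>
        (\<forall>v<Suc u. mem (s''\<lparr>reg := (reg s'')(r_off := int (Suc u))\<rparr>) (base + v) = 0)) s'"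
    by (rule runs_conseq[OF runs_put_mark]) (use u(1,3,4) in \<open>auto simp: less_Suc_eq\<close>)
qed (use assms preparedD(4)[OF assms(1)] memory_size_less_B(2) in \<open>auto simp: marked_def\<close>)

lemma runs_mark_prog:
  assumes "prepared s" "marked S s" "reg s r_residue = int w" "reg s r_q = int q" "w < q" "2 \<le> q" "q \<le> y"
  shows "runs B memory_size mark_prog (block_length div q + 1) (marked (S \<union> {u. u mod q = w})) s"
proof -
  let ?S = "\<lambda>j. S \<union> {u. u mod q = w \<and> u div q < j}"
  let ?mark = "IF V r_off [<] V r_length THEN Put (V r_marks [+] V r_off) (N 1) ELSE Skip"
  let ?body = "r_off ::= V r_residue [+] V r_index [*] V r_q;; ?mark"
  let ?loop = "FOR r_index FROM N 0 TO V r_length [div] V r_q [+] N 1 DO ?body"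
  have quotient: "int block_length div int q = int (block_length div q)" by (simp add: zdiv_int)
  have "block_length div q < block_length" using block_length_pos assms(6) by simp
  show ?thesis
    unfolding mark_prog_def
  proof (rule runs_For[where I = "\<lambda>j. marked (?S j)" and lo = 0 and hi = "block_length div q + 1" and T = "\<lambda>_. 0"])
    fix j s' assume j: "j < block_length div q + 1" "frame ?loop s s'" "reg s' r_index = int j" "marked (?S j) s'"
    define v where "v = w + j * q"
    have s': "prepared s'" by (rule prepared_frame[OF assms(1) j(2)]) auto
    have "j * q \<le> block_length div q * q" using j(1) by (intro mult_le_mono1) simp
    then have "j * q \<le> block_length" using div_times_less_eq_dividend[of block_length q] by linarith
    then have v: "int v < B" "int j * int q < B"
      using memory_size_less_B(3,4) assms(5,7) by (simp_all add: v_def flip: of_nat_mult)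
    have "u mod q = w \<and> u div q < Suc j \<longleftrightarrow> u mod q = w \<and> u div q < j \<or> u = v" for u
      using assms(5) div_mult_mod_eq[of u q] by (auto simp: v_def less_Suc_eq)
    then have S_Suc: "?S (Suc j) = insert v (?S j)" by auto
    let ?Q = "\<lambda>s''. marked (?S (Suc j)) (s''\<lparr>reg := (reg s'')(r_index := int (Suc j))\<rparr>)"
    let ?s = "s'\<lparr>reg := (reg s')(r_off := int v)\<rparr>"
    have "prepared ?s" using s' by (simp add: prepared_def)
    then have "runs B memory_size (Put (V r_marks [+] V r_off) (N 1)) 0 ?Q ?s" if "v < block_length"
      using that j(4) S_Suc by (intro runs_conseq[OF runs_put_mark]) (auto simp: marked_def)
    moreover have "?Q ?s" if "\<not> v < block_length" using that j(4) S_Suc by (auto simp: marked_def)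
    ultimately have "runs B memory_size ?mark 0 ?Q ?s"
      using preparedD(4)[OF s'] by (cases "v < block_length") (simp_all add: runs_Cond runs_Skip)
    then show "runs B memory_size ?body 0 (\<lambda>s''. marked (?S (Suc j)) (s''\<lparr>reg := (reg s'')(r_index := int (Suc j))\<rparr>)) s'"
      using frameD(1)[OF j(2)] assms(3,4) j(3) v by (simp add: runs_simps v_def)
  next
    fix s' assume "marked (?S (max 0 (block_length div q + 1))) s'"
    moreover have "u div q < block_length div q + 1" if "u < block_length" for u
      using that div_le_mono[of u block_length q] by simp
    ultimately show "marked (S \<union> {u. u mod q = w}) s'" by (auto simp: marked_def)
  qed (use assms quotient \<open>block_length div q < block_length\<close> preparedD(4)[OF assms(1)] memory_size_less_B(3) in \<open>auto simp: marked_def\<close>)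
qed

lemma runs_cross_prog:
  assumes "prepared s" "marked S s" "reg s r_residue = int w" "reg s r_q = int q" "reg s r_val = z"
    "w < q" "2 \<le> q" "q \<le> y"
  shows "runs B memory_size cross_prog (if int q dvd z then block_length div q + 1 else 0)
    (marked (S \<union> {u. u mod q = w \<and> int q dvd z})) s"
proof (cases "int q dvd z")
  case True
  have "runs B memory_size mark_prog (block_length div q + 1) (marked (S \<union> {u. u mod q = w})) s"
    by (rule runs_mark_prog) (fact assms)+
  then show ?thesis using True assms(4,5,7) by (simp add: cross_prog_def runs_simps)
next
  case False
  then show ?thesis using assms(2,4,5,7) by (simp add: cross_prog_def runs_simps dvd_eq_mod_eq_0)
qed

lemma runs_offsets_prog:
  assumes s: "prepared s" "marked S s" "reg s r_class = int r" "reg s r_block = int T" "reg s r_form = int i" "reg s r_q = int q"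
    and bounds: "i < k" "2 \<le> q" "q \<le> y" "block_start r T"
  shows "runs B memory_size offsets_prog (form_cost r T q i) (marked (S \<union> {u. int q dvd form i (pos r (T + u))})) s"
proof -
  let ?S = "\<lambda>w. S \<union> {u. u mod q < w \<and> int q dvd form i (pos r (T + u))}"
  let ?loop = "FOR r_residue FROM N 0 TO V r_q DO (locate_prog r_residue;; load_form_prog;; cross_prog)"
  have "q \<le> block_length" using bounds(3) by (simp add: block_length_def le_square order_trans)
  show ?thesis
    unfolding offsets_prog_def
  proof (rule runs_For[where I = "\<lambda>w. marked (?S w)" and lo = 0 and hi = q and T = "offset_cost r T i q"])
    fix w s' assume w: "w < q" "frame ?loop s s'" "reg s' r_residue = int w" "marked (?S w) s'"
    let ?z = "form i (pos r (T + w))" and ?t = "offset_cost r T i q w"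
    let ?Q = "\<lambda>s''. marked (?S (Suc w)) (s''\<lparr>reg := (reg s'')(r_residue := int (Suc w))\<rparr>)"
    have s': "prepared s'" by (rule prepared_frame[OF s(1) w(2)]) auto
    have r: "reg s' r_class = int r" "reg s' r_block = int T" "reg s' r_form = int i" "reg s' r_q = int q"
      using frameD(1)[OF w(2)] s(3-6) by simp_all
    have "w < block_length" using w(1) \<open>q \<le> block_length\<close> by simp
    have "int q dvd form i (pos r (T + u)) \<longleftrightarrow> int q dvd ?z" if "u mod q = w" for u
      using dvd_form_pos_mod[of q i r T u] that by simp
    then have S_Suc: "?S (Suc w) = ?S w \<union> {u. u mod q = w \<and> int q dvd ?z}"
      by (auto simp: less_Suc_eq)
    show "runs B memory_size (locate_prog r_residue;; load_form_prog;; cross_prog) ?t ?Q s'"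
    proof (rule runs_Seq[OF runs_locate_prog[OF s' r(1,2) w(3) bounds(4) \<open>w < block_length\<close>], where T'' = ?t])
      fix u assume u: "frame (locate_prog r_residue) s' u" "reg u r_pos = pos r (T + w)"
      have "prepared u" by (rule prepared_frame[OF s' u(1)]) auto
      show "runs B memory_size (load_form_prog;; cross_prog) ?t ?Q u"
      proof (rule runs_Seq[OF runs_load_form_prog[OF _ _ bounds(1) u(2)], where T'' = ?t])
        fix v assume v: "frame load_form_prog u v" "reg v r_val = ?z"
        have "prepared v" by (rule prepared_frame[OF \<open>prepared u\<close> v(1)]) auto
        then show "runs B memory_size cross_prog ?t ?Q v"
          by (rule runs_conseq[OF runs_cross_prog[where S = "?S w" and w = w and q = q]])
            (use w frameD[OF u(1)] frameD[OF v(1)] v(2) r bounds(2,3) S_Suc in \<open>auto simp: marked_def offset_cost_def\<close>)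
      qed (use w(4) frameD[OF u(1)] r pos_bounds(4)[OF bounds(4) \<open>w < block_length\<close>] in \<open>auto simp: marked_def\<close>)
    qed simp
  qed (use s bounds y_less_B(1) in \<open>auto simp: marked_def form_cost_def lessThan_atLeast0\<close>)
qed

lemma runs_forms_prog:
  assumes s: "prepared s" "marked S s" "reg s r_class = int r" "reg s r_block = int T" "reg s r_q = int q"
    and bounds: "2 \<le> q" "q \<le> y" "block_start r T"
  shows "runs B memory_size forms_prog (\<Sum>i<k. 1 + form_cost r T q i) (marked (S \<union> {u. hits q (pos r (T + u))})) s"
  unfolding forms_prog_def
proof (rule runs_For[where lo = 0 and hi = k and T = "form_cost r T q" and
      I = "\<lambda>i. marked (S \<union> {u. \<exists>j<i. int q dvd form j (pos r (T + u))})"])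
  fix i s' assume i: "i < k" "frame (FOR r_form FROM N 0 TO V r_forms DO offsets_prog) s s'" "reg s' r_form = int i"
    "marked (S \<union> {u. \<exists>j<i. int q dvd form j (pos r (T + u))}) s'"
  have s': "prepared s'" by (rule prepared_frame[OF s(1) i(2)]) auto
  show "runs B memory_size offsets_prog (form_cost r T q i) (\<lambda>s''. marked
      (S \<union> {u. \<exists>j<Suc i. int q dvd form j (pos r (T + u))}) (s''\<lparr>reg := (reg s'')(r_form := int (Suc i))\<rparr>)) s'"
    by (rule runs_conseq[OF runs_offsets_prog[OF s' i(4) _ _ i(3) _ i(1) bounds]])
      (use frameD(1)[OF i(2)] s(3-5) in \<open>auto simp: marked_def less_Suc_eq\<close>)
qed (use s preparedD(1)[OF s(1)] memory_size_less_B(2) in \<open>auto simp: marked_def hits_def lessThan_atLeast0 base_def\<close>)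

lemma runs_sieve_prog:
  assumes s: "prepared s" "marked {} s" "reg s r_class = int r" "reg s r_block = int T" and "block_start r T"
  shows "runs B memory_size sieve_prog (\<Sum>q\<in>{2..<y + 1}. prime_cost r T q)
    (marked {u. \<not> avoids_upto y (pos r (T + u))}) s"
proof -
  let ?S = "\<lambda>q. {u. \<exists>p<q. prime p \<and> hits p (pos r (T + u))}"
  let ?cross = "IF V r_isprime [=] N 1 THEN forms_prog ELSE Skip"
  let ?loop = "FOR r_q FROM N 2 TO V r_root [+] N 1 DO (r_cand ::= V r_q;; prime_prog;; ?cross)"
  show ?thesis
    unfolding sieve_prog_def
  proof (rule runs_For[where I = "\<lambda>q. marked (?S q)" and lo = 2 and hi = "y + 1" and T = "\<lambda>q. prime_cost r T q - 1"])
    fix q s' assume q: "2 \<le> q" "q < y + 1" "frame ?loop s s'" "reg s' r_q = int q" "marked (?S q) s'"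
    let ?Q = "\<lambda>s''. marked (?S (Suc q)) (s''\<lparr>reg := (reg s'')(r_q := int (Suc q))\<rparr>)"
    let ?s = "s'\<lparr>reg := (reg s')(r_cand := int q)\<rparr>"
    have S_Suc: "?S (Suc q) = ?S q \<union> (if prime q then {u. hits q (pos r (T + u))} else {})"
      by (auto simp: less_Suc_eq)
    have "prepared s'" by (rule prepared_frame[OF s(1) q(3)]) auto
    then have prepared: "prepared ?s" by (simp add: prepared_def)
    have "runs B memory_size (prime_prog;; ?cross) (prime_cost r T q - 1) ?Q ?s"
    proof (rule runs_Seq[OF runs_prime_prog, where T'' = "prime_cost r T q - 1 - q"])
      fix u assume u: "frame prime_prog ?s u" "reg u r_isprime = of_bool (prime q)"
      have regs: "prepared u" "reg u r_class = int r" "reg u r_block = int T" "reg u r_q = int q" "marked (?S q) u"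
        using prepared_frame[OF prepared u(1)] frameD[OF u(1)] frameD(1)[OF q(3)] s(3,4) q(4,5)
        by (simp_all add: marked_def)
      show "runs B memory_size ?cross (prime_cost r T q - 1 - q) ?Q u"
      proof (cases "prime q")
        case True
        have "runs B memory_size forms_prog (prime_cost r T q - 1 - q) ?Q u"
          by (rule runs_conseq[OF runs_forms_prog[OF regs(1,5,2-4) q(1) _ assms(5)]])
            (use q(2) True S_Suc in \<open>auto simp: prime_cost_def marked_def\<close>)
        then show ?thesis using u(2) True by (simp add: runs_simps)
      next
        case False
        then show ?thesis using u(2) regs(5) S_Suc by (simp add: runs_simps marked_def)
      qed
    qed (use q(1,2) y_less_B(1) in \<open>auto simp: prime_cost_def\<close>)
    then show "runs B memory_size (r_cand ::= V r_q;; prime_prog;; ?cross) (prime_cost r T q - 1) ?Q s'"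
      using q(4) by (simp add: runs_simps)
  next
    have "?S 2 = {}" by (auto dest: prime_ge_2_nat)
    then show "marked (?S 2) (s\<lparr>reg := (reg s)(r_q := int 2)\<rparr>)"
      using s(2) by (simp add: marked_def)
  next
    fix s' assume "marked (?S (max 2 (y + 1))) s'"
    moreover have "max 2 (y + 1) = Suc y" using y_bounds(1) by simp
    ultimately show "marked {u. \<not> avoids_upto y (pos r (T + u))} s'"
      by (auto simp: marked_def less_Suc_eq_le)
  qed (use preparedD(2)[OF s(1)] y_less_B(1) in \<open>auto simp: prime_cost_def\<close>)
qed
lemma runs_scan_step:
  assumes s: "prepared s" "reg s r_class = int r" "reg s r_block = int T" "reg s r_off = int u"
    "marked {u. \<not> avoids_upto y (pos r (T + u))} s" and block: "block_start r T" and u: "u < block_length"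
  shows "runs B memory_size (scan_step K) (survivor_cost r (T + u))
    (\<lambda>s'. set (printed s') = set (printed s) \<union> found r {T + u}) s"
proof -
  let ?x = "pos r (T + u)" and ?t = "survivor_cost r (T + u)"
  let ?Q = "\<lambda>s'. set (printed s') = set (printed s) \<union> found r {T + u}"
  let ?test = "IF V r_mark [=] N 0 THEN (locate_prog r_off;; report_prog (tests_prog K)) ELSE Skip"
  have mark: "mem s (base + u) = of_bool (\<not> avoids_upto y ?x)" using s(5) u by (simp add: marked_def)
  define s1 where "s1 = s\<lparr>reg := (reg s)(r_mark := mem s (base + u)), cells := max (cells s) (Suc (base + u))\<rparr>"
  have s1: "prepared s1" "input_memory (mem s1)" "reg s1 r_class = int r" "reg s1 r_block = int T" "reg s1 r_off = int u"
    using s by (simp_all add: s1_def prepared_def marked_def)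
  have "runs B memory_size ?test ?t ?Q s1"
  proof (cases "avoids_upto y ?x")
    case False
    have "\<not> all_prime ?x" using False avoids_upto_if_all_prime pos_bounds(3)[OF block u] by blast
    then show ?thesis using False mark by (auto simp: s1_def runs_simps found_def)
  next
    case True
    have "runs B memory_size (locate_prog r_off;; report_prog (tests_prog K)) ?t ?Q s1"
    proof (rule runs_Seq[OF runs_locate_prog[OF s1(1,3-5) block u], where T'' = ?t])
      fix v assume v: "frame (locate_prog r_off) s1 v" "reg v r_pos = ?x"
      have "prepared v" by (rule prepared_frame[OF s1(1) v(1)]) auto
      show "runs B memory_size (report_prog (tests_prog K)) ?t ?Q v"
      proof (rule runs_conseq[OF runs_report_prog[OF v(2) preparedD(7)[OF \<open>prepared v\<close>], where T = ?t]])
        assume "?x \<le> hi"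
        moreover from this have "?t = k * (test_cost + 1)" using True by (simp add: survivor_cost_def)
        ultimately show "runs B memory_size (tests_prog K) ?t (\<lambda>s'. reg s' r_all = of_bool (all_prime ?x)) v"
          using runs_tests_prog[OF \<open>prepared v\<close> _ v(2) pos_bounds(3)[OF block u] _ True] frameD(2)[OF v(1)] s1(2) by simp
      qed (use frameD(3)[OF v(1)] in \<open>auto simp: s1_def found_def\<close>)
    qed simp
    then show ?thesis using True mark by (simp add: runs_simps s1_def)
  qed
  moreover have "nat (int base + int u) = base + u" by simp
  ultimately show ?thesis
    unfolding scan_step_def
      using preparedD(9)[OF s(1)] s(4) base_less[OF u] by (simp add: runs_simps s1_def)
qed

lemma runs_scan_prog:
  assumes s: "prepared s" "reg s r_class = int r" "reg s r_block = int T"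
    "marked {u. \<not> avoids_upto y (pos r (T + u))} s" and block: "block_start r T"
  shows "runs B memory_size (scan_prog K) (block_length + (\<Sum>u<block_length. survivor_cost r (T + u)))
    (\<lambda>s'. set (printed s') = set (printed s) \<union> found r {T..<T + block_length}) s"
  unfolding scan_prog_def
proof (rule runs_For[where lo = 0 and hi = block_length and T = "\<lambda>u. survivor_cost r (T + u)" and
      I = "\<lambda>u s'. set (printed s') = set (printed s) \<union> found r {T..<T + u}"])
  fix u s' assume u: "u < block_length" "frame (FOR r_off FROM N 0 TO V r_length DO scan_step K) s s'" "reg s' r_off = int u"
    "set (printed s') = set (printed s) \<union> found r {T..<T + u}"
  have "prepared s'" by (rule prepared_frame[OF s(1) u(2)]) auto
  moreover have "{T..<T + Suc u} = {T..<T + u} \<union> {T + u}" by auto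
  then have "found r {T..<T + Suc u} = found r {T..<T + u} \<union> found r {T + u}"
    by (simp only: found_Un)
  ultimately show "runs B memory_size (scan_step K) (survivor_cost r (T + u)) (\<lambda>s''.
      set (printed (s''\<lparr>reg := (reg s'')(r_off := int (Suc u))\<rparr>)) = set (printed s) \<union> found r {T..<T + Suc u}) s'"
    using u frameD[OF u(2)] s(2-4) block
    by (intro runs_conseq[OF runs_scan_step[of s' r T u]]) (auto simp: marked_def)
qed (use s preparedD(4)[OF s(1)] memory_size_less_B(3) in \<open>auto simp: found_def sum_Suc lessThan_atLeast0\<close>)

lemma runs_block_prog:
  assumes "prepared s" "input_memory (mem s)" "reg s r_class = int r" "reg s r_block = int T" "block_start r T"
  shows "runs B memory_size (block_prog K) (2 * block_length + (\<Sum>q\<in>{2..<y + 1}. prime_cost r T q) + (\<Sum>u<block_length. survivor_cost r (T + u)))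
    (\<lambda>s'. input_memory (mem s') \<and> set (printed s') = set (printed s) \<union> found r {T..<T + block_length}) s"
proof -
  let ?sieve = "\<Sum>q\<in>{2..<y + 1}. prime_cost r T q" and ?scan = "\<Sum>u<block_length. survivor_cost r (T + u)"
  let ?Q = "\<lambda>s'. input_memory (mem s') \<and> set (printed s') = set (printed s) \<union> found r {T..<T + block_length}"
  show ?thesis
    unfolding block_prog_def
  proof (rule runs_Seq[OF runs_clear_prog[OF assms(1,2)], where T'' = "?sieve + (block_length + ?scan)"])
    fix u assume u: "frame clear_prog s u" "marked {} u"
    have "prepared u" by (rule prepared_frame[OF assms(1) u(1)]) auto
    have "runs B memory_size sieve_prog ?sieve (marked {v. \<not> avoids_upto y (pos r (T + v))}) u"
      using u(2) \<open>prepared u\<close> frameD[OF u(1)] assms(3-5) by (intro runs_sieve_prog) simp_all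
    then show "runs B memory_size (sieve_prog;; scan_prog K) (?sieve + (block_length + ?scan)) ?Q u"
    proof (rule runs_Seq)
      fix v assume v: "frame sieve_prog u v" "marked {v. \<not> avoids_upto y (pos r (T + v))} v"
      have "prepared v" by (rule prepared_frame[OF \<open>prepared u\<close> v(1)]) auto
      then show "runs B memory_size (scan_prog K) (block_length + ?scan) ?Q v"
        by (rule runs_conseq[OF runs_scan_prog[of v r T]])
          (use v frameD[OF u(1)] frameD[OF v(1)] assms(3-5) in \<open>auto simp: frameD(2) marked_def\<close>)
    qed simp
  qed simp
qed
lemma block_start_if_less_blocks:
  assumes "r < wheel" "start \<le> hi" "j < blocks"
  shows "block_start r (j * block_length)" "int (j * block_length) < B"
proof -
  have "j * (wheel * block_length) \<le> nat (hi - start) div (wheel * block_length) * (wheel * block_length)"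
    using assms(3) by (intro mult_le_mono1) (simp add: blocks_def)
  also have "\<dots> \<le> nat (hi - start)" by (rule div_times_less_eq_dividend)
  finally have "int (wheel * (j * block_length)) \<le> hi - start"
    using assms(2) by (simp add: le_nat_iff mult_ac)
  then show "block_start r (j * block_length)" using assms(1) by (simp add: block_start_def)
  have "int (j * block_length) \<le> int (wheel * (j * block_length))"
    using wheel_bounds(1) by (intro of_nat_mono) simp
  also have "\<dots> \<le> W ^ 3"
    using \<open>int (wheel * (j * block_length)) \<le> hi - start\<close> abs_hi_le abs_lo_le y_less_W W_square(1) W(1) four_times_power[of 2 3]
    by (simp add: start_def)
  finally show "int (j * block_length) < B" by (rule less_B_if_le_power) simp
qed

lemma blocks_eq:
  assumes "start \<le> hi"
  shows "(hi - start) div (int wheel * int block_length) + 1 = int blocks"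
  using assms by (simp add: blocks_def zdiv_int)

lemma blocks_bounded:
  assumes "start \<le> hi"
  shows "\<bar>hi - start\<bar> + 1 < B" "int blocks < B"
proof -
  have "\<bar>hi - start\<bar> \<le> 5 * W" using abs_hi_le abs_lo_le y_less_W by (simp add: start_def)
  then show width: "\<bar>hi - start\<bar> + 1 < B"
    using W(1) W_square(1) four_times_power[of 2 3] less_B_if_le_power[of "\<bar>hi - start\<bar> + 1" 3]
    by linarith
  have "int (nat (hi - start) div (wheel * block_length)) \<le> int (nat (hi - start))"
    by (simp only: of_nat_le_iff div_le_dividend)
  then show "int blocks < B" using width assms by (simp add: blocks_def)
qed

lemma blocks_product_bounded: "int wheel * int block_length < B"
proof -
  have "int wheel * int block_length \<le> W * W\<^sup>2"
    using wheel_bounds(2) y_less_W block_length_le W(1) by (intro mult_mono) auto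
  then show ?thesis
    using less_B_if_le_power[of "int wheel * int block_length" 3]
    by (simp add: power2_eq_square power3_eq_cube)
qed

lemma runs_class_prog:
  assumes "prepared s" "input_memory (mem s)" "reg s r_class = int r" "r < wheel" "admissible r"
  shows "runs B memory_size (class_prog K) (class_cost r)
    (\<lambda>s'. input_memory (mem s') \<and> set (printed s') = set (printed s) \<union> found r UNIV) s"
    (is "runs B _ _ _ ?Q s")
proof (cases "hi < start")
  case True
  then have "\<not> pos r u \<le> hi" for u using pos_ge_start[of r u] by simp
  then have "found r UNIV = {}" by (auto simp: found_def)
  then show ?thesis using True assms(1,2) by (simp add: class_prog_def runs_simps preparedD)
next
  case False
  let ?loop = "FOR r_segment FROM N 0 TO V r_blocks DO (r_block ::= V r_segment [*] V r_length;; block_prog K)"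
  let ?I = "\<lambda>j s'. input_memory (mem s') \<and> set (printed s') = set (printed s) \<union> found r {..<j * block_length}"
  let ?T = "\<lambda>j. 2 * block_length + sieve_cost + (\<Sum>u<block_length. survivor_cost r (j * block_length + u))"
  let ?s = "s\<lparr>reg := (reg s)(r_blocks := int blocks)\<rparr>"
  have prepared: "prepared ?s" using assms(1) by (simp add: prepared_def)
  note blocks = blocks_eq[OF False[unfolded not_less]] and bounded = blocks_bounded[OF False[unfolded not_less]]
  have "runs B memory_size ?loop (class_cost r) ?Q ?s"
  proof (rule runs_For[where I = ?I and lo = 0 and hi = blocks and T = ?T])
    fix j s' assume j: "j < blocks" "frame ?loop ?s s'" "reg s' r_segment = int j" "?I j s'"
    have s': "prepared s'" by (rule prepared_frame[OF prepared j(2)]) auto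
    note bounds = block_start_if_less_blocks[OF assms(4) _ j(1)]
    let ?s' = "s'\<lparr>reg := (reg s')(r_block := int (j * block_length))\<rparr>"
    have "prepared ?s'" using s' by (simp add: prepared_def)
    have "{..<Suc j * block_length} = {..<j * block_length} \<union> {j * block_length..<j * block_length + block_length}" by auto
    then have found_Suc: "found r {..<Suc j * block_length} = found r {..<j * block_length} \<union> found r {j * block_length..<j * block_length + block_length}"
      by (simp only: found_Un)
    have "runs B memory_size (block_prog K) (?T j) (\<lambda>s''. ?I (Suc j) (s''\<lparr>reg := (reg s'')(r_segment := int (Suc j))\<rparr>)) ?s'"
    proof (rule runs_conseq[OF runs_block_prog[OF \<open>prepared ?s'\<close>, of r "j * block_length"]])
      show "reg ?s' r_class = int r" using frameD(1)[OF j(2)] assms(3) by simp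
      show "block_start r (j * block_length)" using bounds(1) False by simp
    qed (use j(4) found_Suc sum_prime_cost_le[OF assms(5), of "j * block_length"] in \<open>auto simp del: sum.op_ivl_Suc\<close>)
    then show "runs B memory_size (r_block ::= V r_segment [*] V r_length;; block_prog K) (?T j)
        (\<lambda>s''. ?I (Suc j) (s''\<lparr>reg := (reg s'')(r_segment := int (Suc j))\<rparr>)) s'"
      using j(3) preparedD(4)[OF s'] bounds(2) False by (simp add: runs_simps)
  qed (use assms(2) sum_block_costs_le bounded(2) found_lessThan_blocks in
      \<open>auto simp: found_def lessThan_atLeast0\<close>)
  then show ?thesis
    unfolding class_prog_def
      using False assms(1) blocks bounded blocks_product_bounded wheel_bounds(1) block_length_pos
    by (simp add: runs_simps preparedD)
qed

lemma runs_classes_prog: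
  assumes "prepared s" "input_memory (mem s)"
  shows "runs B memory_size (classes_prog K) classes_cost
    (\<lambda>s'. set (printed s') = set (printed s) \<union> (\<Union>r<wheel. found r UNIV)) s"
proof -
  let ?I = "\<lambda>r s'. input_memory (mem s') \<and> set (printed s') = set (printed s) \<union> (\<Union>r'<r. found r' UNIV)"
  let ?T = "\<lambda>r. k * (y + 1) + of_bool (admissible r) * class_cost r"
  let ?search = "IF V r_all [=] N 1 THEN class_prog K ELSE Skip"
  let ?loop = "FOR r_class FROM N 0 TO V r_wheel DO (admissible_prog;; ?search)"
  show ?thesis
    unfolding classes_prog_def
  proof (rule runs_For[where I = ?I and lo = 0 and hi = wheel and T = ?T])
    fix r s' assume r: "r < wheel" "frame ?loop s s'" "reg s' r_class = int r" "?I r s'"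
    let ?Q = "\<lambda>s''. ?I (Suc r) (s''\<lparr>reg := (reg s'')(r_class := int (Suc r))\<rparr>)"
    have s': "prepared s'" by (rule prepared_frame[OF assms(1) r(2)]) auto
    have found_Suc: "(\<Union>r'<Suc r. found r' UNIV) = (\<Union>r'<r. found r' UNIV) \<union> found r UNIV"
      by (auto simp: less_Suc_eq)
    show "runs B memory_size (admissible_prog;; ?search) (?T r) ?Q s'"
    proof (rule runs_Seq[OF runs_admissible_prog[OF s' _ r(3,1)], where T'' = "of_bool (admissible r) * class_cost r"])
      fix u assume u: "frame admissible_prog s' u" "reg u r_all = of_bool (admissible r)"
      have "prepared u" by (rule prepared_frame[OF s' u(1)]) auto
      show "runs B memory_size ?search (of_bool (admissible r) * class_cost r) ?Q u"
      proof (cases "admissible r")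
        case True
        have "runs B memory_size (class_prog K) (class_cost r) ?Q u"
          by (rule runs_conseq[OF runs_class_prog[OF \<open>prepared u\<close> _ _ r(1) True]])
            (use r(3,4) frameD[OF u(1)] found_Suc in auto)
        then show ?thesis using u(2) True by (simp add: runs_simps)
      next
        case False
        then show ?thesis
          using u(2) r(4) frameD[OF u(1)] found_eq_empty_if_not_admissible found_Suc
          by (simp add: runs_simps)
      qed
    qed (use r(4) in auto)
  next
    have "int wheel < B" using wheel_bounds(2) y_less_B(1) by linarith
    then show "int wheel < B" .
  qed (use assms preparedD(3)[OF assms(1)] in \<open>auto simp: classes_cost_def lessThan_atLeast0\<close>)
qed

end
definition prepare_prog :: "nat \<Rightarrow> com" where
  "prepare_prog K =
    Get r_forms (N 0);;
    Get r_n (N 1);;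
    root_prog K;;
    wheel_prog;;
    bound_prog;;
    range_prog;;
    r_start ::= V r_lo [+] V r_root;;
    r_marks ::= N 2 [+] N 2 [*] V r_forms"

definition main_prog :: "nat \<Rightarrow> com" where
  "main_prog K = prepare_prog K;; small_prog;; classes_prog K"

context sieve_run
begin

lemma runs_prepare_prog:
  assumes "input_memory (mem s)"
  shows "runs B memory_size (prepare_prog K) (K + y * (K + 1) + (y + 1) * (y + 1) + bound_cost + k)
    (\<lambda>s'. prepared s' \<and> mem s' = mem s \<and> printed s' = printed s) s"
    (is "runs B _ _ _ ?Q s")
proof -
  define s0 where "s0 = s\<lparr>reg := (reg s)(r_forms := int k, r_n := int n), cells := max (max (cells s) (Suc 0)) (Suc (Suc 0))\<rparr>"
  have s0: "reg s0 r_forms = int k" "reg s0 r_n = int n" "mem s0 = mem s" "printed s0 = printed s"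
    by (simp_all add: s0_def)
  let ?finish = "r_start ::= V r_lo [+] V r_root;; r_marks ::= N 2 [+] N 2 [*] V r_forms"
  have "runs B memory_size (root_prog K;; wheel_prog;; bound_prog;; range_prog;; ?finish)
    (K + y * (K + 1) + ((y + 1) * (y + 1) + (bound_cost + (k + 0)))) ?Q s0"
  proof (rule runs_Seq[OF runs_root_prog[OF s0(2)] _ order_refl])
    fix s1 assume s1: "frame (root_prog K) s0 s1" "reg s1 r_root = int y"
    show "runs B memory_size (wheel_prog;; bound_prog;; range_prog;; ?finish)
        ((y + 1) * (y + 1) + (bound_cost + (k + 0))) ?Q s1"
    proof (rule runs_Seq[OF runs_wheel_prog[OF s1(2)] _ order_refl])
      fix s2 assume s2: "frame wheel_prog s1 s2" "reg s2 r_wheel = int wheel"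
      have "reg s2 r_root = int y" "reg s2 r_n = int n"
        using frameD(1)[OF s1(1)] frameD(1)[OF s2(1)] s1(2) s0(2) by simp_all
      note runs_bound_prog[OF this, of memory_size]
      then show "runs B memory_size (bound_prog;; range_prog;; ?finish) (bound_cost + (k + 0)) ?Q s2"
      proof (rule runs_Seq[OF _ _ order_refl])
        fix s3 assume s3: "frame bound_prog s2 s3" "reg s3 r_length = int block_length \<and> reg s3 r_maxbase = int (nonresidue_bound (n div y))"
        note frames = frameD[OF s1(1)] frameD[OF s2(1)] frameD[OF s3(1)]
        have "input_memory (mem s3)" "reg s3 r_forms = int k" "reg s3 r_n = int n"
          using assms s0 by (simp_all add: frames)
        note runs_range_prog[OF this]
        then show "runs B memory_size (range_prog;; ?finish) (k + 0) ?Q s3"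
        proof (rule runs_Seq[OF _ _ order_refl])
          fix s4 assume s4: "frame range_prog s3 s4" "reg s4 r_lo = lo \<and> reg s4 r_hi = hi"
          note frames = frames frameD[OF s4(1)]
          have "\<bar>lo + int y\<bar> < B" using abs_lo_le y_less_W W_square(2) by linarith
          moreover have "2 * int k + 2 < B" using W(1,2) W_square(2) by linarith
          ultimately show "runs B memory_size ?finish 0 ?Q s4"
            using s0 s1(2) s2(2) s3(2) s4(2)
            by (simp add: runs_simps frames prepared_def start_def base_def)
        qed
      qed
    qed
  qed
  moreover have "memory_size > 1" "1 < B" using W(1) W_square(2) by (simp_all add: memory_size_def)
  ultimately show ?thesis
    using assms by (simp add: prepare_prog_def runs_simps input_memory_def s0_def add.assoc)
qed

lemma runs_main_prog:
  assumes "input_memory (mem s)"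
  shows "runs B memory_size (main_prog K) total_cost
    (\<lambda>s'. set (printed s') = set (printed s) \<union> {x. lo \<le> x \<and> x \<le> hi \<and> all_prime x}) s"
    (is "runs B _ _ _ ?Q s")
  unfolding main_prog_def
proof (rule runs_Seq[OF runs_prepare_prog[OF assms]])
  let ?small = "y * (k * (start_form_sum + 1) + 1)"
  fix s1 assume s1: "prepared s1 \<and> mem s1 = mem s \<and> printed s1 = printed s"
  then have "runs B memory_size small_prog ?small
    (\<lambda>s'. set (printed s') = set (printed s) \<union> {x. lo \<le> x \<and> x < start \<and> x \<le> hi \<and> all_prime x}) s1"
    using assms runs_small_prog[of s1] by simp
  then show "runs B memory_size (small_prog;; classes_prog K) (?small + classes_cost) ?Q s1"
  proof (rule runs_Seq[OF _ _ order_refl])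
    fix s2 assume s2: "frame small_prog s1 s2"
      "set (printed s2) = set (printed s) \<union> {x. lo \<le> x \<and> x < start \<and> x \<le> hi \<and> all_prime x}"
    have "prepared s2" using s1 by (intro prepared_frame[OF _ s2(1)]) auto
    moreover have "input_memory (mem s2)" using s1 assms frameD(2)[OF s2(1)] by simp
    moreover have "{x. lo \<le> x \<and> x \<le> hi \<and> all_prime x} =
      {x. lo \<le> x \<and> x < start \<and> x \<le> hi \<and> all_prime x} \<union> {x. start \<le> x \<and> x \<le> hi \<and> all_prime x}"
      by (auto simp: start_def)
    ultimately show "runs B memory_size (classes_prog K) classes_cost ?Q s2"
      using s2(2) by (intro runs_conseq[OF runs_classes_prog]) (simp_all add: UN_found Un_assoc)
  qed
qed (simp add: total_cost_def)

end

section \<open>The pattern program\<close>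

definition pattern_program :: "nat \<Rightarrow> program" where
  "pattern_program K = code 60 (main_prog K) 0 @ [Halt]"

lemmas program_defs = main_prog_def prepare_prog_def root_prog_def root_step_def wheel_prog_def wheel_step_def
  bound_prog_def bound_step_def range_prog_def form_range_prog_def coefficients_prog_def prime_prog_def
  powmod_prog_def pow_prog_def ispow_prog_def floor_root_prog_def bisect_prog_def nonresidue_prog_def
  nonresidue_step_def test_prog_def powers_prog_def witness_prog_def half_power_prog_def bases_prog_def
  small_prog_def report_prog_def naive_prog_def every_form_prog_def load_form_prog_def classes_prog_def
  admissible_prog_def coprime_prog_def class_prog_def block_prog_def clear_prog_def sieve_prog_def forms_prog_def
  offsets_prog_def locate_prog_def cross_prog_def mark_prog_def scan_prog_def scan_step_def tests_prog_def For_def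

lemma vars_main_prog: "vars (main_prog K) \<subseteq> {..<60}"
  by (simp add: program_defs)

lemma constants_main_prog: "constants (main_prog K) \<subseteq> {0, 1, 2, 3, 5, 8, 9, int K, int K + 1}"
  by (simp add: program_defs)

lemma abs_less_two_power_floorlog: "\<bar>v\<bar> < 2 ^ floorlog 2 (nat \<bar>v\<bar>)"
proof (cases "v = 0")
  case False
  then have "nat \<bar>v\<bar> < 2 ^ floorlog 2 (nat \<bar>v\<bar>)"
    using floorlog_bounds[of "nat \<bar>v\<bar>" 2] by simp
  then have "int (nat \<bar>v\<bar>) < int (2 ^ floorlog 2 (nat \<bar>v\<bar>))"
    by (simp only: of_nat_less_iff)
  then show ?thesis by simp
qed simp

definition slope :: "int poly list \<Rightarrow> nat \<Rightarrow> int" where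
  "slope P i = coeff (P ! i) 1"

definition intercept :: "int poly list \<Rightarrow> nat \<Rightarrow> int" where
  "intercept P i = coeff (P ! i) 0"

lemma nth_coefficient_pairs:
  assumes "i < length P"
  shows "concat (map (\<lambda>f. [g f, h f]) P) ! (2 * i) = g (P ! i)"
    and "concat (map (\<lambda>f. [g f, h f]) P) ! Suc (2 * i) = h (P ! i)"
  using assms by (induction P arbitrary: i) (auto simp: nth_Cons split: nat.splits)

lemma length_pattern_input: "length (pattern_input P n) = 2 + 2 * length P"
  by (simp add: pattern_input_def length_concat comp_def sum_list_triv)

lemma poly_degree_1:
  fixes f :: "'a::comm_semiring_1 poly"
  assumes "degree f = 1"
  shows "f = [:coeff f 0, coeff f 1:]"
proof (rule poly_eqI)
  fix j :: nat
  have "coeff f j = 0" if "1 < j" using that assms by (intro coeff_eq_0) simp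
  then show "coeff f j = coeff [:coeff f 0, coeff f 1:] j"
    by (cases j rule: nat.exhaust; cases "j - 1") auto
qed

locale pattern =
  fixes P :: "int poly list"
  assumes pattern: "is_pattern P" "2 < length P"
begin

abbreviation "k \<equiv> length P"

lemma
  assumes "i < k"
  shows nth_pattern: "P ! i = [:intercept P i, slope P i:]"
    and slope_pos: "0 < slope P i"
proof -
  have "degree (P ! i) = 1" "0 < lead_coeff (P ! i)"
    using pattern(1) nth_mem[OF assms] by (auto simp: is_pattern_def)
  then show "P ! i = [:intercept P i, slope P i:]" "0 < slope P i"
    using poly_degree_1[of "P ! i"] by (simp_all add: slope_def intercept_def)
qed

sublocale linear_forms k "slope P" "intercept P"
proof
  show "0 < k" using pattern(2) by linarith
  fix i j assume ij: "i < k" "j < k" "i \<noteq> j"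
  have "distinct P" using pattern(1) by (simp add: is_pattern_def)
  then have "P ! i \<noteq> P ! j" using ij by (simp add: nth_eq_iff_index_eq)
  then show "(slope P i, intercept P i) \<noteq> (slope P j, intercept P j)"
    using nth_pattern[OF ij(1)] nth_pattern[OF ij(2)] by auto
qed (rule slope_pos)

lemma poly_eq_form:
  assumes "i < k"
  shows "poly (P ! i) x = form i x"
  by (simp add: nth_pattern[OF assms] form_def mult.commute)

end

locale pattern_run = pattern P for P :: "int poly list" +
  fixes K n :: nat
  assumes K_ge_6: "6 \<le> K"
begin

sublocale pattern_search k "slope P" "intercept P" K n
  by unfold_locales (use K_ge_6 in simp)

lemma prime_pattern_positions_eq: "prime_pattern_positions P n = {x. lo \<le> x \<and> x \<le> hi \<and> all_prime x}"
proof -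
  have "set P \<noteq> {}" using pattern(2) by auto
  then have "Max ((\<lambda>f. poly f x) ` set P) \<le> int n \<longleftrightarrow> x \<le> hi" for x
    by (auto simp: le_hi_iff all_set_conv_all_nth poly_eq_form)
  moreover have "(\<forall>f\<in>set P. prime (poly f x)) \<longleftrightarrow> all_prime x" for x
    by (auto simp: all_prime_def all_set_conv_all_nth poly_eq_form)
  moreover have "lo \<le> x" if "all_prime x" for x
    using that by (auto simp: lo_le_iff all_prime_def intro: prime_ge_2_int)
  ultimately show ?thesis unfolding prime_pattern_positions_def by blast
qed

definition longest :: nat where
  "longest = Max ((\<lambda>v. floorlog 2 (nat \<bar>v\<bar>)) ` set (pattern_input P n))"

definition input_bound :: int where "input_bound = 2 ^ longest"
definition word_range :: int where "word_range = 2 ^ ((K + 14) * longest - 1)"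

lemma abs_input_less:
  assumes "v \<in> set (pattern_input P n)"
  shows "\<bar>v\<bar> < input_bound"
proof -
  have "floorlog 2 (nat \<bar>v\<bar>) \<le> longest"
    unfolding longest_def using assms by (intro Max_ge) auto
  then have "(2 :: int) ^ floorlog 2 (nat \<bar>v\<bar>) \<le> input_bound"
    unfolding input_bound_def by (intro power_increasing) auto
  then show ?thesis using abs_less_two_power_floorlog[of v] by linarith
qed

lemma in_pattern_input:
  "int k \<in> set (pattern_input P n)" "int n \<in> set (pattern_input P n)"
  "i < k \<Longrightarrow> slope P i \<in> set (pattern_input P n)" "i < k \<Longrightarrow> intercept P i \<in> set (pattern_input P n)"
  by (auto simp: pattern_input_def slope_def intercept_def)

lemma longest_ge_2: "2 \<le> longest"
proof (rule ccontr)
  assume "\<not> 2 \<le> longest"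
  then have "input_bound \<le> 2 ^ 1" unfolding input_bound_def by (intro power_increasing) auto
  then show False using abs_input_less[OF in_pattern_input(1)] pattern(2) by simp
qed

lemma two_power_word_size: "(2 :: int) ^ ((K + 14) * longest) = 2 * word_range"
  using longest_ge_2 by (cases "(K + 14) * longest") (simp_all add: word_range_def)

lemma input_bound_power_le: "4 \<le> input_bound" "input_bound ^ (K + 12) \<le> word_range"
proof -
  show ge_4: "4 \<le> input_bound"
    using power_increasing[of 2 longest "2 :: int"] longest_ge_2 by (simp add: input_bound_def)
  have "2 * input_bound ^ (K + 12) \<le> input_bound ^ 2 * input_bound ^ (K + 12)"
    using ge_4 power_mono[of 4 input_bound 2] by (intro mult_right_mono) auto
  also have "\<dots> = 2 ^ ((K + 14) * longest)"
    by (simp add: input_bound_def mult.commute flip: power_mult power_add) (simp add: algebra_simps)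
  finally show "input_bound ^ (K + 12) \<le> word_range" by (simp add: two_power_word_size)
qed

sublocale sieve_run k "slope P" "intercept P" K n input_bound word_range
proof
  show "4 \<le> input_bound" "input_bound ^ (K + 12) \<le> word_range" by (fact input_bound_power_le)+
  show "int k < input_bound" "int n < input_bound"
    using abs_input_less[OF in_pattern_input(1)] abs_input_less[OF in_pattern_input(2)] by simp_all
  fix i assume "i < k"
  then show "slope P i < input_bound" "\<bar>intercept P i\<bar> < input_bound"
    using abs_input_less[OF in_pattern_input(3)] abs_input_less[OF in_pattern_input(4)] by fastforce+
qed

lemma word_size_eq: "word_size (K + 14) (pattern_input P n) = (K + 14) * longest"
  by (simp add: word_size_def longest_def)

sublocale word_bound "word_size (K + 14) (pattern_input P n)" word_range
proof
  fix v assume "\<bar>v\<bar> < word_range"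
  then show "fits (word_size (K + 14) (pattern_input P n)) v"
    unfolding fits_def word_size_eq two_power_word_size by linarith
qed

abbreviation "start_state \<equiv> init_state (pattern_input P n)"

lemma input_memory_start: "input_memory (mem start_state)"
proof -
  have "pattern_input P n ! (2 + 2 * i) = slope P i" "pattern_input P n ! (3 + 2 * i) = intercept P i" if "i < k" for i
    using nth_coefficient_pairs[OF that, of "\<lambda>f. coeff f 1" "\<lambda>f. coeff f 0"]
    unfolding pattern_input_def slope_def intercept_def by (simp_all add: eval_nat_numeral)
  then show ?thesis
    unfolding input_memory_def init_state_def
    by (auto simp: length_pattern_input) (auto simp: pattern_input_def)
qed

lemma words_bounded_start: "words_bounded word_range start_state"
proof -
  have "input_bound ^ 1 \<le> input_bound ^ (K + 12)"
    using input_bound_power_le(1) by (intro power_increasing) auto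
  then have bound: "input_bound \<le> word_range" using input_bound_power_le(2) by simp
  have "0 < word_range" by (simp add: word_range_def)
  moreover have "\<bar>pattern_input P n ! j\<bar> < word_range" if "j < length (pattern_input P n)" for j
    using abs_input_less[OF nth_mem[OF that]] bound by linarith
  ultimately show ?thesis by (auto simp: words_bounded_def init_state_def)
qed

lemma pattern_program_computes:
  obtains outp t sp where
    "ram_computes (K + 14) (pattern_program K) (pattern_input P n) outp t sp"
    "set outp = prime_pattern_positions P n"
    "t \<le> length (pattern_program K) * (total_cost + 1)"
    "sp \<le> word_size (K + 14) (pattern_input P n) * (card (\<Union>i\<in>set (pattern_program K). set_instr i) + memory_size)"
proof -
  let ?prog = "pattern_program K" and ?c = "main_prog K" and ?s = start_state
  obtain t s' where run: "big word_range memory_size ?c ?s t s'" "t \<le> total_cost"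
    "set (printed s') = {x. lo \<le> x \<and> x \<le> hi \<and> all_prime x}"
    using runs_main_prog[OF input_memory_start] by (auto simp: runs_def init_state_def)
  have "\<forall>i\<in>constants ?c. \<bar>i\<bar> < word_range"
  proof
    fix i assume "i \<in> constants ?c"
    then have "i \<in> {0, 1, 2, 3, 5, 8, 9, int K, int K + 1}" using constants_main_prog by blast
    moreover have "9 < word_range" using W_square(2) W(1) by linarith
    ultimately show "\<bar>i\<bar> < word_range" using K_less_B by auto
  qed
  with run(1) words_bounded_start have "simulated 60 ?c ?s t s'"
    using vars_main_prog by (rule big_simulated)
  moreover have "code_at ?prog (pc ?s) (code 60 ?c (pc ?s))"
    by (auto simp: code_at_def pattern_program_def init_state_def)
  moreover have "agree 60 ?s ?s" by (simp add: agree_def)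
  ultimately obtain u S where S: "reach (word_size (K + 14) (pattern_input P n)) ?prog ?s u S"
    "u \<le> code_length 60 ?c * (t + 1)" "pc S = pc ?s + code_length 60 ?c" "agree 60 S s'"
    by (rule simulatedE)
  have "halted ?prog S" using S(3) by (simp add: halted_def pattern_program_def init_state_def nth_append)
  moreover have "printed S = printed s'" "cells S = cells s'" using S(4) by (auto simp: agree_def)
  moreover have "cells s' \<le> memory_size"
    using big_cells[OF run(1)] by (simp add: init_state_def length_pattern_input memory_size_def)
  moreover have "u \<le> length ?prog * (total_cost + 1)"
  proof -
    have "code_length 60 ?c * (t + 1) \<le> length ?prog * (total_cost + 1)"
      using run(2) by (intro mult_le_mono) (auto simp: pattern_program_def)
    then show ?thesis using S(2) by linarith
  qed
  ultimately show ?thesis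
    using S(1) run(3) that[of "printed S" u]
    by (simp add: ram_computes_def reach_def prime_pattern_positions_eq mult_le_mono2)
qed

end

section \<open>Time and space\<close>

lemma word_size_pattern_input_bigo:
  "(\<lambda>n. real (word_size \<kappa> (pattern_input P n))) \<in> O(\<lambda>n. ln (real n))"
proof -
  let ?length = "\<lambda>v :: int. floorlog 2 (nat \<bar>v\<bar>)"
  define rest where "rest = int (length P) # concat (map (\<lambda>f. [coeff f 1, coeff f 0]) P)"
  define A where "A = Max (?length ` set rest)"
  have "Max (?length ` set (pattern_input P n)) \<le> A + floorlog 2 n" for n
  proof (intro Max.boundedI)
    fix v assume "v \<in> ?length ` set (pattern_input P n)"
    then have "v \<in> ?length ` set rest \<or> v = floorlog 2 n" by (auto simp: pattern_input_def rest_def)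
    moreover have "v \<le> A" if "v \<in> ?length ` set rest"
      unfolding A_def using that by (intro Max_ge) auto
    ultimately show "v \<le> A + floorlog 2 n" by fastforce
  qed (auto simp: pattern_input_def)
  then have "word_size \<kappa> (pattern_input P n) \<le> \<kappa> * (A + floorlog 2 n)" for n
    unfolding word_size_def by (rule mult_le_mono2)
  then have "real (word_size \<kappa> (pattern_input P n)) \<le> real \<kappa> * (real A + real (floorlog 2 n + 1))" for n
    by (rule order_trans[OF of_nat_mono]) (simp add: distrib_left)
  then have "(\<lambda>n. real (word_size \<kappa> (pattern_input P n))) \<in> O(\<lambda>n. real A + real (floorlog 2 n + 1))"
    by (intro bigoI[of _ "real \<kappa>"] always_eventually allI) simp
  also have "(\<lambda>n. real A) \<in> O(\<lambda>n. ln (real n))" by real_asymp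
  then have "(\<lambda>n. real A + real (floorlog 2 n + 1)) \<in> O(\<lambda>n. ln (real n))"
    using floorlog_bigo by (rule sum_in_bigo)
  finally show ?thesis .
qed

lemma pattern_program_runs:
  assumes "is_pattern P" "2 < length P" "6 \<le> K"
  obtains time space where
    "\<And>n. \<exists>outp. ram_computes (K + 14) (pattern_program K) (pattern_input P n) outp (time n) (space n) \<and>
      set outp = prime_pattern_positions P n"
    "conjecture_A \<Longrightarrow> (\<lambda>n. real (time n)) \<in> O(\<lambda>n. real n / ln (ln (real n)) ^ (length P - 1))"
    "(\<lambda>n. real (space n)) \<in> O(\<lambda>n. ln (real n) * real n powr (2 / real K))"
proof -
  interpret pattern P by unfold_locales (fact assms)+
  interpret pattern_family k "slope P" "intercept P" K by unfold_locales (fact assms)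
  let ?prog = "pattern_program K"
  let ?regs = "card (\<Union>i\<in>set ?prog. set_instr i)"
  let ?w = "\<lambda>n. word_size (K + 14) (pattern_input P n)"
  have "\<exists>t sp. (\<exists>outp. ram_computes (K + 14) ?prog (pattern_input P n) outp t sp \<and> set outp = prime_pattern_positions P n) \<and>
    t \<le> length ?prog * (search.total_cost n + 1) \<and> sp \<le> ?w n * (?regs + search.memory_size n)" for n
  proof -
    interpret pattern_run P K n by unfold_locales (fact assms)
    show ?thesis by (rule pattern_program_computes) blast
  qed
  then obtain time space where run:
    "\<And>n. \<exists>outp. ram_computes (K + 14) ?prog (pattern_input P n) outp (time n) (space n) \<and> set outp = prime_pattern_positions P n"
    and time: "\<And>n. time n \<le> length ?prog * (search.total_cost n + 1)"
    and space: "\<And>n. space n \<le> ?w n * (?regs + search.memory_size n)"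
    by metis
  show ?thesis
  proof (rule that[OF run])
    assume "conjecture_A"
    have "(\<lambda>n. 1) \<in> O(rate)" unfolding rate_def by real_asymp
    then have "(\<lambda>n. real (search.total_cost n) + 1) \<in> O(rate)"
      using total_cost_bigo[OF \<open>conjecture_A\<close>] assms(2) by (intro sum_in_bigo) simp_all
    moreover have "real (time n) \<le> real (length ?prog) * (real (search.total_cost n) + 1)" for n
      using of_nat_mono[OF time[of n], where 'a = real] by (simp add: algebra_simps)
    then have "(\<lambda>n. real (time n)) \<in> O(\<lambda>n. real (search.total_cost n) + 1)"
      by (intro bigoI[of _ "real (length ?prog)"] always_eventually allI) (simp only: real_norm_def abs_of_nat abs_of_nonneg)
    ultimately show "(\<lambda>n. real (time n)) \<in> O(\<lambda>n. real n / ln (ln (real n)) ^ (k - 1))"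
      unfolding rate_def using landau_o.big_trans by blast
  next
    have "0 < 2 / real K" using assms(3) by simp
    then have "(\<lambda>n. C) \<in> O(\<lambda>n. real n powr (2 / real K))" for C :: real by real_asymp
    then have "(\<lambda>n. real (?w n) * (real ?regs + real (search.memory_size n))) \<in> O(\<lambda>n. ln (real n) * real n powr (2 / real K))"
      by (intro landau_o.big.mult word_size_pattern_input_bigo sum_in_bigo memory_size_bigo)
    moreover have "real (space n) \<le> real (?w n) * (real ?regs + real (search.memory_size n))" for n
      using of_nat_mono[OF space[of n], where 'a = real] by simp
    then have "(\<lambda>n. real (space n)) \<in> O(\<lambda>n. real (?w n) * (real ?regs + real (search.memory_size n)))"
      by (intro bigoI[of _ 1] always_eventually allI) simp
    ultimately show "(\<lambda>n. real (space n)) \<in> O(\<lambda>n. ln (real n) * real n powr (2 / real K))"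
      using landau_o.big_trans by blast
  qed
qed

theorem theorem1p3:
  fixes c :: real
  assumes "c > 2"
  shows "\<exists>(\<kappa>::nat) (prog::program). \<forall>(k::nat) (P::int poly list).
    k > 2 \<and> length P = k \<and> is_pattern P \<longrightarrow>
    (\<exists>(time :: nat \<Rightarrow> nat) (space :: nat \<Rightarrow> nat).
       (\<forall>n. \<exists>outp. ram_computes \<kappa> prog (pattern_input P n) outp (time n) (space n) \<and>
                   set outp = prime_pattern_positions P n) \<and>
       (\<forall>\<^sub>F n in sequentially. real (space n) \<le> real n powr (1 / c)) \<and>
       (conjecture_A \<and> conjecture_B \<longrightarrow>
         (\<lambda>n. real (time n)) \<in> O(\<lambda>n. real n / ln (ln (real n)) ^ (k - 1))))"
proof -
  define K where "K = nat \<lceil>4 * c\<rceil>"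
  have "4 * c \<le> real K" unfolding K_def by linarith
  then have K: "6 \<le> K" "2 / real K < 1 / c" using assms by (linarith, simp add: field_simps)
  then have little: "(\<lambda>n. ln (real n) * real n powr (2 / real K)) \<in> o(\<lambda>n. real n powr (1 / c))" by real_asymp
  show ?thesis
  proof (intro exI[of _ "K + 14"] exI[of _ "pattern_program K"] allI impI, elim conjE)
    fix k and P :: "int poly list"
    assume P: "2 < k" "length P = k" "is_pattern P"
    obtain time space where run: "\<And>n. \<exists>outp. ram_computes (K + 14) (pattern_program K) (pattern_input P n) outp
        (time n) (space n) \<and> set outp = prime_pattern_positions P n"
      and time: "conjecture_A \<Longrightarrow> (\<lambda>n. real (time n)) \<in> O(\<lambda>n. real n / ln (ln (real n)) ^ (k - 1))"
      and space: "(\<lambda>n. real (space n)) \<in> O(\<lambda>n. ln (real n) * real n powr (2 / real K))"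
      by (rule pattern_program_runs[of P K]) (use P K(1) in auto)
    have "\<forall>\<^sub>F n in sequentially. real (space n) \<le> real n powr (1 / c)"
      using landau_o.smallD[OF landau_o.big_small_trans[OF space little], of 1] by simp
    then show "\<exists>time space. (\<forall>n. \<exists>outp. ram_computes (K + 14) (pattern_program K) (pattern_input P n) outp
        (time n) (space n) \<and> set outp = prime_pattern_positions P n) \<and>
      (\<forall>\<^sub>F n in sequentially. real (space n) \<le> real n powr (1 / c)) \<and>
      (conjecture_A \<and> conjecture_B \<longrightarrow> (\<lambda>n. real (time n)) \<in> O(\<lambda>n. real n / ln (ln (real n)) ^ (k - 1)))"
      using run time by blast
  qed
qed

end
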